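(* Let $D\subset\mathbb{R}^2$ be a centrosymmetric convex domain, and let a packing of translates of $D$ be given whose corresponding subdivision of the plane is a subdivision into convex polygons with at most six sides each. Let $\lambda$ be the average number of neighbours (in a large circle), let $d'$ be the density of the packing in the large circle, and let $d_0'$ denote the density of the thinnest six-neighbour lattice packing of translates of $D$. Then asymptotically the following lower bounds hold: (i) if $d_0'\ge \frac78$ and $4\le\lambda\le 6$, then $$d'\ \ge\ \frac{d_0'}{2d_0'(6-\lambda)+\left(\frac32\lambda-8\right)};$$ (ii) if $d_0'\ge\frac78$ and $3\le\lambda\le4$, then $$d'\ \ge\ \frac{d_0'}{2d_0'(\lambda-2)+6-2\lambda};$$ (iii) if $d_0'\le\frac78$, then $$d'\ \ge\ \frac{d_0'}{\frac23 d_0'(6-\lambda)+\frac13(\lambda-3)}.$$ Moreover, for any $3\le\lambda\le6$ and any $\frac34\le d_0'\le1$ equality is attained, e.g. for $D$ a centrosymmetric hexagon one of whose main diagonals is parallel to the corresponding two opposite sides (those not meeting that diagonal), where the ratio of the length of these sides to the length of this diagonal is $2d_0'-1$.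
   Context: A convex domain is a compact convex set in $\mathbb{R}^2$ with nonempty interior. A packing of translates of $D$ is a family $\{D+x:x\in X\}$ with pairwise disjoint interiors; two different members are neighbours if they touch (have a common point). The corresponding subdivision of the plane has vertex set $X$, and its edges are the segments $[x,y]$ for which $D+x$ and $D+y$ are neighbours (segments connecting homologous points of touching translates); the hypothesis includes that these segments do form the edges of a subdivision of $\mathbb{R}^2$ into convex polygons. The number of sides of a polygon of the subdivision is the number of edges of the subdivision on its boundary (angles equal to $\pi$ at vertices are allowed). A lattice packing is a packing whose set $X$ is a lattice; a six-neighbour packing is one in which each member has at least six neighbours; "thinnest" means of minimal density. Meaning of "in a large circle" and "asymptotically": let $B_R$ be the Euclidean disc of radius $R$ about the origin, $N(R)=|X\cap B_R|$, $\lambda(R)$ the average number of neighbours of the translates $D+x$, $x\in X\cap B_R$, and $d'(R)=N(R)\,\mathrm{area}(D)/(\pi R^2)$. A lower bound $d'\ge f(\lambda)$ holding asymptotically means: whenever $R_j\to\infty$ and $\lambda(R_j)\to\lambda$ (with $\lambda$ in the indicated range), then $\liminf_j d'(R_j)\ge f(\lambda)$. Equality being attained for a given $\lambda$ and $D$ means that there is a packing of translates of $D$ satisfying the hypotheses with $\lambda(R)\to\lambda$ and $d'(R)\to f(\lambda)$ as $R\to\infty$. When $2d_0'-1=1$ the hexagon in the equality case is degenerate, namely a parallelogram. *)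

theory Defs
  imports "HOL-Analysis.Analysis"
begin

type_synonym plane = "real ^ 2"

definition convex_domain :: "plane set \<Rightarrow> bool" where
  "convex_domain D \<longleftrightarrow> compact D \<and> convex D \<and> interior D \<noteq> {}"

definition centrosymmetric :: "plane set \<Rightarrow> bool" where
  "centrosymmetric D \<longleftrightarrow> (\<exists>c. \<forall>x\<in>D. 2 *\<^sub>R c - x \<in> D)"

definition translate :: "plane set \<Rightarrow> plane \<Rightarrow> plane set" where
  "translate D x = (\<lambda>d. d + x) ` D"

definition is_packing :: "plane set \<Rightarrow> plane set \<Rightarrow> bool" where
  "is_packing D X \<longleftrightarrow>
     pairwise (\<lambda>x y. interior (translate D x) \<inter> interior (translate D y) = {}) X"

definition neighbours :: "plane set \<Rightarrow> plane set \<Rightarrow> plane \<Rightarrow> plane set" where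
  "neighbours D X x = {y\<in>X. y \<noteq> x \<and> translate D x \<inter> translate D y \<noteq> {}}"

definition packing_edges :: "plane set \<Rightarrow> plane set \<Rightarrow> plane set set" where
  "packing_edges D X = {closed_segment x y | x y. x \<in> X \<and> y \<in> neighbours D X x}"

definition convex_polygon :: "plane set \<Rightarrow> bool" where
  "convex_polygon P \<longleftrightarrow> polytope P \<and> interior P \<noteq> {}"

definition sides :: "plane set set \<Rightarrow> plane set \<Rightarrow> plane set set" where
  "sides E P = {e\<in>E. e \<subseteq> frontier P}"

text \<open>
  \<open>V\<close>, \<open>E\<close>, \<open>F\<close> are the vertices, edges and faces of an edge-to-edge subdivision of the plane
  into convex polygons. A vertex may lie in the relative interior of a side of the convex set
  \<open>P \<in> F\<close> (angle \<open>\<pi>\<close>); that side of the set then counts as several sides of the face.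
\<close>
definition convex_subdivision ::
    "plane set \<Rightarrow> plane set set \<Rightarrow> plane set set \<Rightarrow> bool" where
  "convex_subdivision V E F \<longleftrightarrow>
     (\<forall>e\<in>E. \<exists>x\<in>V. \<exists>y\<in>V. x \<noteq> y \<and> e = closed_segment x y \<and> e \<inter> V = {x, y}) \<and>
     pairwise (\<lambda>e e'. e \<inter> e' \<subseteq> V) E \<and>
     V \<subseteq> \<Union>E \<and>
     (\<forall>P\<in>F. convex_polygon P) \<and>
     \<Union>F = UNIV \<and>
     locally_finite_in euclidean F \<and>
     pairwise (\<lambda>P Q. interior P \<inter> interior Q = {}) F \<and>
     (\<forall>P\<in>F. frontier P = \<Union>(sides E P)) \<and>
     (\<forall>e\<in>E. \<exists>P\<in>F. e \<in> sides E P)"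

definition packing_with_small_faces :: "plane set \<Rightarrow> plane set \<Rightarrow> bool" where
  "packing_with_small_faces D X \<longleftrightarrow>
     is_packing D X \<and>
     (\<exists>F. convex_subdivision X (packing_edges D X) F \<and>
          (\<forall>P\<in>F. finite (sides (packing_edges D X) P) \<and>
                  card (sides (packing_edges D X) P) \<le> 6))"

definition num_points :: "plane set \<Rightarrow> real \<Rightarrow> nat" where
  "num_points X R = card (X \<inter> cball 0 R)"

definition avg_neighbours :: "plane set \<Rightarrow> plane set \<Rightarrow> real \<Rightarrow> real" where
  "avg_neighbours D X R =
     (\<Sum>x \<in> X \<inter> cball 0 R. real (card (neighbours D X x))) / real (num_points X R)"

definition disc_density :: "plane set \<Rightarrow> plane set \<Rightarrow> real \<Rightarrow> real" where
  "disc_density D X R = real (num_points X R) * measure lebesgue D / (pi * R\<^sup>2)"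

definition is_lattice :: "plane set \<Rightarrow> bool" where
  "is_lattice L \<longleftrightarrow>
     (\<exists>u v. u \<noteq> v \<and> independent {u, v} \<and>
            L = {of_int i *\<^sub>R u + of_int j *\<^sub>R v | i j :: int. True})"

definition six_neighbour_lattice_packing :: "plane set \<Rightarrow> plane set \<Rightarrow> bool" where
  "six_neighbour_lattice_packing D L \<longleftrightarrow>
     is_lattice L \<and> is_packing D L \<and> (\<forall>x\<in>L. 6 \<le> card (neighbours D L x))"

text \<open>
  For a lattice the limit of \<open>disc_density\<close> always exists, and the infimum below is attained
  for every convex domain (by compactness), so it is the density of the thinnest packing.
\<close>
definition thinnest_density :: "plane set \<Rightarrow> real" where
  "thinnest_density D =
     Inf {d. \<exists>L. six_neighbour_lattice_packing D L \<and> (disc_density D L \<longlongrightarrow> d) at_top}"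

definition asymptotic_lower_bound :: "plane set \<Rightarrow> plane set \<Rightarrow> real \<Rightarrow> real \<Rightarrow> bool" where
  "asymptotic_lower_bound D X l b \<longleftrightarrow>
     (\<forall>R :: nat \<Rightarrow> real.
        filterlim R at_top sequentially \<longrightarrow>
        (\<lambda>j. avg_neighbours D X (R j)) \<longlonglongrightarrow> l \<longrightarrow>
        ereal b \<le> liminf (\<lambda>j. ereal (disc_density D X (R j))))"

definition bound_attained :: "plane set \<Rightarrow> real \<Rightarrow> real \<Rightarrow> bool" where
  "bound_attained D l b \<longleftrightarrow>
     (\<exists>X. packing_with_small_faces D X \<and>
          (avg_neighbours D X \<longlongrightarrow> l) at_top \<and>
          (disc_density D X \<longlongrightarrow> b) at_top)"

definition bound_i :: "real \<Rightarrow> real \<Rightarrow> real" where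
  "bound_i d l = d / (2 * d * (6 - l) + (3 / 2 * l - 8))"

definition bound_ii :: "real \<Rightarrow> real \<Rightarrow> real" where
  "bound_ii d l = d / (2 * d * (l - 2) + 6 - 2 * l)"

definition bound_iii :: "real \<Rightarrow> real \<Rightarrow> real" where
  "bound_iii d l = d / (2 / 3 * d * (6 - l) + 1 / 3 * (l - 3))"

text \<open>
  The hexagon with consecutive vertices \<open>a, b, b', a', 2c - b, 2c - b'\<close>, where \<open>a' = 2c - a\<close>.
  The sides \<open>[b, b']\<close> and \<open>[2c - b, 2c - b']\<close> are parallel to the main diagonal \<open>[a, a']\<close>, and
  \<open>r\<close> is the ratio of their length to that of the diagonal. For \<open>0 < r < 1\<close> the six points are
  the vertices of a convex hexagon; for \<open>r = 1\<close> the hull is a parallelogram in which \<open>a\<close>, \<open>a'\<close>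
  are midpoints of sides. (Interchanging \<open>b\<close> and \<open>b'\<close> does not change the hull.)
\<close>
definition special_hexagon :: "real \<Rightarrow> plane set \<Rightarrow> bool" where
  "special_hexagon r D \<longleftrightarrow>
     (\<exists>c a b a' b'.
        a' = 2 *\<^sub>R c - a \<and> \<not> collinear {a, b, a'} \<and>
        (\<exists>t. b - b' = t *\<^sub>R (a - a')) \<and> dist b b' = r * dist a a' \<and>
        D = convex hull {a, b, b', a', 2 *\<^sub>R c - b, 2 *\<^sub>R c - b'})"

end

(*
  Two translates of D touch iff their difference lies on the boundary of B = 2 (D - c), a body
  symmetric about 0 of area M = 4 area(D).  Pairs u, v such that u, v, u - v are on the boundary
  of B span the six-neighbour lattices, so that d0 = area(D) / Delta, where Delta is the largest
  determinant of such a pair.  Comparing B with fans of triangles with apex 0 shows that a face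
  with 3, 4, 5, 6 sides has area at most Delta/2, M - 2 Delta, M - Delta, M.  Faces are counted by
  their leftmost vertices: between any two consecutive edges leaving a vertex to the right there
  is a face with this leftmost vertex, which replaces Euler's formula.  A bound of the form
  alpha + beta k for the area of a k-gon, with alpha <= 0, then gives an upper bound for the area
  of the disc; the three cases correspond to three choices of alpha and beta.

  Equality: for the special hexagon, columns of points (single points or touching pairs) are
  placed at horizontal distances for which every face has the extremal area.  Two kinds of
  columns are mixed according to a word with prescribed, possibly irrational frequency and only
  O(sqrt n) changes of letter among n letters, so that the places where the kind changes have
  density zero.
*)
theory Submission
  imports Defs
begin

text \<open>By Euler's formula a mean degree \<lambda> goes with 2 \<lambda> / (\<lambda> - 2) sides
  per face on average, so the values 6, 4, 3 of \<lambda> stand for 3, 4, 6 sides. Plot the face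
  bounds over 3, 4, 5, 6: the theorem is the upper concave envelope of these points. Those over 4,
  5, 6 lie on one line, and the point over 4 is above the chord from 3 to 6 exactly if
  \<open>7 / 2 * \<Delta> \<le> M\<close>, that is, \<open>7 / 8 \<le> d0\<close>. The delicate
  bound is the one for quadrangles. It rests on the fact that a large hexagon in \<open>B\<close>
  forces all parallelograms to be small: |u ^ v| + 2 |a ^ b| \<le> M for u, v in \<open>B\<close>
  and every hexagonal pair a, b. The counts are inequalities only: up to boundary effects at least
  deg/2 - 1 faces per vertex, and at most two faces per edge. Hence the signs required of \<alpha>
  and \<beta>. Angles equal to pi forbid identifying the edges of a face with the sides of the
  polytope, so its boundary is cut into two monotone chains of subdivision edges instead.\<close>

section \<open>Determinants in the plane and fans of triangles\<close>

definition wedge :: "plane \<Rightarrow> plane \<Rightarrow> real" where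
  "wedge a b = a$1 * b$2 - a$2 * b$1"

lemma wedge_simps [simp]:
  "wedge a a = 0" "wedge 0 a = 0" "wedge a 0 = 0"
  "wedge (- a) b = - wedge a b" "wedge a (- b) = - wedge a b"
  "wedge (t *\<^sub>R a) b = t * wedge a b" "wedge a (t *\<^sub>R b) = t * wedge a b"
  by (simp_all add: wedge_def algebra_simps)

lemma wedge_add:
  "wedge (a + b) c = wedge a c + wedge b c" "wedge c (a + b) = wedge c a + wedge c b"
  "wedge (a - b) c = wedge a c - wedge b c" "wedge c (a - b) = wedge c a - wedge c b"
  by (simp_all add: wedge_def algebra_simps)

lemma wedge_commute: "wedge a b = - wedge b a"
  by (simp add: wedge_def)

lemma wedge_sum: "finite I \<Longrightarrow> wedge (\<Sum>i\<in>I. f i) c = (\<Sum>i\<in>I. wedge (f i) c)"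
  by (induction rule: finite_induct) (simp_all add: wedge_add)

lemma bounded_linear_wedge: "bounded_linear (wedge a)"
  unfolding linear_conv_bounded_linear[symmetric]
  by (rule linearI) (simp_all add: wedge_add)

lemma continuous_on_wedge [continuous_intros]:
  "continuous_on S f \<Longrightarrow> continuous_on S h \<Longrightarrow> continuous_on S (\<lambda>x. wedge (f x) (h x))"
  unfolding wedge_def by (intro continuous_intros)

text \<open>Cramer's rule; it supplies the coordinates of a point in an oblique basis
  throughout.\<close>

lemma wedge_expansion:
  assumes "wedge a b \<noteq> 0"
  shows "z = (wedge z b / wedge a b) *\<^sub>R a + (wedge a z / wedge a b) *\<^sub>R b"
proof -
  have "wedge a b *\<^sub>R z = wedge z b *\<^sub>R a + wedge a z *\<^sub>R b"
    by (simp add: vec_eq_iff forall_2 wedge_def algebra_simps)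
  then have "(1 / wedge a b) *\<^sub>R (wedge a b *\<^sub>R z) = (1 / wedge a b) *\<^sub>R (wedge z b *\<^sub>R a + wedge a z *\<^sub>R b)"
    by simp
  then show ?thesis using assms by (simp add: scaleR_add_right)
qed

text \<open>The vector on the right is \<open>a\<close> after a quarter turn, so that results on
  hyperplanes and the Cauchy-Schwarz inequality apply to \<open>wedge\<close>.\<close>

lemma wedge_inner: "wedge a z = (\<chi> i. if i = 1 then - a$2 else a$1) \<bullet> z"
  by (simp add: wedge_def inner_vec_def sum_2)

lemma negligible_wedge_line:
  assumes "a \<noteq> 0" shows "negligible {z. wedge a z = 0}"
proof -
  let ?n = "(\<chi> i. if i = 1 then - a$2 else a$1) :: plane"
  have "?n \<noteq> 0" using assms by (auto simp: vec_eq_iff forall_2)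
  moreover have "{z. wedge a z = 0} = {z. ?n \<bullet> z = 0}" by (simp add: wedge_inner)
  ultimately show ?thesis using negligible_hyperplane[of ?n 0] by simp
qed

lemma closed_wedge_halfplane: "closed {z. 0 \<le> wedge a z}"
  by (intro closed_Collect_le continuous_intros)

lemma measure_triangle:
  "measure lebesgue (convex hull {p, x, y}) = \<bar>wedge (x - p) (y - p)\<bar> / 2"
proof -
  have "convex hull {p, x, y} \<in> sets lborel"
    using compact_imp_closed[OF finite_imp_compact_convex_hull[of "{p, x, y}"]] by auto
  then show ?thesis
    by (simp add: content_triangle wedge_def algebra_simps measure_completion)
qed

lemma compact_triangle: "compact (convex hull {p, x, y :: plane})"
  by (intro finite_imp_compact_convex_hull) simp

lemma convex_wedge_halfplane: "convex {z. 0 \<le> wedge a z}"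
  by (rule convexI) (simp add: wedge_add)

lemma measure_uminus_image:
  fixes S :: "plane set"
  assumes "S \<in> lmeasurable" shows "measure lebesgue (uminus ` S) = measure lebesgue S"
  using measure_linear_image[of uminus S] assms
  by (simp add: linear_uminus det_2 matrix_def axis_def)

text \<open>
  Area of a symmetric convex body from below: the triangles spanned by the origin and consecutive
  points of an angularly sorted sequence do not overlap.
\<close>

fun fan_area :: "plane list \<Rightarrow> real" where
  "fan_area (p # q # ps) = wedge p q / 2 + fan_area (q # ps)"
| "fan_area _ = 0"

fun fan_union :: "plane list \<Rightarrow> plane set" where
  "fan_union (p # q # ps) = convex hull {0, p, q} \<union> fan_union (q # ps)"
| "fan_union _ = {}"

lemma compact_fan_union: "compact (fan_union ps)"
  by (induction ps rule: fan_union.induct) (auto intro: compact_Un compact_triangle)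

lemma fan_union_subset:
  assumes "set ps \<subseteq> C" "convex C" "0 \<in> C"
  shows "fan_union ps \<subseteq> C"
  using assms(1)
proof (induction ps rule: fan_union.induct)
  case (1 p q ps)
  have "convex hull {0, p, q} \<subseteq> C" using 1(2) assms by (intro hull_minimal) auto
  with 1 show ?case by auto
qed auto

text \<open>Sortedness puts \<open>p\<close> on one side of the line through 0 and \<open>q\<close>
  and all later points on the other, so the first triangle meets the rest of the fan only in that
  line. If \<open>q = 0\<close> there is no line, but then the first triangle has area 0.\<close>

lemma measure_fan_union:
  assumes "sorted_wrt (\<lambda>p q. 0 \<le> wedge p q) ps"
  shows "measure lebesgue (fan_union ps) = fan_area ps"
  using assms
proof (induction ps rule: fan_union.induct)
  case (1 p q ps)
  let ?T = "convex hull {0, p, q}" and ?S = "fan_union (q # ps)"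
  have T: "measure lebesgue ?T = wedge p q / 2"
    using 1(2) by (simp add: measure_triangle)
  have neg: "negligible (?T \<inter> ?S)"
  proof (cases "q = 0")
    case True
    have "measure lebesgue ?T = 0" using T True by simp
    then have "negligible ?T"
      using compact_triangle lmeasurable_compact negligible_iff_measure by blast
    then show ?thesis by (rule negligible_subset) auto
  next
    case False
    have "?S \<subseteq> {z. 0 \<le> wedge q z}"
      using 1(2) by (intro fan_union_subset convex_wedge_halfplane) auto
    moreover have "?T \<subseteq> {z. 0 \<le> wedge (- q) z}"
      using 1(2) wedge_commute[of q p] by (intro hull_minimal convex_wedge_halfplane) auto
    ultimately have "?T \<inter> ?S \<subseteq> {z. wedge q z = 0}" by fastforce
    then show ?thesis using negligible_wedge_line[OF False] negligible_subset by blast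
  qed
  have "measure lebesgue (?T \<union> ?S) = measure lebesgue ?T + measure lebesgue ?S - measure lebesgue (?T \<inter> ?S)"
    by (intro measure_Un3 lmeasurable_compact compact_triangle compact_fan_union)
  then show ?case using neg T 1 by (simp add: negligible_imp_measure0)
qed auto

section \<open>Symmetric convex bodies and inscribed hexagons\<close>

locale sym_body =
  fixes B :: "plane set"
  assumes compact_B: "compact B" and convex_B: "convex B"
    and zero_interior: "0 \<in> interior B" and sym_B: "x \<in> B \<Longrightarrow> - x \<in> B"
begin

definition M where "M = measure lebesgue B"

text \<open>With the symmetry of \<open>B\<close> this says that u, v, v - u and their negatives,
  the vertices of an affine image of the regular hexagon, lie on the boundary.\<close>

definition hex_pair :: "plane \<Rightarrow> plane \<Rightarrow> bool" where
  "hex_pair u v \<longleftrightarrow> u \<in> frontier B \<and> v \<in> frontier B \<and> u - v \<in> frontier B"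

lemma zero_B: "0 \<in> B" using zero_interior interior_subset by blast
lemma closed_B: "closed B" using compact_B compact_imp_closed by blast

lemma frontier_iff: "x \<in> frontier B \<longleftrightarrow> x \<in> B \<and> x \<notin> interior B"
  by (simp add: frontier_def closed_B)

lemma sym_iff: "- x \<in> B \<longleftrightarrow> x \<in> B" using sym_B[of x] sym_B[of "-x"] by auto

lemma uminus_image: "uminus ` B = B"
  using sym_iff by (metis (no_types, lifting) image_subset_iff minus_minus rev_image_eqI subsetI subset_antisym)

lemma sym_interior: "- x \<in> interior B \<longleftrightarrow> x \<in> interior B"
proof -
  have "interior (uminus ` B) = uminus ` interior B"
    by (rule interior_negations)
  then show ?thesis using uminus_image by (metis (no_types, lifting) image_iff minus_minus)
qed

lemma sym_frontier: "- x \<in> frontier B \<longleftrightarrow> x \<in> frontier B"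
  by (simp add: frontier_iff sym_iff sym_interior)

lemma scale_interior: "x \<in> B \<Longrightarrow> \<bar>t\<bar> < 1 \<Longrightarrow> t *\<^sub>R x \<in> interior B"
proof -
  have *: "s *\<^sub>R y \<in> interior B" if "y \<in> B" "0 \<le> s" "s < 1" for s y
    using mem_interior_convex_shrink[OF convex_B zero_interior that(1), of "1 - s"] that
    by (simp add: algebra_simps)
  assume "x \<in> B" "\<bar>t\<bar> < 1"
  then show ?thesis using *[of x t] *[of "- x" "- t"] sym_B by (cases "t \<ge> 0") auto
qed

text \<open>\<open>B\<close> behaves as the unit ball of a norm: after sign changes of
  \<open>x\<close> and \<open>y\<close> the sum is a convex combination, scaled towards 0 by the
  total weight \<open>k\<close>.\<close>

lemma combo_B:
  assumes "x \<in> B" "y \<in> B" "\<bar>s\<bar> + \<bar>t\<bar> \<le> 1" shows "s *\<^sub>R x + t *\<^sub>R y \<in> B"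
proof -
  have "sgn s *\<^sub>R x \<in> B" "sgn t *\<^sub>R y \<in> B"
    using assms sym_B zero_B by (auto simp: sgn_if)
  define k where "k = \<bar>s\<bar> + \<bar>t\<bar>"
  show ?thesis
  proof (cases "k = 0")
    case True
    then have "s = 0" "t = 0" by (simp_all add: k_def add_nonneg_eq_0_iff)
    then show ?thesis using zero_B by simp
  next
    case False
    then have k: "0 < k" "k \<le> 1" using assms(3) by (simp_all add: k_def add_nonneg_eq_0_iff less_le)
    let ?z = "(\<bar>s\<bar> / k) *\<^sub>R (sgn s *\<^sub>R x) + (\<bar>t\<bar> / k) *\<^sub>R (sgn t *\<^sub>R y)"
    have "?z \<in> B"
      using k \<open>sgn s *\<^sub>R x \<in> B\<close> \<open>sgn t *\<^sub>R y \<in> B\<close>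
      by (intro convexD[OF convex_B]) (auto simp: k_def add_divide_distrib[symmetric] simp del: scaleR_scaleR)
    then have "k *\<^sub>R ?z + (1 - k) *\<^sub>R 0 \<in> B"
      using convexD[OF convex_B, of ?z 0 k "1 - k"] k zero_B by simp
    moreover have "k *\<^sub>R ?z = s *\<^sub>R x + t *\<^sub>R y"
      using k by (simp add: scaleR_add_right abs_mult_sgn)
    ultimately show ?thesis by simp
  qed
qed

lemma combo_interior:
  assumes "x \<in> B" "y \<in> B" "\<bar>s\<bar> + \<bar>t\<bar> < 1" shows "s *\<^sub>R x + t *\<^sub>R y \<in> interior B"
proof -
  obtain k where k: "\<bar>s\<bar> + \<bar>t\<bar> < k" "k < 1" using assms(3) dense by blast
  then have "k > 0" by linarith
  then have "(s / k) *\<^sub>R x + (t / k) *\<^sub>R y \<in> B"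
    using k by (intro combo_B assms) (simp add: field_simps)
  then have "k *\<^sub>R ((s / k) *\<^sub>R x + (t / k) *\<^sub>R y) \<in> interior B"
    using k \<open>k > 0\<close> by (intro scale_interior) auto
  then show ?thesis using \<open>k > 0\<close> by (simp add: scaleR_add_right)
qed

text \<open>The sorted list describes a half-turn from its head to the negative of the head, so the
  fan fits into one of the two halves into which the line of the head cuts \<open>B\<close>. The
  halves are mirror images and have equal area.\<close>

lemma fan_area_le:
  assumes "set ps \<subseteq> B" "sorted_wrt (\<lambda>p q. 0 \<le> wedge p q) (ps @ [- hd ps])" "hd ps \<noteq> 0" "ps \<noteq> []"
  shows "2 * fan_area (ps @ [- hd ps]) \<le> M"
proof -
  let ?p = "hd ps"
  let ?U = "B \<inter> {z. 0 \<le> wedge ?p z}" and ?L = "B \<inter> {z. 0 \<le> wedge (- ?p) z}"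
  have U: "compact ?U" and L: "compact ?L"
    by (intro compact_Int_closed compact_B closed_wedge_halfplane)+
  have "uminus ` ?U = ?L"
  proof
    show "uminus ` ?U \<subseteq> ?L" using sym_B by auto
    show "?L \<subseteq> uminus ` ?U"
    proof
      fix z assume "z \<in> ?L"
      then have "- z \<in> ?U" using sym_B by auto
      then show "z \<in> uminus ` ?U" by (metis image_eqI minus_minus)
    qed
  qed
  then have eq: "measure lebesgue ?L = measure lebesgue ?U"
    using measure_uminus_image[OF lmeasurable_compact[OF U]] by simp
  have "?U \<union> ?L = B" by auto
  moreover have "negligible (?U \<inter> ?L)"
    by (rule negligible_subset[OF negligible_wedge_line[OF assms(3)]]) auto
  ultimately have "M = measure lebesgue ?U + measure lebesgue ?L"
    using measure_Un3[OF lmeasurable_compact[OF U] lmeasurable_compact[OF L]]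
    unfolding M_def by (simp add: negligible_imp_measure0)
  then have M: "M = 2 * measure lebesgue ?U" using eq by simp
  have "set (ps @ [- hd ps]) \<subseteq> ?U"
  proof -
    have "0 \<le> wedge ?p q" if "q \<in> set ps" for q
      using assms(2,4) that by (cases ps) auto
    moreover have "- ?p \<in> B" using assms sym_B by (meson hd_in_set subsetD)
    ultimately show ?thesis using assms by auto
  qed
  then have "fan_union (ps @ [- hd ps]) \<subseteq> ?U"
    by (intro fan_union_subset convex_Int convex_B convex_wedge_halfplane) (auto simp: zero_B)
  then have "measure lebesgue (fan_union (ps @ [- hd ps])) \<le> measure lebesgue ?U"
    using U by (intro measure_mono_fmeasurable lmeasurable_compact)
      (auto intro: compact_fan_union lmeasurable_compact fmeasurableD)
  then show ?thesis using measure_fan_union[OF assms(2)] M by simp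
qed

text \<open>Sign changes and reordering affect neither \<open>B\<close> nor the absolute
  determinants, so \<open>a\<close>, \<open>b\<close>, \<open>c\<close> may be assumed to be in
  angular order within a half-turn. Then the left side is twice the area of the fan over
  \<open>a, b, c, - a\<close>.\<close>

lemma wedge_triple_le:
  assumes "a \<in> B" "b \<in> B" "c \<in> B"
  shows "\<bar>wedge a b\<bar> + \<bar>wedge b c\<bar> + \<bar>wedge a c\<bar> \<le> M"
proof -
  have *: "wedge a b + wedge b c + wedge a c \<le> M"
    if "a \<in> B" "b \<in> B" "c \<in> B" "0 \<le> wedge a b" "0 \<le> wedge b c" "0 \<le> wedge a c" "a \<noteq> 0" for a b c
    using fan_area_le[of "[a, b, c]"] that wedge_commute[of a b] wedge_commute[of a c] by simp
  have **: "\<bar>wedge a b\<bar> + \<bar>wedge b c\<bar> + \<bar>wedge a c\<bar> \<le> M"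
    if "a \<in> B" "b \<in> B" "c \<in> B" "0 \<le> wedge a b" "0 \<le> wedge a c" "a \<noteq> 0" for a b c
    using *[of a b c] *[of a c b] that wedge_commute[of b c] by (cases "0 \<le> wedge b c") auto
  \<comment> \<open>The signs of \<open>b\<close> and \<open>c\<close> are chosen so that both lie
    on the positive side of \<open>a\<close>.\<close>
  have ***: "\<bar>wedge a b\<bar> + \<bar>wedge b c\<bar> + \<bar>wedge a c\<bar> \<le> M"
    if "a \<noteq> 0" "a \<in> B" "b \<in> B" "c \<in> B" for a b c
  proof -
    define b' c' where "b' = (if 0 \<le> wedge a b then b else - b)" and "c' = (if 0 \<le> wedge a c then c else - c)"
    have "\<bar>wedge a b'\<bar> + \<bar>wedge b' c'\<bar> + \<bar>wedge a c'\<bar> \<le> M"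
      using that sym_B by (intro **) (auto simp: b'_def c'_def)
    then show ?thesis by (auto simp: b'_def c'_def split: if_splits)
  qed
  show ?thesis
  proof (cases "a = 0")
    case True
    have "M \<ge> 0" by (simp add: M_def)
    then show ?thesis using True ***[of b c c] assms by (cases "b = 0") auto
  qed (use *** assms in auto)
qed

text \<open>Twice the area of the fan with apex 0 over the path 0, a, a + b, a + b + c. This is half
  of a hexagonal face, or the larger part of a pentagonal one.\<close>

lemma wedge_path_le:
  assumes "a \<in> B" "b \<in> B" "c \<in> B"
  shows "\<bar>wedge a b\<bar> + \<bar>wedge (a + b) c\<bar> \<le> M"
  using wedge_triple_le[OF assms] by (simp add: wedge_add)

text \<open>Turns the hexagon by one vertex, so that a statement on the cone of \<open>a\<close> and
  \<open>b\<close> is available for the other cones as well.\<close>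

lemma hex_pair_rotate: "hex_pair a b \<Longrightarrow> hex_pair b (b - a)"
  by (metis (no_types, lifting) hex_pair_def minus_diff_eq sym_frontier diff_diff_eq2 add_diff_cancel_left' )

text \<open>Otherwise \<open>a\<close> would be a combination of the given point and of
  \<open>a - b\<close> with coefficients 1 / (p + q) and q / (p + q), whose sum is less than 1, so
  \<open>a\<close> would be interior.\<close>

lemma hex_pair_coord_le_1:
  assumes "hex_pair a b" "p *\<^sub>R a + q *\<^sub>R b \<in> B" "0 \<le> p" "0 \<le> q"
  shows "p \<le> 1"
proof (rule ccontr)
  assume "\<not> p \<le> 1"
  then have p: "p > 1" by simp
  have a: "a = (1 / (p + q)) *\<^sub>R (p *\<^sub>R a + q *\<^sub>R b) + (q / (p + q)) *\<^sub>R (a - b)"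
  proof -
    have "(p + q) *\<^sub>R a = (p *\<^sub>R a + q *\<^sub>R b) + q *\<^sub>R (a - b)" by (simp add: algebra_simps)
    then have "(1 / (p + q)) *\<^sub>R ((p + q) *\<^sub>R a) = (1 / (p + q)) *\<^sub>R ((p *\<^sub>R a + q *\<^sub>R b) + q *\<^sub>R (a - b))" by simp
    then show ?thesis using p assms by (simp add: scaleR_add_right)
  qed
  have "\<bar>1 / (p + q)\<bar> + \<bar>q / (p + q)\<bar> < 1" using p assms by (simp add: field_simps)
  then have "a \<in> interior B" using assms a combo_interior[of "p *\<^sub>R a + q *\<^sub>R b" "a - b" "1 / (p + q)" "q / (p + q)"]
    by (metis frontier_iff hex_pair_def)
  then show False using assms by (simp add: hex_pair_def frontier_iff)
qed

lemma hex_pair_swap: "hex_pair a b \<Longrightarrow> hex_pair b a"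
  by (metis hex_pair_def minus_diff_eq sym_frontier)

text \<open>
  In units of \<open>wedge a b\<close>: if \<open>u\<close> and \<open>v\<close> lie at relative heights \<open>h\<close>, \<open>k\<close> over two
  consecutive edges of the hexagon spanned by \<open>a, b\<close>, then \<open>B\<close> has area at least \<open>3 + h + k\<close>,
  while \<open>wedge u v \<le> 1 + h + k\<close>.
\<close>

lemma wedge_hex_adjacent:
  assumes h: "hex_pair a b" and pos: "0 < wedge a b"
    and u: "u \<in> B" "0 \<le> wedge a u" "0 \<le> wedge u b"
    and v: "v \<in> B" "0 \<le> wedge b v" "0 \<le> wedge v (b - a)"
  shows "\<bar>wedge u v\<bar> + 2 * wedge a b \<le> M"
proof -
  define w where "w = wedge a b"
  define p q where "p = wedge u b / w" and "q = wedge a u / w"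
  have u_eq: "u = p *\<^sub>R a + q *\<^sub>R b" using wedge_expansion[of a b u] pos by (simp add: p_def q_def w_def)
  have w': "wedge b (b - a) = w" using wedge_commute[of b a] by (simp add: wedge_add w_def)
  define r s where "r = wedge v (b - a) / w" and "s = wedge b v / w"
  have v_eq: "v = r *\<^sub>R b + s *\<^sub>R (b - a)" using wedge_expansion[of b "b - a" v] pos w' by (simp add: r_def s_def w_def)
  have nn: "0 \<le> p" "0 \<le> q" "0 \<le> r" "0 \<le> s" using u v pos by (simp_all add: p_def q_def r_def s_def w_def)
  have h2: "hex_pair b (b - a)" using hex_pair_rotate[OF h] .
  have ab: "a \<in> B" "b \<in> B" "b - a \<in> B" using h h2 by (simp_all add: hex_pair_def frontier_iff)
  have le1: "p \<le> 1" "q \<le> 1" "r \<le> 1" "s \<le> 1"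
    using hex_pair_coord_le_1[OF h, of p q] hex_pair_coord_le_1[OF hex_pair_swap[OF h], of q p]
      hex_pair_coord_le_1[OF h2, of r s] hex_pair_coord_le_1[OF hex_pair_swap[OF h2], of s r]
      nn u v u_eq v_eq by (simp_all add: add.commute)
  have ba: "wedge b a = - w" using wedge_commute[of b a] by (simp add: w_def)
  have ws: "wedge a u = q * w" "wedge u b = p * w" "wedge b v = s * w" "wedge v (b - a) = r * w"
    "wedge a v = (r + s) * w" "wedge u v = (p * r + p * s + q * s) * w" "wedge u (b - a) = (p + q) * w"
    unfolding u_eq v_eq using ba by (simp_all add: wedge_add w_def[symmetric] algebra_simps)
  have wp: "w > 0" using pos w_def by simp
  have "a \<noteq> 0" using pos by auto
  \<comment> \<open>The fan without \<open>v\<close> is the better one if \<open>v\<close> lies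
    below its edge of the hexagon, that is, if \<open>r + s \<le> 1\<close>.\<close>
  have "2 * fan_area [a, u, b, b - a, - a] \<le> M"
    using fan_area_le[of "[a, u, b, b - a]"] ab u \<open>a \<noteq> 0\<close> nn wp w'
      wedge_commute[of u a] ba
    by (auto simp: ws wedge_add w_def[symmetric] split: if_splits)
  then have 0: "(p + q + 2) * w \<le> M"
    using ba w' by (simp add: ws(1-3) wedge_add w_def[symmetric] algebra_simps)
  have "2 * fan_area [a, u, b, v, b - a, - a] \<le> M"
    using fan_area_le[of "[a, u, b, v, b - a]"] ab u v \<open>a \<noteq> 0\<close> nn wp w'
      wedge_commute[of u a] wedge_commute[of v a] ba
    by (auto simp: ws wedge_add w_def[symmetric] split: if_splits)
  then have 1: "(p + q + r + s + 1) * w \<le> M"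
    using ba w' ws(4) by (simp add: ws(1-3) wedge_add w_def[symmetric] algebra_simps)
  have "p * (r + s) + q * s + 2 \<le> max (p + q + 2) (p + q + r + s + 1)"
  proof (cases "r + s \<le> 1")
    case True
    then show ?thesis using mult_left_mono[of "r + s" 1 p] mult_left_mono[of s 1 q] nn le1 by simp
  next
    case False
    \<comment> \<open>Expanded, this is p (r + s) + q s \<le> p + q + r + s - 1, where the left side
      is \<open>wedge u v\<close> in units of \<open>wedge a b\<close>.\<close>
    then have "0 \<le> (1 - p) * (r + s - 1) + q * (1 - s)"
      using nn le1 by simp
    then show ?thesis by (simp add: algebra_simps max_def)
  qed
  then have "(p * (r + s) + q * s + 2) * w \<le> max (p + q + 2) (p + q + r + s + 1) * w"
    using wp by (intro mult_right_mono) auto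
  then have "wedge u v + 2 * w \<le> M" using 0 1 by (simp add: ws max_def algebra_simps split: if_splits)
  moreover have "0 \<le> wedge u v" using nn wp by (simp add: ws)
  ultimately show ?thesis by (simp add: w_def)
qed

text \<open>All coordinates with respect to \<open>a\<close>, \<open>b\<close> are between 0 and 1,
  so the determinant of \<open>u\<close> and \<open>v\<close> is at most one unit
  \<open>wedge a b\<close>, while the hexagon alone accounts for three units of
  \<open>M\<close>.\<close>

lemma wedge_hex_same:
  assumes h: "hex_pair a b" and pos: "0 < wedge a b"
    and u: "u \<in> B" "0 \<le> wedge a u" "0 \<le> wedge u b"
    and v: "v \<in> B" "0 \<le> wedge a v" "0 \<le> wedge v b"
  shows "\<bar>wedge u v\<bar> + 2 * wedge a b \<le> M"
proof -
  define w where "w = wedge a b"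
  have wp: "w > 0" using pos w_def by simp
  define p q r s where "p = wedge u b / w" and "q = wedge a u / w" and "r = wedge v b / w" and "s = wedge a v / w"
  have eq: "u = p *\<^sub>R a + q *\<^sub>R b" "v = r *\<^sub>R a + s *\<^sub>R b"
    using wedge_expansion[of a b u] wedge_expansion[of a b v] pos by (simp_all add: p_def q_def r_def s_def w_def)
  have nn: "0 \<le> p" "0 \<le> q" "0 \<le> r" "0 \<le> s" using u v pos by (simp_all add: p_def q_def r_def s_def w_def)
  have le1: "p \<le> 1" "q \<le> 1" "r \<le> 1" "s \<le> 1"
    using hex_pair_coord_le_1[OF h, of p q] hex_pair_coord_le_1[OF hex_pair_swap[OF h], of q p]
      hex_pair_coord_le_1[OF h, of r s] hex_pair_coord_le_1[OF hex_pair_swap[OF h], of s r]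
      nn u v eq by (simp_all add: add.commute)
  have uv: "wedge u v = (p * s - q * r) * w"
    unfolding eq using wedge_commute[of b a] by (simp add: wedge_add w_def algebra_simps)
  have "\<bar>p * s - q * r\<bar> \<le> 1"
    using mult_mono[of p 1 s 1] mult_mono[of q 1 r 1] nn le1 mult_nonneg_nonneg[of p s] mult_nonneg_nonneg[of q r]
    by linarith
  then have "\<bar>wedge u v\<bar> \<le> w" using wp by (simp add: uv abs_mult mult_le_cancel_right2)
  moreover have "3 * w \<le> M"
  proof -
    have "a \<in> B" "b \<in> B" "b - a \<in> B"
      using h hex_pair_rotate[OF h] by (simp_all add: hex_pair_def frontier_iff)
    from wedge_triple_le[OF this] show ?thesis
      using wp wedge_commute[of b a] by (simp add: wedge_add w_def)
  qed
  ultimately show ?thesis by (simp add: w_def)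
qed

text \<open>Up to sign, every vector lies in one of the three cones spanned by consecutive vertices
  of the hexagon with vertices \<open>\<plusminus>a, \<plusminus>b, \<plusminus>(b - a)\<close>.\<close>

lemma hexagon_cones:
  fixes a b u :: plane
  obtains u' c d where "u' = u \<or> u' = - u" "(c, d) \<in> {(a, b), (b, b - a), (b - a, - a)}"
    "0 \<le> wedge c u'" "0 \<le> wedge u' d"
proof -
  have "\<exists>u' c d. (u' = u \<or> u' = - u) \<and> (c, d) \<in> {(a, b), (b, b - a), (b - a, - a)} \<and>
    0 \<le> wedge c u' \<and> 0 \<le> wedge u' d"
  proof -
    define u' where "u' = (if 0 \<le> wedge a u then u else - u)"
    have u': "u' = u \<or> u' = - u" "0 \<le> wedge a u'" by (auto simp: u'_def)
    consider "0 \<le> wedge u' b" | "0 \<le> wedge b u'" "0 \<le> wedge u' (b - a)" | "0 \<le> wedge (b - a) u'"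
      using wedge_commute[of b u'] wedge_commute[of "b - a" u'] by linarith
    then show ?thesis
    proof cases
      case 3
      then show ?thesis using u' wedge_commute[of u' a]
        by (intro exI[of _ u'] exI[of _ "b - a"] exI[of _ "- a"]) auto
    next
      case 1
      then show ?thesis using u'
        by (intro exI[of _ u'] exI[of _ a] exI[of _ b]) auto
    next
      case 2
      then show ?thesis using u'
        by (intro exI[of _ u'] exI[of _ b] exI[of _ "b - a"]) auto
    qed
  qed
  then show ?thesis using that by blast
qed

text \<open>After sign changes both vectors lie in cones of the hexagon. Two of the three cones are
  equal or adjacent if the first is regarded as the successor of the third up to sign, so one of the
  two preceding lemmas applies.\<close>

lemma wedge_hex_pos:
  assumes h: "hex_pair a b" and pos: "0 < wedge a b" and u: "u \<in> B" and v: "v \<in> B"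
  shows "\<bar>wedge u v\<bar> + 2 * wedge a b \<le> M"
proof -
  obtain u' c d where u': "u' = u \<or> u' = - u" "(c, d) \<in> {(a, b), (b, b - a), (b - a, - a)}"
    "0 \<le> wedge c u'" "0 \<le> wedge u' d" by (rule hexagon_cones)
  obtain v' e f where v': "v' = v \<or> v' = - v" "(e, f) \<in> {(a, b), (b, b - a), (b - a, - a)}"
    "0 \<le> wedge e v'" "0 \<le> wedge v' f" by (rule hexagon_cones)
  have B: "u' \<in> B" "v' \<in> B" "- u' \<in> B" "- v' \<in> B" using u' v' u v sym_B by auto
  have uv: "\<bar>wedge u v\<bar> = \<bar>wedge u' v'\<bar>" "\<bar>wedge u' v'\<bar> = \<bar>wedge v' u'\<bar>"
    using u' v' wedge_commute[of u' v'] by auto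
  have h2: "hex_pair b (b - a)" using hex_pair_rotate[OF h] .
  have h3: "hex_pair (b - a) (- a)" using hex_pair_rotate[OF h2] by simp
  have w: "wedge b (b - a) = wedge a b" "wedge (b - a) (- a) = wedge a b"
    using wedge_commute[of b a] by (simp_all add: wedge_add)
  have r: "b - a - b = - a" "- a - (b - a) = - b" by simp_all
  note same = wedge_hex_same[OF h] wedge_hex_same[OF h2] wedge_hex_same[OF h3]
  note adj = wedge_hex_adjacent[OF h] wedge_hex_adjacent[OF h2, unfolded r] wedge_hex_adjacent[OF h3, unfolded r]
  have "\<bar>wedge u' v'\<bar> + 2 * wedge a b \<le> M"
  proof -
    consider "c = a" "d = b" "e = a" "f = b" | "c = a" "d = b" "e = b" "f = b - a"
      | "c = a" "d = b" "e = b - a" "f = - a" | "c = b" "d = b - a" "e = a" "f = b"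
      | "c = b" "d = b - a" "e = b" "f = b - a" | "c = b" "d = b - a" "e = b - a" "f = - a"
      | "c = b - a" "d = - a" "e = a" "f = b" | "c = b - a" "d = - a" "e = b" "f = b - a"
      | "c = b - a" "d = - a" "e = b - a" "f = - a"
      using u'(2) v'(2) by auto
    then show ?thesis
    proof cases
      case 1 then show ?thesis using same(1)[of u' v'] u' v' B pos by simp
    next
      case 2 then show ?thesis using adj(1)[of u' v'] u' v' B pos by simp
    next
      \<comment> \<open>The successor of the cone of \<open>b - a\<close> and \<open>- a\<close> is
        that of \<open>- a\<close> and \<open>- b\<close>, which contains
        \<open>- u'\<close>.\<close>
      case 3 then show ?thesis using adj(3)[of v' "- u'"] u' v' B pos uv w by simp
    next
      case 4 then show ?thesis using adj(1)[of v' u'] u' v' B pos uv by simp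
    next
      case 5 then show ?thesis using same(2)[of u' v'] u' v' B pos w by simp
    next
      case 6 then show ?thesis using adj(2)[of u' v'] u' v' B pos w by simp
    next
      case 7 then show ?thesis using adj(3)[of u' "- v'"] u' v' B pos uv w by simp
    next
      case 8 then show ?thesis using adj(2)[of v' u'] u' v' B pos uv w by simp
    next
      case 9 then show ?thesis using same(3)[of u' v'] u' v' B pos w by simp
    qed
  qed
  then show ?thesis using uv by simp
qed

text \<open>Read as an upper bound for \<open>wedge a b\<close> with \<open>u\<close>,
  \<open>v\<close> fixed, this yields the bound \<open>M - 2 * \<Delta>\<close> for all
  determinants, which governs quadrangles and pentagons.\<close>

lemma wedge_hex_le:
  assumes h: "hex_pair a b" and u: "u \<in> B" and v: "v \<in> B"
  shows "\<bar>wedge u v\<bar> + 2 * \<bar>wedge a b\<bar> \<le> M"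
proof (cases "wedge a b" "0 :: real" rule: linorder_cases)
  case less
  then show ?thesis
    using wedge_hex_pos[OF hex_pair_swap[OF h] _ u v] wedge_commute[of a b] by simp
next
  case equal
  then show ?thesis using wedge_triple_le[OF u v zero_B] by simp
next
  case greater
  then show ?thesis using wedge_hex_pos[OF h _ u v] by simp
qed

end

section \<open>Closed polygons with edge vectors on the boundary of B\<close>

text \<open>For the path that starts in \<open>s\<close> and has edge vectors \<open>us\<close>,
  this is twice the total area of the triangles with apex 0 over its edges.\<close>

fun fan_sum :: "plane \<Rightarrow> plane list \<Rightarrow> real" where
  "fan_sum s [] = 0"
| "fan_sum s (u # us) = \<bar>wedge s u\<bar> + fan_sum (s + u) us"

lemma fan_sum_append: "fan_sum s (us @ vs) = fan_sum s us + fan_sum (s + sum_list us) vs"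
  by (induction us arbitrary: s) (auto simp: add.assoc)

text \<open>The apex is the first vertex, so the triangles over the first and the last edge vanish.
  A triangle is a hexagonal pair \<open>a\<close>, \<open>- b\<close>. A quadrangle consists of two
  triangles, a pentagon of a path of three edges and a triangle, a hexagon of two paths of three
  edges; a triangle contributes at most \<open>M - 2 * \<Delta>\<close> to the sum and such a path
  at most \<open>M\<close>.\<close>

lemma (in sym_body) fan_sum_le:
  assumes us: "set us \<subseteq> frontier B" "sum_list us = 0"
    and hex: "\<And>u v. hex_pair u v \<Longrightarrow> \<bar>wedge u v\<bar> \<le> \<Delta>"
    and wedge: "\<And>u v. u \<in> B \<Longrightarrow> v \<in> B \<Longrightarrow> \<bar>wedge u v\<bar> \<le> M - 2 * \<Delta>"
  shows "length us \<le> 2 \<Longrightarrow> fan_sum 0 us = 0"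
    and "length us = 3 \<Longrightarrow> fan_sum 0 us / 2 \<le> \<Delta> / 2"
    and "length us = 4 \<Longrightarrow> fan_sum 0 us / 2 \<le> M - 2 * \<Delta>"
    and "length us = 5 \<Longrightarrow> fan_sum 0 us / 2 \<le> M - \<Delta>"
    and "length us = 6 \<Longrightarrow> fan_sum 0 us / 2 \<le> M"
proof -
  assume "length us \<le> 2"
  then consider "us = []" | u where "us = [u]" | u v where "us = [u, v]"
    by (cases us; cases "tl us"; cases "tl (tl us)") auto
  then show "fan_sum 0 us = 0"
  proof cases
    case 3
    then have "v = - u" using us(2) by (simp add: eq_neg_iff_add_eq_0 add.commute)
    then show ?thesis using 3 by simp
  qed auto
next
  assume "length us = 3"
  then obtain a b c where l: "us = [a, b, c]"
    by (auto simp: numeral_eq_Suc length_Suc_conv)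
  then have "c + (a + b) = 0" using us(2) by (simp add: add_ac)
  then have c: "c = - (a + b)" by (simp only: eq_neg_iff_add_eq_0)
  have "a \<in> frontier B" "b \<in> frontier B" "- (a + b) \<in> frontier B" using us(1) l c by auto
  then have "hex_pair a (- b)" unfolding hex_pair_def using sym_frontier[of b] sym_frontier[of "a + b"] by simp
  from hex[OF this] show "fan_sum 0 us / 2 \<le> \<Delta> / 2" by (simp add: l c wedge_add wedge_commute[of b a])
next
  assume "length us = 4"
  then obtain a b c d where l: "us = [a, b, c, d]"
    by (auto simp: numeral_eq_Suc length_Suc_conv)
  have "(a + b) + (c + d) = 0" using us(2) l by (simp add: add_ac)
  then have ab: "a + b = - (c + d)" by (simp only: eq_neg_iff_add_eq_0)
  have B: "a \<in> B" "b \<in> B" "c \<in> B" "d \<in> B" using us(1) l by (auto simp: frontier_iff)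
  have "fan_sum 0 us = \<bar>wedge a b\<bar> + \<bar>wedge d c\<bar>"
    unfolding l using wedge_commute[of c d] by (simp add: ab) (simp add: wedge_add)
  then show "fan_sum 0 us / 2 \<le> M - 2 * \<Delta>" using wedge[of a b] wedge[of d c] B by simp
next
  assume "length us = 5"
  then obtain a b c d e where l: "us = [a, b, c, d, e]"
    by (auto simp: numeral_eq_Suc length_Suc_conv)
  have "(a + b + c) + (d + e) = 0" using us(2) l by (simp add: add_ac)
  then have abc: "a + b + c = - (d + e)" by (simp only: eq_neg_iff_add_eq_0)
  have B: "a \<in> B" "b \<in> B" "c \<in> B" "d \<in> B" "e \<in> B" using us(1) l by (auto simp: frontier_iff)
  have "fan_sum 0 us = \<bar>wedge a b\<bar> + \<bar>wedge (a + b) c\<bar> + \<bar>wedge e d\<bar>"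
    unfolding l by (simp add: abc) (simp add: wedge_add)
  then show "fan_sum 0 us / 2 \<le> M - \<Delta>"
    using wedge_path_le[of a b c] wedge[of e d] B by simp
next
  assume "length us = 6"
  then obtain a b c d e f where l: "us = [a, b, c, d, e, f]"
    by (auto simp: numeral_eq_Suc length_Suc_conv)
  have "(a + b + c) + (d + e + f) = 0" using us(2) l by (simp add: add_ac)
  then have abc: "a + b + c = - (d + e + f)" by (simp only: eq_neg_iff_add_eq_0)
  have B: "a \<in> B" "b \<in> B" "c \<in> B" "d \<in> B" "e \<in> B" "f \<in> B" using us(1) l by (auto simp: frontier_iff)
  have "wedge (- (d + e + f)) d = - wedge (f + e) d" "wedge (- (d + e + f) + d) e = - wedge f e"
    "wedge (- (d + e + f) + d + e) f = 0"
    by (simp_all add: wedge_add)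
  then have "fan_sum 0 us = \<bar>wedge a b\<bar> + \<bar>wedge (a + b) c\<bar> + (\<bar>wedge f e\<bar> + \<bar>wedge (f + e) d\<bar>)"
    unfolding l by (simp only: fan_sum.simps abc add_0 wedge_simps abs_minus_cancel abs_zero)
  then show "fan_sum 0 us / 2 \<le> M"
    using wedge_path_le[of a b c] wedge_path_le[of f e d] B by simp
qed

section \<open>The boundary of a convex face as two monotone chains\<close>

lemma wedge_eq_0:
  assumes "wedge a b = 0" "a \<noteq> 0" obtains c where "b = c *\<^sub>R a"
proof -
  have 1: "b$1 * a$2 = b$2 * a$1" using assms(1) by (simp add: wedge_def algebra_simps)
  consider "a$1 \<noteq> 0" | "a$2 \<noteq> 0" using assms(2) by (auto simp: vec_eq_iff forall_2)
  then show ?thesis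
  proof cases
    case 1
    then have "b = (b$1 / a$1) *\<^sub>R a" using \<open>b$1 * a$2 = b$2 * a$1\<close> by (simp add: vec_eq_iff forall_2 field_simps)
    then show ?thesis using that by blast
  next
    case 2
    then have "b = (b$2 / a$2) *\<^sub>R a" using \<open>b$1 * a$2 = b$2 * a$1\<close> by (simp add: vec_eq_iff forall_2 field_simps)
    then show ?thesis using that by blast
  qed
qed

lemma triangle_interior:
  assumes "convex P" "v \<in> P" "v + a \<in> P" "v + b \<in> P" "wedge a b \<noteq> 0" "0 < s" "0 < t" "s + t < 1"
  shows "v + s *\<^sub>R a + t *\<^sub>R b \<in> interior P"
proof -
  define S T where "S = (\<lambda>z. wedge (z - v) b / wedge a b)" and "T = (\<lambda>z. wedge a (z - v) / wedge a b)"
  let ?U = "{z. 0 < S z} \<inter> {z. 0 < T z} \<inter> {z. S z + T z < 1}"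
  have "open ?U"
    unfolding S_def T_def using assms(5)
    by (intro open_Int open_Collect_less continuous_intros) auto
  moreover have "?U \<subseteq> P"
  proof
    fix z assume z: "z \<in> ?U"
    have "z - v = S z *\<^sub>R a + T z *\<^sub>R b" using wedge_expansion[OF assms(5), of "z - v"] by (simp add: S_def T_def)
    then have "z = (1 - S z - T z) *\<^sub>R v + S z *\<^sub>R (v + a) + T z *\<^sub>R (v + b)"
      by (simp add: algebra_simps)
    moreover have "(1 - S z - T z) *\<^sub>R v + S z *\<^sub>R (v + a) + T z *\<^sub>R (v + b) \<in> convex hull {v, v + a, v + b}"
      unfolding convex_hull_3 using z
      by (intro CollectI exI[of _ "1 - S z - T z"] exI[of _ "S z"] exI[of _ "T z"]) auto
    moreover have "convex hull {v, v + a, v + b} \<subseteq> P" using assms by (intro hull_minimal) auto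
    ultimately show "z \<in> P" by auto
  qed
  moreover have "v + s *\<^sub>R a + t *\<^sub>R b \<in> ?U"
    using assms by (simp add: S_def T_def wedge_add)
  ultimately show ?thesis using interior_maximal by blast
qed

text \<open>
  If \<open>z\<close> were outside the cone, the triangle \<open>v, v + a, v + b\<close> together with \<open>z\<close> would have
  a boundary segment in the interior of its hull.
\<close>

lemma convex_subset_cone:
  assumes P: "convex P" "v \<in> P" "v + a \<in> P" "v + b \<in> P" and ab: "wedge a b \<noteq> 0"
    and a: "\<And>t. 0 < t \<Longrightarrow> t \<le> 1 \<Longrightarrow> v + t *\<^sub>R a \<notin> interior P"
    and b: "\<And>t. 0 < t \<Longrightarrow> t \<le> 1 \<Longrightarrow> v + t *\<^sub>R b \<notin> interior P"
    and z: "z \<in> P"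
  shows "0 \<le> wedge (z - v) b / wedge a b \<and> 0 \<le> wedge a (z - v) / wedge a b"
proof -
  have main: "0 \<le> wedge (z - v) b / wedge a b"
    if P: "v + a \<in> P" "v + b \<in> P" and ab: "wedge a b \<noteq> 0"
      and b: "\<And>t. 0 < t \<Longrightarrow> t \<le> 1 \<Longrightarrow> v + t *\<^sub>R b \<notin> interior P" for a b
  proof (rule ccontr)
    define \<alpha> \<beta> where "\<alpha> = wedge (z - v) b / wedge a b" and "\<beta> = wedge a (z - v) / wedge a b"
    assume "\<not> ?thesis"
    then have \<alpha>: "\<alpha> < 0" by (simp add: \<alpha>_def)
    have zv: "z = v + \<alpha> *\<^sub>R a + \<beta> *\<^sub>R b"
      using wedge_expansion[OF ab, of "z - v"] by (simp add: \<alpha>_def \<beta>_def algebra_simps)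
    \<comment> \<open>So small that \<open>s\<close> stays in the open interval from 0 to 1/2 and
      the coordinate of the final point along \<open>b\<close> between 0 and 1.\<close>
    define k where "k = 1 / (4 * (\<bar>\<alpha>\<bar> + \<bar>\<beta>\<bar> + 1))"
    have k: "0 < k" "k \<le> 1 / 4" "k * \<bar>\<alpha>\<bar> \<le> 1 / 4" "k * \<bar>\<beta>\<bar> \<le> 1 / 4"
      by (simp_all add: k_def field_simps)
    \<comment> \<open>Chosen to cancel the coordinate along \<open>a\<close> in the combination of
      \<open>z\<close> and \<open>?w\<close> with weights \<open>k\<close> and \<open>1 - k\<close>.
      That point is interior because \<open>?w\<close> is, yet it lies on the segment from
      \<open>v\<close> to \<open>v + b\<close>.\<close>
    define s where "s = - k * \<alpha> / (1 - k)"
    have "0 < - k * \<alpha>" using k \<alpha> by (simp add: mult_pos_neg)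
    then have s: "0 < s" "s < 1 / 2" using k \<alpha> by (simp_all add: s_def field_simps)
    let ?w = "v + s *\<^sub>R a + (1 / 2) *\<^sub>R b"
    have w: "?w \<in> interior P" using s assms(1,2) P ab by (intro triangle_interior) auto
    have "z - (1 - k) *\<^sub>R (z - ?w) \<in> interior P"
      using mem_interior_convex_shrink[OF assms(1) w z, of "1 - k"] k by simp
    moreover have "z - (1 - k) *\<^sub>R (z - ?w) = v + (k * \<beta> + (1 - k) / 2) *\<^sub>R b"
    proof -
      have "z - (1 - k) *\<^sub>R (z - ?w) = v + (k * \<alpha> + (1 - k) * s) *\<^sub>R a + (k * \<beta> + (1 - k) / 2) *\<^sub>R b"
        unfolding zv by (simp add: algebra_simps)
      moreover have "k * \<alpha> + (1 - k) * s = 0" using k by (simp add: s_def)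
      ultimately show ?thesis by simp
    qed
    moreover have "0 < k * \<beta> + (1 - k) / 2" "k * \<beta> + (1 - k) / 2 \<le> 1"
    proof -
      have "\<bar>k * \<beta>\<bar> \<le> 1 / 4" using k by (simp add: abs_mult)
      then show "0 < k * \<beta> + (1 - k) / 2" "k * \<beta> + (1 - k) / 2 \<le> 1" using k by (simp_all add: field_simps)
    qed
    ultimately show False using b by auto
  qed
  have "wedge b a \<noteq> 0" using ab wedge_commute[of a b] by simp
  then have "0 \<le> wedge (z - v) a / wedge b a" using main[of b a] P a by blast
  then have "0 \<le> wedge a (z - v) / wedge a b"
    using wedge_commute[of b a] wedge_commute[of "z - v" a] by simp
  then show ?thesis using main[of a b] P ab b by blast
qed

text \<open>\<open>A\<close> consists of the edges of the subdivision on the boundary of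
  \<open>P\<close>, directed so that \<open>g\<close> increases. Several arcs may lie on one side of
  the convex set, so angles equal to pi are covered. Words such as left and right refer to
  \<open>g\<close>.\<close>

locale polygon_face =
  fixes P :: "plane set" and A :: "(plane \<times> plane) set" and g :: "plane \<Rightarrow> real"
  assumes convex_P: "convex P" and compact_P: "compact P" and interior_P: "interior P \<noteq> {}"
    and finite_A: "finite A"
    and frontier_P: "frontier P = (\<Union>(x, y)\<in>A. closed_segment x y)"
    and linear_g: "linear g"
    and g_less: "(x, y) \<in> A \<Longrightarrow> g x < g y"
    and no_overlap: "(x, y) \<in> A \<Longrightarrow> (x', y') \<in> A \<Longrightarrow> (x, y) \<noteq> (x', y') \<Longrightarrow>
      closed_segment x y \<inter> closed_segment x' y' \<subseteq> {x, y}"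
    and inj_g: "inj_on g (fst ` A \<union> snd ` A)"
begin

abbreviation "verts \<equiv> fst ` A \<union> snd ` A"

lemma closed_P: "closed P" using compact_P compact_imp_closed by blast

lemma arc_frontier: "(x, y) \<in> A \<Longrightarrow> closed_segment x y \<subseteq> frontier P"
  using frontier_P by auto

lemma arc_P: "(x, y) \<in> A \<Longrightarrow> closed_segment x y \<subseteq> P"
  using arc_frontier closed_P frontier_subset_closed by blast

lemma verts_frontier: "v \<in> verts \<Longrightarrow> v \<in> frontier P"
  using arc_frontier[of v] arc_frontier[of _ v] ends_in_segment by (auto simp: subset_eq)

text \<open>Reversing all arcs and the sign of \<open>g\<close> preserves the axioms, so statements
  on left ends carry over to right ends.\<close>

lemma mirror: "polygon_face P (prod.swap ` A) (\<lambda>z. - g z)"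
proof (rule polygon_face.intro, goal_cases)
  case 5
  show ?case unfolding frontier_P by (force simp: closed_segment_commute)
next
  case 6
  show ?case using linear_g by (simp add: linear_compose_neg)
next
  case (8 x y x' y')
  then have "closed_segment y x \<inter> closed_segment y' x' \<subseteq> {y, x}" by (intro no_overlap) auto
  then show ?case unfolding closed_segment_commute[of x y] closed_segment_commute[of x' y'] by auto
next
  case 9
  have "fst ` prod.swap ` A \<union> snd ` prod.swap ` A = verts" by (simp add: image_image Un_commute)
  moreover have "inj_on (\<lambda>z. - g z) verts"
    by (rule inj_onI, rule inj_onD[OF inj_g]) simp_all
  ultimately show ?case by (simp only:)
next
  case (7 x y)
  then have "(y, x) \<in> A" by auto
  then show ?case using g_less by simp
qed (simp_all add: convex_P compact_P interior_P finite_A)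

lemma g_segment:
  assumes "(x, y) \<in> A" "z \<in> closed_segment x y"
  shows "g x \<le> g z" "g z = g x \<Longrightarrow> z = x"
proof -
  obtain u where u: "0 \<le> u" "u \<le> 1" "z = (1 - u) *\<^sub>R x + u *\<^sub>R y" using assms by (auto simp: in_segment)
  have gz: "g z = g x + u * (g y - g x)"
    unfolding u(3) using linear_g by (simp add: linear_add linear_scale) (simp add: algebra_simps)
  show "g x \<le> g z" using gz u g_less[OF assms(1)] by simp
  show "z = x" if "g z = g x" using that gz u g_less[OF assms(1)] by simp
qed

lemma A_nonempty: "A \<noteq> {}"
proof -
  have "frontier P \<noteq> {}"
    using interior_P compact_P compact_imp_bounded frontier_eq_empty interior_empty not_bounded_UNIV by metis
  then show ?thesis using frontier_P by auto
qed

text \<open>A minimum of \<open>g\<close> on \<open>P\<close> is not interior, since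
  \<open>g\<close> decreases against the direction of an arc. So it lies on an arc and must be the
  left end of it; injectivity of \<open>g\<close> on the vertices makes it unique.\<close>

lemma leftmost:
  obtains p where "p \<in> fst ` A" "\<And>z. z \<in> P \<Longrightarrow> z \<noteq> p \<Longrightarrow> g p < g z"
proof -
  have "P \<noteq> {}" using interior_P by auto
  moreover have "continuous_on P g" using linear_g linear_continuous_on linear_conv_bounded_linear by blast
  ultimately obtain p where p: "p \<in> P" "\<And>z. z \<in> P \<Longrightarrow> g p \<le> g z"
    using continuous_attains_inf[OF compact_P] by blast
  obtain x0 y0 where "(x0, y0) \<in> A" using A_nonempty by auto
  then have d: "g (y0 - x0) > 0" using g_less linear_g by (simp add: linear_diff)
  have *: "q \<in> fst ` A" if "q \<in> P" "g q = g p" for q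
  proof -
    have "q \<notin> interior P"
    proof
      assume "q \<in> interior P"
      then obtain e where e: "e > 0" "cball q e \<subseteq> P" by (meson mem_interior_cball)
      define t where "t = e / norm (y0 - x0)"
      have "y0 - x0 \<noteq> 0" using d linear_g linear_0 by fastforce
      then have "q - t *\<^sub>R (y0 - x0) \<in> cball q e" "t > 0" using e by (auto simp: t_def dist_norm)
      then have "q - t *\<^sub>R (y0 - x0) \<in> P" using e(2) by blast
      then have "g p \<le> g (q - t *\<^sub>R (y0 - x0))" using p(2) by blast
      then show False using that d \<open>t > 0\<close> linear_g by (simp add: linear_diff linear_scale zero_less_mult_iff)
    qed
    then have "q \<in> frontier P" using that closed_P by (simp add: frontier_def)
    then obtain x y where xy: "(x, y) \<in> A" "q \<in> closed_segment x y" using frontier_P by auto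
    then have "g p \<le> g x" using p arc_P[OF xy(1)] by auto
    then have "q = x" using g_segment[OF xy] that by auto
    then show ?thesis using xy by force
  qed
  show ?thesis
  proof (rule that[of p])
    show "p \<in> fst ` A" using *[OF p(1)] by simp
    fix z assume z: "z \<in> P" "z \<noteq> p"
    show "g p < g z"
    proof (rule ccontr)
      assume "\<not> g p < g z"
      then have "g z = g p" using p(2)[OF z(1)] by simp
      then show False using *[OF z(1)] *[OF p(1)] z inj_g by (metis UnI1 inj_onD)
    qed
  qed
qed

text \<open>Both arcs lead to the right, so parallel ones have the same direction and the shorter is
  contained in the longer, against \<open>no_overlap\<close>.\<close>

lemma parallel_arcs:
  assumes "(v, y) \<in> A" "(v, y') \<in> A" "wedge (y - v) (y' - v) = 0" shows "y = y'"
proof (rule ccontr)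
  assume ne: "y \<noteq> y'"
  have pos: "g (y - v) > 0" "g (y' - v) > 0" using g_less assms linear_g by (simp_all add: linear_diff)
  define k where "k = g (y' - v) / g (y - v)"
  have "y - v \<noteq> 0" using pos linear_0[OF linear_g] by auto
  obtain c where c: "y' - v = c *\<^sub>R (y - v)"
    using wedge_eq_0[OF assms(3) \<open>y - v \<noteq> 0\<close>] by blast
  then have "g (y' - v) = c * g (y - v)" using linear_scale[OF linear_g, of c "y - v"] by simp
  then have "c > 0" using pos zero_less_mult_pos2 by auto
  have y': "y' = v + c *\<^sub>R (y - v)" using c by (simp add: algebra_simps)
  have "(1 / c) *\<^sub>R (y' - v) = y - v" unfolding c using \<open>c > 0\<close> by simp
  then have y: "y = v + (1 / c) *\<^sub>R (y' - v)" by simp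
  have "y' \<in> closed_segment v y \<or> y \<in> closed_segment v y'"
  proof (cases "c \<le> 1")
    case True
    then have "y' \<in> closed_segment v y"
      unfolding in_segment using \<open>c > 0\<close> y' by (intro exI[of _ c]) (auto simp: algebra_simps)
    then show ?thesis ..
  next
    case False
    then have "y \<in> closed_segment v y'"
      unfolding in_segment using \<open>c > 0\<close> y by (intro exI[of _ "1 / c"]) (auto simp: algebra_simps)
    then show ?thesis ..
  qed
  then show False
    using no_overlap[OF assms(1,2)] no_overlap[OF assms(2,1)] ne g_less assms by fastforce
qed

lemma arcs_cone:
  assumes "(v, y) \<in> A" "(v, y') \<in> A" "y \<noteq> y'" "z \<in> P"
  shows "0 \<le> wedge (z - v) (y' - v) / wedge (y - v) (y' - v)"
    "0 \<le> wedge (y - v) (z - v) / wedge (y - v) (y' - v)"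
proof -
  have w: "wedge (y - v) (y' - v) \<noteq> 0" using parallel_arcs assms by blast
  have *: "v + t *\<^sub>R (x - v) \<notin> interior P" if "(v, x) \<in> A" "0 < t" "t \<le> 1" for t x
  proof -
    have "v + t *\<^sub>R (x - v) \<in> closed_segment v x"
      unfolding in_segment using that by (intro exI[of _ t]) (auto simp: algebra_simps)
    then show ?thesis using arc_frontier[OF that(1)] by (auto simp: frontier_def)
  qed
  have "v \<in> P" "y \<in> P" "y' \<in> P" using arc_P assms by auto
  then show "0 \<le> wedge (z - v) (y' - v) / wedge (y - v) (y' - v)"
    "0 \<le> wedge (y - v) (z - v) / wedge (y - v) (y' - v)"
    using convex_subset_cone[OF convex_P, of v "y - v" "y' - v" z] w * assms by auto
qed

text \<open>Two arcs from \<open>v\<close> confine \<open>P\<close> to the cone between them, where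
  \<open>g\<close> is at least \<open>g v\<close>. This fails once \<open>P\<close> reaches further
  left than \<open>v\<close>.\<close>

lemma start_unique:
  assumes "(v, y) \<in> A" "(v, y') \<in> A" "z \<in> P" "g z < g v" shows "y = y'"
proof (rule ccontr)
  assume ne: "y \<noteq> y'"
  let ?\<alpha> = "wedge (z - v) (y' - v) / wedge (y - v) (y' - v)"
  let ?\<beta> = "wedge (y - v) (z - v) / wedge (y - v) (y' - v)"
  have "z - v = ?\<alpha> *\<^sub>R (y - v) + ?\<beta> *\<^sub>R (y' - v)"
    using parallel_arcs[OF assms(1,2)] ne by (intro wedge_expansion) auto
  then have "g (z - v) = g (?\<alpha> *\<^sub>R (y - v) + ?\<beta> *\<^sub>R (y' - v))" by (rule arg_cong)
  also have "\<dots> = ?\<alpha> * g (y - v) + ?\<beta> * g (y' - v)"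
    by (simp only: linear_add[OF linear_g] linear_scale[OF linear_g] real_scaleR_def)
  finally have "g (z - v) = ?\<alpha> * g (y - v) + ?\<beta> * g (y' - v)" .
  moreover have "0 \<le> ?\<alpha>" "0 \<le> ?\<beta>" using arcs_cone[OF assms(1,2) ne assms(3)] by auto
  moreover have "g (y - v) > 0" "g (y' - v) > 0" "g (z - v) < 0"
    using g_less assms linear_g by (simp_all add: linear_diff)
  ultimately show False by (smt (verit) mult_nonneg_nonneg)
qed

text \<open>The cone of any two arcs contains \<open>P\<close> and hence the end of the third; the
  signs which this forces on the three determinants are contradictory.\<close>

lemma at_most_two_arcs:
  assumes "(v, a) \<in> A" "(v, b) \<in> A" "(v, c) \<in> A" shows "a = b \<or> b = c \<or> a = c"
proof (rule ccontr)
  assume "\<not> ?thesis"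
  then have ne: "a \<noteq> b" "b \<noteq> c" "a \<noteq> c" by auto
  have P: "a \<in> P" "b \<in> P" "c \<in> P" using arc_P assms by auto
  define ab bc ac where "ab = wedge (a - v) (b - v)" and "bc = wedge (b - v) (c - v)" and "ac = wedge (a - v) (c - v)"
  have nz: "ab \<noteq> 0" "bc \<noteq> 0" "ac \<noteq> 0" using parallel_arcs assms ne unfolding ab_def bc_def ac_def by blast+
  have "0 \<le> - bc / ab" "0 \<le> ac / ab"
    using arcs_cone[OF assms(1,2) ne(1) P(3)] wedge_commute[of "b - v" "c - v"] by (simp_all add: ab_def bc_def ac_def)
  moreover have "0 \<le> bc / ac" "0 \<le> ab / ac"
    using arcs_cone[OF assms(1,3) ne(3) P(2)] by (simp_all add: ab_def bc_def ac_def)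
  ultimately show False using nz by (smt (verit) divide_nonneg_neg divide_pos_pos divide_pos_neg divide_neg_pos)
qed

lemma local_arcs:
  assumes "v \<in> verts"
  obtains e where "e > 0" "\<And>x y z. (x, y) \<in> A \<Longrightarrow> z \<in> closed_segment x y \<Longrightarrow> z \<in> ball v e \<Longrightarrow> v = x \<or> v = y"
proof -
  let ?C = "\<Union>(x, y)\<in>{(x, y)\<in>A. v \<noteq> x \<and> v \<noteq> y}. closed_segment x y"
  have "closed ?C" by (intro closed_UN finite_subset[OF _ finite_A]) auto
  moreover have "v \<notin> ?C"
  proof
    assume "v \<in> ?C"
    then obtain x y where xy: "(x, y) \<in> A" "v \<noteq> x" "v \<noteq> y" "v \<in> closed_segment x y" by auto
    obtain x' y' where xy': "(x', y') \<in> A" "v = x' \<or> v = y'" using assms by auto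
    then show False using no_overlap[OF xy(1) xy'(1)] xy by auto
  qed
  ultimately have "open (- ?C)" "v \<in> - ?C" by blast+
  then obtain e where e: "e > 0" "ball v e \<subseteq> - ?C" by (meson openE)
  show ?thesis
  proof (rule that[OF e(1)])
    fix x y z assume "(x, y) \<in> A" "z \<in> closed_segment x y" "z \<in> ball v e"
    then show "v = x \<or> v = y" using e(2) by blast
  qed
qed

text \<open>If no arc starts in \<open>v\<close>, the part of a small disc to the right of
  \<open>v\<close> contains no boundary point. It meets \<open>P\<close> in the direction of
  \<open>q\<close>, so by connectedness it lies in the interior. Prolonging an arc from
  \<open>x\<close> to \<open>v\<close> beyond \<open>v\<close> then puts \<open>v\<close> strictly
  between a point of \<open>P\<close> and an interior point, so \<open>v\<close> would be
  interior.\<close>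

lemma start_exists:
  assumes v: "v \<in> verts" and q: "q \<in> P" "g v < g q"
  shows "\<exists>y. (v, y) \<in> A"
proof (rule ccontr)
  assume no: "\<nexists>y. (v, y) \<in> A"
  then obtain x where x: "(x, v) \<in> A" using v by auto
  obtain e where e: "e > 0" "\<And>x y z. (x, y) \<in> A \<Longrightarrow> z \<in> closed_segment x y \<Longrightarrow> z \<in> ball v e \<Longrightarrow> v = x \<or> v = y"
    using local_arcs[OF v] by blast
  define H where "H = ball v e \<inter> {z. g v < g z}"
  have cont: "continuous_on UNIV g" using linear_g linear_continuous_on linear_conv_bounded_linear by blast
  have "convex {z. g v < g z}"
    using convex_linear_vimage[OF linear_g convex_real_interval(3)[of "g v"]] by (simp add: vimage_def)
  then have "connected H" unfolding H_def by (intro convex_connected convex_Int convex_ball)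
  have "H \<inter> frontier P = {}"
  proof (rule ccontr)
    assume "H \<inter> frontier P \<noteq> {}"
    then obtain z x y where z: "z \<in> H" "(x, y) \<in> A" "z \<in> closed_segment x y" using frontier_P by auto
    then have "v = x \<or> v = y" using e(2)[of x y z] by (auto simp: H_def)
    then have "v = y" using no z by auto
    then have "g z \<le> g v"
      using polygon_face.g_segment(1)[OF mirror, of y x z] z by (auto simp: closed_segment_commute)
    then show False using z by (simp add: H_def)
  qed
  have *: "v + t *\<^sub>R d \<in> H" if "0 < t" "t * norm d < e" "0 < g d" for t d
    using that linear_g by (auto simp: H_def dist_norm linear_add linear_scale)
  have small: "\<exists>t. 0 < t \<and> t \<le> 1 \<and> t * norm d < e" for d :: plane
  proof -
    have d: "norm d + 1 > 0" by (simp add: add_nonneg_pos)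
    define t where "t = min 1 (e / (norm d + 1))"
    have t: "0 < t" "t \<le> 1" "t \<le> e / (norm d + 1)" using e(1) d by (auto simp: t_def)
    then have "t * (norm d + 1) \<le> e" using d by (simp add: field_simps)
    then have "t * norm d < e" using t by (simp add: algebra_simps)
    then show ?thesis using t by blast
  qed
  have vP: "v \<in> P" using arc_P[OF x] by auto
  obtain t where t: "0 < t" "t \<le> 1" "t * norm (q - v) < e" using small by blast
  have "v + t *\<^sub>R (q - v) \<in> H" using t q linear_g by (intro *) (auto simp: linear_diff)
  moreover have "v + t *\<^sub>R (q - v) \<in> P"
    using convexD[OF convex_P vP q(1), of "1 - t" t] t by (simp add: algebra_simps)
  ultimately have "H \<subseteq> P" using connected_Int_frontier[OF \<open>connected H\<close>, of P] \<open>H \<inter> frontier P = {}\<close> by auto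
  then have HI: "H \<subseteq> interior P" using \<open>H \<inter> frontier P = {}\<close> closed_P by (auto simp: frontier_def)
  obtain s where s: "0 < s" "s \<le> 1" "s * norm (v - x) < e" using small by blast
  have "v + s *\<^sub>R (v - x) \<in> H" using s g_less[OF x] linear_g by (intro *) (auto simp: linear_diff)
  then have w: "v + s *\<^sub>R (v - x) \<in> interior P" using HI by auto
  have xP: "x \<in> P" using arc_P[OF x] by auto
  have "x - (1 / (1 + s)) *\<^sub>R (x - (v + s *\<^sub>R (v - x))) \<in> interior P"
    using s by (intro mem_interior_convex_shrink[OF convex_P w xP]) auto
  moreover have "x - (1 / (1 + s)) *\<^sub>R (x - (v + s *\<^sub>R (v - x))) = v"
  proof -
    have "x - (v + s *\<^sub>R (v - x)) = (1 + s) *\<^sub>R (x - v)" by (simp add: algebra_simps)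
    then show ?thesis using s by simp
  qed
  ultimately show False using verts_frontier[OF v] by (simp add: frontier_def)
qed

text \<open>With a single arc at \<open>p\<close>, the two halves of a small disc on either side of
  its line are free of boundary points, so each lies inside or outside \<open>P\<close>. Inside is
  impossible, as each half has points to the left of \<open>p\<close>. So near \<open>p\<close> the
  interior of \<open>P\<close> is contained in a line and empty, although \<open>p\<close> is in the
  closure of the interior.\<close>

lemma two_arcs:
  assumes p: "p \<in> fst ` A" "\<And>z. z \<in> P \<Longrightarrow> z \<noteq> p \<Longrightarrow> g p < g z"
  obtains y y' where "(p, y) \<in> A" "(p, y') \<in> A" "y \<noteq> y'"
proof -
  obtain y where y: "(p, y) \<in> A" using p by auto
  have "\<exists>y'. (p, y') \<in> A \<and> y' \<noteq> y"
  proof (rule ccontr)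
    assume "\<not> ?thesis"
    then have only: "\<And>y'. (p, y') \<in> A \<Longrightarrow> y' = y" by auto
    obtain e where e: "e > 0" "\<And>x y z. (x, y) \<in> A \<Longrightarrow> z \<in> closed_segment x y \<Longrightarrow> z \<in> ball p e \<Longrightarrow> p = x \<or> p = y"
      using local_arcs[of p] p by blast
    have pP: "p \<in> P" using arc_P[OF y] by auto
    define n where "n = y - p"
    have n: "g n > 0" using g_less[OF y] linear_g by (simp add: n_def linear_diff)
    then have "n \<noteq> 0" using linear_0[OF linear_g] by auto
    define H where "H = (\<lambda>m. ball p e \<inter> {z. 0 < wedge m (z - p)})"
    have Hempty: "H m \<inter> P = {}" if m: "m = n \<or> m = - n" for m
    proof (rule ccontr)
      assume ne: "H m \<inter> P \<noteq> {}"
      have "convex {z. 0 < wedge m (z - p)}"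
      proof -
        have "{z. 0 < wedge m (z - p)} = wedge m -` {wedge m p<..}" by (auto simp: wedge_add)
        then show ?thesis
          using convex_linear_vimage[OF bounded_linear.linear[OF bounded_linear_wedge] convex_real_interval(3)[of "wedge m p"], of m]
          by simp
      qed
      then have "connected (H m)" unfolding H_def by (intro convex_connected convex_Int convex_ball)
      moreover have "H m \<inter> frontier P = {}"
      proof (rule ccontr)
        assume "H m \<inter> frontier P \<noteq> {}"
        then obtain z x' y' where z: "z \<in> H m" "(x', y') \<in> A" "z \<in> closed_segment x' y'" using frontier_P by auto
        then have "p = x' \<or> p = y'" using e(2)[of x' y' z] by (auto simp: H_def)
        moreover have "p \<noteq> y'" using g_less[OF z(2)] p(2)[of x'] arc_P[OF z(2)] by fastforce
        ultimately have "z \<in> closed_segment p y" using z only by auto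
        then obtain u where "z = (1 - u) *\<^sub>R p + u *\<^sub>R y" by (auto simp: in_segment)
        then have "z - p = u *\<^sub>R n" by (simp add: n_def algebra_simps)
        then have "wedge m (z - p) = 0" using m by auto
        then show False using z by (simp add: H_def)
      qed
      ultimately have "H m \<subseteq> P" using ne connected_Int_frontier by blast
      define r :: plane where "r = (\<chi> i. if i = 1 then - m$2 else m$1)"
      have r: "0 < wedge m r"
      proof -
        have "m \<noteq> 0" using m \<open>n \<noteq> 0\<close> by auto
        then have "m$1 \<noteq> 0 \<or> m$2 \<noteq> 0" by (auto simp: vec_eq_iff forall_2)
        then show ?thesis by (simp add: wedge_def r_def sum_power2_gt_zero_iff flip: power2_eq_square)
      qed
      \<comment> \<open>Small enough for \<open>g\<close> still to decrease when the direction
        \<open>- n\<close> is tilted by \<open>k *\<^sub>R r\<close> into the open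
        half-plane.\<close>
      define k where "k = g n / (\<bar>g r\<bar> + 1)"
      have k: "k > 0" "k * g r < g n" using n by (auto simp: k_def field_simps) (smt (verit) mult_left_mono abs_ge_self)
      define d where "d = - n + k *\<^sub>R r"
      have d: "g d < 0" "0 < wedge m d"
        using k n r m linear_g
        by (auto simp: d_def linear_add linear_scale linear_neg wedge_add linear_diff mult_less_0_iff)
      define t where "t = e / (norm d + 1)"
      have "norm d + 1 > 0" by (simp add: add_nonneg_pos)
      then have t: "t > 0" "t * norm d < e" using e(1) by (auto simp: t_def field_simps)
      then have "p + t *\<^sub>R d \<in> H m" using d by (auto simp: H_def dist_norm)
      then have "p + t *\<^sub>R d \<in> P" using \<open>H m \<subseteq> P\<close> by auto
      moreover have "g (p + t *\<^sub>R d) < g p" using t d linear_g by (simp add: linear_add linear_scale mult_pos_neg)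
      ultimately show False using p(2)[of "p + t *\<^sub>R d"] by fastforce
    qed
    have sub: "ball p e \<inter> interior P \<subseteq> (+) p ` {z. wedge n z = 0}"
    proof
      fix z assume z: "z \<in> ball p e \<inter> interior P"
      then have "\<not> 0 < wedge n (z - p)" "\<not> 0 < wedge (- n) (z - p)"
        using Hempty[of n] Hempty[of "- n"] interior_subset unfolding H_def by blast+
      then have "wedge n (z - p) = 0" by simp
      then show "z \<in> (+) p ` {z. wedge n z = 0}" by (intro image_eqI[of _ _ "z - p"]) auto
    qed
    have "negligible ((+) p ` {z. wedge n z = 0})"
      using negligible_wedge_line[OF \<open>n \<noteq> 0\<close>] negligible_translation by blast
    then have "negligible (ball p e \<inter> interior P)" using sub negligible_subset by blast
    moreover have "open (ball p e \<inter> interior P)" by auto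
    ultimately have "ball p e \<inter> interior P = {}" using open_not_negligible by blast
    moreover have "p \<in> closure (interior P)"
      using pP convex_closure_interior[OF convex_P interior_P] closed_P by (simp add: closure_closed)
    ultimately show False using e(1) by (metis Int_commute closure_iff_nhds_not_empty centre_in_ball open_ball order_refl)
  qed
  then show ?thesis using that y by auto
qed

fun chain :: "plane \<Rightarrow> (plane \<times> plane) list \<Rightarrow> plane \<Rightarrow> bool" where
  "chain v [] w \<longleftrightarrow> v = w"
| "chain v (e # es) w \<longleftrightarrow> fst e = v \<and> e \<in> A \<and> chain (snd e) es w"

lemma chain_subset: "chain v es w \<Longrightarrow> set es \<subseteq> A"
  by (induction es arbitrary: v) auto

lemma chain_g: "chain v es w \<Longrightarrow> e \<in> set es \<Longrightarrow> g v \<le> g (fst e)"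
proof (induction es arbitrary: v)
  case (Cons e' es)
  then have "g (fst e') < g (snd e')" using g_less[of "fst e'" "snd e'"] by (metis chain.simps(2) prod.collapse)
  then show ?case using Cons.IH[of "snd e'"] Cons.prems by auto
qed auto

lemma chain_distinct: "chain v es w \<Longrightarrow> distinct es"
proof (induction es arbitrary: v)
  case (Cons e es)
  then have "g (fst e) < g (snd e)" using g_less[of "fst e" "snd e"] by (metis chain.simps(2) prod.collapse)
  then have "e \<notin> set es" using Cons.prems chain_g[of "snd e" es w e] by auto
  with Cons show ?case by auto
qed auto

lemma chain_first: "chain v es w \<Longrightarrow> e \<in> set es \<Longrightarrow> fst e = v \<Longrightarrow> e = hd es"
proof (cases es)
  case (Cons e' es')
  assume a: "chain v es w" "e \<in> set es" "fst e = v"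
  have "g v < g (snd e')" using a Cons g_less[of "fst e'" "snd e'"] by (metis chain.simps(2) prod.collapse)
  then show ?thesis using a Cons chain_g[of "snd e'" es' w e] by auto
qed auto

lemma chain_next: "chain v es w \<Longrightarrow> e \<in> set es \<Longrightarrow> snd e \<noteq> w \<Longrightarrow> \<exists>e'\<in>set es. fst e' = snd e"
proof (induction es arbitrary: v)
  case (Cons e' es)
  show ?case
  proof (cases "e = e'")
    case True
    then show ?thesis using Cons.prems by (cases es) auto
  next
    case False
    then show ?thesis using Cons.IH[of "snd e'"] Cons.prems by auto
  qed
qed auto

lemma chain_prev: "chain v es w \<Longrightarrow> e \<in> set es \<Longrightarrow> fst e \<noteq> v \<Longrightarrow> \<exists>e'\<in>set es. snd e' = fst e"
proof (induction es arbitrary: v)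
  case (Cons e' es)
  then have "e \<in> set es" by auto
  show ?case
  proof (cases "fst e = snd e'")
    case False
    then show ?thesis using Cons.IH[of "snd e'"] Cons.prems \<open>e \<in> set es\<close> by auto
  qed auto
qed auto

lemma card_less:
  fixes h :: "plane \<Rightarrow> real"
  assumes "u \<in> verts" "h v < h u"
  shows "card {x \<in> verts. h u < h x} < card {x \<in> verts. h v < h x}"
proof (rule psubset_card_mono)
  show "finite {x \<in> verts. h v < h x}" using finite_A by auto
  have "u \<notin> {x \<in> verts. h u < h x}" by simp
  moreover have "u \<in> {x \<in> verts. h v < h x}" using assms by simp
  moreover have "{x \<in> verts. h u < h x} \<subseteq> {x \<in> verts. h v < h x}" using assms(2) by auto
  ultimately show "{x \<in> verts. h u < h x} \<subset> {x \<in> verts. h v < h x}" by blast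
qed

lemma chain_exists:
  assumes "v \<in> verts" "q \<in> verts" "\<And>z. z \<in> P \<Longrightarrow> z \<noteq> q \<Longrightarrow> g z < g q"
  shows "\<exists>es. chain v es q"
  using assms(1)
proof (induction "card {x \<in> verts. g v < g x}" arbitrary: v rule: less_induct)
  case less
  show ?case
  proof (cases "v = q")
    case True
    then show ?thesis by (intro exI[of _ "[]"]) simp
  next
    case False
    have "v \<in> P" "q \<in> P" using verts_frontier less.prems assms(2) closed_P by (auto simp: frontier_def)
    then have "\<exists>y. (v, y) \<in> A" using start_exists[OF less.prems, of q] assms(3) False by auto
    then obtain y where y: "(v, y) \<in> A" by blast
    then have "g v < g y" using g_less by auto
    moreover have "y \<in> verts" using image_eqI[of y snd "(v, y)" A] y by simp
    ultimately have "card {x \<in> verts. g y < g x} < card {x \<in> verts. g v < g x}" "y \<in> verts"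
      using card_less[of y g v] by auto
    then obtain es where "chain y es q" using less.hyps by blast
    then show ?thesis using y by (intro exI[of _ "(v, y) # es"]) simp
  qed
qed

lemma fan_sum_chain:
  "chain v es w \<Longrightarrow> fan_sum (v - p) (map (\<lambda>e. snd e - fst e) es)
    = (\<Sum>e\<leftarrow>es. \<bar>wedge (fst e - p) (snd e - p)\<bar>)"
proof (induction es arbitrary: v)
  case (Cons e es)
  have "wedge (v - p) (snd e - v) = wedge (v - p) (snd e - p)"
    by (simp add: wedge_def algebra_simps)
  then show ?case using Cons by simp
qed auto

text \<open>A triangle over an arc does not depend on the direction in which the arc is passed, so a
  chain run backwards contributes the same sum.\<close>

lemma fan_sum_rev_chain:
  "chain v es w \<Longrightarrow> fan_sum (w - p) (map (\<lambda>e. fst e - snd e) (rev es))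
    = (\<Sum>e\<leftarrow>es. \<bar>wedge (fst e - p) (snd e - p)\<bar>)"
  and sum_chain: "chain v es w \<Longrightarrow> (\<Sum>e\<leftarrow>es. snd e - fst e) = w - v"
  and sum_rev_chain: "chain v es w \<Longrightarrow> (\<Sum>e\<leftarrow>rev es. fst e - snd e) = v - w"
proof (induction es arbitrary: v)
  case (Cons e es)
  { case 1
    have "\<bar>wedge (snd e - p) (v - snd e)\<bar> = \<bar>wedge (v - p) (snd e - p)\<bar>"
      by (simp add: wedge_def algebra_simps abs_minus_commute)
    then show ?case using 1 Cons.IH(1)[of "snd e"] Cons.IH(3)[of "snd e"] by (simp add: fan_sum_append)
  next
    case 2 then show ?case using Cons.IH(2)[of "snd e"] by simp
  next
    case 3 then show ?case using Cons.IH(3)[of "snd e"] by simp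
  }
qed auto

lemma chain_dist:
  assumes "\<And>x y. (x, y) \<in> A \<Longrightarrow> dist x y \<le> L"
  shows "chain v es w \<Longrightarrow> e \<in> set es \<Longrightarrow> dist v (fst e) \<le> L * length es \<and> dist v (snd e) \<le> L * length es"
proof (induction es arbitrary: v)
  case (Cons e' es)
  have e': "dist v (snd e') \<le> L" "fst e' = v" using assms[of "fst e'" "snd e'"] Cons.prems by auto
  then have "L \<ge> 0" using zero_le_dist order_trans by blast
  show ?case
  proof (cases "e = e'")
    case True
    then show ?thesis using e' \<open>L \<ge> 0\<close> by (simp add: algebra_simps add_increasing2)
  next
    case False
    then have "dist (snd e') (fst e) \<le> L * length es" "dist (snd e') (snd e) \<le> L * length es"
      using Cons by auto
    then show ?thesis using e' dist_triangle[of v "fst e" "snd e'"] dist_triangle[of v "snd e" "snd e'"]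
      by (simp add: algebra_simps)
  qed
qed auto

text \<open>Takes the place of the Jordan curve theorem. Two arcs start in the leftmost vertex
  \<open>p\<close>, and each is prolonged to the rightmost vertex \<open>q\<close>. Induction from
  the left shows that every arc belongs to one of the chains, because a vertex other than
  \<open>p\<close> has an incoming arc and only one outgoing arc. A common arc could be traced back,
  by uniqueness of incoming arcs, to a common first arc.\<close>

lemma two_chains:
  obtains p q es fs where "p \<in> fst ` A" "\<And>z. z \<in> P \<Longrightarrow> z \<noteq> p \<Longrightarrow> g p < g z"
    "chain p es q" "chain p fs q" "set es \<union> set fs = A" "set es \<inter> set fs = {}"
proof -
  obtain p where p: "p \<in> fst ` A" "\<And>z. z \<in> P \<Longrightarrow> z \<noteq> p \<Longrightarrow> g p < g z" using leftmost by blast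
  interpret mir: polygon_face P "prod.swap ` A" "\<lambda>z. - g z" by (rule mirror)
  obtain q where q: "q \<in> fst ` prod.swap ` A" "\<And>z. z \<in> P \<Longrightarrow> z \<noteq> q \<Longrightarrow> - g q < - g z"
    using mir.leftmost by blast
  have qv: "q \<in> snd ` A" using q(1) by (auto simp: image_image)
  have qmax: "\<And>z. z \<in> P \<Longrightarrow> z \<noteq> q \<Longrightarrow> g z < g q" using q(2) by auto
  have vP: "v \<in> P" if "v \<in> verts" for v using verts_frontier[OF that] closed_P by (auto simp: frontier_def)
  obtain y y' where y: "(p, y) \<in> A" "(p, y') \<in> A" "y \<noteq> y'" using two_arcs[OF p] by blast
  have arcv: "b \<in> verts" "a \<in> verts" if "(a, b) \<in> A" for a b
    using image_eqI[of b snd "(a, b)" A] image_eqI[of a fst "(a, b)" A] that by simp_all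
  obtain es' where es': "chain y es' q" using chain_exists[of y q] arcv[OF y(1)] qv qmax by blast
  obtain fs' where fs': "chain y' fs' q" using chain_exists[of y' q] arcv[OF y(2)] qv qmax by blast
  define es fs where "es = (p, y) # es'" and "fs = (p, y') # fs'"
  have ch: "chain p es q" "chain p fs q" using es' fs' y by (simp_all add: es_def fs_def)
  have pred: "\<exists>x. (x, v) \<in> A" if "v \<in> fst ` A" "v \<noteq> p" for v
  proof -
    have "v \<in> fst ` prod.swap ` A \<union> snd ` prod.swap ` A" using that(1) by (simp add: image_image)
    moreover have "v \<in> P" "p \<in> P" using p(1) that(1) vP by auto
    moreover have "- g v < - g p" using p(2)[OF \<open>v \<in> P\<close> that(2)] by simp
    ultimately show ?thesis using mir.start_exists[of v p] by auto
  qed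
  have uniq: "y1 = y2" if "(v, y1) \<in> A" "(v, y2) \<in> A" "v \<noteq> p" for v y1 y2
  proof (rule start_unique[OF that(1,2)])
    show "p \<in> P" using p vP by auto
    show "g p < g v" using p(2)[OF vP[OF arcv(2)[OF that(1)]] that(3)] .
  qed
  have uniq': "y1 = y2" if "(y1, v) \<in> A" "(y2, v) \<in> A" "v \<noteq> q" for v y1 y2
  proof (rule mir.start_unique)
    show "(v, y1) \<in> prod.swap ` A" "(v, y2) \<in> prod.swap ` A"
      using that image_eqI[of "(v, y1)" prod.swap "(y1, v)" A] image_eqI[of "(v, y2)" prod.swap "(y2, v)" A] by simp_all
    show "q \<in> P" using qv vP by auto
    show "- g q < - g v" using qmax[OF vP[OF arcv(1)[OF that(1)]] that(3)] by simp
  qed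
  have next_in: "(v, y1) \<in> set cs" if c: "chain p cs q" and h: "(v, y1) \<in> A" "(x, v) \<in> set cs" "v \<noteq> p" for cs v y1 x
  proof -
    have "v \<noteq> q" using g_less[OF h(1)] qmax[OF vP[OF arcv(1)[OF h(1)]]] by fastforce
    then obtain e' where e': "e' \<in> set cs" "fst e' = v" using chain_next[OF c h(2)] by auto
    then have "e' \<in> A" using chain_subset[OF c] by auto
    then have "snd e' = y1" using uniq[of v "snd e'" y1] e' h by (metis prod.collapse)
    then show ?thesis using e' by (metis prod.collapse)
  qed
  have cover: "(v, y1) \<in> set es \<union> set fs" if "(v, y1) \<in> A" for v y1
    using that
  proof (induction "card {x \<in> verts. g x < g v}" arbitrary: v y1 rule: less_induct)
    case less
    show ?case
    proof (cases "v = p")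
      case True
      then have "y1 = y \<or> y1 = y'" using at_most_two_arcs[of p y1 y y'] y less.prems by auto
      then show ?thesis using True by (auto simp: es_def fs_def)
    next
      case False
      have "v \<in> fst ` A" using image_eqI[of v fst "(v, y1)" A] less.prems by simp
      then obtain x where x: "(x, v) \<in> A" using pred False by blast
      then have "g x < g v" using g_less by auto
      then have "card {u \<in> verts. g u < g x} < card {u \<in> verts. g u < g v}"
        using card_less[of x "\<lambda>z. - g z" v] arcv[OF x] by auto
      then have "(x, v) \<in> set es \<union> set fs" using less.hyps x by blast
      then show ?thesis using next_in[OF ch(1) less.prems] next_in[OF ch(2) less.prems] False by blast
    qed
  qed
  have disj: "(v, y1) \<notin> set es \<inter> set fs" for v y1
  proof (induction "card {x \<in> verts. g x < g v}" arbitrary: v y1 rule: less_induct)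
    case less
    show ?case
    proof
      assume in2: "(v, y1) \<in> set es \<inter> set fs"
      show False
      proof (cases "v = p")
        case True
        then show ?thesis using chain_first[OF ch(1), of "(v, y1)"] chain_first[OF ch(2), of "(v, y1)"] in2 y
          by (auto simp: es_def fs_def)
      next
        case False
        obtain e1 where e1: "e1 \<in> set es" "snd e1 = v" using chain_prev[OF ch(1), of "(v, y1)"] in2 False by auto
        obtain e2 where e2: "e2 \<in> set fs" "snd e2 = v" using chain_prev[OF ch(2), of "(v, y1)"] in2 False by auto
        have A: "e1 \<in> A" "e2 \<in> A" "(v, y1) \<in> A" using chain_subset ch e1 e2 in2 by blast+
        have "v \<noteq> q" using g_less[OF A(3)] qmax[OF vP[OF arcv(1)[OF A(3)]]] by fastforce
        then have "fst e1 = fst e2" using uniq'[of "fst e1" v "fst e2"] A e1 e2 by (metis prod.collapse)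
        then have "e1 = e2" using e1 e2 by (simp add: prod_eq_iff)
        define x where "x = fst e1"
        have x: "(x, v) \<in> set es \<inter> set fs" "(x, v) \<in> A" using e1 e2 \<open>e1 = e2\<close> A by (auto simp: x_def)
        then have "g x < g v" using g_less by auto
        then have "card {u \<in> verts. g u < g x} < card {u \<in> verts. g u < g v}"
          using card_less[of x "\<lambda>z. - g z" v] arcv[OF x(2)] by auto
        then show False using less.hyps x by blast
      qed
    qed
  qed
  have "set es \<union> set fs = A" using cover chain_subset[OF ch(1)] chain_subset[OF ch(2)] by auto
  moreover have "set es \<inter> set fs = {}" using disj by auto
  ultimately show ?thesis using that p ch by blast
qed

text \<open>The ray from \<open>p\<close> through \<open>z\<close> leaves the compact set
  \<open>P\<close> in a boundary point \<open>w\<close>, which lies on an arc; \<open>z\<close> is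
  between \<open>p\<close> and \<open>w\<close>, hence in the triangle over that arc.\<close>

lemma P_subset_fan:
  assumes "p \<in> P" shows "P \<subseteq> (\<Union>(x, y)\<in>A. convex hull {p, x, y})"
proof
  fix z assume z: "z \<in> P"
  show "z \<in> (\<Union>(x, y)\<in>A. convex hull {p, x, y})"
  proof (cases "z = p")
    case True
    obtain x y where "(x, y) \<in> A" using A_nonempty by auto
    moreover have "p \<in> convex hull {p, x, y}" by (simp add: hull_inc)
    ultimately show ?thesis using True by blast
  next
    case False
    define T where "T = {t. p + t *\<^sub>R (z - p) \<in> P}"
    have "closed T"
      unfolding T_def using closed_vimage[OF closed_P, of "\<lambda>t. p + t *\<^sub>R (z - p)"]
      by (simp add: vimage_def continuous_intros)
    moreover have "bounded T"
    proof -
      obtain b where b: "\<And>x. x \<in> P \<Longrightarrow> norm x \<le> b" using compact_imp_bounded[OF compact_P] bounded_iff by blast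
      have "\<bar>t\<bar> \<le> (b + norm p) / norm (z - p)" if "t \<in> T" for t
      proof -
        have "norm (t *\<^sub>R (z - p)) \<le> norm (p + t *\<^sub>R (z - p)) + norm p"
          using norm_triangle_ineq4[of "p + t *\<^sub>R (z - p)" p] by (simp only: add_diff_cancel_left')
        also have "\<dots> \<le> b + norm p" using b[of "p + t *\<^sub>R (z - p)"] that by (simp add: T_def)
        finally show ?thesis using False by (simp add: pos_le_divide_eq)
      qed
      then show ?thesis using bounded_iff[of T] by auto
    qed
    ultimately have "compact T" using compact_eq_bounded_closed by blast
    have "1 \<in> T" using z by (simp add: T_def)
    then obtain t where t: "t \<in> T" "\<And>s. s \<in> T \<Longrightarrow> s \<le> t" using compact_attains_sup[OF \<open>compact T\<close>] by blast
    then have "t \<ge> 1" using \<open>1 \<in> T\<close> by auto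
    define w where "w = p + t *\<^sub>R (z - p)"
    have "w \<in> P" using t by (simp add: T_def w_def)
    have "w \<notin> interior P"
    proof
      assume "w \<in> interior P"
      then obtain e where e: "e > 0" "cball w e \<subseteq> P" by (meson mem_interior_cball)
      define s where "s = e / norm (z - p)"
      have "s > 0" using e False by (simp add: s_def)
      have "w + s *\<^sub>R (z - p) \<in> cball w e" using e False by (simp add: s_def dist_norm)
      then have "t + s \<in> T" using e by (auto simp: T_def w_def algebra_simps)
      then show False using t(2)[of "t + s"] \<open>s > 0\<close> by simp
    qed
    then have "w \<in> frontier P" using \<open>w \<in> P\<close> closed_P by (simp add: frontier_def)
    then obtain x y where xy: "(x, y) \<in> A" "w \<in> closed_segment x y" using frontier_P by auto
    have "closed_segment x y \<subseteq> convex hull {p, x, y}"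
      unfolding segment_convex_hull by (intro hull_mono) auto
    then have w: "w \<in> convex hull {p, x, y}" using xy by auto
    have p: "p \<in> convex hull {p, x, y}" by (simp add: hull_inc)
    have "z = (1 - 1 / t) *\<^sub>R p + (1 / t) *\<^sub>R w" using \<open>t \<ge> 1\<close> by (simp add: w_def algebra_simps)
    moreover have "(1 - 1 / t) *\<^sub>R p + (1 / t) *\<^sub>R w \<in> convex hull {p, x, y}"
      using \<open>t \<ge> 1\<close> by (intro convexD[OF convex_convex_hull p w]) auto
    ultimately have "z \<in> convex hull {p, x, y}" by metis
    then show ?thesis using xy by blast
  qed
qed

text \<open>One chain forwards and the other backwards form a closed path from the leftmost vertex
  through all arcs, and \<open>us\<close> lists its edge vectors. The triangles with apex in that
  vertex cover \<open>P\<close>, which gives the inequality.\<close>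

theorem face_area:
  obtains us where "length us = card A" "sum_list us = 0"
    "\<And>u. u \<in> set us \<Longrightarrow> \<exists>(x, y)\<in>A. u = y - x \<or> u = x - y" "measure lebesgue P \<le> fan_sum 0 us / 2"
proof -
  obtain p q es fs where c: "p \<in> fst ` A"
    "chain p es q" "chain p fs q" "set es \<union> set fs = A" "set es \<inter> set fs = {}"
    using two_chains by metis
  define us where "us = map (\<lambda>e. snd e - fst e) es @ map (\<lambda>e. fst e - snd e) (rev fs)"
  have dist: "distinct es" "distinct fs" using chain_distinct c by blast+
  have "card A = card (set es) + card (set fs)" using c by (metis List.finite_set card_Un_disjoint)
  then have 1: "length us = card A" using dist by (simp add: us_def distinct_card)
  have 2: "sum_list us = 0" using sum_chain[OF c(2)] sum_rev_chain[OF c(3)] by (simp add: us_def)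
  have 3: "\<exists>(x, y)\<in>A. u = y - x \<or> u = x - y" if u: "u \<in> set us" for u
  proof -
    have "\<exists>e\<in>set es \<union> set fs. u = snd e - fst e \<or> u = fst e - snd e" using u by (auto simp: us_def)
    then show ?thesis using c(4) by force
  qed
  have pP: "p \<in> P" using verts_frontier c(1) closed_P by (auto simp: frontier_def)
  let ?f = "\<lambda>e. \<bar>wedge (fst e - p) (snd e - p)\<bar>"
  have "fan_sum 0 us = (\<Sum>e\<leftarrow>es. ?f e) + (\<Sum>e\<leftarrow>fs. ?f e)"
    using fan_sum_chain[OF c(2), of p] fan_sum_rev_chain[OF c(3), of p] sum_chain[OF c(2)]
    by (simp add: us_def fan_sum_append)
  also have "\<dots> = sum ?f (set es) + sum ?f (set fs)" using dist by (simp add: sum_list_distinct_conv_sum_set)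
  also have "\<dots> = sum ?f A" using sum.union_disjoint[OF finite_set finite_set c(5), of ?f] c(4) by simp
  finally have fs: "fan_sum 0 us = sum ?f A" .
  have "measure lebesgue P \<le> measure lebesgue (\<Union>e\<in>A. convex hull {p, fst e, snd e})"
  proof (rule measure_mono_fmeasurable)
    show "P \<subseteq> (\<Union>e\<in>A. convex hull {p, fst e, snd e})" using P_subset_fan[OF pP] by (auto simp: case_prod_beta)
    show "(\<Union>e\<in>A. convex hull {p, fst e, snd e}) \<in> lmeasurable"
      using finite_A by (intro fmeasurable.finite_UN lmeasurable_compact compact_triangle)
  qed (use compact_P lmeasurable_compact in auto)
  also have "\<dots> \<le> (\<Sum>e\<in>A. measure lebesgue (convex hull {p, fst e, snd e}))"
    using finite_A by (intro measure_UNION_le fmeasurableD lmeasurable_compact compact_triangle)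
  also have "\<dots> = fan_sum 0 us / 2" by (simp add: fs measure_triangle sum_divide_distrib)
  finally show ?thesis using that 1 2 3 by blast
qed

text \<open>A chain from \<open>p\<close> reaches every vertex in at most \<open>card A\<close>
  steps, and the triangles with apex \<open>p\<close> cover \<open>P\<close>. Bounded faces keep the
  boundary effects in a large disc of lower order.\<close>

lemma face_diameter:
  assumes L: "\<And>x y. (x, y) \<in> A \<Longrightarrow> dist x y \<le> L"
    and p: "p \<in> fst ` A" "\<And>z. z \<in> P \<Longrightarrow> z \<noteq> p \<Longrightarrow> g p < g z"
    and z: "z \<in> P"
  shows "dist p z \<le> L * card A"
proof -
  obtain p' q es fs where c: "p' \<in> fst ` A" "\<And>z. z \<in> P \<Longrightarrow> z \<noteq> p' \<Longrightarrow> g p' < g z"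
    "chain p' es q" "chain p' fs q" "set es \<union> set fs = A" "set es \<inter> set fs = {}"
    using two_chains by metis
  have P: "p \<in> P" "p' \<in> P" using verts_frontier c(1) p(1) closed_P by (auto simp: frontier_def)
  then have "p' = p" using c(2)[of p] p(2)[of p'] by fastforce
  have "(fst (SOME e. e \<in> A), snd (SOME e. e \<in> A)) \<in> A" using A_nonempty by (simp add: some_in_eq)
  then have "L \<ge> 0" using L zero_le_dist order_trans by blast
  have len: "length es \<le> card A" "length fs \<le> card A"
    using chain_distinct c finite_A by (metis card_mono chain_subset distinct_card)+
  have *: "dist p x \<le> L * card A \<and> dist p y \<le> L * card A" if "(x, y) \<in> A" for x y
  proof -
    have "L * length es \<le> L * card A" "L * length fs \<le> L * card A" using len \<open>L \<ge> 0\<close> by (auto intro!: mult_left_mono)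
    moreover have "(x, y) \<in> set es \<or> (x, y) \<in> set fs" using c(5) that by blast
    ultimately show ?thesis
      using chain_dist[OF L c(3), of "(x, y)"] chain_dist[OF L c(4), of "(x, y)"] \<open>p' = p\<close> by fastforce
  qed
  obtain x y where xy: "(x, y) \<in> A" "z \<in> convex hull {p, x, y}" using P_subset_fan[OF P(1)] z by blast
  have "convex hull {p, x, y} \<subseteq> cball p (L * card A)"
    using *[OF xy(1)] \<open>L \<ge> 0\<close> by (intro hull_minimal convex_cball) auto
  then show ?thesis using xy(2) by auto
qed

end

section \<open>Counting vertices, edges and faces of a subdivision by left ends\<close>

definition slanted :: "real \<Rightarrow> plane \<Rightarrow> real" where
  "slanted t z = z$1 + t * z$2"

lemma linear_slanted: "linear (slanted t)"
  by (rule linearI) (simp_all add: slanted_def algebra_simps)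

text \<open>The shear (x, y) -> (x + t y, y) has determinant 1, so determinants may be computed in
  the coordinates \<open>slanted t\<close> and \<open>$2\<close>.\<close>

lemma wedge_slanted:
  "wedge a b = slanted t a * b$2 - a$2 * slanted t b"
  by (simp add: wedge_def slanted_def algebra_simps)

text \<open>Two distinct points take the same value for at most one \<open>t\<close>, and countably
  many exceptions do not exhaust the reals.\<close>

lemma exists_injective_slanted:
  assumes "countable X" obtains t where "inj_on (slanted t) X"
proof -
  define bad where "bad = (\<lambda>(x, y). - (x - y)$1 / (x - y :: plane)$2) ` (X \<times> X)"
  have "countable bad" unfolding bad_def using assms by simp
  then have "bad \<noteq> UNIV" using uncountable_UNIV_real by auto
  then obtain t where t: "t \<notin> bad" by auto
  have "inj_on (slanted t) X"
  proof (rule inj_onI)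
    fix x y assume xy: "x \<in> X" "y \<in> X" "slanted t x = slanted t y"
    then have eq: "(x - y)$1 + t * (x - y)$2 = 0" by (simp add: slanted_def algebra_simps)
    have "(x - y)$2 = 0"
    proof (rule ccontr)
      assume "(x - y)$2 \<noteq> 0"
      then have "t = - (x - y)$1 / (x - y)$2" using eq by (simp add: field_simps)
      then show False using t xy unfolding bad_def by (auto intro: image_eqI[of _ _ "(x, y)"])
    qed
    then show "x = y" using eq by (simp add: vec_eq_iff forall_2)
  qed
  then show ?thesis using that by blast
qed

lemma finite_has_min:
  fixes f :: "'a \<Rightarrow> real"
  assumes "finite S" "S \<noteq> {}" shows "\<exists>m\<in>S. \<forall>x\<in>S. f m \<le> f x"
proof -
  have "Min (f ` S) \<in> f ` S" using assms by simp
  then obtain m where m: "m \<in> S" "Min (f ` S) = f m" by blast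
  have "f m \<le> f x" if "x \<in> S" for x using Min_le[of "f ` S" "f x"] assms(1) that m(2) by simp
  then show ?thesis using m(1) by blast
qed

text \<open>The vector \<open>n\<close> points to the same side of the line of \<open>x\<close> and
  \<open>y\<close> as \<open>z\<close>, so from the midpoint it leads into the triangle
  \<open>x, y, z\<close>. Hence two faces on the same side of a common edge overlap.\<close>

lemma interior_near_midpoint:
  assumes P: "convex P" "x \<in> P" "y \<in> P" "z \<in> P"
    and z: "0 < wedge (y - x) (z - x) * wedge (y - x) n"
  shows "\<exists>d>0. \<forall>t. 0 < t \<longrightarrow> t < d \<longrightarrow> midpoint x y + t *\<^sub>R n \<in> interior P"
proof -
  define a b where "a = y - x" and "b = z - x"
  have w: "wedge a b \<noteq> 0" using z by (auto simp: a_def b_def)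
  define p q where "p = wedge n b / wedge a b" and "q = wedge a n / wedge a b"
  have q: "q > 0" using z w by (auto simp: q_def a_def b_def zero_less_divide_iff zero_less_mult_iff)
  have n: "n = p *\<^sub>R a + q *\<^sub>R b" using wedge_expansion[OF w, of n] by (simp add: p_def q_def)
  define d where "d = 1 / (2 * (\<bar>p\<bar> + \<bar>q\<bar> + 1))"
  have D: "\<bar>p\<bar> + \<bar>q\<bar> + 1 > 0" by linarith
  then have "d > 0" by (simp add: d_def)
  moreover have "midpoint x y + t *\<^sub>R n \<in> interior P" if "0 < t" "t < d" for t
  proof -
    have "t * (\<bar>p\<bar> + \<bar>q\<bar> + 1) < 1 / 2" using that D by (simp add: d_def field_simps)
    then have *: "t * \<bar>p\<bar> + t * q + t < 1 / 2" using q by (simp add: algebra_simps)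
    have "\<bar>t * p\<bar> = t * \<bar>p\<bar>" using that by (simp add: abs_mult)
    moreover have "t * q > 0" using that q by simp
    ultimately have "0 < 1 / 2 + t * p" "(1 / 2 + t * p) + t * q < 1" "t * q > 0"
      using * that by linarith+
    then have "x + (1 / 2 + t * p) *\<^sub>R a + (t * q) *\<^sub>R b \<in> interior P"
      using P w by (intro triangle_interior) (auto simp: a_def b_def)
    moreover have "midpoint x y = x + (1 / 2) *\<^sub>R a"
      by (simp add: midpoint_def a_def vec_eq_iff field_simps)
    ultimately show ?thesis by (simp add: n algebra_simps)
  qed
  ultimately show ?thesis by blast
qed

text \<open>\<open>L\<close> bounds the lengths of the edges, and \<open>t0\<close> fixes a
  direction in which no two vertices are level, so that every edge has a left and a right
  end.\<close>

locale subdivision =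
  fixes X :: "plane set" and E F :: "plane set set" and L :: real and t0 :: real
  assumes sub: "convex_subdivision X E F"
    and finite_X: "\<And>z r. finite (X \<inter> cball z r)"
    and E_len: "\<And>x y. closed_segment x y \<in> E \<Longrightarrow> dist x y \<le> L"
    and sides_6: "\<And>P. P \<in> F \<Longrightarrow> finite (sides E P) \<and> card (sides E P) \<le> 6"
    and inj: "inj_on (slanted t0) X"
begin

abbreviation "g \<equiv> slanted t0"

definition adj where "adj x y \<longleftrightarrow> x \<in> X \<and> y \<in> X \<and> x \<noteq> y \<and> closed_segment x y \<in> E"
definition rights where "rights x = {y. adj x y \<and> g x < g y}"
definition lefts where "lefts x = {y. adj x y \<and> g y < g x}"
definition arcs where "arcs P = {(x, y). y \<in> rights x \<and> closed_segment x y \<subseteq> frontier P}"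
definition leftmost_of where "leftmost_of P x \<longleftrightarrow> x \<in> P \<and> (\<forall>z\<in>P. z \<noteq> x \<longrightarrow> g x < g z)"

lemmas lin = linear_add[OF linear_slanted[of t0]] linear_diff[OF linear_slanted[of t0]]
  linear_scale[OF linear_slanted[of t0]]

lemma edge_ends: "e \<in> E \<Longrightarrow> \<exists>x\<in>X. \<exists>y\<in>X. x \<noteq> y \<and> e = closed_segment x y \<and> e \<inter> X = {x, y}"
  and edges_cross: "pairwise (\<lambda>e e'. e \<inter> e' \<subseteq> X) E"
  and face_polygon: "P \<in> F \<Longrightarrow> convex_polygon P"
  and cover: "\<Union>F = UNIV"
  and lf: "locally_finite_in euclidean F"
  and faces_disjoint: "pairwise (\<lambda>P Q. interior P \<inter> interior Q = {}) F"
  and frontier_face: "P \<in> F \<Longrightarrow> frontier P = \<Union>(sides E P)"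
  and edge_side: "e \<in> E \<Longrightarrow> \<exists>P\<in>F. e \<in> sides E P"
  using sub unfolding convex_subdivision_def by blast+

lemma face_props:
  assumes "P \<in> F" shows "convex P" "compact P" "closed P" "interior P \<noteq> {}"
  using face_polygon[OF assms] polytope_imp_compact polytope_imp_convex polytope_imp_closed
  unfolding convex_polygon_def by auto

lemma adj_sym: "adj x y \<longleftrightarrow> adj y x"
  unfolding adj_def by (auto simp: closed_segment_commute)

lemma adj_dist: "adj x y \<Longrightarrow> dist x y \<le> L"
  unfolding adj_def using E_len by auto

lemma adj_X: assumes "adj x y" shows "closed_segment x y \<inter> X = {x, y}"
proof -
  obtain u v where "u \<noteq> v" "closed_segment x y = closed_segment u v" "closed_segment x y \<inter> X = {u, v}"
    using assms edge_ends unfolding adj_def by blast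
  then show ?thesis by (metis closed_segment_eq)
qed

lemma edge_adj: assumes "e \<in> E" obtains x y where "adj x y" "e = closed_segment x y" "g x < g y"
proof -
  obtain x y where xy: "x \<in> X" "y \<in> X" "x \<noteq> y" "e = closed_segment x y" using edge_ends[OF assms] by blast
  then have "g x \<noteq> g y" using inj by (auto dest: inj_onD)
  then consider "g x < g y" | "g y < g x" by linarith
  then show ?thesis
  proof cases
    case 1 then show ?thesis using that[of x y] xy assms by (auto simp: adj_def)
  next
    case 2 then show ?thesis using that[of y x] xy assms by (auto simp: adj_def closed_segment_commute)
  qed
qed

lemma finite_adj: "finite {y. adj x y}"
  by (rule finite_subset[OF _ finite_X[of x L]]) (auto simp: adj_def intro: E_len)

lemma finite_rights: "finite (rights x)" and finite_lefts: "finite (lefts x)"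
  using finite_adj[of x] by (auto simp: rights_def lefts_def intro: rev_finite_subset)

lemma deg_split: "card {y. adj x y} = card (rights x) + card (lefts x)"
proof -
  have "{y. adj x y} = rights x \<union> lefts x"
  proof -
    have "g x \<noteq> g y" if "adj x y" for y using that inj unfolding adj_def by (auto dest: inj_onD)
    then show ?thesis unfolding rights_def lefts_def by (auto simp: neq_iff)
  qed
  moreover have "rights x \<inter> lefts x = {}" by (auto simp: rights_def lefts_def)
  ultimately show ?thesis using finite_rights finite_lefts card_Un_disjoint by metis
qed

lemma finite_faces: assumes "compact K" shows "finite {P \<in> F. P \<inter> K \<noteq> {}}"
proof -
  have "\<forall>x. \<exists>V. open V \<and> x \<in> V \<and> finite {P \<in> F. P \<inter> V \<noteq> {}}"
    using lf unfolding locally_finite_in_def by simp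
  from choice[OF this] obtain V where
    V: "\<And>x. open (V x)" "\<And>x. x \<in> V x" "\<And>x. finite {P \<in> F. P \<inter> V x \<noteq> {}}" by blast
  obtain C where C: "C \<subseteq> K" "finite C" "K \<subseteq> (\<Union>x\<in>C. V x)"
    using compactE_image[OF assms, of K V] V by blast
  have "{P \<in> F. P \<inter> K \<noteq> {}} \<subseteq> (\<Union>x\<in>C. {P \<in> F. P \<inter> V x \<noteq> {}})"
  proof
    fix P assume "P \<in> {P \<in> F. P \<inter> K \<noteq> {}}"
    then obtain z where "P \<in> F" "z \<in> P" "z \<in> K" by blast
    then show "P \<in> (\<Union>x\<in>C. {P \<in> F. P \<inter> V x \<noteq> {}})" using C(3) by blast
  qed
  then show ?thesis by (rule finite_subset) (use C V in auto)
qed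

text \<open>The edge lies on the boundary of some face \<open>Q\<close>, hence in the closure of its
  interior. If it entered the interior of \<open>P\<close>, the two interiors would meet, so
  \<open>P = Q\<close>, which would have an interior boundary point.\<close>

lemma edge_interior: assumes "e \<in> E" "P \<in> F" shows "e \<inter> interior P = {}"
proof (rule ccontr)
  assume "e \<inter> interior P \<noteq> {}"
  then obtain z where z: "z \<in> e" "z \<in> interior P" by auto
  obtain Q where Q: "Q \<in> F" "e \<subseteq> frontier Q" using edge_side[OF assms(1)] by (auto simp: sides_def)
  have "z \<in> closure (interior Q)"
    using Q z face_props[OF Q(1)] convex_closure_interior[of Q] by (auto simp: frontier_def)
  then have "interior P \<inter> interior Q \<noteq> {}" using z closure_iff_nhds_not_empty[of z "interior Q"] by blast
  then have "P = Q" using faces_disjoint assms Q by (auto simp: pairwise_def)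
  then show False using Q z by (auto simp: frontier_def)
qed

lemma face_arcs:
  assumes "P \<in> F"
  shows "polygon_face P (arcs P) g" "card (arcs P) \<le> 6"
proof -
  have inj2: "inj_on (\<lambda>(x, y). closed_segment x y) (arcs P)"
  proof (rule inj_onI, clarify)
    fix x y x' y' assume a: "(x, y) \<in> arcs P" "(x', y') \<in> arcs P" "closed_segment x y = closed_segment x' y'"
    then have "{x, y} = {x', y'}" using closed_segment_eq by blast
    then show "x = x' \<and> y = y'" using a unfolding arcs_def rights_def by (auto simp: doubleton_eq_iff)
  qed
  have im: "(\<lambda>(x, y). closed_segment x y) ` arcs P = sides E P"
  proof
    show "(\<lambda>(x, y). closed_segment x y) ` arcs P \<subseteq> sides E P"
      by (auto simp: arcs_def sides_def rights_def adj_def)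
    show "sides E P \<subseteq> (\<lambda>(x, y). closed_segment x y) ` arcs P"
    proof
      fix e assume e: "e \<in> sides E P"
      then have "e \<in> E" by (simp add: sides_def)
      then obtain x y where "adj x y" "e = closed_segment x y" "g x < g y" using edge_adj by blast
      then show "e \<in> (\<lambda>(x, y). closed_segment x y) ` arcs P"
        using e by (intro image_eqI[of _ _ "(x, y)"]) (auto simp: arcs_def rights_def sides_def)
    qed
  qed
  have fin: "finite (arcs P)" using inj2 im sides_6[OF assms] finite_image_iff by metis
  show "card (arcs P) \<le> 6" using sides_6[OF assms] card_image[OF inj2] im by simp
  show "polygon_face P (arcs P) g"
  proof (rule polygon_face.intro, goal_cases)
    case 5
    have "frontier P = \<Union>((\<lambda>(x, y). closed_segment x y) ` arcs P)" using frontier_face[OF assms] im by simp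
    then show ?case by simp
  next
    case (7 x y) then show ?case by (simp add: arcs_def rights_def)
  next
    case (8 x y x' y')
    then have "closed_segment x y \<noteq> closed_segment x' y'" using inj_onD[OF inj2, of "(x, y)" "(x', y')"] by auto
    moreover have "adj x y" "adj x' y'" using 8 by (auto simp: arcs_def rights_def)
    ultimately have "closed_segment x y \<inter> closed_segment x' y' \<subseteq> X"
      using edges_cross by (auto simp: pairwise_def adj_def)
    then show ?case using adj_X[OF \<open>adj x y\<close>] by blast
  next
    case 9
    have "fst ` arcs P \<union> snd ` arcs P \<subseteq> X" by (auto simp: arcs_def rights_def adj_def)
    then show ?case using inj inj_on_subset by blast
  qed (use face_props[OF assms] fin linear_slanted in simp_all)
qed

lemma face_leftmost: assumes "P \<in> F"
  obtains p where "leftmost_of P p" "p \<in> X" "\<And>z. z \<in> P \<Longrightarrow> dist p z \<le> 6 * L"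
proof -
  interpret polygon_face P "arcs P" g by (rule face_arcs[OF assms])
  obtain p where p: "p \<in> fst ` arcs P" "\<And>z. z \<in> P \<Longrightarrow> z \<noteq> p \<Longrightarrow> g p < g z" using leftmost by blast
  have d: "dist x y \<le> L" if "(x, y) \<in> arcs P" for x y
    using that adj_dist by (auto simp: arcs_def rights_def)
  obtain x y where "(x, y) \<in> arcs P" using A_nonempty by auto
  then have "L \<ge> 0" using d zero_le_dist order_trans by blast
  have "dist p z \<le> 6 * L" if "z \<in> P" for z
  proof -
    have "dist p z \<le> L * card (arcs P)" using face_diameter[OF d p that] .
    also have "\<dots> \<le> L * 6" using face_arcs(2)[OF assms] \<open>L \<ge> 0\<close> by (intro mult_left_mono) auto
    finally show ?thesis by simp
  qed
  moreover have "p \<in> P" using verts_frontier[of p] p closed_P by (auto simp: frontier_def)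
  moreover have "p \<in> X" using p(1) by (auto simp: arcs_def rights_def adj_def)
  ultimately show ?thesis using that p by (auto simp: leftmost_of_def)
qed

lemma face_not_line: assumes "P \<in> F" "a \<noteq> 0" shows "\<exists>z\<in>P. wedge a (z - x) \<noteq> 0"
proof (rule ccontr)
  assume "\<not> ?thesis"
  then have *: "\<And>z. z \<in> P \<Longrightarrow> wedge a (z - x) = 0" by blast
  have "interior P \<subseteq> (+) x ` {z. wedge a z = 0}"
  proof
    fix z assume "z \<in> interior P"
    then have "wedge a (z - x) = 0" using * interior_subset by blast
    then show "z \<in> (+) x ` {z. wedge a z = 0}" by (intro image_eqI[of _ _ "z - x"]) auto
  qed
  moreover have "negligible ((+) x ` {z. wedge a z = 0})"
    using negligible_wedge_line[OF assms(2)] negligible_translation by blast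
  ultimately have "negligible (interior P)" using negligible_subset by blast
  then show False using open_not_negligible[of "interior P"] face_props(4)[OF assms(1)] by auto
qed

text \<open>\<open>s\<close> records whether a face has points on the left of the edge from
  \<open>x\<close> to \<open>y\<close>. Faces with the same value would both contain points near the
  midpoint on the same side, so \<open>s\<close> is injective.\<close>

lemma two_faces: "card {P \<in> F. (x, y) \<in> arcs P} \<le> 2"
proof (cases "y \<in> rights x")
  case False
  then have "{P \<in> F. (x, y) \<in> arcs P} = {}" by (auto simp: arcs_def)
  then show ?thesis by (simp only: card.empty)
next
  case True
  let ?F = "{P \<in> F. (x, y) \<in> arcs P}"
  define s where "s = (\<lambda>P. \<exists>z\<in>P. 0 < wedge (y - x) (z - x))"
  define n :: plane where "n = (\<chi> i. if i = 1 then - (y - x)$2 else (y - x)$1)"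
  have "y \<noteq> x" using True by (auto simp: rights_def)
  then have "(y - x)$1 \<noteq> 0 \<or> (y - x)$2 \<noteq> 0" by (auto simp: vec_eq_iff forall_2)
  then have n: "0 < wedge (y - x) n"
    using sum_power2_gt_zero_iff[of "(y - x)$1" "(y - x)$2"]
    by (simp add: wedge_def n_def power2_eq_square del: vector_minus_component)
  have xyP: "x \<in> P" "y \<in> P" if "P \<in> ?F" for P
  proof -
    have "closed_segment x y \<subseteq> P" using that face_props(3)[of P] frontier_subset_closed by (auto simp: arcs_def)
    then show "x \<in> P" "y \<in> P" by auto
  qed
  have neg: "\<exists>z\<in>P. wedge (y - x) (z - x) < 0" if "P \<in> ?F" "\<not> s P" for P
  proof -
    have "\<exists>z\<in>P. wedge (y - x) (z - x) \<noteq> 0" using face_not_line[of P "y - x" x] that \<open>y \<noteq> x\<close> by auto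
    then obtain z where "z \<in> P" "wedge (y - x) (z - x) \<noteq> 0" by blast
    moreover have "\<not> 0 < wedge (y - x) (z - x)" using that(2) \<open>z \<in> P\<close> by (auto simp: s_def)
    ultimately show ?thesis by (intro bexI[of _ z]) auto
  qed
  have "inj_on s ?F"
  proof (rule inj_onI, rule ccontr)
    fix P Q assume PQ: "P \<in> ?F" "Q \<in> ?F" "s P = s Q" "P \<noteq> Q"
    obtain c z z' where c: "z \<in> P" "z' \<in> Q" "0 < wedge (y - x) (z - x) * wedge (y - x) (c *\<^sub>R n)"
      "0 < wedge (y - x) (z' - x) * wedge (y - x) (c *\<^sub>R n)"
    proof (cases "s P")
      case True
      then obtain z z' where "z \<in> P" "0 < wedge (y - x) (z - x)" "z' \<in> Q" "0 < wedge (y - x) (z' - x)"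
        using PQ s_def by auto
      then show ?thesis using n by (intro that[of z z' 1]) auto
    next
      case False
      then obtain z z' where "z \<in> P" "wedge (y - x) (z - x) < 0" "z' \<in> Q" "wedge (y - x) (z' - x) < 0"
        using neg[OF PQ(1)] neg[OF PQ(2)] PQ(3) by auto
      then show ?thesis using n by (intro that[of z z' "-1"]) (auto simp: mult_neg_pos)
    qed
    have F: "P \<in> F" "Q \<in> F" using PQ by auto
    obtain d d' where "d > 0" "d' > 0"
      "\<And>t. 0 < t \<Longrightarrow> t < d \<Longrightarrow> midpoint x y + t *\<^sub>R (c *\<^sub>R n) \<in> interior P"
      "\<And>t. 0 < t \<Longrightarrow> t < d' \<Longrightarrow> midpoint x y + t *\<^sub>R (c *\<^sub>R n) \<in> interior Q"
      using interior_near_midpoint[OF face_props(1)[OF F(1)] xyP[OF PQ(1)] c(1) c(3)]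
        interior_near_midpoint[OF face_props(1)[OF F(2)] xyP[OF PQ(2)] c(2) c(4)] by blast
    then have "midpoint x y + (min d d' / 2) *\<^sub>R (c *\<^sub>R n) \<in> interior P \<inter> interior Q"
      by (smt (verit) IntI field_sum_of_halves min_def)
    then show False using faces_disjoint F PQ(4) by (auto simp: pairwise_def)
  qed
  then have "card ?F \<le> card (UNIV :: bool set)" by (rule card_inj_on_le) auto
  then show ?thesis by simp
qed

text \<open>A small open triangle at \<open>x\<close> between the two edges meets no edge: edges
  that avoid \<open>x\<close> stay away, and an edge at \<open>x\<close> inside the angle would lead
  to a right neighbour in between. Being connected, the triangle lies in one face \<open>P\<close>.
  Then \<open>P\<close> contains initial pieces of both edges, which are not interior, so
  \<open>convex_subset_cone\<close> confines \<open>P\<close> to the angle.\<close>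

lemma face_between:
  assumes y: "y \<in> rights x" "y' \<in> rights x" and w: "0 < wedge (y - x) (y' - x)"
    and cons: "\<And>v. v \<in> rights x \<Longrightarrow> \<not> (0 < wedge (y - x) (v - x) \<and> 0 < wedge (v - x) (y' - x))"
  obtains P where "P \<in> F" "x \<in> P"
    "\<And>z. z \<in> P \<Longrightarrow> 0 \<le> wedge (z - x) (y' - x) \<and> 0 \<le> wedge (y - x) (z - x)"
proof -
  define a b where "a = y - x" and "b = y' - x"
  have ab: "0 < wedge a b" using w by (simp add: a_def b_def)
  have ga: "g a > 0" "g b > 0" using y by (auto simp: rights_def a_def b_def lin)
  have xX: "x \<in> X" using y by (auto simp: rights_def adj_def)
  \<comment> \<open>The edges near \<open>x\<close> that avoid \<open>x\<close>. The bound on their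
    lengths makes them finite in number, so their union is closed and has a positive distance from
    \<open>x\<close>.\<close>
  define C where "C = \<Union>{e \<in> E. x \<notin> e \<and> e \<inter> cball x 1 \<noteq> {}}"
  have "finite {e \<in> E. x \<notin> e \<and> e \<inter> cball x 1 \<noteq> {}}"
  proof (rule finite_subset)
    show "{e \<in> E. x \<notin> e \<and> e \<inter> cball x 1 \<noteq> {}} \<subseteq>
      (\<lambda>(u, v). closed_segment u v) ` ((X \<inter> cball x (1 + L)) \<times> (X \<inter> cball x (1 + L)))"
    proof
      fix e assume "e \<in> {e \<in> E. x \<notin> e \<and> e \<inter> cball x 1 \<noteq> {}}"
      then obtain z where e: "e \<in> E" "z \<in> e" "dist x z \<le> 1" by auto
      obtain u v where uv: "adj u v" "e = closed_segment u v" using edge_adj[OF e(1)] by blast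
      have "dist z u \<le> dist u v" "dist z v \<le> dist u v"
        using e uv dist_in_closed_segment[of z u v] by (auto simp: dist_commute)
      then have "dist x u \<le> 1 + L" "dist x v \<le> 1 + L"
        using e(3) adj_dist[OF uv(1)] dist_triangle[of x u z] dist_triangle[of x v z] by linarith+
      then show "e \<in> (\<lambda>(u, v). closed_segment u v) ` ((X \<inter> cball x (1 + L)) \<times> (X \<inter> cball x (1 + L)))"
        using uv by (intro image_eqI[of _ _ "(u, v)"]) (auto simp: adj_def)
    qed
  qed (use finite_X in auto)
  moreover have "closed e" if "e \<in> E" for e using edge_ends[OF that] by auto
  ultimately have "closed C" unfolding C_def by (intro closed_Union) auto
  moreover have "x \<notin> C" by (auto simp: C_def)
  ultimately obtain e where e: "e > 0" "ball x e \<inter> C = {}"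
    using openE[of "- C" x] by (metis ComplI disjoint_eq_subset_Compl open_Compl)
  define k where "k = min e 1 / (norm a + norm b + 1)"
  have nn: "norm a + norm b + 1 > 0" by (simp add: add_nonneg_pos)
  have k: "0 < k" "k * (norm a + norm b) < min e 1" "k \<le> 1"
  proof -
    show "0 < k" using e nn by (simp add: k_def)
    have "k * (norm a + norm b + 1) = min e 1" using nn by (simp add: k_def)
    then have "k * (norm a + norm b) + k = min e 1" by (simp add: distrib_left)
    then show "k * (norm a + norm b) < min e 1" using \<open>0 < k\<close> by linarith
    have "min e 1 \<le> norm a + norm b + 1" by (smt (verit) norm_ge_zero)
    then show "k \<le> 1" using nn by (simp add: k_def)
  qed
  \<comment> \<open>The open triangle at \<open>x\<close> in the basis \<open>a\<close>,
    \<open>b\<close>. The scale \<open>k\<close> keeps it inside the disc free of \<open>C\<close>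
    and, being at most 1, makes \<open>k / 2\<close> times an edge a part of that edge.\<close>
  define T where "T = {z. 0 < wedge (z - x) b / wedge a b \<and> 0 < wedge a (z - x) / wedge a b
      \<and> wedge (z - x) b / wedge a b + wedge a (z - x) / wedge a b < k}"
  have T_expand: "z = x + (wedge (z - x) b / wedge a b) *\<^sub>R a + (wedge a (z - x) / wedge a b) *\<^sub>R b" for z
    using wedge_expansion[of a b "z - x"] ab by (simp add: algebra_simps)
  have T_I: "x + s *\<^sub>R a + t *\<^sub>R b \<in> T" if "0 < s" "0 < t" "s + t < k" for s t
    using that ab by (simp add: T_def wedge_add)
  have T_E: "\<exists>s t. z = x + s *\<^sub>R a + t *\<^sub>R b \<and> 0 < s \<and> 0 < t \<and> s + t < k" if "z \<in> T" for z
    using that T_expand[of z] unfolding T_def by blast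
  have "convex T"
  proof (rule convexI)
    fix p q u v assume pq: "p \<in> T" "q \<in> T" "0 \<le> u" "0 \<le> v" "u + v = (1::real)"
    obtain s t where p: "p = x + s *\<^sub>R a + t *\<^sub>R b" "0 < s" "0 < t" "s + t < k" using T_E[OF pq(1)] by blast
    obtain s' t' where q: "q = x + s' *\<^sub>R a + t' *\<^sub>R b" "0 < s'" "0 < t'" "s' + t' < k" using T_E[OF pq(2)] by blast
    have u: "u = 1 - v" using pq by simp
    have "u *\<^sub>R p + v *\<^sub>R q = x + (u * s + v * s') *\<^sub>R a + (u * t + v * t') *\<^sub>R b"
      unfolding p q u by (simp add: algebra_simps)
    moreover have pos: "0 < u * c + v * d" if "0 < c" "0 < d" for c d
      using that pq by (metis add.commute add.right_neutral add_nonneg_pos add_pos_nonneg less_eq_real_def mult_pos_pos mult_zero_left order_less_irrefl zero_neq_one)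
    moreover have "(u * s + v * s') + (u * t + v * t') < k"
    proof -
      have "u * k + v * k = k" using pq(5) by (metis distrib_right mult_1)
      moreover have "0 < u * (k - (s + t)) + v * (k - (s' + t'))" using pos[of "k - (s + t)" "k - (s' + t')"] p q by simp
      ultimately show ?thesis by (simp add: algebra_simps)
    qed
    ultimately show "u *\<^sub>R p + v *\<^sub>R q \<in> T" using p q T_I by simp
  qed
  have T_ball: "T \<subseteq> ball x (min e 1)"
  proof
    fix z assume "z \<in> T"
    then obtain s t where z: "z = x + s *\<^sub>R a + t *\<^sub>R b" "0 < s" "0 < t" "s + t < k" using T_E by blast
    have "norm (s *\<^sub>R a + t *\<^sub>R b) \<le> s * norm a + t * norm b" using z norm_triangle_ineq[of "s *\<^sub>R a" "t *\<^sub>R b"] by simp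
    also have "\<dots> \<le> k * norm a + k * norm b" using z by (intro add_mono mult_right_mono) auto
    also have "\<dots> < min e 1" using k by (simp add: algebra_simps)
    finally have "norm (s *\<^sub>R a + t *\<^sub>R b) < min e 1" .
    moreover have "dist x z = norm (s *\<^sub>R a + t *\<^sub>R b)" unfolding z(1) dist_norm by (metis add.assoc add_diff_cancel_left' norm_minus_commute)
    ultimately show "z \<in> ball x (min e 1)" by simp
  qed
  have TE: "z \<notin> d" if h: "z \<in> T" "d \<in> E" for z d
  proof
    assume "z \<in> d"
    have zb: "z \<in> ball x e" "z \<in> cball x 1" using T_ball h(1) by auto
    have "x \<in> d"
    proof (rule ccontr)
      assume "x \<notin> d"
      then have "d \<in> {e \<in> E. x \<notin> e \<and> e \<inter> cball x 1 \<noteq> {}}" using h(2) \<open>z \<in> d\<close> zb by blast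
      then have "z \<in> C" using \<open>z \<in> d\<close> unfolding C_def by blast
      then show False using e zb by auto
    qed
    obtain u v where uv: "adj u v" "d = closed_segment u v" using edge_adj[OF h(2)] by blast
    then have "x = u \<or> x = v" using adj_X[OF uv(1)] xX \<open>x \<in> d\<close> by auto
    then obtain v where v: "adj x v" "d = closed_segment x v" using uv adj_sym closed_segment_commute by metis
    obtain c where c: "0 \<le> c" "z = (1 - c) *\<^sub>R x + c *\<^sub>R v" using \<open>z \<in> d\<close> v by (auto simp: in_segment)
    then have zx: "z - x = c *\<^sub>R (v - x)" by (simp add: algebra_simps)
    have wz: "0 < wedge (z - x) b" "0 < wedge a (z - x)" using h(1) ab by (simp_all add: T_def zero_less_divide_iff)
    then have "c > 0" using c(1) zx by (cases "c = 0") auto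
    then have wv: "0 < wedge (v - x) b" "0 < wedge a (v - x)" using wz zx by (simp_all add: zero_less_mult_iff)
    \<comment> \<open>Points of \<open>T\<close> are to the right of \<open>x\<close>, so an edge at
      \<open>x\<close> through such a point ends in a right neighbour strictly between
      \<open>y\<close> and \<open>y'\<close>, against \<open>cons\<close>.\<close>
    obtain s t where z: "z = x + s *\<^sub>R a + t *\<^sub>R b" "0 < s" "0 < t" using T_E[OF h(1)] by blast
    have "g (z - x) = s * g a + t * g b" unfolding z by (simp add: lin)
    then have "g (z - x) > 0" using z(2,3) ga by (simp add: add_pos_pos)
    then have "g (v - x) > 0" using zx \<open>c > 0\<close> by (simp add: lin(3) zero_less_mult_iff)
    then have "v \<in> rights x" using v by (simp add: rights_def lin)
    then show False using cons[of v] wv by (simp add: a_def b_def)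
  qed
  have k3: "x + (k/3) *\<^sub>R a + (k/3) *\<^sub>R b \<in> T" using k by (intro T_I) auto
  obtain P where P: "P \<in> F" "x + (k/3) *\<^sub>R a + (k/3) *\<^sub>R b \<in> P" using cover by blast
  have "T \<inter> frontier P = {}" using TE frontier_face[OF P(1)] by (fastforce simp: sides_def)
  then have TP: "T \<subseteq> P" using connected_Int_frontier[OF convex_connected[OF \<open>convex T\<close>], of P] k3 P(2) by blast
  \<comment> \<open>\<open>x\<close> and the points on the two edges are only limits of points of
    the open triangle; closedness of \<open>P\<close> adds them.\<close>
  have limP: "p \<in> P" if "c > 0" "\<And>t. 0 < t \<Longrightarrow> t < c \<Longrightarrow> p + t *\<^sub>R d \<in> P" for p d c
  proof -
    have "p \<in> closure P"
      unfolding closure_approachable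
    proof (intro allI impI)
      fix r :: real assume "r > 0"
      define t where "t = min (c / 2) (r / (2 * (norm d + 1)))"
      have nd: "norm d + 1 > 0" by (simp add: add_nonneg_pos)
      have t: "0 < t" "t < c" "t \<le> r / (2 * (norm d + 1))" using \<open>r > 0\<close> that(1) nd by (auto simp: t_def)
      then have "t * (2 * (norm d + 1)) \<le> r" using nd by (simp add: field_simps)
      then have "2 * (t * norm d) < r * 2" using t \<open>r > 0\<close> by (simp add: algebra_simps)
      then have "dist (p + t *\<^sub>R d) p < r" using t by (simp add: dist_norm)
      then show "\<exists>y\<in>P. dist y p < r" using that(2) t by blast
    qed
    then show ?thesis using face_props(3)[OF P(1)] by (simp add: closure_closed)
  qed
  have xP: "x \<in> P"
  proof (rule limP[of "k / 2" _ "a + b"])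
    fix t :: real assume "0 < t" "t < k / 2"
    then have "x + t *\<^sub>R a + t *\<^sub>R b \<in> T" by (intro T_I) auto
    then show "x + t *\<^sub>R (a + b) \<in> P" using TP by (auto simp: scaleR_add_right add.assoc)
  qed (use k in simp)
  have aP: "x + (k/2) *\<^sub>R a \<in> P"
  proof (rule limP[of "k / 2" _ b])
    fix t :: real assume "0 < t" "t < k / 2"
    then show "x + (k/2) *\<^sub>R a + t *\<^sub>R b \<in> P" using TP T_I[of "k/2" t] by auto
  qed (use k in simp)
  have bP: "x + (k/2) *\<^sub>R b \<in> P"
  proof (rule limP[of "k / 2" _ a])
    fix t :: real assume "0 < t" "t < k / 2"
    then have "x + t *\<^sub>R a + (k/2) *\<^sub>R b \<in> P" using TP T_I[of t "k/2"] by auto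
    then show "x + (k/2) *\<^sub>R b + t *\<^sub>R a \<in> P" by (simp add: add_ac)
  qed (use k in simp)
  have notint: "x + t *\<^sub>R ((k/2) *\<^sub>R (v - x)) \<notin> interior P" if "v \<in> rights x" "0 < t" "t \<le> 1" for t v
  proof -
    have "closed_segment x v \<in> E" using that by (simp add: rights_def adj_def)
    moreover have "t * (k / 2) \<le> 1 * 1" using that k by (intro mult_mono) auto
    then have "x + t *\<^sub>R ((k/2) *\<^sub>R (v - x)) \<in> closed_segment x v"
      unfolding in_segment using that k by (intro exI[of _ "t * (k/2)"]) (auto simp: algebra_simps)
    ultimately show ?thesis using edge_interior P(1) by blast
  qed
  have "0 \<le> wedge (z - x) b \<and> 0 \<le> wedge a (z - x)" if "z \<in> P" for z
  proof -
    have w': "wedge ((k/2) *\<^sub>R a) ((k/2) *\<^sub>R b) > 0" using ab k by simp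
    have "0 \<le> wedge (z - x) ((k/2) *\<^sub>R b) / wedge ((k/2) *\<^sub>R a) ((k/2) *\<^sub>R b) \<and>
      0 \<le> wedge ((k/2) *\<^sub>R a) (z - x) / wedge ((k/2) *\<^sub>R a) ((k/2) *\<^sub>R b)"
      using w' less_imp_neq[OF ab] k notint[OF y(1)] notint[OF y(2)] that
      by (intro convex_subset_cone[OF face_props(1)[OF P(1)] xP aP bP]) (simp_all add: a_def b_def)
    then have "0 \<le> wedge (z - x) ((k/2) *\<^sub>R b)" "0 \<le> wedge ((k/2) *\<^sub>R a) (z - x)"
      using w' divide_neg_pos not_le by blast+
    then show ?thesis using k(1) by (auto simp: zero_le_mult_iff)
  qed
  then show ?thesis using that[of P] P(1) xP by (simp add: a_def b_def)
qed

lemma parallel_rights: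
  assumes "u \<in> rights x" "v \<in> rights x" "wedge (u - x) (v - x) = 0" shows "u = v"
proof -
  have uv: "adj x u" "adj x v" "g (u - x) > 0" "g (v - x) > 0" using assms by (auto simp: rights_def lin)
  then have "u - x \<noteq> 0" using linear_0[OF linear_slanted[of t0]] by auto
  then obtain c where c: "v - x = c *\<^sub>R (u - x)" using wedge_eq_0[OF assms(3)] by blast
  then have "g (v - x) = c * g (u - x)" by (simp add: lin(3))
  then have "c > 0" using uv zero_less_mult_pos2 by auto
  have v: "v = x + c *\<^sub>R (u - x)" using c by (simp add: algebra_simps)
  have "(1 / c) *\<^sub>R (v - x) = u - x" unfolding c using \<open>c > 0\<close> by simp
  then have u: "u = x + (1 / c) *\<^sub>R (v - x)" by simp
  have X: "u \<in> X" "v \<in> X" "u \<noteq> x" "v \<noteq> x" using uv by (auto simp: adj_def)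
  show ?thesis
  proof (cases "c \<le> 1")
    case True
    then have "v \<in> closed_segment x u"
      unfolding in_segment using \<open>c > 0\<close> v by (intro exI[of _ c]) (auto simp: algebra_simps)
    then show ?thesis using adj_X[OF uv(1)] X by blast
  next
    case False
    then have "u \<in> closed_segment x v"
      unfolding in_segment using \<open>c > 0\<close> u by (intro exI[of _ "1 / c"]) (auto simp: algebra_simps)
    then show ?thesis using adj_X[OF uv(2)] X by blast
  qed
qed

text \<open>Order the right neighbours by slope. Between each of them but the topmost and the next
  one there is a face with leftmost vertex \<open>x\<close>, and these faces are distinct.\<close>

lemma rights_le_faces:
  "card (rights x) \<le> Suc (card {P \<in> F. leftmost_of P x})"
proof (cases "rights x = {}")
  case True
  then show ?thesis by simp
next
  case False
  \<comment> \<open>The slope in sheared coordinates; it orders the directions to the right as the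
    sign of \<open>wedge\<close> does.\<close>
  define sl where "sl = (\<lambda>v. (v - x)$2 / g (v - x))"
  have gpos: "0 < g (v - x)" if "v \<in> rights x" for v using that by (simp add: rights_def lin)
  have sl: "0 < wedge (u - x) (v - x) \<longleftrightarrow> sl u < sl v" if "u \<in> rights x" "v \<in> rights x" for u v
    using gpos[OF that(1)] gpos[OF that(2)] unfolding wedge_slanted[of _ _ t0] sl_def
    by (simp add: field_simps)
  have sl_inj: "sl u \<noteq> sl v" if "u \<in> rights x" "v \<in> rights x" "u \<noteq> v" for u v
  proof
    assume "sl u = sl v"
    then have "wedge (u - x) (v - x) = 0" using sl[OF that(1,2)] sl[OF that(2,1)] wedge_commute[of "u - x" "v - x"] by simp
    then show False using parallel_rights that by blast
  qed
  obtain m where m: "m \<in> rights x" "\<And>v. v \<in> rights x \<Longrightarrow> sl v \<le> sl m"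
    using finite_has_min[OF finite_rights False, of "\<lambda>v. - sl v"] by auto
  define R where "R = rights x - {m}"
  have "\<exists>P. \<exists>y'\<in>rights x. sl y < sl y' \<and> (\<forall>v\<in>rights x. sl y < sl v \<longrightarrow> sl y' \<le> sl v) \<and> P \<in> F \<and> x \<in> P \<and>
      (\<forall>z\<in>P. 0 \<le> wedge (z - x) (y' - x) \<and> 0 \<le> wedge (y - x) (z - x))" if "y \<in> R" for y
  proof -
    have y: "y \<in> rights x" "sl y < sl m" using that m sl_inj[of y m] by (auto simp: R_def less_le)
    let ?U = "{v \<in> rights x. sl y < sl v}"
    have "finite ?U" "?U \<noteq> {}" using finite_rights m y by auto
    then have "\<exists>y'\<in>?U. \<forall>v\<in>?U. sl y' \<le> sl v" by (rule finite_has_min)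
    then obtain y' where y': "y' \<in> ?U" "\<And>v. v \<in> ?U \<Longrightarrow> sl y' \<le> sl v" by blast
    have "0 < wedge (y - x) (y' - x)" using sl y y' by auto
    moreover have "\<not> (0 < wedge (y - x) (v - x) \<and> 0 < wedge (v - x) (y' - x))" if "v \<in> rights x" for v
      using sl[OF y(1) that] sl[OF that, of y'] y' that by fastforce
    ultimately obtain P where "P \<in> F" "x \<in> P" "\<And>z. z \<in> P \<Longrightarrow> 0 \<le> wedge (z - x) (y' - x) \<and> 0 \<le> wedge (y - x) (z - x)"
      using face_between[of y x y'] y y' by blast
    then show ?thesis using y' by blast
  qed
  then obtain \<Phi> where \<Phi>: "\<And>y. y \<in> R \<Longrightarrow> \<exists>y'\<in>rights x. sl y < sl y' \<and> (\<forall>v\<in>rights x. sl y < sl v \<longrightarrow> sl y' \<le> sl v) \<and> \<Phi> y \<in> F \<and> x \<in> \<Phi> y \<and>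
      (\<forall>z\<in>\<Phi> y. 0 \<le> wedge (z - x) (y' - x) \<and> 0 \<le> wedge (y - x) (z - x))" by metis
  \<comment> \<open>The linear relation between three vectors of the plane, with the linear form
    \<open>g\<close> applied to it.\<close>
  have gid: "g d * wedge a b + g a * wedge b d + g b * wedge d a = 0" for a b d
    unfolding wedge_slanted[of _ _ t0] by (simp add: algebra_simps)
  have lm: "leftmost_of (\<Phi> y) x" "\<Phi> y \<in> F" if y: "y \<in> R" for y
  proof -
    obtain y' where y': "y' \<in> rights x" "sl y < sl y'" "\<Phi> y \<in> F" "x \<in> \<Phi> y"
      "\<And>z. z \<in> \<Phi> y \<Longrightarrow> 0 \<le> wedge (z - x) (y' - x) \<and> 0 \<le> wedge (y - x) (z - x)" using \<Phi>[OF y] by blast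
    have yr: "y \<in> rights x" using y by (simp add: R_def)
    then have w: "0 < wedge (y - x) (y' - x)" using sl y' by auto
    have "g x < g z" if z: "z \<in> \<Phi> y" "z \<noteq> x" for z
    proof -
      have zx: "z - x = (wedge (z - x) (y' - x) / wedge (y - x) (y' - x)) *\<^sub>R (y - x) + (wedge (y - x) (z - x) / wedge (y - x) (y' - x)) *\<^sub>R (y' - x)"
        using w by (intro wedge_expansion) simp
      have nz: "wedge (z - x) (y' - x) \<noteq> 0 \<or> wedge (y - x) (z - x) \<noteq> 0" using zx z(2) by auto
      have "g (z - x) * wedge (y - x) (y' - x) = g (y - x) * wedge (z - x) (y' - x) + g (y' - x) * wedge (y - x) (z - x)"
        using gid[of "z - x" "y - x" "y' - x"] wedge_commute[of "y' - x" "z - x"] wedge_commute[of "z - x" "y - x"] by simp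
      also have "\<dots> > 0" using nz y'(5)[OF z(1)] gpos[OF yr] gpos[OF y'(1)]
        by (smt (verit) mult_pos_pos mult_nonneg_nonneg)
      finally have "g (z - x) > 0" using w zero_less_mult_pos2 by auto
      then show ?thesis by (simp add: lin)
    qed
    then show "leftmost_of (\<Phi> y) x" "\<Phi> y \<in> F" using y' by (auto simp: leftmost_of_def)
  qed
  \<comment> \<open>If both faces coincide, the face lies below the successor \<open>a\<close> of
    \<open>y1\<close>, which is not above \<open>y2\<close>, and also above \<open>y2\<close>. So it
    is contained in a line.\<close>
  have neq: "\<Phi> y1 \<noteq> \<Phi> y2" if y: "y1 \<in> R" "y2 \<in> R" "sl y1 < sl y2" for y1 y2
  proof
    assume eq: "\<Phi> y1 = \<Phi> y2"
    have yr: "y1 \<in> rights x" "y2 \<in> rights x" using y by (auto simp: R_def)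
    obtain a where a: "a \<in> rights x" "sl a \<le> sl y2" "\<And>z. z \<in> \<Phi> y1 \<Longrightarrow> 0 \<le> wedge (z - x) (a - x)"
      using \<Phi>[OF y(1)] y(3) yr by blast
    have b: "0 \<le> wedge (y2 - x) (z - x)" if "z \<in> \<Phi> y1" for z using \<Phi>[OF y(2)] eq that by auto
    have ab: "0 \<le> wedge (a - x) (y2 - x)"
      using sl[OF yr(2) a(1)] a(2) wedge_commute[of "a - x" "y2 - x"] by auto
    have "wedge (y2 - x) (z - x) = 0" if z: "z \<in> \<Phi> y1" for z
    proof -
      have "0 \<le> g (z - x)"
        using lm(1)[OF y(1)] z linear_0[OF linear_slanted[of t0]] by (cases "z = x") (auto simp: leftmost_of_def lin less_imp_le)
      then have "0 \<le> g (z - x) * wedge (a - x) (y2 - x)" using ab by simp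
      moreover have "0 \<le> g (y2 - x) * wedge (z - x) (a - x)" using gpos[OF yr(2)] a(3)[OF z] by simp
      moreover have "0 \<le> g (a - x) * wedge (y2 - x) (z - x)" using gpos[OF a(1)] b[OF z] by simp
      ultimately have "g (a - x) * wedge (y2 - x) (z - x) = 0" using gid[of "z - x" "a - x" "y2 - x"] by linarith
      then show ?thesis using gpos[OF a(1)] by simp
    qed
    moreover have "y2 - x \<noteq> 0" using gpos[OF yr(2)] linear_0[OF linear_slanted[of t0]] by auto
    ultimately show False using face_not_line[OF lm(2)[OF y(1)], of "y2 - x" x] by blast
  qed
  have "inj_on \<Phi> R"
  proof (rule inj_onI, rule ccontr)
    fix u v assume uv: "u \<in> R" "v \<in> R" "\<Phi> u = \<Phi> v" "u \<noteq> v"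
    then have "sl u \<noteq> sl v" using sl_inj[of u v] by (simp add: R_def)
    then show False using neq[of u v] neq[of v u] uv by (auto simp: neq_iff)
  qed
  moreover have "\<Phi> ` R \<subseteq> {P \<in> F. leftmost_of P x}" using lm by auto
  moreover have "finite {P \<in> F. leftmost_of P x}"
    by (rule finite_subset[OF _ finite_faces[of "{x}"]]) (auto simp: leftmost_of_def)
  ultimately have "card R \<le> card {P \<in> F. leftmost_of P x}" by (rule card_inj_on_le)
  then show ?thesis using m finite_rights by (simp add: R_def)
qed

text \<open>A face has only one leftmost vertex, so the families of faces for different vertices are
  disjoint and the preceding estimates add up.\<close>

lemma rights_sum_le_faces:
  assumes "finite S"
  shows "(\<Sum>x\<in>S. card (rights x)) \<le> card S + card {P \<in> F. \<exists>x\<in>S. leftmost_of P x}"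
proof -
  have fin: "finite {P \<in> F. leftmost_of P x}" for x
    by (rule finite_subset[OF _ finite_faces[of "{x}"]]) (auto simp: leftmost_of_def)
  have "(\<Sum>x\<in>S. card (rights x)) \<le> (\<Sum>x\<in>S. Suc (card {P \<in> F. leftmost_of P x}))"
    by (intro sum_mono rights_le_faces)
  also have "\<dots> = card S + (\<Sum>x\<in>S. card {P \<in> F. leftmost_of P x})" by (simp add: sum_Suc)
  also have "(\<Sum>x\<in>S. card {P \<in> F. leftmost_of P x}) = card (\<Union>x\<in>S. {P \<in> F. leftmost_of P x})"
  proof (rule card_UN_disjoint[symmetric, OF assms])
    show "\<forall>i\<in>S. \<forall>j\<in>S. i \<noteq> j \<longrightarrow> {P \<in> F. leftmost_of P i} \<inter> {P \<in> F. leftmost_of P j} = {}"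
      unfolding leftmost_of_def by (auto, metis less_asym)
  qed (use fin in auto)
  also have "(\<Union>x\<in>S. {P \<in> F. leftmost_of P x}) = {P \<in> F. \<exists>x\<in>S. leftmost_of P x}" by auto
  finally show ?thesis .
qed

text \<open>Double counting of the pairs of a face and a directed edge on its boundary; each edge
  occurs for at most two faces.\<close>

lemma sides_sum_le_rights:
  assumes "finite S" "finite FF" "FF \<subseteq> F" and S: "\<And>P x y. P \<in> FF \<Longrightarrow> (x, y) \<in> arcs P \<Longrightarrow> x \<in> S"
  shows "(\<Sum>P\<in>FF. card (arcs P)) \<le> 2 * (\<Sum>x\<in>S. card (rights x))"
proof -
  define U where "U = (SIGMA x:S. rights x)"
  have U: "finite U" "card U = (\<Sum>x\<in>S. card (rights x))"
    unfolding U_def using assms(1) finite_rights by (auto simp: card_SigmaI)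
  have "card (arcs P) = (\<Sum>a\<in>U. if a \<in> arcs P then 1 else 0)" if "P \<in> FF" for P
  proof -
    have "arcs P = {a \<in> U. a \<in> arcs P}" using S[OF that] by (auto simp: U_def arcs_def)
    then show ?thesis using U(1) by (simp add: sum.If_cases Int_def)
  qed
  then have "(\<Sum>P\<in>FF. card (arcs P)) = (\<Sum>P\<in>FF. \<Sum>a\<in>U. if a \<in> arcs P then 1 else 0)" by simp
  also have "\<dots> = (\<Sum>a\<in>U. \<Sum>P\<in>FF. if a \<in> arcs P then 1 else 0)" by (rule sum.swap)
  also have "\<dots> \<le> (\<Sum>a\<in>U. 2)"
  proof (rule sum_mono)
    fix a assume "a \<in> U"
    obtain x y where a: "a = (x, y)" by (cases a)
    have "finite {P \<in> F. a \<in> arcs P}"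
    proof (rule finite_subset[OF _ finite_faces[of "{x}"]])
      show "{P \<in> F. a \<in> arcs P} \<subseteq> {P \<in> F. P \<inter> {x} \<noteq> {}}"
        using face_props(3) frontier_subset_closed by (fastforce simp: arcs_def a)
    qed simp
    then have "card {P \<in> FF. a \<in> arcs P} \<le> card {P \<in> F. a \<in> arcs P}" using assms(3) by (intro card_mono) auto
    also have "\<dots> \<le> 2" unfolding a by (rule two_faces)
    finally show "(\<Sum>P\<in>FF. if a \<in> arcs P then 1 else 0) \<le> (2::nat)"
      using assms(2) by (simp add: sum.If_cases Int_def)
  qed
  finally show ?thesis using U by simp
qed

abbreviation "V r \<equiv> X \<inter> cball 0 r"

text \<open>An edge is counted once at either end, and passing from one end to the other costs
  \<open>L\<close> in the radius.\<close>

lemma rights_le_lefts: "(\<Sum>x\<in>V r. card (rights x)) \<le> (\<Sum>x\<in>V (r + L). card (lefts x))"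
  and lefts_le_rights: "(\<Sum>x\<in>V r. card (lefts x)) \<le> (\<Sum>x\<in>V (r + L). card (rights x))"
proof -
  have far: "y \<in> V (r + L)" if "adj x y" "x \<in> V r" for x y
    using that adj_dist[OF that(1)] dist_triangle[of 0 y x] by (auto simp: adj_def)
  have "card (SIGMA x:V r. rights x) \<le> card (SIGMA x:V (r + L). lefts x)"
    using far adj_sym finite_X finite_lefts
    by (intro card_inj_on_le[of prod.swap]) (auto simp: rights_def lefts_def)
  then show "(\<Sum>x\<in>V r. card (rights x)) \<le> (\<Sum>x\<in>V (r + L). card (lefts x))"
    using finite_X finite_rights finite_lefts by (simp add: card_SigmaI)
  have "card (SIGMA x:V r. lefts x) \<le> card (SIGMA x:V (r + L). rights x)"
    using far adj_sym finite_X finite_rights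
    by (intro card_inj_on_le[of prod.swap]) (auto simp: rights_def lefts_def)
  then show "(\<Sum>x\<in>V r. card (lefts x)) \<le> (\<Sum>x\<in>V (r + L). card (rights x))"
    using finite_X finite_rights finite_lefts by (simp add: card_SigmaI)
qed

definition deg_sum where "deg_sum r = (\<Sum>x\<in>V r. card {y. adj x y})"

text \<open>The disc is covered by the faces that meet it. Their number is bounded below by right
  neighbours, their sides are bounded above, and the signs of \<alpha> and \<beta> fit. As two
  points of a face are at most 12 L apart, these faces have their vertices within radius R - L, and
  the other ends of edges there are within R. A further L in the radius 15 L lets left neighbours be
  counted as right neighbours.\<close>

theorem area_inequality:
  fixes \<alpha> \<beta> R :: real
  assumes area: "\<And>P. P \<in> F \<Longrightarrow> measure lebesgue P \<le> \<alpha> + \<beta> * card (arcs P)" and "\<alpha> \<le> 0" "0 \<le> \<beta>" "0 \<le> L"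
  shows "measure lebesgue (cball (0::plane) (R - 14 * L))
    \<le> \<alpha> * (deg_sum (R - 15 * L) / 2 - card (V R)) + \<beta> * deg_sum R"
proof -
  let ?K = "cball (0::plane) (R - 14 * L)"
  define FF where "FF = {P \<in> F. P \<inter> ?K \<noteq> {}}"
  have fin: "finite FF" unfolding FF_def by (rule finite_faces) auto
  have sub: "FF \<subseteq> F" by (auto simp: FF_def)
  have near: "norm x \<le> R - L" if "P \<in> FF" "x \<in> P" for x P
  proof -
    have "P \<inter> ?K \<noteq> {}" using that by (simp add: FF_def)
    then obtain z where "z \<in> P" "z \<in> ?K" by blast
    then have z: "z \<in> P" "norm z \<le> R - 14 * L" by simp_all
    have "P \<in> F" using that sub by blast
    then obtain p where p: "\<And>z. z \<in> P \<Longrightarrow> dist p z \<le> 6 * L" using face_leftmost by metis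
    have "dist z x \<le> 12 * L" using p[OF z(1)] p[OF that(2)] dist_triangle[of z x p] by (simp add: dist_commute)
    then show ?thesis using z(2) norm_triangle_ineq2[of x z] \<open>0 \<le> L\<close> by (simp add: dist_norm norm_minus_commute)
  qed
  have arcx: "x \<in> V (R - L)" if "P \<in> FF" "(x, y) \<in> arcs P" for P x y
  proof -
    have "x \<in> P" using that face_props(3)[of P] sub frontier_subset_closed[of P] by (fastforce simp: arcs_def)
    then show ?thesis using near[OF that(1)] that by (auto simp: arcs_def rights_def adj_def)
  qed
  have Fcover: "?K \<subseteq> \<Union>FF" using cover by (auto simp: FF_def)
  have lm: "P \<in> lmeasurable" if "P \<in> FF" for P using that sub face_props(2) lmeasurable_compact by blast
  have "measure lebesgue ?K \<le> measure lebesgue (\<Union>FF)"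
    using Fcover fin lm by (intro measure_mono_fmeasurable fmeasurable.finite_Union) auto
  also have "\<dots> \<le> (\<Sum>P\<in>FF. measure lebesgue P)"
    using measure_UNION_le[OF fin, of "\<lambda>P. P" lebesgue] lm by (auto dest: fmeasurableD)
  also have "\<dots> \<le> (\<Sum>P\<in>FF. \<alpha> + \<beta> * card (arcs P))" using area sub by (intro sum_mono) auto
  also have "\<dots> = \<alpha> * card FF + \<beta> * (\<Sum>P\<in>FF. card (arcs P))"
    by (simp add: sum.distrib sum_distrib_left)
  also have "\<dots> \<le> \<alpha> * (deg_sum (R - 15 * L) / 2 - card (V R)) + \<beta> * deg_sum R"
  proof (rule add_mono)
    have "(\<Sum>x\<in>V (R - 14 * L). card (rights x)) \<le> card (V (R - 14 * L)) + card {P \<in> F. \<exists>x\<in>V (R - 14 * L). leftmost_of P x}"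
      using finite_X by (rule rights_sum_le_faces)
    also have "\<dots> \<le> card (V R) + card FF"
      using finite_X fin \<open>0 \<le> L\<close> by (intro add_mono card_mono) (auto simp: FF_def leftmost_of_def)
    finally have 1: "(\<Sum>x\<in>V (R - 14 * L). card (rights x)) \<le> card (V R) + card FF" .
    have "deg_sum (R - 15 * L) = (\<Sum>x\<in>V (R - 15 * L). card (rights x)) + (\<Sum>x\<in>V (R - 15 * L). card (lefts x))"
      by (simp add: deg_sum_def deg_split sum.distrib)
    also have "(\<Sum>x\<in>V (R - 15 * L). card (rights x)) \<le> (\<Sum>x\<in>V (R - 14 * L). card (rights x))"
      using finite_X \<open>0 \<le> L\<close> by (intro sum_mono2) auto
    also have "(\<Sum>x\<in>V (R - 15 * L). card (lefts x)) \<le> (\<Sum>x\<in>V (R - 14 * L). card (rights x))"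
      using lefts_le_rights[of "R - 15 * L"] by (simp add: algebra_simps)
    finally have "deg_sum (R - 15 * L) \<le> 2 * (card (V R) + card FF)" using 1 by simp
    then have "real (deg_sum (R - 15 * L)) \<le> real (2 * (card (V R) + card FF))" by (rule of_nat_mono)
    then have "deg_sum (R - 15 * L) / 2 - card (V R) \<le> real (card FF)" by simp
    then show "\<alpha> * real (card FF) \<le> \<alpha> * (deg_sum (R - 15 * L) / 2 - card (V R))"
      using \<open>\<alpha> \<le> 0\<close> by (rule mult_left_mono_neg)
    have "(\<Sum>P\<in>FF. card (arcs P)) \<le> 2 * (\<Sum>x\<in>V (R - L). card (rights x))"
      using finite_X fin sub arcx by (rule sides_sum_le_rights)
    also have "\<dots> = (\<Sum>x\<in>V (R - L). card (rights x)) + (\<Sum>x\<in>V (R - L). card (rights x))" by simp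
    also have "\<dots> \<le> (\<Sum>x\<in>V R. card (rights x)) + (\<Sum>x\<in>V R. card (lefts x))"
      using rights_le_lefts[of "R - L"] finite_X \<open>0 \<le> L\<close> by (intro add_mono sum_mono2) auto
    also have "\<dots> = deg_sum R" by (simp add: deg_sum_def deg_split sum.distrib)
    finally have "real (\<Sum>P\<in>FF. card (arcs P)) \<le> real (deg_sum R)" by (rule of_nat_mono)
    then show "\<beta> * (\<Sum>P\<in>FF. card (arcs P)) \<le> \<beta> * real (deg_sum R)" using \<open>0 \<le> \<beta>\<close> by (rule mult_left_mono)
  qed
  finally show ?thesis .
qed

end

section \<open>Linear coordinates, discs and tilings\<close>

definition frame :: "plane \<Rightarrow> plane \<Rightarrow> plane \<Rightarrow> plane" where
  "frame e f z = z$1 *\<^sub>R e + z$2 *\<^sub>R f"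

lemma linear_frame: "linear (frame e f)"
  by (rule linearI) (simp_all add: frame_def algebra_simps)

lemma inj_frame: assumes "wedge e f \<noteq> 0" shows "inj (frame e f)"
proof (rule injI)
  fix x y assume "frame e f x = frame e f y"
  then have "frame e f (x - y) = 0" using linear_diff[OF linear_frame] by simp
  then have "wedge e (frame e f (x - y)) = 0" "wedge (frame e f (x - y)) f = 0" by simp_all
  then have "(x - y)$2 = 0" "(x - y)$1 = 0" using assms by (simp_all add: frame_def wedge_add)
  then show "x = y" by (simp add: vec_eq_iff forall_2)
qed

lemma surj_frame: assumes "wedge e f \<noteq> 0" shows "surj (frame e f)"
  using linear_injective_imp_surjective[OF linear_frame inj_frame[OF assms]] by simp

lemma det_frame: "det (matrix (frame e f)) = wedge e f"
  by (simp add: det_2 matrix_def frame_def axis_def wedge_def)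

lemma measure_frame: "S \<in> lmeasurable \<Longrightarrow> measure lebesgue (frame e f ` S) = \<bar>wedge e f\<bar> * measure lebesgue S"
  by (simp add: measure_linear_image[OF linear_frame] det_frame)

definition pt :: "real \<Rightarrow> real \<Rightarrow> plane" where "pt x y = (\<chi> i. if i = 1 then x else y)"

lemma pt_nth [simp]: "pt x y $ 1 = x" "pt x y $ 2 = y" by (simp_all add: pt_def)

lemma pt_eta [simp]: "pt (z$1) (z$2) = z" by (simp add: vec_eq_iff forall_2)

lemma plane_eqI: "x$1 = y$1 \<Longrightarrow> x$2 = y$2 \<Longrightarrow> x = (y::plane)" by (simp add: vec_eq_iff forall_2)

lemma frame_pt: "frame e f (pt x y) = x *\<^sub>R e + y *\<^sub>R f" by (simp add: frame_def)

lemma mem_cbox_pt: "z \<in> cbox (pt a c) (pt b d) \<longleftrightarrow> a \<le> z$1 \<and> z$1 \<le> b \<and> c \<le> z$2 \<and> z$2 \<le> d"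
  by (auto simp: mem_box_cart forall_2)

lemma measure_cbox_pt:
  assumes "a \<le> b" "c \<le> d" shows "measure lebesgue (cbox (pt a c) (pt b d)) = (b - a) * (d - c)"
proof -
  have "pt a c \<in> cbox (pt a c) (pt b d)" using assms by (simp add: mem_cbox_pt)
  then have "cbox (pt a c) (pt b d) \<noteq> {}" by auto
  then show ?thesis by (simp add: content_cbox_cart UNIV_2 measure_completion)
qed

lemma measure_disc:
  assumes "0 \<le> r"
  shows "measure lebesgue (cball (z::plane) r) = pi * r\<^sup>2" "measure lborel (cball (z::plane) r) = pi * r\<^sup>2"
    "measure lebesgue (ball (z::plane) r) = pi * r\<^sup>2"
  using assms by (simp_all add: measure_completion content_cball content_ball unit_ball_vol_2)

text \<open>Each tile is within \<rho> of its base point, so the tiles with base point in the disc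
  cover the disc of radius R - \<rho> and stay inside that of radius R + \<rho>.\<close>

lemma tiling_count:
  fixes b :: "'i \<Rightarrow> plane" and C :: "'i \<Rightarrow> plane set" and R \<rho> :: real
  assumes fin: "finite {i. b i \<in> cball 0 R}"
    and meas: "\<And>i. C i \<in> lmeasurable"
    and neg: "\<And>i j. i \<noteq> j \<Longrightarrow> negligible (C i \<inter> C j)"
    and near: "\<And>i. C i \<subseteq> cball (b i) \<rho>"
    and cover: "(\<Union>i. C i) = UNIV"
    and R: "0 \<le> \<rho>" "\<rho> \<le> R"
  shows "pi * (R - \<rho>)\<^sup>2 \<le> (\<Sum>i | b i \<in> cball 0 R. measure lebesgue (C i))"
    and "(\<Sum>i | b i \<in> cball 0 R. measure lebesgue (C i)) \<le> pi * (R + \<rho>)\<^sup>2"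
proof -
  let ?J = "{i. b i \<in> cball 0 R}"
  have eq: "(\<Sum>i\<in>?J. measure lebesgue (C i)) = measure lebesgue (\<Union>i\<in>?J. C i)"
    using fin meas neg by (intro measure_negligible_finite_Union_image[symmetric]) (auto simp: pairwise_def)
  have m: "(\<Union>i\<in>?J. C i) \<in> lmeasurable" using fin meas by (intro fmeasurable.finite_UN) auto
  have "cball 0 (R - \<rho>) \<subseteq> (\<Union>i\<in>?J. C i)"
  proof
    fix z :: plane assume z: "z \<in> cball 0 (R - \<rho>)"
    obtain i where i: "z \<in> C i" using cover by auto
    then have "dist (b i) z \<le> \<rho>" using near[of i] by auto
    then have "norm (b i) \<le> R" using z norm_triangle_ineq2[of "b i" z] by (simp add: dist_norm)
    then show "z \<in> (\<Union>i\<in>?J. C i)" using i by auto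
  qed
  then have "measure lebesgue (cball (0::plane) (R - \<rho>)) \<le> measure lebesgue (\<Union>i\<in>?J. C i)"
    using m by (intro measure_mono_fmeasurable) auto
  then show "pi * (R - \<rho>)\<^sup>2 \<le> (\<Sum>i\<in>?J. measure lebesgue (C i))" using eq R by (simp add: measure_disc)
  have "(\<Union>i\<in>?J. C i) \<subseteq> cball 0 (R + \<rho>)"
  proof
    fix z assume "z \<in> (\<Union>i\<in>?J. C i)"
    then obtain i where i: "norm (b i) \<le> R" "z \<in> C i" by auto
    then have "dist (b i) z \<le> \<rho>" using near[of i] by auto
    then show "z \<in> cball 0 (R + \<rho>)" using i norm_triangle_ineq2[of z "b i"] by (simp add: dist_norm norm_minus_commute)
  qed
  then have "measure lebesgue (\<Union>i\<in>?J. C i) \<le> measure lebesgue (cball (0::plane) (R + \<rho>))"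
    using m by (intro measure_mono_fmeasurable) (auto dest: fmeasurableD)
  then show "(\<Sum>i\<in>?J. measure lebesgue (C i)) \<le> pi * (R + \<rho>)\<^sup>2" using eq R by (simp add: measure_disc)
qed

section \<open>Packings by translates of a centrally symmetric domain\<close>

locale centered_body =
  fixes D :: "plane set" and c :: plane
  assumes domain: "convex_domain D" and center: "x \<in> D \<Longrightarrow> 2 *\<^sub>R c - x \<in> D"
begin

definition B where "B = (\<lambda>d. 2 *\<^sub>R (d - c)) ` D"

lemma compact_D: "compact D" and convex_D: "convex D" and interior_D: "interior D \<noteq> {}"
  using domain by (auto simp: convex_domain_def)

text \<open>Convexity and symmetry about \<open>c\<close> turn the difference set of
  \<open>S\<close> into the doubled copy of \<open>S - c\<close>: a difference of two points is
  twice the vector from \<open>c\<close> to the midpoint of one and the reflection of the other. It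
  is applied to \<open>D\<close> and to its interior, for contacts and for overlaps.\<close>

lemma overlap_iff:
  assumes "convex S" "\<And>x. x \<in> S \<Longrightarrow> 2 *\<^sub>R c - x \<in> S"
  shows "translate S x \<inter> translate S y \<noteq> {} \<longleftrightarrow> x - y \<in> (\<lambda>d. 2 *\<^sub>R (d - c)) ` S"
proof
  assume "translate S x \<inter> translate S y \<noteq> {}"
  then obtain d d' where d: "d \<in> S" "d' \<in> S" "d + x = d' + y" by (auto simp: translate_def)
  have "x - y = d' - d" using d(3) by (simp add: algebra_simps)
  also have "\<dots> = 2 *\<^sub>R (((1/2) *\<^sub>R d' + (1/2) *\<^sub>R (2 *\<^sub>R c - d)) - c)" by (simp add: algebra_simps)
  finally have "x - y = 2 *\<^sub>R (((1/2) *\<^sub>R d' + (1/2) *\<^sub>R (2 *\<^sub>R c - d)) - c)" .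
  moreover have "(1/2) *\<^sub>R d' + (1/2) *\<^sub>R (2 *\<^sub>R c - d) \<in> S"
    using assms d by (intro convexD) auto
  ultimately show "x - y \<in> (\<lambda>d. 2 *\<^sub>R (d - c)) ` S" by blast
next
  assume "x - y \<in> (\<lambda>d. 2 *\<^sub>R (d - c)) ` S"
  then obtain d where d: "d \<in> S" "x - y = 2 *\<^sub>R (d - c)" by blast
  then have "x = y + 2 *\<^sub>R (d - c)" by (simp add: algebra_simps)
  then have "(2 *\<^sub>R c - d) + x = d + y" by (simp add: vec_eq_iff algebra_simps)
  moreover have "(2 *\<^sub>R c - d) + x \<in> translate S x" "d + y \<in> translate S y"
    using d(1) assms(2)[OF d(1)] unfolding translate_def by blast+
  ultimately show "translate S x \<inter> translate S y \<noteq> {}" by (metis disjoint_iff)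
qed

lemma B_alt: "B = (+) (- 2 *\<^sub>R c) ` ((*\<^sub>R) 2 ` D)"
  by (auto simp: B_def image_image algebra_simps)

lemma interior_scaled: "interior ((\<lambda>d. 2 *\<^sub>R (d - c)) ` S) = (\<lambda>d. 2 *\<^sub>R (d - c)) ` interior S"
proof -
  have "(\<lambda>d. 2 *\<^sub>R (d - c)) ` S = (*\<^sub>R) 2 ` ((\<lambda>d. d - c) ` S)" for S :: "plane set" by (simp add: image_image)
  moreover have "interior ((*\<^sub>R) 2 ` S) = (*\<^sub>R) 2 ` interior S" for S :: "plane set"
    by (rule interior_injective_linear_image) (auto simp: inj_def linear_scaleR)
  ultimately show ?thesis by (simp add: interior_translation_subtract)
qed

lemma center_interior: "x \<in> interior D \<Longrightarrow> 2 *\<^sub>R c - x \<in> interior D"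
proof -
  have "(\<lambda>x. 2 *\<^sub>R c - x) ` D = D"
  proof
    show "D \<subseteq> (\<lambda>x. 2 *\<^sub>R c - x) ` D"
    proof
      fix x assume "x \<in> D"
      then show "x \<in> (\<lambda>x. 2 *\<^sub>R c - x) ` D" using center by (intro image_eqI[of _ _ "2 *\<^sub>R c - x"]) auto
    qed
  qed (use center in auto)
  moreover have "(\<lambda>x. 2 *\<^sub>R c - x) ` S = (+) (2 *\<^sub>R c) ` (uminus ` S)" for S by (simp add: image_image)
  ultimately have "(\<lambda>x. 2 *\<^sub>R c - x) ` interior D = interior D"
    by (metis interior_negations interior_translation)
  then show "x \<in> interior D \<Longrightarrow> 2 *\<^sub>R c - x \<in> interior D" by blast
qed

sublocale sym_body B
proof
  show "compact B" unfolding B_alt by (intro compact_translation compact_scaling compact_D)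
  show "convex B" unfolding B_alt by (intro convex_translation convex_scaling convex_D)
  obtain x where x: "x \<in> interior D" using interior_D by blast
  have "(1/2) *\<^sub>R x + (1/2) *\<^sub>R (2 *\<^sub>R c - x) \<in> interior D"
    using x center_interior[OF x] convex_D by (intro convexD[OF convex_interior]) auto
  then have "c \<in> interior D" by (simp add: algebra_simps)
  then show "0 \<in> interior B" unfolding B_def interior_scaled by force
  show "- x \<in> B" if "x \<in> B" for x
  proof -
    obtain d where d: "d \<in> D" "x = 2 *\<^sub>R (d - c)" using \<open>x \<in> B\<close> unfolding B_def by blast
    then have "- x = 2 *\<^sub>R ((2 *\<^sub>R c - d) - c)" unfolding d(2) by (simp add: vec_eq_iff algebra_simps)
    then show ?thesis using center[OF d(1)] unfolding B_def by blast
  qed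
qed

lemma M_eq: "M = 4 * measure lebesgue D"
proof -
  have "linear ((*\<^sub>R) 2 :: plane \<Rightarrow> plane)" by (simp add: linear_scaleR)
  then have "measure lebesgue ((*\<^sub>R) 2 ` D) = 4 * measure lebesgue D"
    using measure_linear_image[of "(*\<^sub>R) 2" D] lmeasurable_compact[OF compact_D]
    by (simp add: det_2 matrix_def axis_def)
  then show ?thesis unfolding M_def unfolding B_alt by (simp only: measure_translation)
qed

lemma area_pos: "measure lebesgue D > 0"
  using interior_D convex_D negligible_convex_interior[OF convex_D]
    negligible_iff_measure[of D] lmeasurable_compact[OF compact_D] by (simp add: less_le)

lemma touch_iff: "translate D x \<inter> translate D y \<noteq> {} \<longleftrightarrow> x - y \<in> B"
  unfolding B_def using overlap_iff[OF convex_D center] .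

lemma interior_translate: "interior (translate S x) = translate (interior S) x"
proof -
  have "translate S x = (+) x ` S" for S unfolding translate_def by (simp add: add.commute)
  then show ?thesis by (simp add: interior_translation)
qed

lemma packing_iff: "is_packing D X \<longleftrightarrow> (\<forall>x\<in>X. \<forall>y\<in>X. x \<noteq> y \<longrightarrow> x - y \<notin> interior B)"
proof -
  have "translate (interior D) x \<inter> translate (interior D) y \<noteq> {} \<longleftrightarrow> x - y \<in> interior B" for x y
    using overlap_iff[OF convex_interior[OF convex_D] center_interior] by (simp add: B_def interior_scaled)
  then show ?thesis unfolding is_packing_def pairwise_def interior_translate by blast
qed

lemma neighbours_eq: "neighbours D X x = {y \<in> X. y \<noteq> x \<and> y - x \<in> B}"
  unfolding neighbours_def touch_iff using sym_iff[of "x - y" for y] by (metis (no_types, lifting) minus_diff_eq sym_iff)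

lemma neighbours_packing:
  "is_packing D X \<Longrightarrow> x \<in> X \<Longrightarrow> neighbours D X x = {y \<in> X. y - x \<in> frontier B}"
  using zero_interior unfolding neighbours_eq packing_iff frontier_iff by auto

text \<open>A common bound for the norms on \<open>D\<close> and on \<open>B\<close>, so that it
  controls both the reach of a translate and the length of an edge.\<close>

definition width where "width = (SOME b. \<forall>x\<in>D \<union> B. norm x \<le> b)"

lemma width: "x \<in> D \<Longrightarrow> norm x \<le> width" "x \<in> B \<Longrightarrow> norm x \<le> width"
proof -
  have "bounded (D \<union> B)" using compact_D compact_B compact_imp_bounded by blast
  then obtain b where "\<forall>x\<in>D \<union> B. norm x \<le> b" unfolding bounded_iff by blast
  then have "\<forall>x\<in>D \<union> B. norm x \<le> width" unfolding width_def by (rule someI)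
  then show "x \<in> D \<Longrightarrow> norm x \<le> width" "x \<in> B \<Longrightarrow> norm x \<le> width" by auto
qed

lemma width_nonneg: "0 \<le> width" using width(2)[OF zero_B] by simp

text \<open>Two translates meet in a convex set without interior points, which is negligible, so
  their areas add up inside \<open>U\<close>.\<close>

lemma packing_card_le:
  assumes X: "is_packing D X" and S: "S \<subseteq> X" "finite S" and U: "U \<in> lmeasurable"
    and SU: "\<And>x. x \<in> S \<Longrightarrow> cball x width \<subseteq> U"
  shows "card S * measure lebesgue D \<le> measure lebesgue U"
proof -
  have tr: "translate D x = (+) x ` D" for x unfolding translate_def by (simp add: add.commute)
  have comp: "compact (translate D x)" for x unfolding tr by (intro compact_translation compact_D)
  have conv: "convex (translate D x)" for x unfolding tr by (intro convex_translation convex_D)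
  have "negligible (translate D x \<inter> translate D y)" if "x \<in> S" "y \<in> S" "x \<noteq> y" for x y
  proof -
    have "interior (translate D x) \<inter> interior (translate D y) = {}"
      using X that S by (auto simp: is_packing_def pairwise_def)
    then show ?thesis using negligible_convex_interior[of "translate D x \<inter> translate D y"] conv
      by (simp add: convex_Int)
  qed
  then have "measure lebesgue (\<Union>x\<in>S. translate D x) = (\<Sum>x\<in>S. measure lebesgue (translate D x))"
    using S comp by (intro measure_negligible_finite_Union_image lmeasurable_compact) (auto simp: pairwise_def)
  then have "card S * measure lebesgue D = measure lebesgue (\<Union>x\<in>S. translate D x)"
    by (simp add: tr measure_translation)
  also have "\<dots> \<le> measure lebesgue U"
  proof (rule measure_mono_fmeasurable[OF _ _ U])
    show "(\<Union>x\<in>S. translate D x) \<subseteq> U"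
    proof
      fix z assume "z \<in> (\<Union>x\<in>S. translate D x)"
      then obtain x d where "x \<in> S" "d \<in> D" "z = d + x" by (auto simp: translate_def)
      then show "z \<in> U" using SU[of x] width(1)[of d] by (auto simp: dist_norm subset_eq)
    qed
    show "(\<Union>x\<in>S. translate D x) \<in> sets lebesgue"
      using S comp lmeasurable_compact by (intro sets.finite_UN) (auto dest: fmeasurableD)
  qed
  finally show ?thesis .
qed

lemma packing_finite: assumes "is_packing D X" shows "finite (X \<inter> cball z r)"
proof -
  have "card S \<le> nat \<lceil>measure lebesgue (cball z (r + width)) / measure lebesgue D\<rceil>"
    if S: "S \<subseteq> X \<inter> cball z r" "finite S" for S
  proof -
  have "card S * measure lebesgue D \<le> measure lebesgue (cball z (r + width))"
  proof (rule packing_card_le[OF assms _ S(2)])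
    fix x assume "x \<in> S"
    then have "dist x z + width \<le> r + width" using S by (auto simp: dist_commute)
    then show "cball x width \<subseteq> cball z (r + width)" by (metis add.commute cball_subset_cball_iff)
  qed (use S in auto)
  then have "card S \<le> measure lebesgue (cball z (r + width)) / measure lebesgue D"
    using area_pos by (simp add: field_simps)
  then show ?thesis by linarith
  qed
  then show ?thesis using finite_if_finite_subsets_card_bdd by blast
qed

lemma packing_count:
  assumes "is_packing D X" "0 \<le> R"
  shows "card (X \<inter> cball 0 R) * measure lebesgue D \<le> pi * (R + width)\<^sup>2"
proof -
  have "card (X \<inter> cball 0 R) * measure lebesgue D \<le> measure lebesgue (cball (0::plane) (R + width))"
    using assms packing_finite by (intro packing_card_le[of X]) (auto simp: cball_subset_cball_iff)
  then show ?thesis using width_nonneg assms by (simp add: measure_disc)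
qed

text \<open>The translates near the boundary of the disc fill an annulus of bounded width, so there
  are only O(R) of them; this controls the change from one radius to another in degree sums.\<close>

lemma packing_annulus:
  assumes "is_packing D X" "0 \<le> a" "a + width \<le> R"
  shows "(real (card (X \<inter> cball 0 R)) - card (X \<inter> cball 0 (R - a))) * measure lebesgue D
    \<le> pi * ((R + width)\<^sup>2 - (R - a - width)\<^sup>2)"
proof -
  let ?S = "X \<inter> cball 0 R - X \<inter> cball 0 (R - a)"
  let ?U = "cball 0 (R + width) - ball (0::plane) (R - a - width)"
  have fin: "finite (X \<inter> cball 0 r)" for r using packing_finite[OF assms(1)] .
  have "card ?S * measure lebesgue D \<le> measure lebesgue ?U"
  proof (rule packing_card_le[OF assms(1)])
    fix x assume x: "x \<in> ?S"
    show "cball x width \<subseteq> ?U"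
    proof
      fix z assume "z \<in> cball x width"
      then have "norm (x - z) \<le> width" by (simp add: dist_norm)
      then show "z \<in> ?U" using x norm_triangle_ineq2[of x z] norm_triangle_ineq2[of z x] by (auto simp: norm_minus_commute)
    qed
  qed (use fin in auto)
  also have "measure lebesgue ?U = measure lebesgue (cball (0::plane) (R + width)) - measure lebesgue (ball (0::plane) (R - a - width))"
    using assms width_nonneg by (intro measurable_measure_Diff) auto
  also have "\<dots> = pi * ((R + width)\<^sup>2 - (R - a - width)\<^sup>2)"
    using assms width_nonneg measure_disc(1)[of "R + width" 0] measure_disc(3)[of "R - a - width" 0]
    by (simp only: right_diff_distrib)
  finally have "card ?S * measure lebesgue D \<le> pi * ((R + width)\<^sup>2 - (R - a - width)\<^sup>2)" .
  moreover have "card ?S = card (X \<inter> cball 0 R) - card (X \<inter> cball 0 (R - a))"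
    using fin assms by (intro card_Diff_subset) auto
  moreover have "card (X \<inter> cball 0 (R - a)) \<le> card (X \<inter> cball 0 R)" using fin assms by (intro card_mono) auto
  ultimately show ?thesis by (simp add: of_nat_diff)
qed

end

section \<open>Lattices and their densities\<close>

definition lattice :: "plane \<Rightarrow> plane \<Rightarrow> plane set" where
  "lattice u v = {of_int i *\<^sub>R u + of_int j *\<^sub>R v | i j :: int. True}"

lemma inj_lattice:
  assumes "wedge u v \<noteq> 0" shows "inj (\<lambda>(i, j). of_int i *\<^sub>R u + of_int j *\<^sub>R v)"
proof (rule injI, clarify)
  fix i j k l :: int
  assume "of_int i *\<^sub>R u + of_int j *\<^sub>R v = of_int k *\<^sub>R u + of_int l *\<^sub>R v"
  then have "frame u v (pt (of_int i) (of_int j)) = frame u v (pt (of_int k) (of_int l))" by (simp add: frame_pt)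
  then have "pt (of_int i) (of_int j) = pt (of_int k) (of_int l)" using inj_frame[OF assms] by (simp add: inj_def)
  then have "(of_int i :: real) = of_int k" "(of_int j :: real) = of_int l" by (metis pt_nth)+
  then show "i = k \<and> j = l" by simp
qed

lemma independent_wedge: assumes "wedge u v \<noteq> 0" shows "u \<noteq> v \<and> independent {u, v}"
proof
  show ne: "u \<noteq> v" using assms by auto
  have "u \<notin> span {v}"
  proof
    assume "u \<in> span {v}"
    then obtain k where "u = k *\<^sub>R v" by (auto simp: span_singleton)
    then show False using assms by simp
  qed
  moreover have "v \<noteq> 0" using assms by auto
  ultimately show "independent {u, v}" using ne by (simp add: independent_insert)
qed

lemma wedge_independent: assumes "u \<noteq> v" "independent {u, v}" shows "wedge u v \<noteq> 0"
proof
  assume w: "wedge u v = 0"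
  have "u \<noteq> 0" using assms(2) dependent_zero by blast
  then obtain k where "v = k *\<^sub>R u" using wedge_eq_0[OF w] by blast
  then have "v \<in> span {u}" by (simp add: span_mul span_base)
  moreover have "v \<notin> span {u}" using assms by (metis independent_insert insert_commute insertE empty_iff singletonD)
  ultimately show False by blast
qed

lemma is_lattice_iff: "is_lattice L \<longleftrightarrow> (\<exists>u v. wedge u v \<noteq> 0 \<and> L = lattice u v)"
proof
  assume "is_lattice L"
  then obtain u v where "u \<noteq> v" "independent {u, v}" "L = lattice u v" unfolding is_lattice_def lattice_def by blast
  then show "\<exists>u v. wedge u v \<noteq> 0 \<and> L = lattice u v" using wedge_independent by blast
next
  assume "\<exists>u v. wedge u v \<noteq> 0 \<and> L = lattice u v"
  then obtain u v where "wedge u v \<noteq> 0" "L = lattice u v" by blast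
  then show "is_lattice L" unfolding is_lattice_def lattice_def using independent_wedge[of u v] by blast
qed

text \<open>Cramer's rule expresses the coefficients by determinants, which the Cauchy-Schwarz
  inequality bounds in terms of the norm.\<close>

lemma finite_lattice_disc: assumes "wedge u v \<noteq> 0"
  shows "finite {p. (case p of (i, j) \<Rightarrow> of_int i *\<^sub>R u + of_int j *\<^sub>R v) \<in> cball (0::plane) R}" (is "finite ?J")
proof -
  define K where "K = R * (norm u + norm v) / \<bar>wedge u v\<bar>"
  have wle: "\<bar>wedge a b\<bar> \<le> norm a * norm b" for a b :: plane
  proof -
    have "norm (perp) = norm a" if "perp = (\<chi> i. if i = 1 then - a$2 else a$1)" for perp :: plane
      unfolding that norm_vec_def L2_set_def by (simp add: sum_2 add.commute)
    then show ?thesis unfolding wedge_inner using Cauchy_Schwarz_ineq2 by metis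
  qed
  have "\<bar>i\<bar> \<le> \<lceil>K\<rceil> \<and> \<bar>j\<bar> \<le> \<lceil>K\<rceil>" if "(i, j) \<in> ?J" for i j :: int
  proof -
    let ?z = "of_int i *\<^sub>R u + of_int j *\<^sub>R v"
    have z: "norm ?z \<le> R" using that by simp
    then have R: "R \<ge> 0" using norm_ge_zero order_trans by blast
    have "\<bar>of_int i\<bar> * \<bar>wedge u v\<bar> = \<bar>wedge ?z v\<bar>" "\<bar>of_int j\<bar> * \<bar>wedge u v\<bar> = \<bar>wedge u ?z\<bar>"
      by (simp_all add: wedge_add abs_mult)
    moreover have "\<bar>wedge ?z v\<bar> \<le> R * norm v" "\<bar>wedge u ?z\<bar> \<le> norm u * R"
      using wle[of ?z v] wle[of u ?z] mult_right_mono[OF z, of "norm v"] mult_left_mono[OF z, of "norm u"] by simp_all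
    moreover have "R * norm v \<le> R * (norm u + norm v)" "norm u * R \<le> R * (norm u + norm v)"
      using R by (simp_all add: algebra_simps)
    ultimately have "\<bar>real_of_int i\<bar> \<le> K" "\<bar>real_of_int j\<bar> \<le> K"
      using assms unfolding K_def by (simp_all add: pos_le_divide_eq)
    then show ?thesis by linarith
  qed
  then have "?J \<subseteq> {-\<lceil>K\<rceil>..\<lceil>K\<rceil>} \<times> {-\<lceil>K\<rceil>..\<lceil>K\<rceil>}" by force
  then show ?thesis by (rule finite_subset) auto
qed

lemma negligible_frame: assumes "negligible S" shows "negligible (frame e f ` S)"
proof -
  have "S \<in> lmeasurable" "measure lebesgue S = 0" using assms negligible_iff_measure by blast+
  moreover have "frame e f ` S \<in> lmeasurable"
    using \<open>S \<in> lmeasurable\<close> by (intro measurable_linear_image[OF linear_frame])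
  ultimately show ?thesis
    using measure_frame[of S e f] by (simp add: negligible_iff_measure)
qed

lemma frame_cbox_negligible:
  assumes w: "wedge e f \<noteq> 0" and "b \<le> a' \<or> b' \<le> a \<or> d \<le> c' \<or> d' \<le> c"
  shows "negligible (frame e f ` cbox (pt a c) (pt b d) \<inter> frame e f ` cbox (pt a' c') (pt b' d'))"
proof -
  have "cbox (pt a c) (pt b d) \<inter> cbox (pt a' c') (pt b' d') \<subseteq>
      {z. axis 1 1 \<bullet> z = a'} \<union> {z. axis 1 1 \<bullet> z = a} \<union> {z. axis 2 1 \<bullet> z = c'} \<union> {z. axis 2 1 \<bullet> z = c}"
    using assms(2) by (auto simp: mem_cbox_pt inner_axis')
  moreover have "negligible ({z::plane. axis 1 1 \<bullet> z = a'} \<union> {z. axis 1 1 \<bullet> z = a} \<union> {z. axis 2 1 \<bullet> z = c'} \<union> {z. axis 2 1 \<bullet> z = c})"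
    by (intro negligible_Un negligible_hyperplane) (auto simp: axis_eq_0_iff)
  ultimately have "negligible (cbox (pt a c) (pt b d) \<inter> cbox (pt a' c') (pt b' d'))" using negligible_subset by blast
  then have "negligible (frame e f ` (cbox (pt a c) (pt b d) \<inter> cbox (pt a' c') (pt b' d')))"
    by (rule negligible_frame)
  then show ?thesis using image_Int[OF inj_frame[OF w]] by metis
qed

lemma frame_norm_le: "norm (frame e f z) \<le> \<bar>z$1\<bar> * norm e + \<bar>z$2\<bar> * norm f"
  unfolding frame_def using norm_triangle_ineq[of "z$1 *\<^sub>R e" "z$2 *\<^sub>R f"] by simp

lemma frame_diff: "frame e f x - frame e f y = frame e f (x - y)"
  using linear_diff[OF linear_frame] by metis

text \<open>The fundamental parallelograms tile the plane, one for each lattice point.\<close>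

lemma lattice_count:
  assumes w: "wedge u v \<noteq> 0" and R: "norm u + norm v \<le> R"
  shows "pi * (R - (norm u + norm v))\<^sup>2 \<le> num_points (lattice u v) R * \<bar>wedge u v\<bar>"
    "num_points (lattice u v) R * \<bar>wedge u v\<bar> \<le> pi * (R + (norm u + norm v))\<^sup>2"
proof -
  define b where "b = (\<lambda>(i, j). of_int i *\<^sub>R u + of_int j *\<^sub>R v)"
  define C where "C = (\<lambda>(i, j). frame u v ` cbox (pt (of_int i) (of_int j)) (pt (of_int i + 1) (of_int j + 1)))"
  have fin: "finite {p. b p \<in> cball 0 R}" unfolding b_def by (rule finite_lattice_disc[OF w])
  have meas: "C p \<in> lmeasurable" for p
    unfolding C_def by (cases p) (auto intro!: measurable_linear_image[OF linear_frame])
  have mC: "measure lebesgue (C p) = \<bar>wedge u v\<bar>" for p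
  proof -
    obtain i j where p: "p = (i, j)" by fastforce
    have "measure lebesgue (cbox (pt (of_int i) (of_int j)) (pt (of_int i + 1) (of_int j + 1))) = 1"
      by (subst measure_cbox_pt) auto
    then show ?thesis unfolding C_def p using measure_frame[of "cbox (pt (of_int i) (of_int j)) (pt (of_int i + 1) (of_int j + 1))" u v] by simp
  qed
  have neg: "negligible (C p \<inter> C q)" if "p \<noteq> q" for p q
  proof -
    obtain i j k l where pq: "p = (i, j)" "q = (k, l)" by fastforce
    then have "i + 1 \<le> k \<or> k + 1 \<le> i \<or> j + 1 \<le> l \<or> l + 1 \<le> j" using that by auto
    then have "real_of_int i + 1 \<le> of_int k \<or> real_of_int k + 1 \<le> of_int i \<or> real_of_int j + 1 \<le> of_int l \<or> real_of_int l + 1 \<le> of_int j"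
      by linarith
    then show ?thesis unfolding C_def pq by (simp add: frame_cbox_negligible[OF w])
  qed
  have near: "C p \<subseteq> cball (b p) (norm u + norm v)" for p
  proof -
    obtain i j where p: "p = (i, j)" by fastforce
    show ?thesis
    proof
      fix z assume "z \<in> C p"
      then obtain x where x: "z = frame u v x" "of_int i \<le> x$1" "x$1 \<le> of_int i + 1" "of_int j \<le> x$2" "x$2 \<le> of_int j + 1"
        by (auto simp: C_def p mem_cbox_pt)
      have "z - b p = frame u v (x - pt (of_int i) (of_int j))" by (simp add: x(1) b_def p frame_pt[symmetric] frame_diff)
      then have "norm (z - b p) \<le> \<bar>x$1 - of_int i\<bar> * norm u + \<bar>x$2 - of_int j\<bar> * norm v"
        using frame_norm_le[of u v "x - pt (of_int i) (of_int j)"] by simp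
      also have "\<dots> \<le> 1 * norm u + 1 * norm v" using x by (intro add_mono mult_right_mono) auto
      finally show "z \<in> cball (b p) (norm u + norm v)" by (simp add: dist_norm norm_minus_commute)
    qed
  qed
  have cover: "(\<Union>p. C p) = UNIV"
  proof -
    have "z \<in> (\<Union>p. C p)" for z
    proof -
      obtain x where x: "z = frame u v x" using surj_frame[OF w] by (auto simp: surj_def)
      have "z \<in> C (\<lfloor>x$1\<rfloor>, \<lfloor>x$2\<rfloor>)" unfolding C_def x
        by (auto simp: mem_cbox_pt intro!: imageI)
      then show ?thesis by blast
    qed
    then show ?thesis by blast
  qed
  have "lattice u v \<inter> cball 0 R = b ` {p. b p \<in> cball 0 R}" by (auto simp: lattice_def b_def)
  moreover have "inj_on b {p. b p \<in> cball 0 R}" using inj_lattice[OF w] inj_on_subset unfolding b_def by blast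
  ultimately have N: "num_points (lattice u v) R = card {p. b p \<in> cball 0 R}" unfolding num_points_def by (simp add: card_image)
  show "pi * (R - (norm u + norm v))\<^sup>2 \<le> num_points (lattice u v) R * \<bar>wedge u v\<bar>"
    "num_points (lattice u v) R * \<bar>wedge u v\<bar> \<le> pi * (R + (norm u + norm v))\<^sup>2"
    using tiling_count[OF fin meas neg near cover _ R] by (simp_all add: mC N)
qed

lemma lattice_density:
  assumes w: "wedge u v \<noteq> 0"
  shows "(disc_density D (lattice u v) \<longlongrightarrow> measure lebesgue D / \<bar>wedge u v\<bar>) at_top"
proof -
  define \<rho> where "\<rho> = norm u + norm v"
  define A where "A = measure lebesgue D"
  have lim1: "((\<lambda>R. A / \<bar>wedge u v\<bar> * ((R - \<rho>)\<^sup>2 / R\<^sup>2)) \<longlongrightarrow> A / \<bar>wedge u v\<bar>) at_top"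
  proof -
    have "((\<lambda>R. (1 - \<rho> / R)\<^sup>2) \<longlongrightarrow> (1 - 0)\<^sup>2) at_top"
      by (intro tendsto_intros tendsto_divide_0[OF tendsto_const] filterlim_at_top_imp_at_infinity filterlim_ident)
    moreover have "\<forall>\<^sub>F R in at_top. (1 - \<rho> / R)\<^sup>2 = (R - \<rho>)\<^sup>2 / R\<^sup>2"
      using eventually_gt_at_top[of 0] by eventually_elim (simp add: power_divide[symmetric] diff_divide_distrib)
    ultimately have "((\<lambda>R. (R - \<rho>)\<^sup>2 / R\<^sup>2) \<longlongrightarrow> (1 - 0)\<^sup>2) at_top" by (rule Lim_transform_eventually)
    from tendsto_mult_left[OF this, of "A / \<bar>wedge u v\<bar>"] show ?thesis by simp
  qed
  have lim2: "((\<lambda>R. A / \<bar>wedge u v\<bar> * ((R + \<rho>)\<^sup>2 / R\<^sup>2)) \<longlongrightarrow> A / \<bar>wedge u v\<bar>) at_top"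
  proof -
    have "((\<lambda>R. (1 + \<rho> / R)\<^sup>2) \<longlongrightarrow> (1 + 0)\<^sup>2) at_top"
      by (intro tendsto_intros tendsto_divide_0[OF tendsto_const] filterlim_at_top_imp_at_infinity filterlim_ident)
    moreover have "\<forall>\<^sub>F R in at_top. (1 + \<rho> / R)\<^sup>2 = (R + \<rho>)\<^sup>2 / R\<^sup>2"
      using eventually_gt_at_top[of 0] by eventually_elim (simp add: power_divide[symmetric] add_divide_distrib)
    ultimately have "((\<lambda>R. (R + \<rho>)\<^sup>2 / R\<^sup>2) \<longlongrightarrow> (1 + 0)\<^sup>2) at_top" by (rule Lim_transform_eventually)
    from tendsto_mult_left[OF this, of "A / \<bar>wedge u v\<bar>"] show ?thesis by simp
  qed
  have A: "A \<ge> 0" by (simp add: A_def)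
  have low: "A / \<bar>wedge u v\<bar> * ((R - \<rho>)\<^sup>2 / R\<^sup>2) \<le> disc_density D (lattice u v) R"
    and up: "disc_density D (lattice u v) R \<le> A / \<bar>wedge u v\<bar> * ((R + \<rho>)\<^sup>2 / R\<^sup>2)" if R: "\<rho> + 1 \<le> R" for R
  proof -
    have "R > 0" using R norm_ge_zero[of u] norm_ge_zero[of v] unfolding \<rho>_def by linarith
    then have P: "pi * R\<^sup>2 > 0" by simp
    let ?N = "real (num_points (lattice u v) R)"
    have c: "pi * (R - \<rho>)\<^sup>2 \<le> ?N * \<bar>wedge u v\<bar>" "?N * \<bar>wedge u v\<bar> \<le> pi * (R + \<rho>)\<^sup>2"
      using lattice_count[OF w, of R] R by (simp_all add: \<rho>_def)
    have dd: "disc_density D (lattice u v) R = (?N * \<bar>wedge u v\<bar>) * (A / \<bar>wedge u v\<bar> / (pi * R\<^sup>2))"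
      using w by (simp add: disc_density_def A_def)
    have K: "0 \<le> A / \<bar>wedge u v\<bar> / (pi * R\<^sup>2)" using A P by simp
    have *: "A / \<bar>wedge u v\<bar> * (x / R\<^sup>2) = pi * x * (A / \<bar>wedge u v\<bar> / (pi * R\<^sup>2))" for x
      using P by (simp add: field_simps)
    show "A / \<bar>wedge u v\<bar> * ((R - \<rho>)\<^sup>2 / R\<^sup>2) \<le> disc_density D (lattice u v) R"
      unfolding dd * by (rule mult_right_mono[OF c(1) K])
    show "disc_density D (lattice u v) R \<le> A / \<bar>wedge u v\<bar> * ((R + \<rho>)\<^sup>2 / R\<^sup>2)"
      unfolding dd * by (rule mult_right_mono[OF c(2) K])
  qed
  have "(disc_density D (lattice u v) \<longlongrightarrow> A / \<bar>wedge u v\<bar>) at_top"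
    by (rule tendsto_sandwich[OF _ _ lim1 lim2]; rule eventually_mono[OF eventually_ge_at_top[of "\<rho> + 1"]]; use low up in blast)
  then show ?thesis by (simp add: A_def)
qed

section \<open>Hexagonal pairs, six-neighbour lattices and the thinnest density\<close>

context sym_body
begin

lemma frontier_parallel:
  assumes "u \<in> frontier B" "v \<in> frontier B" "wedge u v = 0" shows "v = u \<or> v = - u"
proof -
  have "u \<noteq> 0" using assms zero_interior by (auto simp: frontier_iff)
  then obtain k where k: "v = k *\<^sub>R u" using wedge_eq_0[OF assms(3)] by blast
  have "v \<noteq> 0" using assms zero_interior by (auto simp: frontier_iff)
  then have "k \<noteq> 0" using k by auto
  have "\<not> \<bar>k\<bar> < 1" using scale_interior[of u k] assms k by (auto simp: frontier_iff)
  moreover have "\<not> \<bar>k\<bar> > 1"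
  proof
    assume "\<bar>k\<bar> > 1"
    then have "\<bar>1 / k\<bar> < 1" by (simp add: field_simps)
    moreover have "(1 / k) *\<^sub>R v = u" using k \<open>k \<noteq> 0\<close> by simp
    ultimately show False using scale_interior[of v "1 / k"] assms by (auto simp: frontier_iff)
  qed
  ultimately have "k = 1 \<or> k = -1" by linarith
  then show ?thesis using k by auto
qed

text \<open>An intermediate value argument. On the connected boundary of \<open>B\<close> the closed
  set where \<open>u - v\<close> is in \<open>B\<close> contains \<open>u\<close>, and the closed
  set where it is not interior contains \<open>- u\<close>. Together they cover the boundary, so
  they have a common point.\<close>

lemma hex_pair_exists: "\<exists>u v. hex_pair u v \<and> wedge u v \<noteq> 0"
proof -
  have "frontier B \<noteq> {}"
    using zero_interior compact_B compact_imp_bounded frontier_eq_empty not_bounded_UNIV by (metis empty_iff interior_empty)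
  then obtain u where u: "u \<in> frontier B" by blast
  have "u \<noteq> 0" using u zero_interior by (auto simp: frontier_iff)
  have two: "2 *\<^sub>R u \<notin> B"
  proof
    assume "2 *\<^sub>R u \<in> B"
    then have "(1/2) *\<^sub>R (2 *\<^sub>R u) \<in> interior B" by (intro scale_interior) auto
    then show False using u by (simp add: frontier_iff)
  qed
  have "connected (frontier B)"
  proof -
    have "interior B \<noteq> {}" using zero_interior by auto
    then have "rel_frontier B = frontier B" "aff_dim B = int DIM(plane)"
      by (auto simp: rel_frontier_nonempty_interior aff_dim_nonempty_interior)
    then show ?thesis using connected_sphere_gen[OF convex_B compact_imp_bounded[OF compact_B]] by simp
  qed
  define S T where "S = frontier B \<inter> {v. u - v \<in> B}" and "T = frontier B \<inter> {v. u - v \<notin> interior B}"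
  have "closed S"
    unfolding S_def by (intro closed_Int frontier_closed continuous_closed_vimage[OF closed_B, of "\<lambda>v. u - v", simplified vimage_def]) (auto intro!: continuous_intros)
  moreover have "closed T"
  proof -
    have "open {v. u - v \<in> interior B}"
      using continuous_open_vimage[OF open_interior, of "\<lambda>v. u - v" B] by (simp add: vimage_def continuous_intros)
    then have "closed (- {v. u - v \<in> interior B})" by (rule closed_Compl)
    moreover have "- {v. u - v \<in> interior B} = {v. u - v \<notin> interior B}" by auto
    ultimately show ?thesis unfolding T_def by (metis closed_Int frontier_closed)
  qed
  moreover have "u \<in> S" using u zero_B by (simp add: S_def)
  moreover have "- u \<in> T" using u two interior_subset[of B] sym_frontier by (auto simp: T_def scaleR_2)
  moreover have "frontier B \<subseteq> S \<union> T" using interior_subset by (auto simp: S_def T_def)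
  ultimately have "frontier B \<inter> (S \<inter> T) \<noteq> {}"
    using \<open>connected (frontier B)\<close> unfolding connected_closed S_def T_def
    by (smt (verit) Int_commute Int_left_commute Int_Un_distrib disjoint_iff empty_iff inf_assoc IntE IntI u sym_frontier)
  then obtain v where v: "v \<in> frontier B" "u - v \<in> B" "u - v \<notin> interior B" by (auto simp: S_def T_def)
  then have "hex_pair u v" using u by (simp add: hex_pair_def frontier_iff)
  moreover have "wedge u v \<noteq> 0"
  proof
    assume "wedge u v = 0"
    then have "v = u \<or> v = - u" using frontier_parallel u v by blast
    then show False using v zero_interior two by (auto simp: scaleR_2)
  qed
  ultimately show ?thesis by blast
qed

text \<open>\<open>p\<close> is a convex combination of
  \<open>m *\<^sub>R p + n *\<^sub>R q\<close>, with positive weight, and a multiple of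
  \<open>p - q\<close> in \<open>B\<close>. If the first were interior, so would be
  \<open>p\<close>.\<close>

lemma hex_combination:
  assumes p: "p \<in> frontier B" and pq: "p - q \<in> B" and m: "1 \<le> m" and n: "0 \<le> n"
  shows "m *\<^sub>R p + n *\<^sub>R q \<notin> interior B"
proof
  assume z: "m *\<^sub>R p + n *\<^sub>R q \<in> interior B"
  define a b where "a = 1 / (m + n)" and "b = n / (m + n)"
  have mn: "m + n > 0" using m n by simp
  have ab: "0 < a" "0 \<le> b" "a + b \<le> 1" "a \<le> 1" using m n mn by (simp_all add: a_def b_def field_simps)
  \<comment> \<open>Makes \<open>(1 - a) *\<^sub>R y\<close> equal to
    \<open>b *\<^sub>R (p - q)\<close>, with \<open>b \<le> 1 - a\<close>. If \<open>a = 1\<close>,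
    then \<open>b = 0\<close> and the quotient by zero gives \<open>y = 0\<close>, which still
    fits.\<close>
  define y where "y = (b / (1 - a)) *\<^sub>R (p - q)"
  have "\<bar>b / (1 - a)\<bar> \<le> 1" using ab by (cases "a = 1") (auto simp: field_simps)
  then have y: "y \<in> B" using combo_B[OF pq zero_B, of "b / (1 - a)" 0] by (simp add: y_def)
  have "y - a *\<^sub>R (y - (m *\<^sub>R p + n *\<^sub>R q)) \<in> interior B"
    by (rule mem_interior_convex_shrink[OF convex_B z y ab(1,4)])
  moreover have "y - a *\<^sub>R (y - (m *\<^sub>R p + n *\<^sub>R q)) = p"
  proof -
    have "(1 - a) *\<^sub>R y = b *\<^sub>R (p - q)"
    proof (cases "a = 1")
      case True
      then have "b = 0" using ab by simp
      then show ?thesis using True by simp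
    qed (simp add: y_def)
    then have "y - a *\<^sub>R (y - (m *\<^sub>R p + n *\<^sub>R q)) = b *\<^sub>R (p - q) + a *\<^sub>R (m *\<^sub>R p + n *\<^sub>R q)"
      by (simp add: algebra_simps)
    also have "\<dots> = (a * m + b) *\<^sub>R p + (a * n - b) *\<^sub>R q" by (simp add: algebra_simps)
    finally have "y - a *\<^sub>R (y - (m *\<^sub>R p + n *\<^sub>R q)) = (a * m + b) *\<^sub>R p + (a * n - b) *\<^sub>R q" .
    moreover have "a * n - b = 0" "a * m + b = 1" using mn by (simp_all add: a_def b_def add_divide_distrib[symmetric])
    ultimately show ?thesis by simp
  qed
  ultimately show False using p by (simp add: frontier_iff)
qed

text \<open>Up to sign, a nonzero lattice vector is a combination of two consecutive vertices of the
  hexagon with one coefficient at least 1 and the other nonnegative.\<close>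

lemma hex_lattice_interior:
  fixes i j :: int
  assumes h: "hex_pair u v" and ij: "(i, j) \<noteq> (0, 0)"
  shows "of_int i *\<^sub>R u + of_int j *\<^sub>R v \<notin> interior B"
proof -
  have f: "u \<in> frontier B" "v \<in> frontier B" "u - v \<in> frontier B" "v - u \<in> frontier B" "- v \<in> frontier B" "- u \<in> frontier B"
    using h sym_frontier hex_pair_swap[OF h] by (auto simp: hex_pair_def)
  then have B: "u \<in> B" "v \<in> B" "u - v \<in> B" "v - u \<in> B" "- v \<in> B" "- u \<in> B" by (auto simp: frontier_iff)
  have main: "of_int i *\<^sub>R u + of_int j *\<^sub>R v \<notin> interior B" if i: "i > 0 \<or> (i = 0 \<and> j > 0)" for i j :: int
  proof -
    consider "i > 0" "j \<ge> 0" | "i = 0" "j > 0" | "i > 0" "j < 0" "i \<ge> - j" | "i > 0" "j < 0" "i < - j"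
      using i by linarith
    then show ?thesis
    proof cases
      case 1
      then show ?thesis using f B by (intro hex_combination) auto
    next
      case 2
      then show ?thesis using hex_combination[OF f(2) B(4), of "of_int j" 0] by simp
    next
      case 3
      have "of_int (- j) *\<^sub>R (u - v) + of_int (i + j) *\<^sub>R u \<notin> interior B"
        using 3 f B by (intro hex_combination) auto
      moreover have "of_int (- j) *\<^sub>R (u - v) + of_int (i + j) *\<^sub>R u = of_int i *\<^sub>R u + of_int j *\<^sub>R v"
        by (simp add: algebra_simps)
      ultimately show ?thesis by simp
    next
      case 4
      have "of_int i *\<^sub>R (u - v) + of_int (- j - i) *\<^sub>R (- v) \<notin> interior B"
        using 4 f B by (intro hex_combination) auto
      moreover have "of_int i *\<^sub>R (u - v) + of_int (- j - i) *\<^sub>R (- v) = of_int i *\<^sub>R u + of_int j *\<^sub>R v"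
        by (simp add: algebra_simps)
      ultimately show ?thesis by simp
    qed
  qed
  consider "i > 0 \<or> (i = 0 \<and> j > 0)" | "- i > 0 \<or> (- i = 0 \<and> - j > 0)" using ij by fastforce
  then show ?thesis
  proof cases
    case 1 then show ?thesis using main by blast
  next
    case 2
    then have "of_int (- i) *\<^sub>R u + of_int (- j) *\<^sub>R v \<notin> interior B" using main by blast
    moreover have "of_int (- i) *\<^sub>R u + of_int (- j) *\<^sub>R v = - (of_int i *\<^sub>R u + of_int j *\<^sub>R v)" by simp
    ultimately show ?thesis using sym_interior by metis
  qed
qed

end

context centered_body
begin

lemma hex_lattice_six:
  assumes h: "hex_pair u v" and w: "wedge u v \<noteq> 0"
  shows "six_neighbour_lattice_packing D (lattice u v)"
proof -
  let ?b = "\<lambda>(i, j). of_int i *\<^sub>R u + of_int j *\<^sub>R v"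
  have pack: "is_packing D (lattice u v)"
    unfolding packing_iff
  proof (intro ballI impI)
    fix x y assume "x \<in> lattice u v" "y \<in> lattice u v" "x \<noteq> y"
    then obtain i j k l :: int where x: "x = ?b (i, j)" "y = ?b (k, l)" "(i, j) \<noteq> (k, l)"
      by (auto simp: lattice_def)
    then have "x - y = of_int (i - k) *\<^sub>R u + of_int (j - l) *\<^sub>R v" by (simp add: algebra_simps)
    moreover have "(i - k, j - l) \<noteq> (0, 0)" using x by auto
    ultimately show "x - y \<notin> interior B" using hex_lattice_interior[OF h] by metis
  qed
  have "6 \<le> card (neighbours D (lattice u v) x)" if x: "x \<in> lattice u v" for x
  proof -
    obtain i j :: int where ij: "x = of_int i *\<^sub>R u + of_int j *\<^sub>R v" using x by (auto simp: lattice_def)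
    let ?S = "{(1, 0), (-1, 0), (0, 1), (0, -1), (1, -1), (-1, 1)} :: (int \<times> int) set"
    have inj: "inj_on (\<lambda>p. x + ?b p) ?S" 
      using inj_on_subset[OF inj_lattice[OF w] subset_UNIV, of ?S] unfolding inj_on_def by (simp only: add_left_cancel)
    have "card ((\<lambda>p. x + ?b p) ` ?S) = 6" using card_image[OF inj] by simp
    moreover have "(\<lambda>p. x + ?b p) ` ?S \<subseteq> neighbours D (lattice u v) x"
    proof
      fix y assume "y \<in> (\<lambda>p. x + ?b p) ` ?S"
      then obtain k l :: int where kl: "(k, l) \<in> ?S" "y = x + ?b (k, l)" by fastforce
      have "y = of_int (i + k) *\<^sub>R u + of_int (j + l) *\<^sub>R v" using kl ij by (simp add: algebra_simps)
      then have 1: "y \<in> lattice u v" unfolding lattice_def by blast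
      have "?b (k, l) \<in> frontier B"
      proof -
        have f: "u \<in> frontier B" "v \<in> frontier B" "u - v \<in> frontier B" "v - u \<in> frontier B" "- v \<in> frontier B" "- u \<in> frontier B"
          using h hex_pair_swap[OF h] sym_frontier[of u] sym_frontier[of v] by (simp_all add: hex_pair_def)
        show ?thesis using kl(1) by (elim insertE emptyE) (simp_all add: f)
      qed
      then have "y - x \<in> frontier B" using kl(2) by simp
      then show "y \<in> neighbours D (lattice u v) x" using neighbours_packing[OF pack x] 1 by simp
    qed
    moreover have "finite (neighbours D (lattice u v) x)"
    proof (rule finite_subset[OF _ packing_finite[OF pack, of x width]])
      show "neighbours D (lattice u v) x \<subseteq> lattice u v \<inter> cball x width"
        unfolding neighbours_eq using width(2) by (auto simp: dist_norm norm_minus_commute)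
    qed
    ultimately show ?thesis by (metis card_mono)
  qed
  then show ?thesis unfolding six_neighbour_lattice_packing_def is_lattice_iff using pack w by blast
qed

text \<open>
  Two of three pairwise non-parallel minimal vectors that are congruent modulo \<open>2L\<close> give the
  hexagon \<open>(u + v)/2, (u - v)/2\<close>. Otherwise \<open>u \<plusminus> v \<plusminus> w \<in> 2L\<close>, and expressing \<open>v\<close> in the pair
  \<open>u, w\<close> of largest determinant, with coefficients in \<open>[-1, 1]\<close>, shows that one of the vectors
  \<open>(v \<plusminus> u \<plusminus> w)/2\<close> is interior to \<open>B\<close>, hence zero.
\<close>

lemma six_neighbours_hex:
  assumes L: "six_neighbour_lattice_packing D L"
  shows "\<exists>u v. hex_pair u v \<and> wedge u v \<noteq> 0 \<and> lattice u v \<subseteq> L"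
proof -
  obtain e f where w: "wedge e f \<noteq> 0" and Leq: "L = lattice e f"
    using L by (auto simp: six_neighbour_lattice_packing_def is_lattice_iff)
  have pack: "is_packing D L" using L by (simp add: six_neighbour_lattice_packing_def)
  define \<phi> where "\<phi> = (\<lambda>(i, j). of_int i *\<^sub>R e + of_int j *\<^sub>R f :: plane)"
  have mem: "x \<in> L \<longleftrightarrow> (\<exists>i j. x = \<phi> (i, j))" for x by (auto simp: Leq lattice_def \<phi>_def)
  have comb: "of_int a *\<^sub>R x + of_int b *\<^sub>R y \<in> L" if xy: "x \<in> L" "y \<in> L" for x y and a b :: int
  proof -
    obtain i j k l where *: "x = \<phi> (i, j)" "y = \<phi> (k, l)" using xy mem by metis
    have "of_int a *\<^sub>R x + of_int b *\<^sub>R y = \<phi> (a * i + b * k, a * j + b * l)" unfolding * by (simp add: \<phi>_def algebra_simps)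
    then show ?thesis using mem by blast
  qed
  have L0: "0 \<in> L" using comb[of "\<phi> (0, 0)" "\<phi> (0, 0)" 0 0] mem by auto
  have minimal: "x = 0" if "x \<in> L" "x \<in> interior B" for x
    using pack that L0 unfolding packing_iff by (metis diff_zero)
  have sub: "lattice u v \<subseteq> L" if "u \<in> L" "v \<in> L" for u v using comb[OF that] by (auto simp: lattice_def)
  define N where "N = neighbours D L 0"
  have N: "x \<in> N \<longleftrightarrow> x \<in> L \<and> x \<in> frontier B" for x unfolding N_def using neighbours_packing[OF pack L0] by simp
  have "6 \<le> card N" using L L0 by (auto simp: N_def six_neighbour_lattice_packing_def)
  then have finN: "finite N" by (metis card.infinite not_numeral_le_zero)
  have rm: "card (S - {x, - x}) \<ge> card S - 2" if "finite S" for S :: "plane set" and x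
  proof -
    have "card S - card {x, - x} \<le> card (S - {x, - x})" using diff_card_le_card_Diff[of "{x, -x}" S] by simp
    moreover have "card {x, - x} \<le> 2" by (simp add: card_insert_if)
    ultimately show ?thesis by linarith
  qed
  have ex: "\<exists>x. x \<in> S" if "2 \<le> card S" for S :: "plane set" using that by (cases "S = {}") auto
  \<comment> \<open>Six neighbours leave a vector even after two pairs of opposite ones are removed;
    so \<open>u\<close>, \<open>v\<close>, \<open>z\<close> are pairwise non-parallel.\<close>
  obtain u where u: "u \<in> N" using ex[of N] \<open>6 \<le> card N\<close> by auto
  have c1: "card (N - {u, - u}) \<ge> 4" using rm[OF finN, of u] \<open>6 \<le> card N\<close> by linarith
  then obtain v where v: "v \<in> N - {u, - u}" using ex[of "N - {u, - u}"] by auto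
  have "card (N - {u, - u} - {v, - v}) \<ge> 2" using rm[of "N - {u, - u}" v] c1 finN by simp
  then obtain z where z: "z \<in> N - {u, - u} - {v, - v}" using ex by blast
  have nonpar: "wedge x y \<noteq> 0" if "x \<in> N" "y \<in> N" "y \<noteq> x" "y \<noteq> - x" for x y
    using frontier_parallel[of x y] that N by blast
  have half: ?thesis if xy: "x \<in> N" "y \<in> N" "wedge x y \<noteq> 0" "(1/2) *\<^sub>R (x - y) \<in> L" for x y
  proof -
    \<comment> \<open>Both are lattice vectors in \<open>B\<close> and nonzero, hence on the
      boundary, and \<open>a - b\<close> is the boundary vector \<open>y\<close>.\<close>
    define a b where "a = (1/2) *\<^sub>R (x + y)" and "b = (1/2) *\<^sub>R (x - y)"
    have ab: "a = b + y" "b \<in> L" "a - b = y" using xy by (auto simp: a_def b_def vec_eq_iff field_simps)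
    have aL: "a \<in> L" using comb[of b y 1 1] ab xy N by auto
    have B: "x \<in> B" "y \<in> B" using xy N by (auto simp: frontier_iff)
    have aB: "a \<in> B" "b \<in> B"
      using combo_B[OF B, of "1/2" "1/2"] combo_B[OF B, of "1/2" "-1/2"] by (simp_all add: a_def b_def scaleR_add_right scaleR_diff_right)
    have wab: "wedge a b = - wedge x y / 2" using wedge_commute[of y x] by (simp add: a_def b_def wedge_add)
    then have "a \<noteq> 0" "b \<noteq> 0" using xy(3) by auto
    then have "a \<in> frontier B" "b \<in> frontier B" using minimal aL ab aB by (auto simp: frontier_iff)
    then have "hex_pair a b" using ab xy N by (simp add: hex_pair_def)
    then show ?thesis using wab xy(3) sub[OF aL ab(2)] by (intro exI[of _ a] exI[of _ b]) auto
  qed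
  have core: ?thesis if N3: "x \<in> N" "y \<in> N" "t \<in> N" and wxt: "wedge x t \<noteq> 0"
    and max: "\<bar>wedge x y\<bar> \<le> \<bar>wedge x t\<bar>" "\<bar>wedge y t\<bar> \<le> \<bar>wedge x t\<bar>" and s: "(1/2) *\<^sub>R (x + y + t) \<in> L" for x y t
  proof -
    define p q where "p = wedge y t / wedge x t" and "q = wedge x y / wedge x t"
    have y: "y = p *\<^sub>R x + q *\<^sub>R t" using wedge_expansion[OF wxt, of y] by (simp add: p_def q_def)
    have pq: "\<bar>p\<bar> \<le> 1" "\<bar>q\<bar> \<le> 1" using max wxt by (auto simp: p_def q_def)
    \<comment> \<open>With the signs of \<open>p\<close> and \<open>q\<close>, each of
      \<open>\<bar>p - m\<bar>\<close> and \<open>\<bar>q - n\<bar>\<close> is at most 1, and one of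
      them is smaller because \<open>y \<noteq> 0\<close>. So \<open>r\<close> is an interior point
      of \<open>B\<close>.\<close>
    define m n :: int where "m = (if 0 \<le> p then 1 else -1)" and "n = (if 0 \<le> q then 1 else -1)"
    have mn: "m = 1 \<or> m = -1" "n = 1 \<or> n = -1" by (auto simp: m_def n_def)
    define r where "r = (1/2) *\<^sub>R (y - of_int m *\<^sub>R x - of_int n *\<^sub>R t)"
    have B: "x \<in> B" "t \<in> B" "y \<noteq> 0" using N3 N zero_interior by (auto simp: frontier_iff)
    have "r = ((p - of_int m) / 2) *\<^sub>R x + ((q - of_int n) / 2) *\<^sub>R t"
      unfolding r_def y by (simp add: vec_eq_iff field_simps)
    moreover have "\<bar>(p - of_int m) / 2\<bar> + \<bar>(q - of_int n) / 2\<bar> < 1"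
    proof -
      have "p \<noteq> 0 \<or> q \<noteq> 0" using y B by auto
      then show ?thesis using pq by (auto simp: m_def n_def field_simps)
    qed
    ultimately have rI: "r \<in> interior B" using combo_interior[OF B(1,2)] by simp
    \<comment> \<open>\<open>- 1 - m\<close> and \<open>- 1 - n\<close> are even, so
      \<open>r\<close> differs from half of \<open>x + y + t\<close> by a lattice vector.\<close>
    define i j where "i = (- 1 - m) div 2" and "j = (- 1 - n) div 2"
    have ij: "of_int i = (- 1 - of_int m :: real) / 2" "of_int j = (- 1 - of_int n :: real) / 2"
      using mn by (auto simp: i_def j_def)
    have "r = (1/2) *\<^sub>R (x + y + t) + (of_int i *\<^sub>R x + of_int j *\<^sub>R t)"
      unfolding r_def ij by (simp add: vec_eq_iff field_simps)
    moreover have "of_int i *\<^sub>R x + of_int j *\<^sub>R t \<in> L" using comb N3 N by blast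
    ultimately have "r \<in> L" using comb[OF s, of _ 1 1] by simp
    then have "r = 0" using minimal rI by blast
    then have "y - of_int m *\<^sub>R x - of_int n *\<^sub>R t = 0"
      unfolding r_def scaleR_eq_0_iff by simp
    then have y': "y = of_int m *\<^sub>R x + of_int n *\<^sub>R t" by (simp add: algebra_simps)
    let ?a = "of_int m *\<^sub>R x" and ?b = "- (of_int n *\<^sub>R t)"
    have "hex_pair ?a ?b"
    proof -
      have fr: "x \<in> frontier B" "y \<in> frontier B" "t \<in> frontier B" using N3 N by blast+
      have "?a \<in> frontier B" using mn(1) fr(1) sym_frontier[of x] by (elim disjE) simp_all
      moreover have "?b \<in> frontier B" using mn(2) fr(3) sym_frontier[of t] by (elim disjE) simp_all
      moreover have "?a - ?b = y" using y' by simp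
      ultimately show ?thesis using fr(2) unfolding hex_pair_def by simp
    qed
    moreover have "wedge ?a ?b \<noteq> 0" using mn wxt by auto
    moreover have "?a \<in> L" "?b \<in> L" using comb[of x x m 0] comb[of t t "- n" 0] N3 N by auto
    ultimately show ?thesis using sub by blast
  qed
  define par where "par = (\<lambda>x. SOME p. x = \<phi> p)"
  have par: "x = \<phi> (par x)" if "x \<in> L" for x
    unfolding par_def using that mem by (metis (mono_tags) someI)
  \<comment> \<open>The class modulo \<open>2L\<close>, encoded by the parities of the coordinates;
    the value \<open>(True, True)\<close> is the class of 0.\<close>
  define cl where "cl = (\<lambda>x. (even (fst (par x)), even (snd (par x))))"
  have phi_half: "(1/2) *\<^sub>R \<phi> (i, j) \<in> L" if "even i" "even j" for i j
  proof -
    obtain a b where "i = 2 * a" "j = 2 * b" using \<open>even i\<close> \<open>even j\<close> unfolding dvd_def by blast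
    then have "(1/2) *\<^sub>R \<phi> (i, j) = \<phi> (a, b)" by (simp add: \<phi>_def scaleR_add_right)
    then show ?thesis using mem by blast
  qed
  have cl_eq: "(1/2) *\<^sub>R (x - y) \<in> L" if xy: "x \<in> L" "y \<in> L" "cl x = cl y" for x y
  proof -
    have "x - y = \<phi> (fst (par x) - fst (par y), snd (par x) - snd (par y))"
      using par[OF xy(1)] par[OF xy(2)] by (simp add: \<phi>_def case_prod_beta algebra_simps)
    moreover have "even (fst (par x) - fst (par y))" "even (snd (par x) - snd (par y))"
      using xy(3) by (auto simp: cl_def)
    ultimately show ?thesis using phi_half by simp
  qed
  have cl_ne: "cl x \<noteq> (True, True)" if x: "x \<in> N" for x
  proof
    assume c: "cl x = (True, True)"
    have xL: "x \<in> L" using x N by blast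
    have "even (fst (par x))" "even (snd (par x))" using c by (simp_all add: cl_def)
    from phi_half[OF this] have "(1/2) *\<^sub>R x \<in> L" using par[OF xL] by simp
    moreover have "(1/2) *\<^sub>R x \<in> interior B" using x N by (intro scale_interior) (auto simp: frontier_iff)
    ultimately show False using minimal[of "(1/2) *\<^sub>R x"] x N zero_interior by (auto simp: frontier_iff)
  qed
  have uvz: "u \<in> N" "v \<in> N" "z \<in> N" using u v z by auto
  have w3: "wedge u v \<noteq> 0" "wedge u z \<noteq> 0" "wedge v z \<noteq> 0" using nonpar u v z by auto
  show ?thesis
  proof (cases "cl u = cl v \<or> cl u = cl z \<or> cl v = cl z")
    case True
    then show ?thesis using half[OF uvz(1,2) w3(1)] half[OF uvz(1,3) w3(2)] half[OF uvz(2,3) w3(3)] cl_eq uvz N by blast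
  next
    case False
    let ?i = "fst (par u) + fst (par v) + fst (par z)" and ?j = "snd (par u) + snd (par v) + snd (par z)"
    \<comment> \<open>Three distinct nonzero classes modulo \<open>2L\<close> are all the nonzero
      classes, and their sum is zero.\<close>
    have "even ?i \<and> even ?j"
      using False cl_ne[OF uvz(1)] cl_ne[OF uvz(2)] cl_ne[OF uvz(3)] by (auto simp: cl_def)
    moreover have "u + v + z = \<phi> (?i, ?j)"
      using par[of u] par[of v] par[of z] uvz N by (simp add: \<phi>_def case_prod_beta algebra_simps)
    ultimately have s: "(1/2) *\<^sub>R (u + v + z) \<in> L" using phi_half by simp
    consider "\<bar>wedge u v\<bar> \<le> \<bar>wedge u z\<bar>" "\<bar>wedge v z\<bar> \<le> \<bar>wedge u z\<bar>"
      | "\<bar>wedge u z\<bar> \<le> \<bar>wedge u v\<bar>" "\<bar>wedge z v\<bar> \<le> \<bar>wedge u v\<bar>"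
      | "\<bar>wedge v u\<bar> \<le> \<bar>wedge v z\<bar>" "\<bar>wedge u z\<bar> \<le> \<bar>wedge v z\<bar>"
      using wedge_commute[of v z] wedge_commute[of u v] by fastforce
    then show ?thesis
    proof cases
      case 1 then show ?thesis using core[OF uvz(1,2,3) w3(2)] s by simp
    next
      case 2 then show ?thesis using core[OF uvz(1,3,2) w3(1)] s by (simp add: add_ac)
    next
      case 3 then show ?thesis using core[OF uvz(2,1,3) w3(3)] s by (simp add: add_ac)
    qed
  qed
qed

abbreviation "d0 \<equiv> thinnest_density D"

lemma thinnest_le_hex: assumes "hex_pair u v" "wedge u v \<noteq> 0" shows "d0 \<le> measure lebesgue D / \<bar>wedge u v\<bar>"
  unfolding thinnest_density_def
proof (rule cInf_lower)
  show "measure lebesgue D / \<bar>wedge u v\<bar> \<in> {d. \<exists>L. six_neighbour_lattice_packing D L \<and> (disc_density D L \<longlongrightarrow> d) at_top}"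
    using hex_lattice_six[OF assms] lattice_density[OF assms(2)] by blast
  have "0 \<le> d" if "(disc_density D L \<longlongrightarrow> d) at_top" for d L
    using tendsto_lowerbound[OF that, of 0] by (simp add: disc_density_def)
  then show "bdd_below {d. \<exists>L. six_neighbour_lattice_packing D L \<and> (disc_density D L \<longlongrightarrow> d) at_top}"
    by (intro bdd_belowI[of _ 0]) auto
qed

text \<open>A six-neighbour lattice contains the lattice of a hexagonal pair, hence is at least as
  dense, and the density of the latter is the area of \<open>D\<close> over the determinant.\<close>

lemma le_thinnest:
  assumes t: "0 < t" "\<And>u v. hex_pair u v \<Longrightarrow> \<bar>wedge u v\<bar> \<le> t" shows "measure lebesgue D / t \<le> d0"
  unfolding thinnest_density_def
proof (rule cInf_greatest)
  obtain u v where "hex_pair u v" "wedge u v \<noteq> 0" using hex_pair_exists by blast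
  then show "{d. \<exists>L. six_neighbour_lattice_packing D L \<and> (disc_density D L \<longlongrightarrow> d) at_top} \<noteq> {}"
    using hex_lattice_six lattice_density by blast
next
  fix d assume "d \<in> {d. \<exists>L. six_neighbour_lattice_packing D L \<and> (disc_density D L \<longlongrightarrow> d) at_top}"
  then obtain L where L: "six_neighbour_lattice_packing D L" "(disc_density D L \<longlongrightarrow> d) at_top" by blast
  then obtain u v where uv: "hex_pair u v" "wedge u v \<noteq> 0" "lattice u v \<subseteq> L" using six_neighbours_hex by blast
  have "is_packing D L" using L by (simp add: six_neighbour_lattice_packing_def)
  then have "disc_density D (lattice u v) R \<le> disc_density D L R" for R
    unfolding disc_density_def num_points_def using uv(3) packing_finite
    by (intro divide_right_mono mult_right_mono) (auto intro!: card_mono)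
  then have "measure lebesgue D / \<bar>wedge u v\<bar> \<le> d"
    using tendsto_le[OF _ L(2) lattice_density[OF uv(2)]] by auto
  moreover have "measure lebesgue D / t \<le> measure lebesgue D / \<bar>wedge u v\<bar>"
    using t(2)[OF uv(1)] uv(2) t(1) area_pos by (intro divide_left_mono) auto
  ultimately show "measure lebesgue D / t \<le> d" by linarith
qed

text \<open>By \<open>hex_le_Delta\<close> and \<open>Delta_le\<close> this is the least upper bound
  of the determinants of hexagonal pairs. Defining it by the density avoids the choice of a pair
  that attains it.\<close>

definition \<Delta> where "\<Delta> = measure lebesgue D / d0"

lemma thinnest_pos: "0 < d0"
proof -
  have "\<bar>wedge u v\<bar> \<le> M + 1" if "hex_pair u v" for u v
  proof -
    have "u \<in> B" "v \<in> B" using that by (auto simp: hex_pair_def frontier_iff)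
    then show ?thesis using wedge_triple_le[of u v 0] zero_B by simp
  qed
  moreover have "0 < M + 1" using M_eq area_pos by simp
  ultimately show ?thesis using le_thinnest[of "M + 1"] area_pos by (meson divide_pos_pos less_le_trans)
qed

lemma hex_le_Delta: "hex_pair u v \<Longrightarrow> \<bar>wedge u v\<bar> \<le> \<Delta>"
  using thinnest_le_hex[of u v] thinnest_pos area_pos
  by (cases "wedge u v = 0") (auto simp: \<Delta>_def field_simps)

lemma Delta_pos: "0 < \<Delta>" using thinnest_pos area_pos by (simp add: \<Delta>_def)

lemma Delta_le: assumes "\<And>u v. hex_pair u v \<Longrightarrow> \<bar>wedge u v\<bar> \<le> t" shows "\<Delta> \<le> t"
proof -
  obtain u v where "hex_pair u v" "wedge u v \<noteq> 0" using hex_pair_exists by blast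
  then have "0 < t" using assms[of u v] by auto
  then show ?thesis using le_thinnest[of t] assms thinnest_pos by (simp add: \<Delta>_def field_simps)
qed

text \<open>By \<open>wedge_hex_le\<close> no hexagonal pair has a determinant above half of
  \<open>M - \<bar>wedge u v\<bar>\<close>, and \<Delta> is the least such bound.\<close>

lemma wedge_le_M_Delta: assumes "u \<in> B" "v \<in> B" shows "\<bar>wedge u v\<bar> \<le> M - 2 * \<Delta>"
  using Delta_le[of "(M - \<bar>wedge u v\<bar>) / 2"] wedge_hex_le[OF _ assms] by fastforce

text \<open>\<open>wedge_hex_le\<close> with the pair itself in the place of \<open>u\<close> and
  \<open>v\<close>.\<close>

lemma Delta_ineq: "3 * \<Delta> \<le> M"
proof -
  have "\<bar>wedge u v\<bar> \<le> M / 3" if h: "hex_pair u v" for u v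
  proof -
    have "u \<in> B" "v \<in> B" using h by (auto simp: hex_pair_def frontier_iff)
    then show ?thesis using wedge_hex_le[OF h, of u v] by simp
  qed
  then show ?thesis using Delta_le[of "M / 3"] by simp
qed

lemma thinnest_le_1: "d0 \<le> 1"
proof -
  obtain u v where uv: "hex_pair u v" "wedge u v \<noteq> 0" using hex_pair_exists by blast
  have pack: "is_packing D (lattice u v)" using hex_lattice_six[OF uv] by (simp add: six_neighbour_lattice_packing_def)
  have "((\<lambda>R. (1 + width / R)\<^sup>2) \<longlongrightarrow> (1 + 0)\<^sup>2) at_top"
    by (intro tendsto_intros tendsto_divide_0[OF tendsto_const] filterlim_at_top_imp_at_infinity filterlim_ident)
  moreover have "\<forall>\<^sub>F R in at_top. disc_density D (lattice u v) R \<le> (1 + width / R)\<^sup>2"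
    using eventually_gt_at_top[of 0]
  proof eventually_elim
    case (elim R)
    have "disc_density D (lattice u v) R \<le> pi * (R + width)\<^sup>2 / (pi * R\<^sup>2)"
      unfolding disc_density_def num_points_def using packing_count[OF pack, of R] elim by (intro divide_right_mono) auto
    also have "\<dots> = (1 + width / R)\<^sup>2" using elim by (simp add: power_divide[symmetric] add_divide_distrib)
    finally show ?case .
  qed
  ultimately have "measure lebesgue D / \<bar>wedge u v\<bar> \<le> (1 + 0)\<^sup>2"
    using tendsto_le[OF _ _ lattice_density[OF uv(2)]] by auto
  then show ?thesis using thinnest_le_hex[OF uv] by simp
qed

end

section \<open>The asymptotic lower bounds\<close>

context centered_body
begin

lemma degree_bound:
  obtains K where "0 \<le> K" "\<And>X x. is_packing D X \<Longrightarrow> real (card (neighbours D X x)) \<le> K"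
proof -
  let ?K = "pi * (width + width)\<^sup>2 / measure lebesgue D"
  have "real (card (neighbours D X x)) \<le> ?K" if X: "is_packing D X" for X x
  proof -
    have "neighbours D X x \<subseteq> X \<inter> cball x width"
      unfolding neighbours_eq using width(2) by (auto simp: dist_norm norm_minus_commute)
    then have "finite (neighbours D X x)" "neighbours D X x \<subseteq> X" and near: "\<And>y. y \<in> neighbours D X x \<Longrightarrow> dist y x \<le> width"
      using finite_subset[OF _ packing_finite[OF X, of x width]] by (auto simp: dist_commute)
    then have "card (neighbours D X x) * measure lebesgue D \<le> measure lebesgue (cball x (width + width))"
      using packing_card_le[OF X, of "neighbours D X x" "cball x (width + width)"] by (auto simp: cball_subset_cball_iff)
    then show ?thesis using area_pos width_nonneg by (simp add: measure_disc field_simps)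
  qed
  moreover have "0 \<le> ?K" using area_pos by simp
  ultimately show ?thesis using that by blast
qed

text \<open>The four hypotheses say that the line \<alpha> + \<beta> k is above the area bounds for
  k-gons. The counting of faces applies with \<open>width\<close> as the bound for edge lengths and
  with a generic slant, which exists because a packing is countable.\<close>

lemma small_faces_inequality:
  fixes \<alpha> \<beta> :: real
  assumes X: "packing_with_small_faces D X"
    and three: "\<Delta> / 2 \<le> \<alpha> + 3 * \<beta>" and four: "M - 2 * \<Delta> \<le> \<alpha> + 4 * \<beta>"
    and five: "M - \<Delta> \<le> \<alpha> + 5 * \<beta>" and six: "M \<le> \<alpha> + 6 * \<beta>"
    and \<alpha>: "\<alpha> \<le> 0" and \<beta>: "0 \<le> \<beta>"
  shows "is_packing D X"
    and "pi * (max 0 (R - 14 * width))\<^sup>2 \<le>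
      \<alpha> * ((\<Sum>x\<in>X \<inter> cball 0 (R - 15 * width). real (card (neighbours D X x))) / 2 - num_points X R)
      + \<beta> * (\<Sum>x\<in>X \<inter> cball 0 R. real (card (neighbours D X x)))"
proof -
  let ?E = "packing_edges D X"
  obtain F where pack: "is_packing D X" and F: "convex_subdivision X ?E F"
    "\<And>P. P \<in> F \<Longrightarrow> finite (sides ?E P) \<and> card (sides ?E P) \<le> 6"
    using X unfolding packing_with_small_faces_def by blast
  show "is_packing D X" by (rule pack)
  have fin: "finite (X \<inter> cball z r)" for z r by (rule packing_finite[OF pack])
  have "X = (\<Union>n. X \<inter> cball 0 (real n))" using real_arch_simple by auto
  moreover have "countable (\<Union>n. X \<inter> cball 0 (real n))" using fin by (intro countable_UN) (auto intro: countable_finite)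
  ultimately have "countable X" by simp
  then obtain t0 where t0: "inj_on (slanted t0) X" using exists_injective_slanted by blast
  have edge: "x \<in> X \<and> y \<in> neighbours D X x" if "closed_segment x y \<in> ?E" for x y
  proof -
    obtain x' y' where xy: "closed_segment x y = closed_segment x' y'" "x' \<in> X" "y' \<in> neighbours D X x'"
      using \<open>closed_segment x y \<in> ?E\<close> unfolding packing_edges_def by blast
    then have "{x, y} = {x', y'}" using closed_segment_eq by blast
    then consider "x = x'" "y = y'" | "x = y'" "y = x'" by (auto simp: doubleton_eq_iff)
    then show ?thesis
    proof cases
      case 2
      then show ?thesis using xy(2,3) sym_B unfolding neighbours_eq by (metis (mono_tags, lifting) mem_Collect_eq minus_diff_eq)
    qed (use xy in auto)
  qed
  have len: "dist x y \<le> width" if "closed_segment x y \<in> ?E" for x y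
    using edge[OF that] width(2)[of "y - x"] by (simp add: neighbours_eq dist_norm norm_minus_commute)
  interpret S: subdivision X ?E F width t0
    by unfold_locales (fact F(1), fact fin, fact len, fact F(2), fact t0)
  have adj: "S.adj x y \<longleftrightarrow> x \<in> X \<and> y \<in> neighbours D X x" for x y
  proof
    assume "S.adj x y"
    then show "x \<in> X \<and> y \<in> neighbours D X x" using edge unfolding S.adj_def by blast
  next
    assume a: "x \<in> X \<and> y \<in> neighbours D X x"
    then have "closed_segment x y \<in> ?E" unfolding packing_edges_def by blast
    then show "S.adj x y" using a unfolding S.adj_def neighbours_eq by auto
  qed
  have area: "measure lebesgue P \<le> \<alpha> + \<beta> * card (S.arcs P)" if P: "P \<in> F" for P
  proof -
    interpret pf: polygon_face P "S.arcs P" "slanted t0" by (rule S.face_arcs(1)[OF P])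
    obtain us where us: "length us = card (S.arcs P)" "sum_list us = 0"
      "\<And>u. u \<in> set us \<Longrightarrow> \<exists>(x, y)\<in>S.arcs P. u = y - x \<or> u = x - y" "measure lebesgue P \<le> fan_sum 0 us / 2"
      using pf.face_area by blast
    have "set us \<subseteq> frontier B"
    proof
      fix u assume "u \<in> set us"
      then obtain x y where xy: "(x, y) \<in> S.arcs P" "u = y - x \<or> u = x - y" using us(3) by blast
      then have "S.adj x y" by (simp add: S.arcs_def S.rights_def)
      then have "y - x \<in> frontier B" using adj neighbours_packing[OF pack, of x] by simp
      then show "u \<in> frontier B" using xy(2) sym_frontier[of "y - x"] by auto
    qed
    note le = fan_sum_le[OF this us(2) hex_le_Delta wedge_le_M_Delta]
    have pos: "0 < measure lebesgue P"
      using pf.interior_P negligible_convex_interior[OF pf.convex_P] negligible_iff_measure[of P]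
        lmeasurable_compact[OF pf.compact_P] by (simp add: less_le)
    have "length us \<le> 6" using us(1) S.face_arcs(2)[OF P] by simp
    then consider "length us \<le> 2" | "length us = 3" | "length us = 4" | "length us = 5" | "length us = 6" by linarith
    then have "fan_sum 0 us / 2 \<le> \<alpha> + \<beta> * length us"
    proof cases
      \<comment> \<open>Two edge vectors enclose no area, whereas a face has positive area.\<close>
      case 1
      then show ?thesis using le(1) us(4) pos by simp
    next
      case 2
      then show ?thesis using le(2) three by (simp add: mult.commute)
    next
      case 3
      then show ?thesis using le(3) four by (simp add: mult.commute)
    next
      case 4
      then show ?thesis using le(4) five by (simp add: mult.commute)
    next
      case 5
      then show ?thesis using le(5) six by (simp add: mult.commute)
    qed
    then show ?thesis using us(1,4) by simp
  qed
  have deg: "real (S.deg_sum r) = (\<Sum>x\<in>X \<inter> cball 0 r. real (card (neighbours D X x)))" for r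
  proof -
    have "{y. S.adj x y} = neighbours D X x" if "x \<in> X" for x using adj that by auto
    then show ?thesis unfolding S.deg_sum_def by (simp add: of_nat_sum)
  qed
  \<comment> \<open>A disc of negative radius is empty, whence the maximum with 0.\<close>
  have "pi * (max 0 (R - 14 * width))\<^sup>2 = measure lebesgue (cball (0::plane) (R - 14 * width))"
    by (cases "0 \<le> R - 14 * width") (simp_all add: measure_disc)
  then show "pi * (max 0 (R - 14 * width))\<^sup>2 \<le>
      \<alpha> * ((\<Sum>x\<in>X \<inter> cball 0 (R - 15 * width). real (card (neighbours D X x))) / 2 - num_points X R)
      + \<beta> * (\<Sum>x\<in>X \<inter> cball 0 R. real (card (neighbours D X x)))"
    using S.area_inequality[OF area \<alpha> \<beta> width_nonneg, of R] deg by (simp add: num_points_def)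
qed

text \<open>Divided by the area of the disc, the inequality bounds the product of the density and
  \<open>\<kappa>\<close> of the mean degree below by the area of \<open>D\<close>, with an error of
  order 1/R. The change of radius in the degree sum costs O(R) only, since degrees are bounded and
  the annulus is thin.\<close>

lemma small_faces_bound:
  fixes \<alpha> \<beta> :: real
  assumes X: "packing_with_small_faces D X"
    and faces: "\<Delta> / 2 \<le> \<alpha> + 3 * \<beta>" "M - 2 * \<Delta> \<le> \<alpha> + 4 * \<beta>" "M - \<Delta> \<le> \<alpha> + 5 * \<beta>" "M \<le> \<alpha> + 6 * \<beta>"
    and \<alpha>: "\<alpha> \<le> 0" and \<beta>: "0 \<le> \<beta>"
  shows "asymptotic_lower_bound D X l (measure lebesgue D / (\<alpha> * (l / 2 - 1) + \<beta> * l))"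
  unfolding asymptotic_lower_bound_def
proof (intro allI impI)
  fix R :: "nat \<Rightarrow> real"
  assume R: "filterlim R at_top sequentially" and l: "(\<lambda>j. avg_neighbours D X (R j)) \<longlonglongrightarrow> l"
  note pack = small_faces_inequality(1)[OF X faces \<alpha> \<beta>]
  define A where "A = measure lebesgue D"
  have A: "A > 0" using area_pos by (simp add: A_def)
  obtain K where K: "0 \<le> K" "\<And>x. real (card (neighbours D X x)) \<le> K" using degree_bound pack by metis
  define w where "w = width"
  have w: "0 \<le> w" using width_nonneg by (simp add: w_def)
  define S where "S = (\<lambda>r. \<Sum>x\<in>X \<inter> cball 0 r. real (card (neighbours D X x)))"
  define N where "N = (\<lambda>r. real (num_points X r))"
  define C where "C = (- \<alpha>) * K / 2 * (34 * pi * w / A)"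
  have fin: "finite (X \<inter> cball z r)" for z r by (rule packing_finite[OF pack])
  \<comment> \<open>The area available per point: with mean degree x, a point accounts for x / 2 - 1
    faces and x sides of faces.\<close>
  define \<kappa> where "\<kappa> = (\<lambda>x. \<alpha> * (x / 2 - 1) + \<beta> * x)"
  have SN: "S r = avg_neighbours D X r * N r" for r
    using fin[of 0 r] by (cases "X \<inter> cball 0 r = {}") (auto simp: avg_neighbours_def N_def num_points_def S_def)
  have ineq: "pi * (r - 14 * w)\<^sup>2 \<le> N r * \<kappa> (avg_neighbours D X r) + C * r" if r: "16 * w \<le> r" for r
  proof -
    have r0: "0 \<le> r" "15 * w + w \<le> r" using r w by auto
    have ann: "(N r - N (r - 15 * w)) * A \<le> pi * ((r + w)\<^sup>2 - (r - 15 * w - w)\<^sup>2)"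
      using packing_annulus[OF pack, of "15 * w" r] r0 w by (simp add: N_def num_points_def A_def w_def)
    also have "(r + w)\<^sup>2 - (r - 15 * w - w)\<^sup>2 = 17 * w * (2 * r - 15 * w)" by (simp add: power2_eq_square algebra_simps)
    also have "pi * (17 * w * (2 * r - 15 * w)) \<le> pi * (17 * w * (2 * r))" using w by (intro mult_left_mono) auto
    finally have dN: "N r - N (r - 15 * w) \<le> 34 * pi * w / A * r" using A by (simp add: field_simps)
    have "S r \<le> S (r - 15 * w) + K * (N r - N (r - 15 * w))"
    proof -
      let ?V = "X \<inter> cball 0 r" and ?V' = "X \<inter> cball 0 (r - 15 * w)"
      have sub: "?V' \<subseteq> ?V" using w by auto
      have "S r = S (r - 15 * w) + (\<Sum>x\<in>?V - ?V'. real (card (neighbours D X x)))"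
        unfolding S_def using sum.subset_diff[OF sub fin] by (simp add: add.commute)
      also have "(\<Sum>x\<in>?V - ?V'. real (card (neighbours D X x))) \<le> real (card (?V - ?V')) * K"
        using K(2) by (intro sum_bounded_above)
      also have "real (card (?V - ?V')) = N r - N (r - 15 * w)"
        unfolding N_def num_points_def using sub fin card_mono[OF fin sub] by (simp add: card_Diff_subset of_nat_diff)
      finally show ?thesis by (simp add: mult.commute)
    qed
    also have "K * (N r - N (r - 15 * w)) \<le> K * (34 * pi * w / A * r)" using dN K by (intro mult_left_mono)
    finally have SS: "S r - K * (34 * pi * w / A * r) \<le> S (r - 15 * w)" by simp
    have "pi * (r - 14 * w)\<^sup>2 = pi * (max 0 (r - 14 * w))\<^sup>2" using r w by (simp add: max_def)
    also have "\<dots> \<le> \<alpha> * (S (r - 15 * w) / 2 - N r) + \<beta> * S r"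
      using small_faces_inequality(2)[OF X faces \<alpha> \<beta>, of r] by (simp add: S_def N_def w_def)
    also have "\<alpha> * (S (r - 15 * w) / 2 - N r) \<le> \<alpha> * ((S r - K * (34 * pi * w / A * r)) / 2 - N r)"
      using SS \<alpha> by (intro mult_left_mono_neg) auto
    also have "\<alpha> * ((S r - K * (34 * pi * w / A * r)) / 2 - N r) + \<beta> * S r = N r * \<kappa> (avg_neighbours D X r) + C * r"
      unfolding SN \<kappa>_def C_def using A by (simp add: field_simps)
    finally show ?thesis by simp
  qed
  define d where "d = (\<lambda>j. disc_density D X (R j))"
  define k where "k = (\<lambda>j. \<kappa> (avg_neighbours D X (R j)))"
  define low where "low = (\<lambda>j. A * (1 - 14 * w / R j)\<^sup>2 - C * A / pi / R j)"
  have ev: "\<forall>\<^sub>F j in sequentially. 16 * w + 1 \<le> R j" using R by (auto simp: filterlim_at_top)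
  have inv: "(\<lambda>j. c / R j) \<longlonglongrightarrow> 0" for c
    by (intro tendsto_divide_0[OF tendsto_const] filterlim_at_top_imp_at_infinity R)
  have low_lim: "low \<longlonglongrightarrow> A"
  proof -
    have "low \<longlonglongrightarrow> A * (1 - 0)\<^sup>2 - 0" unfolding low_def by (intro tendsto_intros inv)
    then show ?thesis by simp
  qed
  have k_lim: "k \<longlonglongrightarrow> \<kappa> l" unfolding k_def \<kappa>_def by (intro tendsto_intros l) auto
  have low_le: "\<forall>\<^sub>F j in sequentially. low j \<le> d j * k j"
    using ev
  proof eventually_elim
    case (elim j)
    then have Rj: "R j > 0" "16 * w \<le> R j" using w by auto
    have "A / (pi * (R j)\<^sup>2) * (pi * (R j - 14 * w)\<^sup>2) \<le> A / (pi * (R j)\<^sup>2) * (N (R j) * k j + C * R j)"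
      unfolding k_def using ineq[OF Rj(2)] A by (intro mult_left_mono) auto
    moreover have "A / (pi * (R j)\<^sup>2) * (pi * (R j - 14 * w)\<^sup>2) = A * (1 - 14 * w / R j)\<^sup>2"
    proof -
      have "(R j - 14 * w)\<^sup>2 = (R j)\<^sup>2 * (1 - 14 * w / R j)\<^sup>2"
        using Rj by (simp add: power_mult_distrib[symmetric] right_diff_distrib)
      then show ?thesis using Rj by simp
    qed
    moreover have "A / (pi * (R j)\<^sup>2) * (N (R j) * k j + C * R j) = d j * k j + C * A / pi / R j"
      using Rj by (simp add: d_def disc_density_def N_def A_def field_simps power2_eq_square)
    ultimately show ?case by (simp add: low_def)
  qed
  have d_le: "\<forall>\<^sub>F j in sequentially. d j \<le> (1 + w / R j)\<^sup>2"
    using ev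
  proof eventually_elim
    case (elim j)
    then have Rj: "R j > 0" using w by auto
    have "d j \<le> pi * (R j + w)\<^sup>2 / (pi * (R j)\<^sup>2)"
      unfolding d_def disc_density_def num_points_def w_def using packing_count[OF pack, of "R j"] Rj by (intro divide_right_mono) auto
    also have "\<dots> = (1 + w / R j)\<^sup>2" using Rj by (simp add: power_divide[symmetric] add_divide_distrib)
    finally show ?case .
  qed
  have d_nonneg: "0 \<le> d j" for j by (simp add: d_def disc_density_def)
  \<comment> \<open>The limit of \<open>\<kappa>\<close> must be known to be positive before
    dividing by it. As densities are asymptotically at most 1, a nonpositive limit would force the
    positive area \<open>A\<close> to be at most 0.\<close>
  have "A \<le> (1 + 0)\<^sup>2 * max 0 (\<kappa> l)"
  proof (rule tendsto_le[OF _ _ low_lim])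
    show "(\<lambda>j. (1 + w / R j)\<^sup>2 * max 0 (k j)) \<longlonglongrightarrow> (1 + 0)\<^sup>2 * max 0 (\<kappa> l)"
      by (intro tendsto_intros inv k_lim)
    show "\<forall>\<^sub>F j in sequentially. low j \<le> (1 + w / R j)\<^sup>2 * max 0 (k j)"
      using low_le d_le
    proof eventually_elim
      case (elim j)
      have "d j * k j \<le> d j * max 0 (k j)" using d_nonneg by (intro mult_left_mono) auto
      also have "\<dots> \<le> (1 + w / R j)\<^sup>2 * max 0 (k j)" using elim by (intro mult_right_mono) auto
      finally show ?case using elim by simp
    qed
  qed auto
  then have \<kappa>_pos: "\<kappa> l > 0" using A by (auto simp: max_def split: if_splits)
  have "\<forall>\<^sub>F j in sequentially. k j > 0" using order_tendstoD(1)[OF k_lim \<kappa>_pos] .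
  with low_le have "\<forall>\<^sub>F j in sequentially. ereal (low j / k j) \<le> ereal (d j)"
    by eventually_elim (simp add: field_simps)
  then have "liminf (\<lambda>j. ereal (low j / k j)) \<le> liminf (\<lambda>j. ereal (d j))" by (rule Liminf_mono)
  moreover have "(\<lambda>j. ereal (low j / k j)) \<longlonglongrightarrow> ereal (A / \<kappa> l)"
    using \<kappa>_pos by (intro tendsto_ereal tendsto_divide low_lim k_lim) auto
  then have "liminf (\<lambda>j. ereal (low j / k j)) = ereal (A / \<kappa> l)" by (intro lim_imp_Liminf) auto
  ultimately show "ereal (measure lebesgue D / (\<alpha> * (l / 2 - 1) + \<beta> * l)) \<le> liminf (\<lambda>j. ereal (disc_density D X (R j)))"
    by (simp add: A_def \<kappa>_def d_def)
qed

lemma Delta_d0: "\<Delta> * d0 = measure lebesgue D" "M = 4 * (\<Delta> * d0)"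
  using thinnest_pos M_eq by (simp_all add: \<Delta>_def)

text \<open>The line through the bounds for triangles and quadrangles. It is above those for
  pentagons and hexagons exactly if \<open>7 / 2 * \<Delta> \<le> M\<close>, which is the hypothesis
  on \<open>d0\<close>.\<close>

lemma small_faces_bound_i:
  assumes X: "packing_with_small_faces D X" and d: "7 / 8 \<le> d0"
  shows "asymptotic_lower_bound D X l (bound_i d0 l)"
proof -
  have M: "7 / 2 * \<Delta> \<le> M" unfolding Delta_d0(2) using d Delta_pos by (simp add: mult.commute)
  let ?\<beta> = "M - 5 / 2 * \<Delta>"
  let ?\<alpha> = "\<Delta> / 2 - 3 * ?\<beta>"
  have "asymptotic_lower_bound D X l (measure lebesgue D / (?\<alpha> * (l / 2 - 1) + ?\<beta> * l))"
    using M Delta_pos by (intro small_faces_bound[OF X]) (simp_all add: algebra_simps)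
  moreover have "?\<alpha> * (l / 2 - 1) + ?\<beta> * l = \<Delta> * (2 * d0 * (6 - l) + (3 / 2 * l - 8))"
    unfolding Delta_d0(2) by (simp add: algebra_simps)
  then have "measure lebesgue D / (?\<alpha> * (l / 2 - 1) + ?\<beta> * l) = bound_i d0 l"
    using Delta_pos unfolding bound_i_def Delta_d0(1)[symmetric] by simp
  ultimately show ?thesis by simp
qed

text \<open>The line of slope \<Delta> on which the bounds for 4, 5 and 6 sides lie; it passes above
  that for triangles if \<open>7 / 2 * \<Delta> \<le> M\<close>. That \<alpha> is nonpositive
  amounts here to a consequence of \<open>d0 \<le> 1\<close>.\<close>

lemma small_faces_bound_ii:
  assumes X: "packing_with_small_faces D X" and d: "7 / 8 \<le> d0"
  shows "asymptotic_lower_bound D X l (bound_ii d0 l)"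
proof -
  have M: "7 / 2 * \<Delta> \<le> M" unfolding Delta_d0(2) using d Delta_pos by (simp add: mult.commute)
  have M': "M \<le> 4 * \<Delta>" unfolding Delta_d0(2) using thinnest_le_1 Delta_pos by simp
  let ?\<beta> = "\<Delta>"
  let ?\<alpha> = "M - 6 * \<Delta>"
  have "asymptotic_lower_bound D X l (measure lebesgue D / (?\<alpha> * (l / 2 - 1) + ?\<beta> * l))"
    using M M' Delta_pos by (intro small_faces_bound[OF X]) (simp_all add: algebra_simps)
  moreover have "?\<alpha> * (l / 2 - 1) + ?\<beta> * l = \<Delta> * (2 * d0 * (l - 2) + 6 - 2 * l)"
    unfolding Delta_d0(2) by (simp add: algebra_simps)
  then have "measure lebesgue D / (?\<alpha> * (l / 2 - 1) + ?\<beta> * l) = bound_ii d0 l"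
    using Delta_pos unfolding bound_ii_def Delta_d0(1)[symmetric] by simp
  ultimately show ?thesis by simp
qed

text \<open>The line through the bounds for triangles and hexagons. The values over 4 and 5 are
  below it exactly if \<open>M \<le> 7 / 2 * \<Delta>\<close>.\<close>

lemma small_faces_bound_iii:
  assumes X: "packing_with_small_faces D X" and d: "d0 \<le> 7 / 8"
  shows "asymptotic_lower_bound D X l (bound_iii d0 l)"
proof -
  have M: "M \<le> 7 / 2 * \<Delta>" unfolding Delta_d0(2) using d Delta_pos by (simp add: mult.commute)
  let ?\<beta> = "(M - \<Delta> / 2) / 3"
  let ?\<alpha> = "\<Delta> / 2 - 3 * ?\<beta>"
  have "asymptotic_lower_bound D X l (measure lebesgue D / (?\<alpha> * (l / 2 - 1) + ?\<beta> * l))"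
    using M Delta_pos Delta_ineq by (intro small_faces_bound[OF X]) (simp_all add: field_simps)
  moreover have "?\<alpha> * (l / 2 - 1) + ?\<beta> * l = \<Delta> * (2 / 3 * d0 * (6 - l) + 1 / 3 * (l - 3))"
    unfolding Delta_d0(2) by (simp add: field_simps)
  then have "measure lebesgue D / (?\<alpha> * (l / 2 - 1) + ?\<beta> * l) = bound_iii d0 l"
    using Delta_pos unfolding bound_iii_def Delta_d0(1)[symmetric] by simp
  ultimately show ?thesis by simp
qed

end

section \<open>The special hexagon in normal form\<close>

lemma frame_image_B:
  fixes c :: plane
  shows "(\<lambda>d. 2 *\<^sub>R (d - c)) ` (\<lambda>z. c + frame e f z) ` S = frame e f ` ((*\<^sub>R) 2 ` S)"
  by (simp add: image_image linear_scale[OF linear_frame])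

text \<open>The hexagon with vertices (1, 0), (r, 1), (-r, 1) and their negatives: the diagonal has
  length 2 and the sides parallel to it have length 2 r.\<close>

definition std_hexagon :: "real \<Rightarrow> plane set" where
  "std_hexagon r = {z. \<bar>z$2\<bar> \<le> 1 \<and> \<bar>z$1\<bar> + (1 - r) * \<bar>z$2\<bar> \<le> 1}"

text \<open>The gauge function of the standard hexagon; translates at distance 2 in it
  touch.\<close>

definition hnorm :: "real \<Rightarrow> plane \<Rightarrow> real" where
  "hnorm r z = max \<bar>z$2\<bar> (\<bar>z$1\<bar> + (1 - r) * \<bar>z$2\<bar>)"

lemma std_hexagon_hnorm: "std_hexagon r = {z. hnorm r z \<le> 1}"
  by (auto simp: std_hexagon_def hnorm_def)

lemma hnorm_scale: "hnorm r (t *\<^sub>R z) = \<bar>t\<bar> * hnorm r z"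
  by (simp add: hnorm_def abs_mult max_mult_distrib_left distrib_left mult.left_commute)

lemma double_std_hexagon: "(*\<^sub>R) 2 ` std_hexagon r = {z. hnorm r z \<le> 2}"
proof
  show "(*\<^sub>R) 2 ` std_hexagon r \<subseteq> {z. hnorm r z \<le> 2}" by (auto simp: std_hexagon_hnorm hnorm_scale)
  show "{z. hnorm r z \<le> 2} \<subseteq> (*\<^sub>R) 2 ` std_hexagon r"
  proof
    fix z assume "z \<in> {z. hnorm r z \<le> 2}"
    then have "(1/2) *\<^sub>R z \<in> std_hexagon r" by (simp add: std_hexagon_hnorm hnorm_scale)
    then show "z \<in> (*\<^sub>R) 2 ` std_hexagon r" by (intro image_eqI[of _ _ "(1/2) *\<^sub>R z"]) auto
  qed
qed

lemma convex_std_hexagon: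
  assumes "r \<le> 1" shows "convex (std_hexagon r)"
proof (rule convexI)
  fix x y :: plane and u v :: real
  assume xy: "x \<in> std_hexagon r" "y \<in> std_hexagon r" and uv: "0 \<le> u" "0 \<le> v" "u + v = 1"
  have 1: "\<bar>u * p + v * q\<bar> \<le> u * \<bar>p\<bar> + v * \<bar>q\<bar>" for p q :: real
    using uv abs_triangle_ineq[of "u * p" "v * q"] by (simp add: abs_mult)
  have "u * \<bar>x$2\<bar> + v * \<bar>y$2\<bar> \<le> u * 1 + v * 1" using xy uv by (intro add_mono mult_left_mono) (auto simp: std_hexagon_def)
  then have a: "\<bar>u * x$2 + v * y$2\<bar> \<le> 1" using 1[of "x$2" "y$2"] uv by simp
  have "u * (\<bar>x$1\<bar> + (1 - r) * \<bar>x$2\<bar>) + v * (\<bar>y$1\<bar> + (1 - r) * \<bar>y$2\<bar>) \<le> u * 1 + v * 1"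
    using xy uv by (intro add_mono mult_left_mono) (auto simp: std_hexagon_def)
  moreover have "(1 - r) * \<bar>u * x$2 + v * y$2\<bar> \<le> (1 - r) * (u * \<bar>x$2\<bar> + v * \<bar>y$2\<bar>)"
    using 1 assms by (intro mult_left_mono) auto
  ultimately have "\<bar>u * x$1 + v * y$1\<bar> + (1 - r) * \<bar>u * x$2 + v * y$2\<bar> \<le> 1"
    using 1[of "x$1" "y$1"] uv(3) by (simp add: algebra_simps)
  then show "u *\<^sub>R x + v *\<^sub>R y \<in> std_hexagon r" using a by (simp add: std_hexagon_def)
qed

lemma continuous_hnorm: "continuous_on UNIV (hnorm r)"
  unfolding hnorm_def by (intro continuous_intros)

lemma compact_std_hexagon: assumes "r \<le> 1" shows "compact (std_hexagon r)"
proof -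
  have "closed (std_hexagon r)"
    unfolding std_hexagon_hnorm by (intro closed_Collect_le continuous_hnorm continuous_intros)
  moreover have "std_hexagon r \<subseteq> cbox (pt (-1) (-1)) (pt 1 1)"
  proof
    fix z assume z: "z \<in> std_hexagon r"
    then have "0 \<le> (1 - r) * \<bar>z$2\<bar>" using assms by simp
    then show "z \<in> cbox (pt (-1) (-1)) (pt 1 1)" using z by (auto simp: std_hexagon_def mem_cbox_pt abs_le_iff)
  qed
  ultimately show ?thesis using bounded_subset[OF bounded_cbox] compact_eq_bounded_closed by blast
qed

lemma interior_hnorm: "interior {z. hnorm r z \<le> 2} = {z. hnorm r z < 2}"
proof
  have "open {z. hnorm r z < 2}" by (intro open_Collect_less continuous_hnorm continuous_intros)
  then show "{z. hnorm r z < 2} \<subseteq> interior {z. hnorm r z \<le> 2}" by (rule interior_maximal[rotated]) auto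
  show "interior {z. hnorm r z \<le> 2} \<subseteq> {z. hnorm r z < 2}"
  proof
    fix z assume z: "z \<in> interior {z. hnorm r z \<le> 2}"
    then obtain d where d: "d > 0" "cball z d \<subseteq> {z. hnorm r z \<le> 2}" by (meson mem_interior_cball)
    define t where "t = d / (norm z + 1)"
    have nz: "norm z + 1 > 0" by (simp add: add_nonneg_pos)
    then have t: "t > 0" "t * (norm z + 1) = d" using d by (simp_all add: t_def)
    then have "t * norm z \<le> d" by (simp add: distrib_left)
    then have "(1 + t) *\<^sub>R z \<in> cball z d" using t by (simp add: dist_norm algebra_simps)
    then have "hnorm r ((1 + t) *\<^sub>R z) \<le> 2" using d by blast
    then have le: "(1 + t) * hnorm r z \<le> 2" unfolding hnorm_scale using t by simp
    show "z \<in> {z. hnorm r z < 2}"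
    proof (cases "hnorm r z > 0")
      case True
      then have "t * hnorm r z > 0" using t by simp
      then show ?thesis using le by (simp add: distrib_right)
    qed auto
  qed
qed

lemma mem_triangle_0:
  fixes a b :: plane assumes "0 \<le> s" "0 \<le> t" "s + t \<le> 1" shows "s *\<^sub>R a + t *\<^sub>R b \<in> convex hull {0, a, b}"
  unfolding convex_hull_3 using assms
  by (intro CollectI exI[of _ "1 - s - t"] exI[of _ s] exI[of _ t]) auto

lemma std_hexagon_fan:
  assumes r: "0 < r" "r \<le> 1" and z: "z \<in> std_hexagon r" "0 \<le> z$2"
  shows "z \<in> fan_union [pt 1 0, pt r 1, pt (- r) 1, pt (- 1) 0]"
proof -
  have zz: "z$2 \<le> 1" "\<bar>z$1\<bar> + (1 - r) * z$2 \<le> 1" using z by (auto simp: std_hexagon_def)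
  consider "z$1 > r * z$2" | "\<bar>z$1\<bar> \<le> r * z$2" | "z$1 < - (r * z$2)" by linarith
  then show ?thesis
  proof cases
    case 1
    have "z = (z$1 - r * z$2) *\<^sub>R pt 1 0 + z$2 *\<^sub>R pt r 1" by (rule plane_eqI) auto
    moreover have "(z$1 - r * z$2) *\<^sub>R pt 1 0 + z$2 *\<^sub>R pt r 1 \<in> convex hull {0, pt 1 0, pt r 1}"
      using 1 z zz by (intro mem_triangle_0) (auto simp: algebra_simps)
    ultimately show ?thesis by simp
  next
    case 2
    have "z = ((z$2 + z$1 / r) / 2) *\<^sub>R pt r 1 + ((z$2 - z$1 / r) / 2) *\<^sub>R pt (- r) 1"
      using r by (intro plane_eqI) (auto simp: field_simps)
    moreover have "((z$2 + z$1 / r) / 2) *\<^sub>R pt r 1 + ((z$2 - z$1 / r) / 2) *\<^sub>R pt (- r) 1 \<in> convex hull {0, pt r 1, pt (- r) 1}"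
      using 2 z zz r by (intro mem_triangle_0) (auto simp: field_simps abs_le_iff)
    ultimately show ?thesis by simp
  next
    case 3
    have "z = z$2 *\<^sub>R pt (- r) 1 + (- z$1 - r * z$2) *\<^sub>R pt (- 1) 0" by (rule plane_eqI) auto
    moreover have "z$2 *\<^sub>R pt (- r) 1 + (- z$1 - r * z$2) *\<^sub>R pt (- 1) 0 \<in> convex hull {0, pt (- r) 1, pt (- 1) 0}"
      using 3 z zz by (intro mem_triangle_0) (auto simp: algebra_simps)
    ultimately show ?thesis by simp
  qed
qed

lemma std_hexagon_hull:
  assumes r: "0 < r" "r \<le> 1"
  shows "convex hull {pt (-1) 0, pt 1 0, pt r 1, pt (-r) 1, pt r (-1), pt (-r) (-1)} = std_hexagon r" (is "convex hull ?S = _")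
proof
  show "convex hull ?S \<subseteq> std_hexagon r"
    using r by (intro hull_minimal convex_std_hexagon) (auto simp: std_hexagon_def)
  have half: "z \<in> convex hull ?S" if z: "z \<in> std_hexagon r" "0 \<le> z$2" for z
  proof -
    have "(1/2) *\<^sub>R pt (-1) 0 + (1/2) *\<^sub>R pt 1 0 \<in> convex hull ?S"
      by (intro convexD[OF convex_convex_hull] hull_inc) auto
    moreover have "(1/2) *\<^sub>R pt (-1) 0 + (1/2) *\<^sub>R pt 1 0 = 0" by (rule plane_eqI) auto
    ultimately have "0 \<in> convex hull ?S" by simp
    then have "fan_union [pt 1 0, pt r 1, pt (- r) 1, pt (- 1) 0] \<subseteq> convex hull ?S"
      by (intro fan_union_subset convex_convex_hull) (auto intro: hull_inc)
    then show ?thesis using std_hexagon_fan[OF r z] by blast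
  qed
  show "std_hexagon r \<subseteq> convex hull ?S"
  proof
    fix z assume z: "z \<in> std_hexagon r"
    show "z \<in> convex hull ?S"
    proof (cases "0 \<le> z$2")
      case False
      have "- z \<in> std_hexagon r" using z by (simp add: std_hexagon_def)
      then have "- z \<in> convex hull ?S" using half False by simp
      then have "- (- z) \<in> uminus ` (convex hull ?S)" by blast
      also have "uminus ` (convex hull ?S) = convex hull (uminus ` ?S)"
        using convex_hull_linear_image[OF linear_uminus, of ?S] by simp
      also have "uminus ` ?S = ?S"
      proof -
        have "- pt a b = pt (- a) (- b)" for a b by (rule plane_eqI) auto
        then show ?thesis by auto
      qed
      finally show ?thesis by simp
    qed (use half z in auto)
  qed
qed

text \<open>A fan and its mirror image cover the hexagon, which gives the upper bound; the lower
  bound is \<open>fan_area_le\<close> for the same fan.\<close>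

lemma measure_std_hexagon:
  assumes r: "0 < r" "r \<le> 1" shows "measure lebesgue (std_hexagon r) = 2 * (1 + r)"
proof -
  let ?ps = "[pt 1 0, pt r 1, pt (- r) 1]"
  let ?U = "fan_union (?ps @ [- hd ?ps])"
  have hd: "- hd ?ps = pt (- 1) 0" by (simp add: plane_eqI)
  have sorted: "sorted_wrt (\<lambda>p q. 0 \<le> wedge p q) (?ps @ [- hd ?ps])" using r by (auto simp: wedge_def)
  have fan: "fan_area (?ps @ [- hd ?ps]) = 1 + r" by (simp add: wedge_def)
  have U: "measure lebesgue ?U = 1 + r" using measure_fan_union[OF sorted] fan by simp
  have comp: "compact ?U" by (rule compact_fan_union)
  have "std_hexagon r \<subseteq> ?U \<union> uminus ` ?U"
  proof
    fix z assume z: "z \<in> std_hexagon r"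
    show "z \<in> ?U \<union> uminus ` ?U"
    proof (cases "0 \<le> z$2")
      case True
      then show ?thesis using std_hexagon_fan[OF r z] hd by simp
    next
      case False
      then have "- z \<in> ?U" using std_hexagon_fan[OF r, of "- z"] z hd by (simp add: std_hexagon_def)
      then have "- (- z) \<in> uminus ` ?U" by (rule imageI)
      then show ?thesis by simp
    qed
  qed
  moreover have "compact (uminus ` ?U)" using comp compact_negations by blast
  ultimately have "measure lebesgue (std_hexagon r) \<le> measure lebesgue (?U \<union> uminus ` ?U)"
    using comp compact_std_hexagon[OF r(2)]
    by (intro measure_mono_fmeasurable) (auto intro: lmeasurable_compact fmeasurableD compact_Un)
  also have "\<dots> \<le> measure lebesgue ?U + measure lebesgue (uminus ` ?U)"
    using comp \<open>compact (uminus ` ?U)\<close> by (intro measure_Un_le fmeasurableD lmeasurable_compact)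
  also have "\<dots> = 2 * (1 + r)" using U measure_uminus_image[OF lmeasurable_compact[OF comp]] by simp
  finally have le: "measure lebesgue (std_hexagon r) \<le> 2 * (1 + r)" .
  have zero: "0 \<in> interior (std_hexagon r)"
  proof -
    have "open {z. hnorm r z < 1}" by (intro open_Collect_less continuous_hnorm continuous_intros)
    then have "{z. hnorm r z < 1} \<subseteq> interior (std_hexagon r)"
      unfolding std_hexagon_hnorm by (rule interior_maximal[rotated]) auto
    then show ?thesis by (auto simp: hnorm_def)
  qed
  interpret sym_body "std_hexagon r"
  proof
    show "- x \<in> std_hexagon r" if "x \<in> std_hexagon r" for x using that by (simp add: std_hexagon_def)
  qed (use r zero compact_std_hexagon convex_std_hexagon in blast)+
  have "2 * fan_area (?ps @ [- hd ?ps]) \<le> M"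
  proof (rule fan_area_le[OF _ sorted])
    have "pt 1 0 $ 1 \<noteq> (0::plane) $ 1" by simp
    then show "hd ?ps \<noteq> 0" by (metis list.sel(1))
  qed (use r in \<open>auto simp: std_hexagon_def\<close>)
  then show ?thesis using le fan by (simp add: M_def)
qed

locale hexagon_frame =
  fixes D :: "plane set" and c e f :: plane and r :: real
  assumes w: "wedge e f \<noteq> 0" and r: "1 / 2 \<le> r" "r \<le> 1"
    and D_eq: "D = (\<lambda>z. c + frame e f z) ` std_hexagon r"
begin

lemma r_pos: "0 < r" using r by simp

lemma hnorm_ge: "\<bar>z$2\<bar> \<le> hnorm r z" "\<bar>z$1\<bar> + (1 - r) * \<bar>z$2\<bar> \<le> hnorm r z" by (simp_all add: hnorm_def)

lemma D_eq': "D = (+) c ` (frame e f ` std_hexagon r)" by (simp add: D_eq image_image)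

sublocale centered_body D c
proof
  have "compact D" unfolding D_eq'
    by (intro compact_translation compact_continuous_image linear_continuous_on compact_std_hexagon r)
      (simp add: linear_conv_bounded_linear[symmetric] linear_frame)
  moreover have "convex D" unfolding D_eq'
    by (intro convex_translation convex_linear_image linear_frame convex_std_hexagon r)
  moreover have "interior D \<noteq> {}"
  proof
    assume "interior D = {}"
    then have "negligible D" using negligible_convex_interior[OF \<open>convex D\<close>] by simp
    then have "measure lebesgue D = 0" by (rule negligible_imp_measure0)
    moreover have "measure lebesgue D = \<bar>wedge e f\<bar> * (2 * (1 + r))"
      unfolding D_eq' using measure_frame[OF lmeasurable_compact[OF compact_std_hexagon[OF r(2)]]] measure_std_hexagon[OF r_pos r(2)]
      by (simp only: measure_translation)
    ultimately show False using w r by simp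
  qed
  ultimately show "convex_domain D" by (simp add: convex_domain_def)
  show "2 *\<^sub>R c - x \<in> D" if "x \<in> D" for x
  proof -
    obtain z where z: "z \<in> std_hexagon r" "x = c + frame e f z" using \<open>x \<in> D\<close> unfolding D_eq by blast
    then have "- z \<in> std_hexagon r" by (simp add: std_hexagon_def)
    moreover have "2 *\<^sub>R c - x = c + frame e f (- z)"
      unfolding z linear_neg[OF linear_frame] by (simp add: scaleR_2)
    ultimately show ?thesis unfolding D_eq by blast
  qed
qed

lemma measure_D: "measure lebesgue D = \<bar>wedge e f\<bar> * (2 * (1 + r))"
  unfolding D_eq' using measure_frame[OF lmeasurable_compact[OF compact_std_hexagon[OF r(2)]]] measure_std_hexagon[OF r_pos r(2)]
  by (simp only: measure_translation)

lemma B_frame: "B = frame e f ` {z. hnorm r z \<le> 2}"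
  unfolding B_def unfolding D_eq frame_image_B double_std_hexagon ..

lemma interior_B_frame: "interior B = frame e f ` {z. hnorm r z < 2}"
  unfolding B_frame using interior_injective_linear_image[OF linear_frame inj_frame[OF w]] interior_hnorm by metis

lemma frame_mem_B: "frame e f z \<in> B \<longleftrightarrow> hnorm r z \<le> 2"
  unfolding B_frame using inj_frame[OF w] by (auto simp: inj_image_mem_iff)

lemma frame_mem_interior: "frame e f z \<in> interior B \<longleftrightarrow> hnorm r z < 2"
  unfolding interior_B_frame using inj_frame[OF w] by (auto simp: inj_image_mem_iff)

lemma frame_mem_frontier: "frame e f z \<in> frontier B \<longleftrightarrow> hnorm r z = 2"
  unfolding frontier_iff frame_mem_B frame_mem_interior by auto

lemma wedge_frame: "wedge (frame e f x) (frame e f y) = wedge e f * wedge x y"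
  by (simp add: frame_def wedge_add wedge_commute[of f e]) (simp add: wedge_def algebra_simps)

text \<open>Among x, y, x - y and their negatives there are two with nonnegative second coordinates
  whose sum is a third one, and up to sign they have the same determinant. This reduces the claim to
  a pair \<open>a\<close>, \<open>b\<close> in the upper half-plane with \<open>a + b\<close> on the
  boundary.\<close>

lemma wedge_std_le:
  assumes "hnorm r x = 2" "hnorm r y = 2" "hnorm r (x - y) = 2"
  shows "\<bar>wedge x y\<bar> \<le> 4"
proof -
  have *: "\<bar>wedge a b\<bar> \<le> 4"
    if ab: "hnorm r a = 2" "hnorm r b = 2" "hnorm r (a + b) = 2" "0 \<le> a$2" "0 \<le> b$2" for a b
  proof -
    have sum: "a$2 + b$2 \<le> 2" "\<bar>a$1 + b$1\<bar> + (1 - r) * (a$2 + b$2) \<le> 2"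
      using ab(3) hnorm_ge[of "a + b"] ab(4,5) by simp_all
    have a: "a$2 = 2 \<or> \<bar>a$1\<bar> + (1 - r) * a$2 = 2" and b: "b$2 = 2 \<or> \<bar>b$1\<bar> + (1 - r) * b$2 = 2"
      using ab by (auto simp: hnorm_def max_def split: if_splits)
    \<comment> \<open>The heights add up to at most 2. So if one point is on a horizontal side, the
      other has height 0; else both are on slanted sides.\<close>
    consider "a$2 = 2" "b$2 = 0" | "b$2 = 2" "a$2 = 0" | "\<bar>a$1\<bar> + (1 - r) * a$2 = 2" "\<bar>b$1\<bar> + (1 - r) * b$2 = 2"
      using a b sum(1) ab(4,5) by linarith
    then show ?thesis
    proof cases
      case 1
      then have "\<bar>b$1\<bar> = 2" using b by simp
      then show ?thesis using 1 by (simp add: wedge_def abs_mult)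
    next
      case 2
      then have "\<bar>a$1\<bar> = 2" using a by simp
      then show ?thesis using 2 by (simp add: wedge_def abs_mult)
    next
      case 3
      define p q where "p = a$2" and "q = b$2"
      have pq: "0 \<le> p" "0 \<le> q" "p + q \<le> 2" using ab sum by (simp_all add: p_def q_def)
      have nn: "0 \<le> (1 - r) * p * q" using pq r by simp
      have small: "(1 - r) * (p + q) \<le> 1"
        using mult_mono[of "1 - r" "1/2" "p + q" 2] r pq by simp
      have xs: "\<bar>a$1\<bar> = 2 - (1 - r) * p" "\<bar>b$1\<bar> = 2 - (1 - r) * q" using 3 by (simp_all add: p_def q_def)
      have sm: "(1 - r) * p \<le> 1" "(1 - r) * q \<le> 1" using small pq r
        by (smt (verit) mult_left_mono)+
      have "\<bar>a$1 + b$1\<bar> + (1 - r) * (p + q) \<le> 2" using sum by (simp add: p_def q_def)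
      \<comment> \<open>With first coordinates of the same sign the norm of \<open>a + b\<close>
        would be at least 4. With opposite signs the two products in \<open>wedge\<close> do not
        cancel.\<close>
      then have op: "\<bar>a$1 + b$1\<bar> < \<bar>a$1\<bar> + \<bar>b$1\<bar>" unfolding xs using small by (simp add: algebra_simps)
      then have "\<bar>a$1 * q - p * b$1\<bar> = \<bar>a$1\<bar> * q + p * \<bar>b$1\<bar>"
      proof -
        consider "0 \<le> a$1" "b$1 \<le> 0" | "a$1 \<le> 0" "0 \<le> b$1" using op by linarith
        then show ?thesis
        proof cases
          case 1
          then have "0 \<le> a$1 * q" "p * b$1 \<le> 0" using pq by (simp_all add: mult_nonneg_nonpos)
          then show ?thesis using 1 by simp
        next
          case 2
          then have "a$1 * q \<le> 0" "0 \<le> p * b$1" using pq by (simp_all add: mult_nonpos_nonneg)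
          then show ?thesis using 2 by simp
        qed
      qed
      also have "\<dots> = 2 * (p + q) - 2 * ((1 - r) * p * q)" unfolding xs by (simp add: algebra_simps)
      also have "\<dots> \<le> 4" using pq nn by simp
      finally show ?thesis by (simp add: wedge_def p_def q_def)
    qed
  qed
  have neg: "hnorm r (- z) = hnorm r z" for z by (simp add: hnorm_def)
  have 1: "\<bar>wedge a b\<bar> \<le> 4" if ab: "hnorm r a = 2" "hnorm r b = 2" "hnorm r (a - b) = 2" "0 \<le> a$2" for a b
  proof -
    consider "b$2 \<le> 0" | "0 \<le> b$2" "b$2 \<le> a$2" | "0 \<le> b$2" "a$2 \<le> b$2" by linarith
    then show ?thesis
    proof cases
      case 1 then show ?thesis using *[of a "- b"] ab neg[of b] by simp
    next
      case 2 then show ?thesis using *[of "a - b" b] ab by (simp add: wedge_add)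
    next
      case 3 then show ?thesis using *[of "b - a" a] ab neg[of "a - b"] wedge_commute[of a b] by (simp add: wedge_add)
    qed
  qed
  show ?thesis
    using 1[OF assms] 1[of "- x" "- y"] neg[of x] neg[of y] neg[of "x - y"] assms by (cases "0 \<le> x$2") auto
qed

lemma Delta_eq: "\<Delta> = 4 * \<bar>wedge e f\<bar>"
proof (rule antisym)
  show "\<Delta> \<le> 4 * \<bar>wedge e f\<bar>"
  proof (rule Delta_le)
    fix u v assume h: "hex_pair u v"
    obtain x y where xy: "u = frame e f x" "v = frame e f y" using surj_frame[OF w] by (meson surj_def)
    have "hnorm r x = 2" "hnorm r y = 2" "hnorm r (x - y) = 2"
      using h unfolding hex_pair_def xy frame_diff frame_mem_frontier by auto
    then have "\<bar>wedge x y\<bar> \<le> 4" by (rule wedge_std_le)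
    then show "\<bar>wedge u v\<bar> \<le> 4 * \<bar>wedge e f\<bar>" unfolding xy wedge_frame by (simp add: abs_mult mult.commute mult_left_mono)
  qed
  have wedge_std: "wedge (pt 2 0) (pt 1 2) = 4" by (simp add: wedge_def)
  \<comment> \<open>The extremal pair: a horizontal neighbour and one in the next row, shifted by
    half a step. The latter has norm 2 precisely because \<open>1 / 2 \<le> r\<close>.\<close>
  have "hex_pair (frame e f (pt 2 0)) (frame e f (pt 1 2))"
    unfolding hex_pair_def frame_diff frame_mem_frontier using r by (auto simp: hnorm_def max_def)
  from hex_le_Delta[OF this] show "4 * \<bar>wedge e f\<bar> \<le> \<Delta>"
    unfolding wedge_frame using wedge_std by (simp add: abs_mult)
qed

lemma thinnest_eq: "thinnest_density D = (1 + r) / 2"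
proof -
  have "\<bar>wedge e f\<bar> * (4 * d0) = \<bar>wedge e f\<bar> * (2 * (1 + r))"
    using Delta_d0(1) measure_D unfolding Delta_eq by simp
  then have "4 * d0 = 2 * (1 + r)" using w by (simp only: mult_cancel_left) simp
  then show ?thesis by simp
qed

end

lemma special_hexagon_frame:
  assumes r: "1 / 2 \<le> r" "r \<le> 1" and D: "special_hexagon r D"
  obtains c e f where "hexagon_frame D c e f r"
proof -
  obtain c a b a' b' t where h: "a' = 2 *\<^sub>R c - a" "\<not> collinear {a, b, a'}" "b - b' = t *\<^sub>R (a - a')"
    "dist b b' = r * dist a a'" "D = convex hull {a, b, b', a', 2 *\<^sub>R c - b, 2 *\<^sub>R c - b'}"
    using D unfolding special_hexagon_def by blast
  \<comment> \<open>\<open>e\<close> is half of the diagonal, and \<open>f\<close> leads from the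
    centre to the midpoint of the side from \<open>b\<close> to \<open>b'\<close>.\<close>
  define e f where "e = c - a" and "f = (1/2) *\<^sub>R (b + b') - c"
  have "a \<noteq> a'"
  proof
    assume "a = a'"
    then have "{a, b, a'} = {a, b}" by auto
    then show False using h(2) collinear_2 by metis
  qed
  have "\<bar>t\<bar> * dist a a' = r * dist a a'" using h(3,4) by (simp add: dist_norm)
  then have "\<bar>t\<bar> = r" using \<open>a \<noteq> a'\<close> by simp
  \<comment> \<open>Either order of \<open>b\<close> and \<open>b'\<close> may occur; both give the
    same six points.\<close>
  then have t: "t = r \<or> t = - r" by linarith
  have aa: "a = c + frame e f (pt (-1) 0)" "a' = c + frame e f (pt 1 0)"
    by (simp_all add: frame_pt e_def h(1) scaleR_2)
  have bb: "b = c + (f - t *\<^sub>R e)" "b' = c + (f + t *\<^sub>R e)"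
  proof -
    have "a - a' = - 2 *\<^sub>R e" by (simp add: h(1) e_def vec_eq_iff algebra_simps)
    then have d: "b - b' = - (2 * t) *\<^sub>R e" unfolding h(3) by (simp add: mult.commute)
    have s: "b + b' = 2 *\<^sub>R (c + f)" by (simp add: f_def scaleR_right_diff_distrib)
    have "2 *\<^sub>R b = (b + b') + (b - b')" "2 *\<^sub>R b' = (b + b') - (b - b')" by (simp_all add: scaleR_2)
    then have "2 *\<^sub>R b = 2 *\<^sub>R (c + (f - t *\<^sub>R e))" "2 *\<^sub>R b' = 2 *\<^sub>R (c + (f + t *\<^sub>R e))"
      unfolding d s by (simp_all add: algebra_simps)
    then show "b = c + (f - t *\<^sub>R e)" "b' = c + (f + t *\<^sub>R e)" unfolding real_vector.scale_left_imp_eq[of 2] by simp_all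
  qed
  have w: "wedge e f \<noteq> 0"
  proof
    assume w0: "wedge e f = 0"
    have "e \<noteq> 0" using \<open>a \<noteq> a'\<close> h(1) by (auto simp: e_def scaleR_2)
    then obtain k where k: "f = k *\<^sub>R e" using wedge_eq_0[OF w0] by blast
    have "b - a = (k - t + 1) *\<^sub>R e" "a' - a = 2 *\<^sub>R e" unfolding bb k by (simp_all add: e_def h(1) vec_eq_iff algebra_simps)
    then have eqs: "a = a + 0 *\<^sub>R e" "b = a + (k - t + 1) *\<^sub>R e" "a' = a + 2 *\<^sub>R e" by (simp_all add: algebra_simps)
    have ex: "\<exists>s. x = a + s *\<^sub>R e" if "x \<in> {a, b, a'}" for x using that eqs by (elim insertE emptyE) blast+
    have "collinear {a, b, a'}"
      unfolding collinear_def
    proof (intro exI[of _ e] ballI)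
      fix x y assume "x \<in> {a, b, a'}" "y \<in> {a, b, a'}"
      then obtain s s' where "x = a + s *\<^sub>R e" "y = a + s' *\<^sub>R e" using ex by meson
      then have "x - y = (s - s') *\<^sub>R e" by (simp add: algebra_simps)
      then show "\<exists>c. x - y = c *\<^sub>R e" by blast
    qed
    then show False using h(2) by blast
  qed
  have pts: "{a, b, b', a', 2 *\<^sub>R c - b, 2 *\<^sub>R c - b'} =
      (\<lambda>z. c + frame e f z) ` {pt (-1) 0, pt 1 0, pt r 1, pt (-r) 1, pt r (-1), pt (-r) (-1)}"
  proof -
    have b4: "b = c + frame e f (pt (- t) 1)" "b' = c + frame e f (pt t 1)"
      "2 *\<^sub>R c - b = c + frame e f (pt t (- 1))" "2 *\<^sub>R c - b' = c + frame e f (pt (- t) (- 1))"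
      unfolding bb by (simp_all add: frame_pt vec_eq_iff algebra_simps)
    show ?thesis unfolding b4(3,4) unfolding b4(1,2) aa using t by (elim disjE) auto
  qed
  have "(\<lambda>z. c + frame e f z) ` S = (+) c ` (frame e f ` S)" for S by (simp add: image_image)
  then have "D = (\<lambda>z. c + frame e f z) ` (convex hull {pt (-1) 0, pt 1 0, pt r 1, pt (-r) 1, pt r (-1), pt (-r) (-1)})"
    unfolding h(5) pts by (simp only: convex_hull_translation convex_hull_linear_image[OF linear_frame])
  then have "D = (\<lambda>z. c + frame e f z) ` std_hexagon r" using std_hexagon_hull[of r] r by simp
  then have "hexagon_frame D c e f r" using w r by unfold_locales
  then show ?thesis using that by blast
qed

lemma special_hexagon_exists: assumes "1 / 2 \<le> r" "r \<le> 1" shows "\<exists>D. special_hexagon r D"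
proof -
  have eq: "2 *\<^sub>R 0 - pt x y = pt (- x) (- y)" for x y by (rule plane_eqI) auto
  have "\<not> collinear {pt (-1) 0, pt r 1, pt 1 0}"
  proof
    assume "collinear {pt (-1) 0, pt r 1, pt 1 0}"
    then obtain u s t where "pt r 1 - pt (-1) 0 = s *\<^sub>R u" "pt 1 0 - pt (-1) 0 = t *\<^sub>R u"
      unfolding collinear_def by (metis insertI1 insertI2)
    then have "wedge (pt r 1 - pt (-1) 0) (pt 1 0 - pt (-1) 0) = 0" by simp
    then show False by (simp add: wedge_def)
  qed
  moreover have "pt r 1 - pt (- r) 1 = (- r) *\<^sub>R (pt (-1) 0 - pt 1 0)" by (rule plane_eqI) auto
  moreover then have "dist (pt r 1) (pt (- r) 1) = r * dist (pt (-1) 0) (pt 1 0)" using assms by (simp add: dist_norm)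
  ultimately have "special_hexagon r (convex hull {pt (-1) 0, pt r 1, pt (- r) 1, pt 1 0, 2 *\<^sub>R 0 - pt r 1, 2 *\<^sub>R 0 - pt (- r) 1})"
    unfolding special_hexagon_def
  proof (intro exI conjI)
    show "pt 1 0 = 2 *\<^sub>R 0 - pt (-1) 0" unfolding eq by simp
  qed (assumption | rule refl)+
  then show ?thesis by blast
qed

section \<open>Subdivisions from columns of points\<close>

lemma mem_segment_pt:
  assumes "x1 < x2"
  shows "z \<in> closed_segment (pt x1 y1) (pt x2 y2) \<longleftrightarrow>
    x1 \<le> z$1 \<and> z$1 \<le> x2 \<and> (z$2 - y1) * (x2 - x1) = (y2 - y1) * (z$1 - x1)"
proof
  assume "z \<in> closed_segment (pt x1 y1) (pt x2 y2)"
  then obtain u where u: "0 \<le> u" "u \<le> 1" "z = (1 - u) *\<^sub>R pt x1 y1 + u *\<^sub>R pt x2 y2" by (auto simp: in_segment)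
  have z1: "z$1 = x1 + u * (x2 - x1)" and z2: "z$2 = y1 + u * (y2 - y1)" unfolding u(3) by (simp_all add: algebra_simps)
  have "0 \<le> u * (x2 - x1)" "0 \<le> (1 - u) * (x2 - x1)" using u assms by simp_all
  then have "x1 \<le> z$1" "z$1 \<le> x2" unfolding z1 by (simp_all add: algebra_simps)
  moreover have "(z$2 - y1) * (x2 - x1) = (y2 - y1) * (z$1 - x1)" unfolding z1 z2 by (simp add: algebra_simps)
  ultimately show "x1 \<le> z$1 \<and> z$1 \<le> x2 \<and> (z$2 - y1) * (x2 - x1) = (y2 - y1) * (z$1 - x1)" by blast
next
  assume a: "x1 \<le> z$1 \<and> z$1 \<le> x2 \<and> (z$2 - y1) * (x2 - x1) = (y2 - y1) * (z$1 - x1)"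
  define u where "u = (z$1 - x1) / (x2 - x1)"
  have u: "0 \<le> u" "u \<le> 1" "u * (x2 - x1) = z$1 - x1" using a assms by (simp_all add: u_def)
  have "(z$2 - y1) * (x2 - x1) = (y2 - y1) * (u * (x2 - x1))" using a unfolding u(3) by blast
  then have "(z$2 - y1) * (x2 - x1) = (u * (y2 - y1)) * (x2 - x1)" by (simp only: ac_simps)
  then have "z$2 - y1 = u * (y2 - y1)" using assms by simp
  then have "z = (1 - u) *\<^sub>R pt x1 y1 + u *\<^sub>R pt x2 y2"
    using u(3) by (intro plane_eqI) (simp_all add: algebra_simps)
  then show "z \<in> closed_segment (pt x1 y1) (pt x2 y2)" using u by (auto simp: in_segment)
qed

definition halfplane :: "real \<Rightarrow> real \<Rightarrow> real \<Rightarrow> plane set" where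
  "halfplane p q s = {z. p * z$1 + q * z$2 \<le> s}"

lemma halfplane_inner: "halfplane p q s = {z. pt p q \<bullet> z \<le> s}"
  by (simp add: halfplane_def inner_vec_def sum_2)

lemma polyhedron_halfplane: "polyhedron (halfplane p q s)"
  unfolding halfplane_inner by (rule polyhedron_halfspace_le)

lemma interior_halfplane:
  assumes "p \<noteq> 0 \<or> q \<noteq> 0" shows "interior (halfplane p q s) = {z. p * z$1 + q * z$2 < s}"
proof -
  have "pt p q \<noteq> 0" using assms by (metis pt_nth zero_index)
  then show ?thesis using interior_halfspace_le[of "pt p q" s] unfolding halfplane_inner by (simp add: inner_vec_def sum_2)
qed

text \<open>A column has one abscissa or a touching pair at distance 2. Points of consecutive
  columns at heights that differ by 2 have norm distance exactly 2 as long as the gap is at most 2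
  r. A gap of at least 1 keeps points of equal height in columns \<open>k - 1\<close> and
  \<open>k + 1\<close> at distance at least 2.\<close>

locale columns =
  fixes r :: real and a b :: "int \<Rightarrow> real"
  assumes r: "1 / 2 \<le> r" "r \<le> 1"
    and w: "b k = a k \<or> b k = a k + 2"
    and s1: "1 \<le> a (k + 1) - b k" and s2: "a (k + 1) - b k \<le> 2 * r"
begin

text \<open>
  Column \<open>k\<close> has one or two points at each of the heights \<open>2m\<close> with \<open>k + m\<close> even.
  Every face is centred between two vertically adjacent points of a column.
\<close>

definition X where "X = {pt x (2 * of_int m) | k m x. even (k + m) \<and> (x = a k \<or> x = b k)}"

text \<open>\<open>slant\<close>, \<open>bar\<close> and \<open>bridge\<close> are the three kinds
  of contact: between consecutive columns, inside a pair, and across a column \<open>k\<close> at a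
  height where it has no point. A bridge arises only if column \<open>k\<close> is single and both
  gaps next to it are 1.\<close>

definition slant :: "int \<Rightarrow> int \<Rightarrow> int \<Rightarrow> plane set" where
  "slant k m \<epsilon> = closed_segment (pt (b k) (2 * of_int m)) (pt (a (k + 1)) (2 * of_int (m + \<epsilon>)))"
definition bar :: "int \<Rightarrow> int \<Rightarrow> plane set" where
  "bar k m = closed_segment (pt (a k) (2 * of_int m)) (pt (b k) (2 * of_int m))"
definition bridge :: "int \<Rightarrow> int \<Rightarrow> plane set" where
  "bridge k m = closed_segment (pt (b (k - 1)) (2 * of_int m)) (pt (a (k + 1)) (2 * of_int m))"

definition flat where "flat k \<longleftrightarrow> a (k + 1) = b (k - 1) + 2"

definition E where
  "E = {slant k m \<epsilon> | k m \<epsilon>. even (k + m) \<and> (\<epsilon> = 1 \<or> \<epsilon> = - 1)}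
     \<union> {bar k m | k m. even (k + m) \<and> b k = a k + 2}
     \<union> {bridge k m | k m. odd (k + m) \<and> flat k}"

text \<open>For \<open>j = 0\<close> the last condition is void and the region is bounded by slants,
  with bars above and below if column \<open>k\<close> consists of pairs: a quadrangle or a hexagon.
  If \<open>flat k\<close> holds, the bridge cuts the region into two triangles,
  \<open>j = 1\<close> above and \<open>j = - 1\<close> below.\<close>

definition face :: "int \<Rightarrow> int \<Rightarrow> int \<Rightarrow> plane set" where
  "face k m j = {z. \<bar>z$2 - 2 * of_int m\<bar> \<le> 2
     \<and> (a k - b (k - 1)) * \<bar>z$2 - 2 * of_int m\<bar> \<le> 2 * (z$1 - b (k - 1))
     \<and> (a (k + 1) - b k) * \<bar>z$2 - 2 * of_int m\<bar> \<le> 2 * (a (k + 1) - z$1)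
     \<and> 0 \<le> of_int j * (z$2 - 2 * of_int m)}"

definition valid :: "int \<Rightarrow> int \<Rightarrow> int \<Rightarrow> bool" where
  "valid k m j \<longleftrightarrow> odd (k + m) \<and> (if flat k then j = 1 \<or> j = - 1 else j = 0)"

definition F where "F = {face k m j | k m j. valid k m j}"

lemma ab: "a k \<le> b k" using w[of k] by auto

lemma step: "b k + 1 \<le> a (k + 1)" using s1[of k] by simp

lemma mono_cols:
  assumes "k < l" shows "b k + of_int (l - k) \<le> a l"
proof -
  have "b k + of_int (k + 1 + int n - k) \<le> a (k + 1 + int n)" for n
  proof (induction n)
    case 0 then show ?case using step[of k] by simp
  next
    case (Suc n)
    then show ?case using step[of "k + 1 + int n"] ab[of "k + 1 + int n"] by (simp add: add_ac)
  qed
  from this[of "nat (l - k - 1)"] show ?thesis using assms by simp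
qed

lemma b_le_a: "k < l \<Longrightarrow> b k \<le> a l" and a_le: "k \<le> l \<Longrightarrow> a k \<le> a l" and b_le: "k \<le> l \<Longrightarrow> b k \<le> b l"
proof -
  show 1: "b k \<le> a l" if "k < l" for k l using mono_cols[OF that] that by linarith
  show "a k \<le> a l" if "k \<le> l" using 1[of k l] ab[of k] that by (cases "k = l") auto
  show "b k \<le> b l" if "k \<le> l" using 1[of k l] ab[of l] that by (cases "k = l") auto
qed

lemma gap_unique: assumes "b k < x" "x < a (k + 1)" "b l < x" "x < a (l + 1)" shows "k = l"
  using assms a_le[of "k + 1" l] a_le[of "l + 1" k] ab[of l] ab[of k] by (cases k l rule: linorder_cases) auto

lemma prev_step: "b (k - 1) + 1 \<le> a k" using step[of "k - 1"] by simp

lemma flatD: assumes "flat k" shows "b k = a k" "a k = b (k - 1) + 1" "a (k + 1) = b k + 1"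
  using assms w[of k] step[of k] prev_step[of k] by (auto simp: flat_def)

lemma column_at: obtains k where "a k \<le> x" "x < a (k + 1)"
proof -
  have "\<exists>k. a k \<le> x \<and> \<not> a (k + 1) \<le> x"
  proof (rule ccontr)
    assume "\<not> ?thesis"
    then have up: "a k \<le> x \<Longrightarrow> a (k + 1) \<le> x" for k by blast
    define k0 where "k0 = min (- 1) (\<lfloor>x - a 0\<rfloor>)"
    have "k0 < 0" "of_int k0 \<le> x - a 0" unfolding k0_def by linarith+
    then have "a k0 \<le> x" using mono_cols[of k0 0] ab[of k0] by simp
    then have "a (k0 + int n) \<le> x" for n
    proof (induction n)
      case (Suc n) then show ?case using up[of "k0 + int n"] by (simp add: add_ac)
    qed simp
    from this[of "nat (\<lceil>x - a k0\<rceil> + 1)"] mono_cols[of k0 "k0 + int (nat (\<lceil>x - a k0\<rceil> + 1))"] ab[of k0] \<open>a k0 \<le> x\<close>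
    show False by simp linarith
  qed
  then show ?thesis using that by auto
qed

lemma slant_iff:
  "z \<in> slant k m \<epsilon> \<longleftrightarrow> b k \<le> z$1 \<and> z$1 \<le> a (k + 1) \<and>
     (z$2 - 2 * of_int m) * (a (k + 1) - b k) = 2 * of_int \<epsilon> * (z$1 - b k)"
  unfolding slant_def using step[of k] by (subst mem_segment_pt) (auto simp: algebra_simps)

lemma bar_iff: assumes "b k = a k + 2"
  shows "z \<in> bar k m \<longleftrightarrow> a k \<le> z$1 \<and> z$1 \<le> b k \<and> z$2 = 2 * of_int m"
  unfolding bar_def using assms by (subst mem_segment_pt) auto

lemma bridge_iff: assumes "flat k"
  shows "z \<in> bridge k m \<longleftrightarrow> b (k - 1) \<le> z$1 \<and> z$1 \<le> a (k + 1) \<and> z$2 = 2 * of_int m"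
  unfolding bridge_def using assms by (subst mem_segment_pt) (auto simp: flat_def)

lemma mem_X_iff: "z \<in> X \<longleftrightarrow> (\<exists>k m. even (k + m) \<and> (z$1 = a k \<or> z$1 = b k) \<and> z$2 = 2 * of_int m)"
proof
  show "z \<in> X" if "\<exists>k m. even (k + m) \<and> (z$1 = a k \<or> z$1 = b k) \<and> z$2 = 2 * of_int m"
    using that pt_eta[of z] unfolding X_def by (smt (verit) mem_Collect_eq)
qed (auto simp: X_def)

lemma slant_ends: "even (k + m) \<Longrightarrow> \<epsilon> = 1 \<or> \<epsilon> = - 1 \<Longrightarrow> pt (b k) (2 * of_int m) \<in> X \<and> pt (a (k + 1)) (2 * of_int (m + \<epsilon>)) \<in> X"
proof -
  assume h: "even (k + m)" "\<epsilon> = 1 \<or> \<epsilon> = - 1"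
  then have "even ((k + 1) + (m + \<epsilon>))" by auto
  then have "pt (a (k + 1)) (2 * of_int (m + \<epsilon>)) \<in> X" unfolding mem_X_iff by (intro exI[of _ "k + 1"] exI[of _ "m + \<epsilon>"]) simp
  then show ?thesis using h unfolding mem_X_iff by auto
qed

lemma bar_ends: "even (k + m) \<Longrightarrow> pt (a k) (2 * of_int m) \<in> X \<and> pt (b k) (2 * of_int m) \<in> X"
  unfolding mem_X_iff by auto

lemma bridge_ends: "odd (k + m) \<Longrightarrow> pt (b (k - 1)) (2 * of_int m) \<in> X \<and> pt (a (k + 1)) (2 * of_int m) \<in> X"
proof -
  assume h: "odd (k + m)"
  then have "even ((k - 1) + m)" "even ((k + 1) + m)" by auto
  then show ?thesis unfolding mem_X_iff pt_nth by metis
qed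

lemma slant_inner:
  assumes "even (k + m)" "\<epsilon> = 1 \<or> \<epsilon> = - 1" "z \<in> slant k m \<epsilon>" "z \<notin> {pt (b k) (2 * of_int m), pt (a (k + 1)) (2 * of_int (m + \<epsilon>))}"
  shows "b k < z$1" "z$1 < a (k + 1)"
proof -
  have h: "b k \<le> z$1" "z$1 \<le> a (k + 1)" "(z$2 - 2 * of_int m) * (a (k + 1) - b k) = 2 * of_int \<epsilon> * (z$1 - b k)"
    using assms(3) by (auto simp: slant_iff)
  have d: "a (k + 1) - b k > 0" using step[of k] by simp
  have "z$1 \<noteq> b k"
  proof
    assume "z$1 = b k"
    then have "z = pt (b k) (2 * of_int m)" using h d by (intro plane_eqI) auto
    then show False using assms by simp
  qed
  then show "b k < z$1" using h by simp
  have "z$1 \<noteq> a (k + 1)"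
  proof
    assume e: "z$1 = a (k + 1)"
    then have "z$2 - 2 * of_int m = 2 * of_int \<epsilon>" using h(3) d by simp
    then have "z = pt (a (k + 1)) (2 * of_int (m + \<epsilon>))" using e by (intro plane_eqI) auto
    then show False using assms by simp
  qed
  then show "z$1 < a (k + 1)" using h by simp
qed

text \<open>A case rule for a point on an edge: it is an end of the edge, or it is strictly inside
  and its position is explicit. All arguments on crossing edges start from it.\<close>

lemma edge_cases:
  assumes "e \<in> E" "z \<in> e"
  obtains p q where "p \<in> X" "q \<in> X" "p \<noteq> q" "e = closed_segment p q" "z = p \<or> z = q"
  | k m \<epsilon> where "even (k + m)" "\<epsilon> = 1 \<or> \<epsilon> = - 1" "e = slant k m \<epsilon>" "b k < z$1" "z$1 < a (k + 1)"
      "(z$2 - 2 * of_int m) * (a (k + 1) - b k) = 2 * of_int \<epsilon> * (z$1 - b k)"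
  | k m where "even (k + m)" "b k = a k + 2" "e = bar k m" "a k < z$1" "z$1 < b k" "z$2 = 2 * of_int m"
  | k m where "odd (k + m)" "flat k" "e = bridge k m" "b (k - 1) < z$1" "z$1 < a (k + 1)" "z$2 = 2 * of_int m"
proof -
  have ne: "x \<noteq> x' \<Longrightarrow> pt x y \<noteq> pt x' y'" for x x' y y' by (metis pt_nth(1))
  consider (s) k m \<epsilon> where "even (k + m)" "\<epsilon> = 1 \<or> \<epsilon> = - 1" "e = slant k m \<epsilon>"
    | (f) k m where "even (k + m)" "b k = a k + 2" "e = bar k m"
    | (g) k m where "odd (k + m)" "flat k" "e = bridge k m"
    using assms(1) unfolding E_def by blast
  then show ?thesis
  proof cases
    case s
    show ?thesis
    proof (cases "z \<in> {pt (b k) (2 * of_int m), pt (a (k + 1)) (2 * of_int (m + \<epsilon>))}")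
      case True
      then show ?thesis using that(1)[OF _ _ ne] slant_ends[OF s(1,2)] s(3) step[of k] unfolding slant_def by force
    next
      case False
      then show ?thesis using that(2)[OF s] slant_inner[OF s(1,2) _ False] assms(2) s(3) slant_iff by blast
    qed
  next
    case f
    have z: "a k \<le> z$1" "z$1 \<le> b k" "z$2 = 2 * of_int m" using assms(2) f bar_iff by auto
    show ?thesis
    proof (cases "z$1 = a k \<or> z$1 = b k")
      case True
      then have "z = pt (a k) (2 * of_int m) \<or> z = pt (b k) (2 * of_int m)" using z by (metis pt_eta)
      then show ?thesis using that(1)[OF _ _ ne] bar_ends[OF f(1)] f(2,3) unfolding bar_def by force
    next
      case False
      then show ?thesis using that(3)[OF f] z by simp
    qed
  next
    case g
    have z: "b (k - 1) \<le> z$1" "z$1 \<le> a (k + 1)" "z$2 = 2 * of_int m" using assms(2) g bridge_iff by auto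
    show ?thesis
    proof (cases "z$1 = b (k - 1) \<or> z$1 = a (k + 1)")
      case True
      then have "z = pt (b (k - 1)) (2 * of_int m) \<or> z = pt (a (k + 1)) (2 * of_int m)" using z by (metis pt_eta)
      then show ?thesis using that(1)[OF _ _ ne] bridge_ends[OF g(1)] g(2,3) unfolding bridge_def flat_def by force
    next
      case False
      then show ?thesis using that(4)[OF g] z by simp
    qed
  qed
qed

lemma X_not_inner:
  assumes z: "z \<in> X"
  shows "\<not> (b k < z$1 \<and> z$1 < a (k + 1))" "\<not> (a k < z$1 \<and> z$1 < b k)"
    "odd (k + m) \<Longrightarrow> \<not> (b (k - 1) < z$1 \<and> z$1 < a (k + 1) \<and> z$2 = 2 * of_int m)"
proof -
  obtain l n where ln: "even (l + n)" "z$1 = a l \<or> z$1 = b l" "z$2 = 2 * of_int n" using z mem_X_iff by blast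
  show "\<not> (b k < z$1 \<and> z$1 < a (k + 1))"
    using ln(2) b_le[of l k] ab[of l] a_le[of "k + 1" l] by (cases "l \<le> k") auto
  show "\<not> (a k < z$1 \<and> z$1 < b k)"
    using ln(2) b_le_a[of l k] ab[of l] b_le_a[of k l] by (cases l k rule: linorder_cases) auto
  show "\<not> (b (k - 1) < z$1 \<and> z$1 < a (k + 1) \<and> z$2 = 2 * of_int m)" if "odd (k + m)"
  proof
    assume h: "b (k - 1) < z$1 \<and> z$1 < a (k + 1) \<and> z$2 = 2 * of_int m"
    have "\<not> l \<le> k - 1" using h ln(2) b_le[of l "k - 1"] ab[of l] by auto
    moreover have "\<not> k + 1 \<le> l" using h ln(2) a_le[of "k + 1" l] ab[of l] by auto
    ultimately have "l = k" by simp
    moreover have "n = m" using h ln(3) by simp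
    ultimately show False using ln(1) that by simp
  qed
qed

lemma edge_X: assumes "e \<in> E" shows "\<exists>x\<in>X. \<exists>y\<in>X. x \<noteq> y \<and> e = closed_segment x y \<and> e \<inter> X = {x, y}"
proof -
  obtain z where z: "z \<in> e" using assms unfolding E_def slant_def bar_def bridge_def by blast
  have ex: "\<exists>x\<in>X. \<exists>y\<in>X. x \<noteq> y \<and> e = closed_segment x y"
    using assms z
  proof (cases rule: edge_cases)
    case (2 k m \<epsilon>)
    then show ?thesis using slant_ends[OF 2(1,2)] step[of k] unfolding slant_def by (metis less_irrefl pt_nth(1) less_trans)
  next
    case (3 k m)
    then show ?thesis using bar_ends[OF 3(1)] unfolding bar_def by (metis less_irrefl pt_nth(1) less_trans)
  next
    case (4 k m)
    then show ?thesis using bridge_ends[OF 4(1)] unfolding bridge_def by (metis less_irrefl pt_nth(1) less_trans)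
  qed blast
  then obtain x y where xy: "x \<in> X" "y \<in> X" "x \<noteq> y" "e = closed_segment x y" by blast
  have "v = x \<or> v = y" if v: "v \<in> e" "v \<in> X" for v
    using assms v(1)
  proof (cases rule: edge_cases)
    case (1 p q)
    then have "{p, q} = {x, y}" using xy closed_segment_eq by metis
    then show ?thesis using 1 by auto
  qed (use X_not_inner[OF v(2)] in blast)+
  then have "e \<inter> X = {x, y}" using xy by auto
  then show ?thesis using xy by blast
qed

text \<open>Slants lie over gaps, bars over columns of pairs and bridges over single columns with
  their gaps. A slant reaches the height of a row only at its ends, and edges of the same kind are
  kept apart by the parity of column plus row.\<close>

lemma edges_equal:
  assumes e: "e \<in> E" "e' \<in> E" "z \<in> e" "z \<in> e'" "z \<notin> X" shows "e = e'"
proof -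
  have no1: "\<not> (b k < z$1 \<and> z$1 < a (k + 1) \<and> (z$2 - 2 * of_int m) * (a (k + 1) - b k) = 2 * of_int \<epsilon> * (z$1 - b k) \<and> z$2 = 2 * of_int n)"
    if \<epsilon>: "\<epsilon> = 1 \<or> \<epsilon> = - 1" for k m n \<epsilon> :: int
  proof
    assume h: "b k < z$1 \<and> z$1 < a (k + 1) \<and> (z$2 - 2 * of_int m) * (a (k + 1) - b k) = 2 * of_int \<epsilon> * (z$1 - b k) \<and> z$2 = 2 * of_int n"
    then have "of_int (\<epsilon> * (n - m)) * (a (k + 1) - b k) = z$1 - b k" using \<epsilon> by (auto simp: algebra_simps)
    moreover have "0 < z$1 - b k" "z$1 - b k < 1 * (a (k + 1) - b k)" using h by auto
    ultimately have "0 < of_int (\<epsilon> * (n - m)) * (a (k + 1) - b k)"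
      "of_int (\<epsilon> * (n - m)) * (a (k + 1) - b k) < 1 * (a (k + 1) - b k)" by simp_all
    then have "0 < real_of_int (\<epsilon> * (n - m))" "real_of_int (\<epsilon> * (n - m)) < 1"
      using step[of k] by (simp_all only: mult_less_cancel_right zero_less_mult_iff) linarith+
    then have "0 < \<epsilon> * (n - m)" "\<epsilon> * (n - m) < 1" by (simp_all only: of_int_0_less_iff of_int_less_1_iff)
    then show False by linarith
  qed
  have bars: "\<not> (b k < z$1 \<and> z$1 < a (k + 1) \<and> a l < z$1 \<and> z$1 < b l)" for k l
    using b_le[of l k] a_le[of "k + 1" l] by (cases "l \<le> k") auto
  have barbridge: "\<not> (flat k \<and> b (k - 1) < z$1 \<and> z$1 < a (k + 1) \<and> a l < z$1 \<and> z$1 < b l)" for k l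
  proof
    assume h: "flat k \<and> b (k - 1) < z$1 \<and> z$1 < a (k + 1) \<and> a l < z$1 \<and> z$1 < b l"
    have "\<not> l \<le> k - 1" using h b_le[of l "k - 1"] by auto
    moreover have "\<not> k + 1 \<le> l" using h a_le[of "k + 1" l] by auto
    ultimately have "l = k" by simp
    then show False using h flatD(1)[of k] by auto
  qed
  have slantbridge: "\<not> (flat l \<and> b k < z$1 \<and> z$1 < a (k + 1) \<and> b (l - 1) < z$1 \<and> z$1 < a (l + 1) \<and> z$2 = 2 * of_int n \<and>
      (z$2 - 2 * of_int m) * (a (k + 1) - b k) = 2 * of_int \<epsilon> * (z$1 - b k))" if "\<epsilon> = 1 \<or> \<epsilon> = - 1" for k l m n \<epsilon> :: int
    using no1[OF that, of k m n] by blast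
  show ?thesis
    using e(1,3)
  proof (cases rule: edge_cases)
    case (2 k m \<epsilon>)
    note A = 2
    show ?thesis
      using e(2,4)
    proof (cases rule: edge_cases)
      case (2 l n \<epsilon>')
      have kl: "k = l" using gap_unique A 2 by blast
      \<comment> \<open>The relative position in the gap, strictly between 0 and 1. It gives
        \<open>\<bar>m - n\<bar> < 2\<close>, and since \<open>m - n\<close> is even both slants
        start in the same point.\<close>
      define \<theta> where "\<theta> = (z$1 - b k) / (a (k + 1) - b k)"
      have d: "a (k + 1) - b k > 0" using step[of k] by simp
      have \<theta>: "0 < \<theta>" "\<theta> < 1" using A d by (simp_all add: \<theta>_def)
      have "z$2 - 2 * of_int m = 2 * of_int \<epsilon> * \<theta>" "z$2 - 2 * of_int n = 2 * of_int \<epsilon>' * \<theta>"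
        using A(6) 2(6) kl d by (simp_all add: \<theta>_def field_simps)
      then have diff: "of_int (m - n) = (of_int \<epsilon>' - of_int \<epsilon>) * \<theta>" by (simp add: algebra_simps)
      have "even (m - n)" using A(1) 2(1) kl by presburger
      have "\<bar>of_int (m - n) :: real\<bar> < 2" using diff A(2) 2(2) \<theta> by auto
      then have "\<bar>m - n\<bar> < 2" by linarith
      then have "m = n" using \<open>even (m - n)\<close> by presburger
      then have "of_int \<epsilon>' = (of_int \<epsilon> :: real)" using diff \<theta> by simp
      then show ?thesis using A 2 kl \<open>m = n\<close> by simp
    qed (use A e(5) bars no1 in blast)+
  next
    case (3 k m)
    note A = 3
    show ?thesis
      using e(2,4)
    proof (cases rule: edge_cases)
      case (3 l n)
      have "k = l" using A 3 b_le_a[of k l] b_le_a[of l k] by (cases k l rule: linorder_cases) auto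
      then show ?thesis using A 3 by simp
    qed (use A e(5) bars barbridge in blast)+
  next
    case (4 k m)
    note A = 4
    show ?thesis
      using e(2,4)
    proof (cases rule: edge_cases)
      case (4 l n)
      have mn: "m = n" using A 4 by simp
      have "\<not> k + 1 < l" using A 4 a_le[of "k + 1" "l - 1"] ab[of "l - 1"] by auto
      moreover have "\<not> l + 1 < k" using A 4 a_le[of "l + 1" "k - 1"] ab[of "k - 1"] by auto
      moreover have "even (k - l)" using A(1) 4(1) mn by presburger
      ultimately have "k = l" by presburger
      then show ?thesis using A 4 mn by simp
    qed (use A e(5) barbridge no1 in blast)+
  qed (use e(5) in blast)
qed

lemma validD:
  assumes "valid k m j" shows "odd (k + m)" "j = 0 \<or> j = 1 \<or> j = - 1" "flat k \<longleftrightarrow> j \<noteq> 0"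
  using assms by (auto simp: valid_def split: if_splits)

text \<open>Resolving the absolute values shows that a face is a polyhedron whose interior is given
  by the strict inequalities. For \<open>j = 0\<close> the last half-plane would be degenerate and
  is replaced by \<open>UNIV\<close>.\<close>

lemma face_halfplanes:
  "face k m j = halfplane 0 1 (2 + 2 * of_int m) \<inter> halfplane 0 (- 1) (2 - 2 * of_int m)
    \<inter> halfplane (- 2) (a k - b (k - 1)) ((a k - b (k - 1)) * (2 * of_int m) - 2 * b (k - 1))
    \<inter> halfplane (- 2) (- (a k - b (k - 1))) (- (a k - b (k - 1)) * (2 * of_int m) - 2 * b (k - 1))
    \<inter> halfplane 2 (a (k + 1) - b k) ((a (k + 1) - b k) * (2 * of_int m) + 2 * a (k + 1))
    \<inter> halfplane 2 (- (a (k + 1) - b k)) (- (a (k + 1) - b k) * (2 * of_int m) + 2 * a (k + 1))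
    \<inter> (if j = 0 then UNIV else halfplane 0 (- of_int j) (- of_int j * (2 * of_int m)))"
proof -
  have *: "d * \<bar>y\<bar> \<le> u \<longleftrightarrow> d * y \<le> u \<and> - (d * y) \<le> u" if "0 < d" for d y u :: real
  proof -
    have "d * \<bar>y\<bar> = \<bar>d * y\<bar>" using that by (simp add: abs_mult)
    then show ?thesis by (auto simp: abs_le_iff)
  qed
  have d: "0 < a k - b (k - 1)" "0 < a (k + 1) - b k" using step[of k] prev_step[of k] by auto
  show ?thesis
    unfolding face_def *[OF d(1)] *[OF d(2)] halfplane_def
    by (rule set_eqI) (auto simp: algebra_simps abs_le_iff)
qed

lemma face_range: assumes "z \<in> face k m j" shows "b (k - 1) \<le> z$1" "z$1 \<le> a (k + 1)" "\<bar>z$2 - 2 * of_int m\<bar> \<le> 2"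
proof -
  have "0 \<le> (a k - b (k - 1)) * \<bar>z$2 - 2 * of_int m\<bar>" "0 \<le> (a (k + 1) - b k) * \<bar>z$2 - 2 * of_int m\<bar>"
    using step[of k] prev_step[of k] by auto
  then show "b (k - 1) \<le> z$1" "z$1 \<le> a (k + 1)" "\<bar>z$2 - 2 * of_int m\<bar> \<le> 2" using assms by (auto simp: face_def)
qed

lemma polytope_face: "polytope (face k m j)"
proof -
  have "polyhedron (face k m j)" unfolding face_halfplanes by (auto intro!: polyhedron_Int polyhedron_halfplane)
  moreover have "face k m j \<subseteq> cbox (pt (b (k - 1)) (2 * of_int m - 2)) (pt (a (k + 1)) (2 * of_int m + 2))"
    using face_range by (fastforce simp: mem_cbox_pt abs_le_iff)
  ultimately show ?thesis using bounded_subset[OF bounded_cbox] polytope_eq_bounded_polyhedron by blast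
qed

lemma interior_face:
  "interior (face k m j) = {z. \<bar>z$2 - 2 * of_int m\<bar> < 2
     \<and> (a k - b (k - 1)) * \<bar>z$2 - 2 * of_int m\<bar> < 2 * (z$1 - b (k - 1))
     \<and> (a (k + 1) - b k) * \<bar>z$2 - 2 * of_int m\<bar> < 2 * (a (k + 1) - z$1)
     \<and> (j = 0 \<or> 0 < of_int j * (z$2 - 2 * of_int m))}"
proof -
  have *: "d * \<bar>y\<bar> < u \<longleftrightarrow> d * y < u \<and> - (d * y) < u" if "0 < d" for d y u :: real
  proof -
    have "d * \<bar>y\<bar> = \<bar>d * y\<bar>" using that by (simp add: abs_mult)
    then show ?thesis by (auto simp: abs_less_iff)
  qed
  have d: "0 < a k - b (k - 1)" "0 < a (k + 1) - b k" using step[of k] prev_step[of k] by auto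
  show ?thesis
  proof (cases "j = 0")
    case True
    then show ?thesis
      unfolding face_halfplanes *[OF d(1)] *[OF d(2)]
      by (simp add: interior_halfplane) (rule set_eqI, auto simp: algebra_simps abs_less_iff)
  next
    case False
    then show ?thesis
      unfolding face_halfplanes *[OF d(1)] *[OF d(2)]
      by (simp add: interior_halfplane) (rule set_eqI, auto simp: algebra_simps abs_less_iff)
  qed
qed

lemma closed_face: "closed (face k m j)"
  using polytope_face polytope_imp_closed by blast

text \<open>The sides of a face as a combinatorial list; \<open>\<epsilon>\<close> tells whether a
  side belongs to the upper or the lower half. The right slants start above or below the centre and
  end in the right corner, which has height \<open>2 * m\<close>.\<close>

definition border :: "int \<Rightarrow> int \<Rightarrow> int \<Rightarrow> plane set set" where
  "border k m j = {e. (\<exists>\<epsilon>. (\<epsilon> = 1 \<or> \<epsilon> = - 1) \<and> (j = 0 \<or> \<epsilon> = j) \<and>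
      (e = slant (k - 1) m \<epsilon> \<or> e = slant k (m + \<epsilon>) (- \<epsilon>) \<or> e = bar k (m + \<epsilon>) \<and> j = 0 \<and> b k = a k + 2))
    \<or> e = bridge k m \<and> j \<noteq> 0}"

lemma border_E: assumes v: "valid k m j" shows "border k m j \<subseteq> E"
proof -
  note vD = validD[OF v]
  have 1: "slant (k - 1) m \<epsilon> \<in> E" if "\<epsilon> = 1 \<or> \<epsilon> = - 1" for \<epsilon>
  proof -
    have "even (k - 1 + m)" using vD(1) by presburger
    then show ?thesis unfolding E_def using that by blast
  qed
  have 2: "slant k (m + \<epsilon>) (- \<epsilon>) \<in> E" "even (k + (m + \<epsilon>))" if "\<epsilon> = 1 \<or> \<epsilon> = - 1" for \<epsilon>
  proof -
    show "even (k + (m + \<epsilon>))" using vD(1) that by presburger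
    moreover have "- \<epsilon> = 1 \<or> - \<epsilon> = - 1" using that by auto
    ultimately show "slant k (m + \<epsilon>) (- \<epsilon>) \<in> E" unfolding E_def by blast
  qed
  have 3: "bar k (m + \<epsilon>) \<in> E" if "\<epsilon> = 1 \<or> \<epsilon> = - 1" "b k = a k + 2" for \<epsilon>
    using 2(2)[OF that(1)] that(2) unfolding E_def by blast
  have 4: "bridge k m \<in> E" if "j \<noteq> 0" using that vD(1,3) unfolding E_def by blast
  show ?thesis unfolding border_def using 1 2 3 4 by auto
qed

lemma finite_border: "finite (border k m j)" and card_border: "valid k m j \<Longrightarrow> card (border k m j) \<le> 6"
proof -
  let ?s = "[slant (k - 1) m 1, slant (k - 1) m (-1), slant k (m + 1) (-1), slant k (m - 1) 1, bar k (m + 1), bar k (m - 1)]"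
  let ?t = "[slant (k - 1) m j, slant k (m + j) (- j), bridge k m]"
  let ?S = "set ?s" and ?T = "set ?t"
  have mm: "m + - 1 = m - 1" "- (- 1) = (1::int)" by simp_all
  have S: "border k m j \<subseteq> ?S" if "j = 0"
  proof
    fix e assume "e \<in> border k m j"
    then obtain \<epsilon> where "\<epsilon> = 1 \<or> \<epsilon> = - 1" "e = slant (k - 1) m \<epsilon> \<or> e = slant k (m + \<epsilon>) (- \<epsilon>) \<or> e = bar k (m + \<epsilon>)"
      using \<open>j = 0\<close> unfolding border_def by blast
    then show "e \<in> ?S" by (elim disjE) (simp_all only: mm list.set insert_iff simp_thms)
  qed
  have T: "border k m j \<subseteq> ?T" if "j \<noteq> 0"
  proof
    fix e assume "e \<in> border k m j"
    then have "e = slant (k - 1) m j \<or> e = slant k (m + j) (- j) \<or> e = bridge k m"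
      using \<open>j \<noteq> 0\<close> unfolding border_def by blast
    then show "e \<in> ?T" by simp
  qed
  have sub: "border k m j \<subseteq> ?S \<union> ?T" using S T by blast
  then show "finite (border k m j)" by (rule finite_subset) auto
  assume "valid k m j"
  show "card (border k m j) \<le> 6"
  proof (cases "j = 0")
    case True
    then have "card (border k m j) \<le> card ?S" using S by (intro card_mono) auto
    also have "\<dots> \<le> 6" using card_length[of ?s] by (simp only: list.size)
    finally show ?thesis .
  next
    case False
    then have "card (border k m j) \<le> card ?T" using T by (intro card_mono) auto
    also have "\<dots> \<le> 6" using card_length[of ?t] by simp
    finally show ?thesis .
  qed
qed

text \<open>A point of the face is on the boundary if and only if one of the defining inequalities
  is an equality, and each equality describes one kind of side.\<close>

lemma frontier_face: assumes v: "valid k m j" shows "frontier (face k m j) = \<Union>(border k m j)"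
proof
  note vD = validD[OF v]
  define p s d d' where "p = b (k - 1)" and "s = a (k + 1)" and "d = a k - b (k - 1)" and "d' = a (k + 1) - b k"
  have d: "d > 0" "d' > 0" using step[of k] prev_step[of k] by (auto simp: d_def d'_def)
  have ps: "a k = p + d" "b k = s - d'" "p + d \<le> s - d'" using ab[of k] by (auto simp: d_def d'_def p_def s_def)
  have face: "z \<in> face k m j \<longleftrightarrow> \<bar>z$2 - 2 * of_int m\<bar> \<le> 2 \<and> d * \<bar>z$2 - 2 * of_int m\<bar> \<le> 2 * (z$1 - p)
      \<and> d' * \<bar>z$2 - 2 * of_int m\<bar> \<le> 2 * (s - z$1) \<and> 0 \<le> of_int j * (z$2 - 2 * of_int m)" for z
    by (simp add: face_def p_def s_def d_def d'_def)
  have int: "z \<in> interior (face k m j) \<longleftrightarrow> \<bar>z$2 - 2 * of_int m\<bar> < 2 \<and> d * \<bar>z$2 - 2 * of_int m\<bar> < 2 * (z$1 - p)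
      \<and> d' * \<bar>z$2 - 2 * of_int m\<bar> < 2 * (s - z$1) \<and> (j = 0 \<or> 0 < of_int j * (z$2 - 2 * of_int m))" for z
    by (simp add: interior_face p_def s_def d_def d'_def)
  have left: "z \<in> slant (k - 1) m \<epsilon> \<longleftrightarrow> p \<le> z$1 \<and> z$1 \<le> p + d \<and> (z$2 - 2 * of_int m) * d = 2 * of_int \<epsilon> * (z$1 - p)" for z \<epsilon>
    by (simp add: slant_iff p_def d_def)
  have right: "z \<in> slant k (m + \<epsilon>) (- \<epsilon>) \<longleftrightarrow> s - d' \<le> z$1 \<and> z$1 \<le> s \<and> (z$2 - 2 * of_int m) * d' = 2 * of_int \<epsilon> * (s - z$1)" for z \<epsilon>
    unfolding slant_iff ps(2) s_def[symmetric] by (auto simp: algebra_simps)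
  show "frontier (face k m j) \<subseteq> \<Union>(border k m j)"
  proof
    fix z assume "z \<in> frontier (face k m j)"
    then have z: "z \<in> face k m j" "z \<notin> interior (face k m j)" using closed_face by (auto simp: frontier_def)
    define y where "y = z$2 - 2 * of_int m"
    have zf: "\<bar>y\<bar> \<le> 2" "d * \<bar>y\<bar> \<le> 2 * (z$1 - p)" "d' * \<bar>y\<bar> \<le> 2 * (s - z$1)" "0 \<le> of_int j * y"
      using z(1) by (auto simp: face y_def)
    have le: "d * \<bar>y\<bar> \<le> d * 2" "d' * \<bar>y\<bar> \<le> d' * 2" using zf(1) d by (auto intro: mult_left_mono)
    have nn: "0 \<le> d * \<bar>y\<bar>" "0 \<le> d' * \<bar>y\<bar>" using d by auto
    \<comment> \<open>The half of the face that contains the point; on the axis of an undivided face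
      either would do.\<close>
    obtain \<epsilon> :: int where \<epsilon>: "\<epsilon> = 1 \<or> \<epsilon> = - 1" "j = 0 \<or> \<epsilon> = j" "y = of_int \<epsilon> * \<bar>y\<bar>"
    proof (cases "j = 0")
      case True
      then show ?thesis using that[of "if 0 \<le> y then 1 else - 1"] by auto
    next
      case False
      then show ?thesis using that[of j] vD(2) zf(4) by auto
    qed
    have L: "z \<in> \<Union>(border k m j)" if "d * \<bar>y\<bar> = 2 * (z$1 - p)"
    proof -
      have "y * d = 2 * of_int \<epsilon> * (z$1 - p)" using that \<epsilon>(3) by (metis mult.assoc mult.commute)
      moreover have "0 \<le> 2 * (z$1 - p)" "2 * (z$1 - p) \<le> d * 2" using nn(1) le(1) unfolding that by auto
      then have "p \<le> z$1" "z$1 \<le> p + d" by auto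
      ultimately have "z \<in> slant (k - 1) m \<epsilon>" by (simp add: left y_def)
      then show ?thesis unfolding border_def using \<epsilon> by blast
    qed
    have R: "z \<in> \<Union>(border k m j)" if "d' * \<bar>y\<bar> = 2 * (s - z$1)"
    proof -
      have "y * d' = 2 * of_int \<epsilon> * (s - z$1)" using that \<epsilon>(3) by (metis mult.assoc mult.commute)
      moreover have "0 \<le> 2 * (s - z$1)" "2 * (s - z$1) \<le> d' * 2" using nn(2) le(2) unfolding that by auto
      then have "s - d' \<le> z$1" "z$1 \<le> s" by auto
      ultimately have "z \<in> slant k (m + \<epsilon>) (- \<epsilon>)" by (simp add: right y_def)
      then show ?thesis unfolding border_def using \<epsilon> by blast
    qed
    \<comment> \<open>At an extreme height a single column leaves only its vertex, which lies on the
      left slant.\<close>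
    have T: "z \<in> \<Union>(border k m j)" if "\<bar>y\<bar> = 2"
    proof -
      have x: "p + d \<le> z$1" "z$1 \<le> s - d'" using zf that by auto
      show ?thesis
      proof (cases "b k = a k + 2")
        case True
        then have "\<not> flat k" using flatD(1) by auto
        then have "j = 0" using vD(3) by simp
        have "z$2 = 2 * of_int (m + \<epsilon>)" using \<epsilon>(3) that by (simp add: y_def)
        then have "z \<in> bar k (m + \<epsilon>)" using x True ps by (simp add: bar_iff)
        then show ?thesis unfolding border_def using \<epsilon> True \<open>j = 0\<close> by blast
      next
        case False
        then have "z$1 = p + d" using w[of k] ps x by auto
        then show ?thesis using L that by simp
      qed
    qed
    have G: "z \<in> \<Union>(border k m j)" if "j \<noteq> 0" "y = 0"
    proof -
      have "flat k" using vD(3) that by simp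
      moreover have "p \<le> z$1" "z$1 \<le> s" using zf that by auto
      ultimately have "z \<in> bridge k m" using that by (simp add: bridge_iff y_def p_def s_def)
      then show ?thesis unfolding border_def using that(1) by blast
    qed
    have "\<bar>y\<bar> = 2 \<or> d * \<bar>y\<bar> = 2 * (z$1 - p) \<or> d' * \<bar>y\<bar> = 2 * (s - z$1) \<or> (j \<noteq> 0 \<and> y = 0)"
      using z(2) zf unfolding int y_def[symmetric] by (auto simp: less_le)
    then show "z \<in> \<Union>(border k m j)" using L R T G by blast
  qed
  have fr: "z \<in> frontier (face k m j)" if "z \<in> face k m j" "z \<notin> interior (face k m j)" for z
    using that closed_face by (simp add: frontier_def)
  have sign: "\<bar>y\<bar> = t \<and> 0 \<le> of_int \<epsilon> * y" if "\<epsilon> = 1 \<or> \<epsilon> = - 1" "y = of_int \<epsilon> * t" "0 \<le> t"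
    for \<epsilon> :: int and y t :: real using that by auto
  show "\<Union>(border k m j) \<subseteq> frontier (face k m j)"
  proof
    fix z assume "z \<in> \<Union>(border k m j)"
    then consider (l) \<epsilon> where "z \<in> slant (k - 1) m \<epsilon>" "\<epsilon> = 1 \<or> \<epsilon> = - 1" "j = 0 \<or> \<epsilon> = j"
      | (r) \<epsilon> where "z \<in> slant k (m + \<epsilon>) (- \<epsilon>)" "\<epsilon> = 1 \<or> \<epsilon> = - 1" "j = 0 \<or> \<epsilon> = j"
      | (b) \<epsilon> where "z \<in> bar k (m + \<epsilon>)" "\<epsilon> = 1 \<or> \<epsilon> = - 1" "j = 0" "b k = a k + 2"
      | (g) "z \<in> bridge k m" "j \<noteq> 0"
      unfolding border_def by blast
    then show "z \<in> frontier (face k m j)"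
    proof cases
      case l
      define y where "y = z$2 - 2 * of_int m"
      have h: "p \<le> z$1" "z$1 \<le> p + d" "y * d = 2 * of_int \<epsilon> * (z$1 - p)" using l(1) by (auto simp: left y_def)
      have "y = of_int \<epsilon> * (2 * (z$1 - p) / d)" using h(3) d by (simp add: field_simps)
      moreover have nn: "0 \<le> 2 * (z$1 - p) / d" using h d by simp
      ultimately have ay: "\<bar>y\<bar> = 2 * (z$1 - p) / d" "0 \<le> of_int \<epsilon> * y" using sign[OF l(2)] by blast+
      have y: "d * \<bar>y\<bar> = 2 * (z$1 - p)" using ay d by simp
      have "\<bar>y\<bar> \<le> 2" unfolding ay(1) using d h by (simp add: pos_divide_le_eq)
      note y = y this
      have "d' * \<bar>y\<bar> \<le> d' * 2" using y d by (intro mult_left_mono) auto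
      then have "z \<in> face k m j" using y ay h ps(3) l(3) unfolding face y_def[symmetric] by auto
      then show ?thesis using y by (intro fr) (auto simp: int y_def)
    next
      case r
      define y where "y = z$2 - 2 * of_int m"
      have h: "s - d' \<le> z$1" "z$1 \<le> s" "y * d' = 2 * of_int \<epsilon> * (s - z$1)" using r(1) by (auto simp: right y_def)
      have "y = of_int \<epsilon> * (2 * (s - z$1) / d')" using h(3) d by (simp add: field_simps)
      moreover have nn: "0 \<le> 2 * (s - z$1) / d'" using h d by simp
      ultimately have ay: "\<bar>y\<bar> = 2 * (s - z$1) / d'" "0 \<le> of_int \<epsilon> * y" using sign[OF r(2)] by blast+
      have y: "d' * \<bar>y\<bar> = 2 * (s - z$1)" using ay d by simp
      have "\<bar>y\<bar> \<le> 2" unfolding ay(1) using d h by (simp add: pos_divide_le_eq)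
      note y = y this
      have "d * \<bar>y\<bar> \<le> d * 2" using y d by (intro mult_left_mono) auto
      then have "z \<in> face k m j" using y ay h ps(3) r(3) unfolding face y_def[symmetric] by auto
      then show ?thesis using y by (intro fr) (auto simp: int y_def)
    next
      case b
      have h: "p + d \<le> z$1" "z$1 \<le> s - d'" "z$2 = 2 * of_int (m + \<epsilon>)" using b(1) bar_iff[OF b(4)] ps by auto
      then have y: "\<bar>z$2 - 2 * of_int m\<bar> = 2" using b(2) by auto
      have "z \<in> face k m j" unfolding face y using h(1,2) b(3) ps(3) by simp
      moreover have "z \<notin> interior (face k m j)" unfolding int y by simp
      ultimately show ?thesis by (rule fr)
    next
      case g
      have "flat k" using vD(3) g by simp
      then have "p \<le> z$1" "z$1 \<le> s" "z$2 = 2 * of_int m" using g bridge_iff by (auto simp: p_def s_def)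
      then show ?thesis using g by (intro fr) (auto simp: face int)
    qed
  qed
qed

end

context columns
begin

lemma convex_polygon_face: assumes "valid k m j" shows "convex_polygon (face k m j)"
proof -
  have "pt (a k) (2 * of_int m + of_int j) \<in> interior (face k m j)"
    using validD(2)[OF assms] step[of k] prev_step[of k] ab[of k] by (auto simp: interior_face)
  then show ?thesis using polytope_face by (auto simp: convex_polygon_def)
qed

lemma near_even: fixes k :: int and y :: real obtains m where "even (k + m)" "\<bar>y - 2 * of_int m\<bar> \<le> 2"
proof (cases "even (k + \<lfloor>y / 2\<rfloor>)")
  case True
  moreover have "\<bar>y - 2 * of_int \<lfloor>y / 2\<rfloor>\<bar> \<le> 2" by linarith
  ultimately show ?thesis using that by blast
next
  case False
  then have "even (k + (\<lfloor>y / 2\<rfloor> + 1))" by presburger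
  moreover have "2 * of_int \<lfloor>y / 2\<rfloor> \<le> y" "y \<le> 2 * of_int \<lfloor>y / 2\<rfloor> + 2" by linarith+
  then have "\<bar>y - 2 * of_int (\<lfloor>y / 2\<rfloor> + 1)\<bar> \<le> 2" unfolding abs_le_iff of_int_add by auto
  ultimately show ?thesis using that by blast
qed

lemma in_face:
  assumes "odd (k + m)" "\<bar>z$2 - 2 * of_int m\<bar> \<le> 2"
    "(a k - b (k - 1)) * \<bar>z$2 - 2 * of_int m\<bar> \<le> 2 * (z$1 - b (k - 1))"
    "(a (k + 1) - b k) * \<bar>z$2 - 2 * of_int m\<bar> \<le> 2 * (a (k + 1) - z$1)"
  shows "z \<in> \<Union>F"
proof -
  define j :: int where "j = (if flat k then if 0 \<le> z$2 - 2 * of_int m then 1 else - 1 else 0)"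
  have "valid k m j" using assms(1) by (simp add: valid_def j_def)
  moreover have "z \<in> face k m j" using assms(2-4) by (simp add: face_def j_def)
  ultimately show ?thesis unfolding F_def by blast
qed

text \<open>Over a column its own faces are stacked without gaps. Over the gap to the next column
  the point is compared with the slants from a nearby row of column \<open>k\<close>: it lies in a
  face of column \<open>k + 1\<close> or of column \<open>k\<close>.\<close>

lemma Union_F: "\<Union>F = UNIV"
proof -
  have "z \<in> \<Union>F" for z
  proof -
    have le: "(a k - b (k - 1)) * \<bar>y\<bar> \<le> (a k - b (k - 1)) * 2" "(a (k + 1) - b k) * \<bar>y\<bar> \<le> (a (k + 1) - b k) * 2"
      if "\<bar>y\<bar> \<le> 2" for k y
      using mult_left_mono[OF that, of "a k - b (k - 1)"] mult_left_mono[OF that, of "a (k + 1) - b k"] step[of k] prev_step[of k] by auto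
    obtain k where k: "a k \<le> z$1" "z$1 < a (k + 1)" using column_at by blast
    show ?thesis
    proof (cases "z$1 \<le> b k")
      case True
      obtain m where m: "even (k + 1 + m)" "\<bar>z$2 - 2 * of_int m\<bar> \<le> 2" using near_even by blast
      from m(1) have "odd (k + m)" by presburger
      then show ?thesis using m(2) le[OF m(2), of k] k True by (intro in_face[of k m]) auto
    next
      case False
      define d where "d = a (k + 1) - b k"
      have d: "0 < d" using step[of k] by (simp add: d_def)
      obtain m where m: "even (k + m)" "\<bar>z$2 - 2 * of_int m\<bar> \<le> 2" using near_even by blast
      show ?thesis
      proof (cases "d * \<bar>z$2 - 2 * of_int m\<bar> \<le> 2 * (z$1 - b k)")
        case True
        then show ?thesis using m le(2)[OF m(2), of "k + 1"] k ab[of "k + 1"]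
          by (intro in_face[of "k + 1" m]) (auto simp: d_def)
      next
        case F: False
        \<comment> \<open>Leads to the next row on the side of the point; the vertical distances
          from the two rows add up to 2.\<close>
        define \<sigma> :: int where "\<sigma> = (if 0 \<le> z$2 - 2 * of_int m then 1 else - 1)"
        have y: "\<bar>z$2 - 2 * of_int (m + \<sigma>)\<bar> = 2 - \<bar>z$2 - 2 * of_int m\<bar>" using m(2) by (auto simp: \<sigma>_def)
        then have y2: "\<bar>z$2 - 2 * of_int (m + \<sigma>)\<bar> \<le> 2" by simp
        have "d * \<bar>z$2 - 2 * of_int (m + \<sigma>)\<bar> \<le> 2 * (a (k + 1) - z$1)"
          using F unfolding y by (simp add: right_diff_distrib d_def)
        moreover have "odd (k + (m + \<sigma>))" using m(1) by (simp add: \<sigma>_def)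
        moreover have "(a k - b (k - 1)) * \<bar>z$2 - 2 * of_int (m + \<sigma>)\<bar> \<le> 2 * (z$1 - b (k - 1))"
          using order_trans[OF le(1)[OF y2, of k], of "2 * (z$1 - b (k - 1))"] k by simp
        ultimately show ?thesis using y2 by (intro in_face[of k "m + \<sigma>"]) (simp_all add: d_def)
      qed
    qed
  qed
  then show ?thesis by blast
qed

text \<open>Only faces of equal or consecutive columns overlap horizontally. For consecutive columns
  the two slant inequalities add up to the estimate that the vertical distances from the centres
  have sum less than 2, so the rows agree, against parity. For equal columns parity gives equal
  rows, and the sign of the height then determines \<open>j\<close>.\<close>

lemma interiors_meet:
  assumes v: "valid k m j" "valid l n i" and z: "z \<in> interior (face k m j)" "z \<in> interior (face l n i)"
  shows "k = l \<and> m = n \<and> j = i"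
proof -
  have sub: "b (k - 1) < z$1 \<and> z$1 < a (k + 1)" if "z \<in> interior (face k m j)" for k m j
  proof -
    have "0 \<le> (a k - b (k - 1)) * \<bar>z$2 - 2 * of_int m\<bar>" "0 \<le> (a (k + 1) - b k) * \<bar>z$2 - 2 * of_int m\<bar>"
      using step[of k] prev_step[of k] by auto
    then show ?thesis using that by (auto simp: interior_face)
  qed
  have next_col: False if v: "valid k m j" "valid (k + 1) n i" and z: "z \<in> interior (face k m j)" "z \<in> interior (face (k + 1) n i)"
    for k m j n i
  proof -
    define d where "d = a (k + 1) - b k"
    have d: "0 < d" using step[of k] by (simp add: d_def)
    have "d * \<bar>z$2 - 2 * of_int m\<bar> < 2 * (a (k + 1) - z$1)" "d * \<bar>z$2 - 2 * of_int n\<bar> < 2 * (z$1 - b k)"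
      using z by (auto simp: interior_face d_def)
    then have "d * (\<bar>z$2 - 2 * of_int m\<bar> + \<bar>z$2 - 2 * of_int n\<bar>) < d * 2" by (simp add: distrib_left d_def)
    then have "\<bar>z$2 - 2 * of_int m\<bar> + \<bar>z$2 - 2 * of_int n\<bar> < 2" using d by simp
    then have "m = n" by linarith
    then show False using validD(1)[OF v(1)] validD(1)[OF v(2)] by simp
  qed
  have "\<not> k + 1 < l" using sub[OF z(1)] sub[OF z(2)] a_le[of "k + 1" "l - 1"] ab[of "l - 1"] by auto
  moreover have "\<not> l + 1 < k" using sub[OF z(1)] sub[OF z(2)] a_le[of "l + 1" "k - 1"] ab[of "k - 1"] by auto
  moreover have "l \<noteq> k + 1" using next_col v z by blast
  moreover have "k \<noteq> l + 1" using next_col[of l n i m j] v z by blast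
  ultimately have kl: "k = l" by linarith
  have "\<bar>z$2 - 2 * of_int m\<bar> < 2" "\<bar>z$2 - 2 * of_int n\<bar> < 2" using z by (auto simp: interior_face)
  then have "\<bar>m - n\<bar> < 2" by linarith
  moreover have "even (m - n)" using validD(1)[OF v(1)] validD(1)[OF v(2)] kl by presburger
  ultimately have mn: "m = n" by presburger
  have "j = 0 \<or> 0 < of_int j * (z$2 - 2 * of_int m)" "i = 0 \<or> 0 < of_int i * (z$2 - 2 * of_int m)"
    using z mn by (auto simp: interior_face)
  then have "j = i" using validD(2,3)[OF v(1)] validD(2,3)[OF v(2)] kl by auto
  then show ?thesis using kl mn by simp
qed

lemma locally_finite_F: "locally_finite_in euclidean F"
proof -
  have "finite {P \<in> F. P \<inter> ball z 1 \<noteq> {}}" for z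
  proof -
    obtain k0 where k0: "a k0 \<le> z$1 + 1" "z$1 + 1 < a (k0 + 1)" using column_at by blast
    obtain k1 where k1: "a k1 \<le> z$1 - 1" "z$1 - 1 < a (k1 + 1)" using column_at by blast
    let ?I = "{k1 - 1..k0 + 1} \<times> {\<lfloor>z$2 / 2\<rfloor> - 3..\<lfloor>z$2 / 2\<rfloor> + 3} \<times> {- 1..1}"
    have "{P \<in> F. P \<inter> ball z 1 \<noteq> {}} \<subseteq> (\<lambda>(k, m, j). face k m j) ` ?I"
    proof
      fix P assume "P \<in> {P \<in> F. P \<inter> ball z 1 \<noteq> {}}"
      then obtain u where "u \<in> P" "dist z u < 1" "P \<in> F" by auto
      then obtain k m j where P: "P = face k m j" "valid k m j" "u \<in> face k m j" "dist z u < 1" unfolding F_def by blast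
      have "\<bar>(z - u)$i\<bar> < 1" for i using component_le_norm_cart[of "z - u" i] P(4) by (simp add: dist_norm)
      from this[of 1] this[of 2] have u: "\<bar>z$1 - u$1\<bar> < 1" "\<bar>z$2 - u$2\<bar> < 1" by simp_all
      note h = face_range[OF P(3)]
      have "k - 1 < k0 + 1"
      proof (rule ccontr)
        assume "\<not> ?thesis"
        then have "a (k0 + 1) \<le> b (k - 1)" using a_le[of "k0 + 1" "k - 1"] ab[of "k - 1"] by simp
        then show False using h u k0 by linarith
      qed
      moreover have "k1 \<le> k + 1"
      proof (rule ccontr)
        assume "\<not> ?thesis"
        then have "a (k + 1) \<le> a k1" using a_le[of "k + 1" k1] by simp
        then show False using h u k1 by linarith
      qed
      moreover have "\<lfloor>z$2 / 2\<rfloor> - 3 \<le> m" "m \<le> \<lfloor>z$2 / 2\<rfloor> + 3" using h(3) u by linarith+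
      moreover have "j \<in> {- 1..1}" using validD(2)[OF P(2)] by auto
      ultimately have "(k, m, j) \<in> ?I" by simp
      then show "P \<in> (\<lambda>(k, m, j). face k m j) ` ?I" unfolding P(1) by force
    qed
    then show ?thesis by (rule finite_subset) simp
  qed
  note fin = this
  show ?thesis unfolding locally_finite_in_def topspace_euclidean
  proof (intro conjI ballI)
    fix z :: plane
    show "\<exists>V. openin euclidean V \<and> z \<in> V \<and> finite {P \<in> F. P \<inter> V \<noteq> {}}"
      using fin[of z] by (intro exI[of _ "ball z 1"]) auto
  qed simp
qed

text \<open>An edge in the boundary shares its midpoint, which is no vertex, with a listed side;
  edges with a common inner point are equal.\<close>

lemma sides_face: assumes v: "valid k m j" shows "sides E (face k m j) = border k m j"
proof
  show "border k m j \<subseteq> sides E (face k m j)" using border_E[OF v] frontier_face[OF v] unfolding sides_def by blast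
  show "sides E (face k m j) \<subseteq> border k m j"
  proof
    fix e assume "e \<in> sides E (face k m j)"
    then have e: "e \<in> E" "e \<subseteq> \<Union>(border k m j)" unfolding sides_def frontier_face[OF v] by auto
    obtain x y where xy: "x \<noteq> y" "e = closed_segment x y" "e \<inter> X = {x, y}" using edge_X[OF e(1)] by blast
    have mid_e: "midpoint x y \<in> e" unfolding xy(2) by (rule midpoint_in_closed_segment)
    have "midpoint x y \<notin> {x, y}" using xy(1) by (simp add: midpoint_eq_endpoint)
    then have "midpoint x y \<notin> X" using mid_e unfolding xy(3)[symmetric] by simp
    note mid = mid_e this
    obtain e' where e': "e' \<in> border k m j" "midpoint x y \<in> e'" using subsetD[OF e(2) mid(1)] by (rule UnionE)
    have "e = e'" using edges_equal[OF e(1) subsetD[OF border_E[OF v] e'(1)] mid(1) e'(2) mid(2)] .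
    then show "e \<in> border k m j" using e'(1) by simp
  qed
qed

lemma edge_is_side: assumes "e \<in> E" shows "\<exists>P\<in>F. e \<in> sides E P"
proof -
  have *: ?thesis if "valid k m j" "e \<in> border k m j" for k m j
    using that sides_face[OF that(1)] unfolding F_def by blast
  consider (s) k m \<epsilon> where "even (k + m)" "\<epsilon> = 1 \<or> \<epsilon> = - 1" "e = slant k m \<epsilon>"
    | (f) k m where "even (k + m)" "b k = a k + 2" "e = bar k m"
    | (g) k m where "odd (k + m)" "flat k" "e = bridge k m"
    using assms unfolding E_def by blast
  then show ?thesis
  proof cases
    case s
    have "odd (k + (m + \<epsilon>))" using s by auto
    then have "valid k (m + \<epsilon>) (if flat k then - \<epsilon> else 0)" using s(2) by (auto simp: valid_def)
    moreover have "e = slant k ((m + \<epsilon>) + - \<epsilon>) (- (- \<epsilon>))" using s(3) by simp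
    then have "e \<in> border k (m + \<epsilon>) (if flat k then - \<epsilon> else 0)" unfolding border_def using s(2)
      by (intro CollectI disjI1 exI[of _ "- \<epsilon>"]) auto
    ultimately show ?thesis by (rule *)
  next
    case f
    have "odd (k + (m + 1))" using f(1) by presburger
    then have "valid k (m + 1) 0" using flatD(1)[of k] f(2) by (auto simp: valid_def)
    moreover have "e \<in> border k (m + 1) 0" unfolding border_def using f
      by (intro CollectI disjI1 exI[of _ "- 1"]) auto
    ultimately show ?thesis by (rule *)
  next
    case g
    then have "valid k m 1" by (simp add: valid_def)
    moreover have "e \<in> border k m 1" unfolding border_def using g(3) by simp
    ultimately show ?thesis by (rule *)
  qed
qed

lemma X_covered: "X \<subseteq> \<Union>E"
proof
  fix z assume "z \<in> X"
  then obtain k m where km: "even (k + m)" "z$1 = a k \<or> z$1 = b k" "z$2 = 2 * of_int m" using mem_X_iff by blast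
  have "even (k - 1 + (m - 1))" using km(1) by presburger
  then have "slant k m 1 \<in> E" "slant (k - 1) (m - 1) 1 \<in> E" using km(1) unfolding E_def by blast+
  moreover have "z \<in> slant k m 1 \<or> z \<in> slant (k - 1) (m - 1) 1"
    using km(2,3) step[of k] prev_step[of k] by (auto simp: slant_iff)
  ultimately show "z \<in> \<Union>E" by blast
qed

lemma subdivision: "convex_subdivision X E F" "P \<in> F \<Longrightarrow> finite (sides E P) \<and> card (sides E P) \<le> 6"
proof -
  have "pairwise (\<lambda>P Q. interior P \<inter> interior Q = {}) F"
    unfolding pairwise_def F_def using interiors_meet by blast
  moreover have "pairwise (\<lambda>e e'. e \<inter> e' \<subseteq> X) E" unfolding pairwise_def using edges_equal by blast
  moreover have "\<forall>P\<in>F. frontier P = \<Union>(sides E P)" "\<forall>P\<in>F. convex_polygon P"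
    unfolding F_def using frontier_face sides_face convex_polygon_face by auto
  ultimately show "convex_subdivision X E F" unfolding convex_subdivision_def
    using edge_X X_covered Union_F locally_finite_F edge_is_side by blast
  show "P \<in> F \<Longrightarrow> finite (sides E P) \<and> card (sides E P) \<le> 6"
    unfolding F_def using sides_face finite_border card_border by auto
qed

section \<open>Contacts between translates placed at the column points\<close>

lemma hnorm_pt: "hnorm r (pt x y - pt x' y') = max \<bar>y - y'\<bar> (\<bar>x - x'\<bar> + (1 - r) * \<bar>y - y'\<bar>)"
  by (simp add: hnorm_def)

text \<open>Columns of equal parity use the same rows. So different heights in one column, or in
  columns \<open>k\<close> and \<open>k + 2\<close>, differ by at least 4; consecutive columns share
  no height; and columns three or more apart are too far horizontally. There remain pairs, slants
  and bridges.\<close>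

lemma contact:
  assumes "even (k + m)" "even (l + n)" and x: "x = a k \<or> x = b k" and x': "x' = a l \<or> x' = b l" and "k \<le> l"
    and ne: "x \<noteq> x' \<or> m \<noteq> n"
  shows "2 \<le> hnorm r (pt x' (2 * of_int n) - pt x (2 * of_int m))" (is "2 \<le> ?h")
    and "hnorm r (pt x' (2 * of_int n) - pt x (2 * of_int m)) \<le> 2 \<longleftrightarrow>
      l = k \<and> n = m \<and> b k = a k + 2 \<or>
      l = k + 1 \<and> (n = m + 1 \<or> n = m - 1) \<and> x = b k \<and> x' = a (k + 1) \<or>
      l = k + 2 \<and> n = m \<and> x = b k \<and> x' = a (k + 2) \<and> flat (k + 1)"
proof -
  define H where "H = ?h"
  have h: "H = max (2 * \<bar>of_int (n - m)\<bar>) (\<bar>x' - x\<bar> + (1 - r) * (2 * \<bar>of_int (n - m)\<bar>))"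
  proof -
    have "\<bar>2 * of_int n - 2 * of_int m\<bar> = \<bar>2 * real_of_int (n - m)\<bar>" by simp
    also have "\<dots> = 2 * \<bar>real_of_int (n - m)\<bar>" by (simp only: abs_mult abs_numeral)
    finally have *: "\<bar>2 * of_int n - 2 * of_int m\<bar> = 2 * \<bar>real_of_int (n - m)\<bar>" .
    show ?thesis unfolding H_def hnorm_pt * ..
  qed
  have par: "even (l - k) \<longleftrightarrow> even (n - m)" using assms(1,2) by presburger
  have r0: "0 \<le> (1 - r) * (2 * \<bar>of_int (n - m)\<bar>)" using r by simp
  consider "l = k" | "l = k + 1" | "l = k + 2" | "k + 3 \<le> l" using \<open>k \<le> l\<close> by linarith
  then have "2 \<le> H \<and> (H \<le> 2 \<longleftrightarrow> l = k \<and> n = m \<and> b k = a k + 2 \<or>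
      l = k + 1 \<and> (n = m + 1 \<or> n = m - 1) \<and> x = b k \<and> x' = a (k + 1) \<or>
      l = k + 2 \<and> n = m \<and> x = b k \<and> x' = a (k + 2) \<and> flat (k + 1))"
  proof cases
    case 1
    show ?thesis
    proof (cases "n = m")
      case True
      then have "\<bar>x' - x\<bar> = 2" "b k = a k + 2" using x x' 1 ne w[of k] by auto
      then show ?thesis unfolding h using True 1 by simp
    next
      case False
      then have "2 \<le> \<bar>n - m\<bar>" using par 1 by presburger
      then have "2 \<le> \<bar>real_of_int (n - m)\<bar>" by linarith
      then have "4 \<le> 2 * \<bar>real_of_int (n - m)\<bar>" using mult_left_mono[of 2 "\<bar>real_of_int (n - m)\<bar>" 2] by simp
      then have "4 \<le> H" unfolding h by (rule max.coboundedI1)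
      then show ?thesis using False 1 by auto
    qed
  next
    case 2
    then have "odd (n - m)" using par by simp
    show ?thesis
    proof (cases "n = m + 1 \<or> n = m - 1")
      case True
      then have n1: "\<bar>real_of_int (n - m)\<bar> = 1" by auto
      have "x \<le> b k" "a (k + 1) \<le> x'" using x x' 2 ab by auto
      moreover have "x = b k \<or> x = b k - 2" "x' = a (k + 1) \<or> x' = a (k + 1) + 2" using x x' 2 w by (metis add_diff_cancel_right')+
      ultimately have "H \<le> 2 \<longleftrightarrow> x = b k \<and> x' = a (k + 1)" "2 \<le> H"
        unfolding h n1 using s1[of k] s2[of k] r by auto
      then show ?thesis using True 2 by simp
    next
      case False
      then have "2 \<le> \<bar>n - m\<bar>" using \<open>odd (n - m)\<close> by presburger
      then have "2 \<le> \<bar>real_of_int (n - m)\<bar>" by linarith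
      then have "4 \<le> 2 * \<bar>real_of_int (n - m)\<bar>" using mult_left_mono[of 2 "\<bar>real_of_int (n - m)\<bar>" 2] by simp
      then have "4 \<le> H" unfolding h by (rule max.coboundedI1)
      then show ?thesis using False 2 by auto
    qed
  next
    case 3
    show ?thesis
    proof (cases "n = m")
      case True
      have "x \<le> b k" "a (k + 2) \<le> x'" using x x' 3 ab by auto
      moreover have "b k + 2 \<le> a (k + 2)" using mono_cols[of k "k + 2"] by simp
      moreover have "flat (k + 1) \<longleftrightarrow> a (k + 2) = b k + 2" by (simp add: flat_def add.assoc)
      ultimately show ?thesis unfolding h using True 3 by auto
    next
      case False
      then have "2 \<le> \<bar>n - m\<bar>" using par 3 by presburger
      then have "2 \<le> \<bar>real_of_int (n - m)\<bar>" by linarith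
      then have "4 \<le> 2 * \<bar>real_of_int (n - m)\<bar>" using mult_left_mono[of 2 "\<bar>real_of_int (n - m)\<bar>" 2] by simp
      then have "4 \<le> H" unfolding h by (rule max.coboundedI1)
      then show ?thesis using False 3 by auto
    qed
  next
    case 4
    have "b k + real_of_int (l - k) \<le> a l" using mono_cols[of k l] 4 by simp
    moreover have "3 \<le> real_of_int (l - k)" using 4 by linarith
    moreover have "x \<le> b k" "a l \<le> x'" using x x' ab by auto
    ultimately have "3 \<le> \<bar>x' - x\<bar>" by linarith
    then have "3 \<le> H" unfolding h using add_mono[OF _ r0, of 3 "\<bar>x' - x\<bar>"] by (intro max.coboundedI2) simp
    then show ?thesis using 4 by auto
  qed
  then show "2 \<le> ?h" "?h \<le> 2 \<longleftrightarrow> l = k \<and> n = m \<and> b k = a k + 2 \<or>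
      l = k + 1 \<and> (n = m + 1 \<or> n = m - 1) \<and> x = b k \<and> x' = a (k + 1) \<or>
      l = k + 2 \<and> n = m \<and> x = b k \<and> x' = a (k + 2) \<and> flat (k + 1)" unfolding H_def by blast+
qed

lemma hnorm_minus: "hnorm r (p - q) = hnorm r (q - p)"
  by (simp add: hnorm_def abs_minus_commute)

lemma contact_edge:
  assumes p: "p \<in> X" "q \<in> X" "p \<noteq> q"
  shows "2 \<le> hnorm r (q - p)" "hnorm r (q - p) \<le> 2 \<Longrightarrow> closed_segment p q \<in> E"
proof -
  have main: "2 \<le> hnorm r (q - p) \<and> (hnorm r (q - p) \<le> 2 \<longrightarrow> closed_segment p q \<in> E)"
    if pq: "p = pt x (2 * of_int m)" "q = pt x' (2 * of_int n)" "even (k + m)" "even (l + n)"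
      "x = a k \<or> x = b k" "x' = a l \<or> x' = b l" "k \<le> l" "p \<noteq> q" for p q x x' m n k l
  proof -
    have "x \<noteq> x' \<or> m \<noteq> n" using pq by auto
    note c = contact[OF pq(3-7) this]
    have "closed_segment p q \<in> E" if h: "hnorm r (q - p) \<le> 2"
    proof -
      consider "l = k" "n = m" "b k = a k + 2"
        | "l = k + 1" "n = m + 1 \<or> n = m - 1" "x = b k" "x' = a (k + 1)"
        | "l = k + 2" "n = m" "x = b k" "x' = a (k + 2)" "flat (k + 1)"
        using c(2) h unfolding pq(1,2) by blast
      then show ?thesis
      proof cases
        case 1
        then have "closed_segment p q = bar k m"
          using pq(1,2,5,6,8) by (auto simp: bar_def closed_segment_commute)
        then show ?thesis using 1 pq(3) unfolding E_def by blast
      next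
        case 2
        then have "closed_segment p q = slant k m (n - m)" unfolding pq(1,2) slant_def by auto
        moreover have "n - m = 1 \<or> n - m = - 1" using 2 by auto
        ultimately show ?thesis using pq(3) unfolding E_def by blast
      next
        case 3
        then have "closed_segment p q = bridge (k + 1) m" unfolding pq(1,2) bridge_def by (simp add: add_ac)
        moreover have "odd (k + 1 + m)" using pq(3) by presburger
        ultimately show ?thesis using 3 unfolding E_def by blast
      qed
    qed
    then show ?thesis using c(1) unfolding pq(1,2) by blast
  qed
  obtain x x' m n k l where pq: "p = pt x (2 * of_int m)" "q = pt x' (2 * of_int n)" "even (k + m)" "even (l + n)"
      "x = a k \<or> x = b k" "x' = a l \<or> x' = b l"
    using p unfolding X_def by blast
  have "2 \<le> hnorm r (q - p) \<and> (hnorm r (q - p) \<le> 2 \<longrightarrow> closed_segment p q \<in> E)"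
  proof (cases "k \<le> l")
    case True
    show ?thesis using main[OF pq True p(3)] .
  next
    case False
    then have "l \<le> k" "q \<noteq> p" using p(3) by auto
    from main[OF pq(2,1,4,3,6,5) this] show ?thesis unfolding hnorm_minus[of q p] closed_segment_commute[of p q] .
  qed
  then show "2 \<le> hnorm r (q - p)" "hnorm r (q - p) \<le> 2 \<Longrightarrow> closed_segment p q \<in> E" by blast+
qed

lemma edge_contact:
  assumes "e \<in> E" shows "\<exists>p\<in>X. \<exists>q\<in>X. p \<noteq> q \<and> hnorm r (q - p) \<le> 2 \<and> e = closed_segment p q"
proof -
  consider (s) k m \<epsilon> where "even (k + m)" "\<epsilon> = 1 \<or> \<epsilon> = - 1" "e = slant k m \<epsilon>"
    | (f) k m where "even (k + m)" "b k = a k + 2" "e = bar k m"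
    | (g) k m where "odd (k + m)" "flat k" "e = bridge k m"
    using assms unfolding E_def by blast
  then show ?thesis
  proof cases
    case s
    have "pt (b k) (2 * of_int m) \<noteq> pt (a (k + 1)) (2 * of_int (m + \<epsilon>))" using step[of k] by (metis pt_nth(1) add.commute add_le_same_cancel1 not_one_le_zero)
    moreover have "hnorm r (pt (a (k + 1)) (2 * of_int (m + \<epsilon>)) - pt (b k) (2 * of_int m)) \<le> 2"
      unfolding hnorm_pt using s(2) s1[of k] s2[of k] by auto
    ultimately show ?thesis using slant_ends[OF s(1,2)] s(3) unfolding slant_def by blast
  next
    case f
    have "pt (a k) (2 * of_int m) \<noteq> pt (b k) (2 * of_int m)" using f(2) by (metis pt_nth(1) add_cancel_right_right zero_neq_numeral)
    moreover have "hnorm r (pt (b k) (2 * of_int m) - pt (a k) (2 * of_int m)) \<le> 2"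
      unfolding hnorm_pt using f(2) by simp
    ultimately show ?thesis using bar_ends[OF f(1)] f(3) unfolding bar_def by blast
  next
    case g
    have "pt (b (k - 1)) (2 * of_int m) \<noteq> pt (a (k + 1)) (2 * of_int m)" using g(2) unfolding flat_def by (metis pt_nth(1) add_cancel_right_right zero_neq_numeral)
    moreover have "hnorm r (pt (a (k + 1)) (2 * of_int m) - pt (b (k - 1)) (2 * of_int m)) \<le> 2"
      unfolding hnorm_pt using g(2) by (simp add: flat_def)
    ultimately show ?thesis using bridge_ends[OF g(1)] g(3) unfolding bridge_def by blast
  qed
qed

end

text \<open>Everything in the definition is invariant under linear automorphisms; this carries the
  columns from normal coordinates to the given hexagon.\<close>

lemma convex_subdivision_linear_image:
  fixes T :: "plane \<Rightarrow> plane"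
  assumes T: "linear T" "inj T" and sub: "convex_subdivision X E F"
  shows "convex_subdivision (T ` X) ((`) T ` E) ((`) T ` F)"
    and "sides ((`) T ` E) (T ` P) = (`) T ` sides E P"
proof -
  have surj: "surj T" using linear_injective_imp_surjective[OF T] by simp
  have int: "interior (T ` S) = T ` interior S" for S using interior_injective_linear_image[OF T] .
  have fr: "frontier (T ` S) = T ` frontier S" for S
    by (simp add: frontier_def int image_set_diff[OF T(2)] closure_injective_linear_image[OF T])
  have Int: "T ` S \<inter> T ` S' = T ` (S \<inter> S')" for S S' using T(2) by (simp add: image_Int)
  have subs: "T ` S \<subseteq> T ` S' \<longleftrightarrow> S \<subseteq> S'" for S S' using T(2) by (simp add: inj_image_subset_iff)
  have eq: "T ` S = T ` S' \<longleftrightarrow> S = S'" for S S' using T(2) by (simp add: inj_image_eq_iff)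
  show sides: "sides ((`) T ` E) (T ` P) = (`) T ` sides E P" for P
    unfolding sides_def fr by (auto simp: subs)
  note D = sub[unfolded convex_subdivision_def]
  note D1 = D[THEN conjunct1] and D2 = D[THEN conjunct2, THEN conjunct1]
    and D3 = D[THEN conjunct2, THEN conjunct2, THEN conjunct1]
    and D4 = D[THEN conjunct2, THEN conjunct2, THEN conjunct2, THEN conjunct1]
    and D5 = D[THEN conjunct2, THEN conjunct2, THEN conjunct2, THEN conjunct2, THEN conjunct1]
  note D' = D[THEN conjunct2, THEN conjunct2, THEN conjunct2, THEN conjunct2, THEN conjunct2]
  note D6 = D'[THEN conjunct1] and D7 = D'[THEN conjunct2, THEN conjunct1]
    and D8 = D'[THEN conjunct2, THEN conjunct2, THEN conjunct1] and D9 = D'[THEN conjunct2, THEN conjunct2, THEN conjunct2]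
  have 1: "\<forall>e\<in>(`) T ` E. \<exists>x\<in>T ` X. \<exists>y\<in>T ` X. x \<noteq> y \<and> e = closed_segment x y \<and> e \<inter> T ` X = {x, y}"
  proof
    fix e' assume "e' \<in> (`) T ` E"
    then obtain e where e: "e \<in> E" "e' = T ` e" by blast
    then obtain x y where xy: "x \<in> X" "y \<in> X" "x \<noteq> y" "e = closed_segment x y" "e \<inter> X = {x, y}" using D1 by blast
    have "T x \<noteq> T y" using xy(3) T(2) by (simp add: inj_eq)
    moreover have "e' = closed_segment (T x) (T y)" unfolding e(2) xy(4) using closed_segment_linear_image[OF T(1)] by simp
    moreover have "e' \<inter> T ` X = {T x, T y}" unfolding e(2) Int xy(5) by simp
    ultimately show "\<exists>x\<in>T ` X. \<exists>y\<in>T ` X. x \<noteq> y \<and> e' = closed_segment x y \<and> e' \<inter> T ` X = {x, y}" using xy(1,2) by blast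
  qed
  have 2: "pairwise (\<lambda>e e'. e \<inter> e' \<subseteq> T ` X) ((`) T ` E)"
    using D2 unfolding pairwise_def by (auto simp only: ball_simps Int eq subs)
  have 3: "T ` X \<subseteq> \<Union>((`) T ` E)" using D3 by blast
  have 4: "\<forall>P\<in>(`) T ` F. convex_polygon P"
    using D4 polytope_linear_image[OF T(1)] by (auto simp: convex_polygon_def int)
  have 5: "\<Union>((`) T ` F) = UNIV" using D5 surj by (metis image_Union)
  have "finite {P \<in> (`) T ` F. P \<inter> T ` V \<noteq> {}}" if "finite {P \<in> F. P \<inter> V \<noteq> {}}" for V
  proof -
    have "{P \<in> (`) T ` F. P \<inter> T ` V \<noteq> {}} = (`) T ` {P \<in> F. P \<inter> V \<noteq> {}}"
      using Int[of _ V] by (auto simp only: image_is_empty)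
    then show ?thesis using that by simp
  qed
  note fin = this
  have "\<exists>V. openin euclidean V \<and> y \<in> V \<and> finite {U \<in> (`) T ` F. U \<inter> V \<noteq> {}}" for y
  proof -
    obtain x where x: "y = T x" using surj by blast
    have "\<exists>V. open V \<and> x \<in> V \<and> finite {U \<in> F. U \<inter> V \<noteq> {}}"
      using D6 unfolding locally_finite_in_def by simp
    then obtain V where V: "open V" "x \<in> V" "finite {U \<in> F. U \<inter> V \<noteq> {}}" by (elim exE conjE) rule
    have "openin euclidean (T ` V)" using open_surjective_linear_image[OF V(1) T(1) surj] by simp
    moreover have "y \<in> T ` V" using V(2) x by simp
    ultimately show ?thesis using fin[OF V(3)] by (intro exI conjI)
  qed
  then have 6: "locally_finite_in euclidean ((`) T ` F)" unfolding locally_finite_in_def by simp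
  have 7: "pairwise (\<lambda>P Q. interior P \<inter> interior Q = {}) ((`) T ` F)"
    using D7 unfolding pairwise_def by (auto simp only: ball_simps Int eq int image_is_empty)
  have 8: "\<forall>P\<in>(`) T ` F. frontier P = \<Union>(sides ((`) T ` E) P)"
    using D8 by (auto simp only: ball_simps sides fr image_Union[symmetric] eq)
  have 9: "\<forall>e\<in>(`) T ` E. \<exists>P\<in>(`) T ` F. e \<in> sides ((`) T ` E) P"
    using D9 by (auto simp only: ball_simps bex_simps sides) blast
  show "convex_subdivision (T ` X) ((`) T ` E) ((`) T ` F)"
    unfolding convex_subdivision_def using 1 2 3 4 5 6 7 8 9 by blast
qed

locale hexagon_columns = hexagon_frame + columns r a b for a b
begin

lemma frame_diff_B: "frame e f q - frame e f p \<in> B \<longleftrightarrow> hnorm r (q - p) \<le> 2"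
  "frame e f q - frame e f p \<in> interior B \<longleftrightarrow> hnorm r (q - p) < 2"
  using frame_mem_B[of "q - p"] frame_mem_interior[of "q - p"] linear_diff[OF linear_frame, of e f q p] by simp_all

lemma packing_columns: "is_packing D (frame e f ` X)"
proof -
  have "\<not> hnorm r (x - y) < 2" if "x \<in> X" "y \<in> X" "x \<noteq> y" for x y
    using contact_edge(1)[OF that(2,1)] that(3) by force
  then show ?thesis unfolding packing_iff by (auto simp: frame_diff_B)
qed

lemma neighbours_columns:
  "neighbours D (frame e f ` X) (frame e f p) = frame e f ` {q \<in> X. q \<noteq> p \<and> hnorm r (q - p) \<le> 2}"
  unfolding neighbours_eq using inj_frame[OF hexagon_frame.w] hexagon_frame_axioms by (auto simp: frame_diff_B inj_eq)

lemma edges_columns: "packing_edges D (frame e f ` X) = (`) (frame e f) ` E"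
proof -
  have seg: "frame e f ` closed_segment p q = closed_segment (frame e f p) (frame e f q)" for p q
    using closed_segment_linear_image[OF linear_frame] by simp
  show ?thesis
  proof (intro equalityI subsetI)
    fix s assume "s \<in> packing_edges D (frame e f ` X)"
    then obtain p q where "p \<in> X" "q \<in> X" "q \<noteq> p" "hnorm r (q - p) \<le> 2" "s = closed_segment (frame e f p) (frame e f q)"
      unfolding packing_edges_def using neighbours_columns by auto
    then show "s \<in> (`) (frame e f) ` E" using contact_edge(2)[of p q] seg by blast
  next
    fix s assume "s \<in> (`) (frame e f) ` E"
    then obtain p q where "p \<in> X" "q \<in> X" "p \<noteq> q" "hnorm r (q - p) \<le> 2" "s = closed_segment (frame e f p) (frame e f q)"
      using edge_contact seg by blast
    then show "s \<in> packing_edges D (frame e f ` X)"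
      unfolding packing_edges_def using neighbours_columns by blast
  qed
qed

lemma small_faces_columns: "packing_with_small_faces D (frame e f ` X)"
proof -
  have T: "linear (frame e f)" "inj (frame e f)" using linear_frame inj_frame[OF hexagon_frame.w[OF hexagon_frame_axioms]] by auto
  note img = convex_subdivision_linear_image[OF T subdivision(1)]
  have "finite (sides ((`) (frame e f) ` E) P) \<and> card (sides ((`) (frame e f) ` E) P) \<le> 6"
    if P: "P \<in> (`) (frame e f) ` F" for P
  proof -
    obtain Q where Q: "Q \<in> F" "P = frame e f ` Q" using P by blast
    have "card ((`) (frame e f) ` sides E Q) \<le> card (sides E Q)"
      using subdivision(2)[OF Q(1)] by (intro card_image_le) simp
    then show ?thesis unfolding Q(2) img(2) using subdivision(2)[OF Q(1)] by auto
  qed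
  then show ?thesis unfolding packing_with_small_faces_def edges_columns using packing_columns img(1) by blast
qed

end

section \<open>Tilings with slowly growing tiles, and two-letter words\<close>

lemma sublinear_radius: "((\<lambda>R::real. K * (1 + 2 * sqrt R) / R) \<longlongrightarrow> 0) at_top"
proof -
  have "((\<lambda>R::real. K * (inverse R + 2 * inverse (sqrt R))) \<longlongrightarrow> K * (0 + 2 * 0)) at_top"
    by (intro tendsto_intros tendsto_inverse_0_at_top filterlim_ident sqrt_at_top)
  moreover have "\<forall>\<^sub>F R::real in at_top. K * (inverse R + 2 * inverse (sqrt R)) = K * (1 + 2 * sqrt R) / R"
    using eventually_gt_at_top[of 0]
  proof eventually_elim
    case (elim R)
    then have "inverse (sqrt R) = sqrt R / R" using sqrt_divide_self_eq[of R] by simp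
    then show ?case using elim by (simp add: field_simps)
  qed
  ultimately show ?thesis by (simp add: tendsto_cong)
qed

text \<open>The tiles may grow with the square root of the distance from the origin, which is what
  the drift of a two-letter word requires. Tiles that matter for the disc of radius R are still
  within O(sqrt R) of their base points, which is small against R.\<close>

lemma tiling_limit:
  fixes b :: "'i \<Rightarrow> plane" and C :: "'i \<Rightarrow> plane set" and K :: real
  assumes fin: "\<And>R. finite {i. b i \<in> cball 0 R}"
    and meas: "\<And>i. C i \<in> lmeasurable"
    and neg: "\<And>i j. i \<noteq> j \<Longrightarrow> negligible (C i \<inter> C j)"
    and near: "\<And>i. C i \<subseteq> cball (b i) (K * (1 + sqrt (norm (b i))))"
    and cover: "(\<Union>i. C i) = UNIV" and K: "0 \<le> K"
  shows "((\<lambda>R. (\<Sum>i | b i \<in> cball 0 R. measure lebesgue (C i)) / (pi * R\<^sup>2)) \<longlongrightarrow> 1) at_top"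
proof -
  define \<rho> where "\<rho> R = K * (1 + 2 * sqrt R)" for R
  define S where "S R = (\<Sum>i | b i \<in> cball 0 R. measure lebesgue (C i))" for R
  have \<rho>0: "((\<lambda>R. \<rho> R / R) \<longlongrightarrow> 0) at_top" unfolding \<rho>_def by (rule sublinear_radius)
  have bounds: "pi * (R - \<rho> R)\<^sup>2 \<le> S R \<and> S R \<le> pi * (R + \<rho> R)\<^sup>2"
    if R: "0 < R" "K + K\<^sup>2 / 2 \<le> R" "\<rho> R / R < 1" for R
  proof -
    have close: "C i \<subseteq> cball (b i) (\<rho> R)" if "b i \<in> cball 0 R \<or> C i \<inter> cball 0 R \<noteq> {}" for i
    proof -
      \<comment> \<open>A tile that meets the disc has s^2 \<le> R + K + K s for s^2 = |b i|. As 2 K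
        s \<le> K^2 + s^2, this gives s^2 \<le> 2 R + 2 K + K^2, and the lower bound for R makes it
        at most 4 R.\<close>
      have "norm (b i) \<le> 4 * R"
      proof (cases "b i \<in> cball 0 R")
        case False
        then obtain z where z: "z \<in> C i" "norm z \<le> R" using \<open>b i \<in> cball 0 R \<or> C i \<inter> cball 0 R \<noteq> {}\<close> by auto
        define s where "s = sqrt (norm (b i))"
        have s: "s\<^sup>2 = norm (b i)" by (simp add: s_def)
        have "norm (b i) \<le> norm z + dist (b i) z" using norm_triangle_ineq2[of "b i" z] by (simp add: dist_norm)
        moreover have "dist (b i) z \<le> K * (1 + s)" using near[of i] z(1) by (auto simp: s_def)
        ultimately have "s\<^sup>2 \<le> R + K + K * s" using z(2) by (simp add: s distrib_left)
        moreover have "0 \<le> (K - s)\<^sup>2" by simp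
        then have "2 * (K * s) \<le> K\<^sup>2 + s\<^sup>2" by (simp add: power2_diff)
        ultimately have "s\<^sup>2 \<le> 4 * R" using R(2) by linarith
        then show ?thesis by (simp add: s)
      qed (use R in auto)
      then have "sqrt (norm (b i)) \<le> sqrt (4 * R)" by simp
      then have "sqrt (norm (b i)) \<le> 2 * sqrt R" by (simp add: real_sqrt_mult)
      then have "K * (1 + sqrt (norm (b i))) \<le> \<rho> R" unfolding \<rho>_def using K by (intro mult_left_mono) auto
      then show ?thesis using near[of i] subset_cball by blast
    qed
    have \<rho>: "0 \<le> \<rho> R" "\<rho> R \<le> R" using R K by (simp_all add: \<rho>_def)
    let ?J = "{i. b i \<in> cball 0 R}"
    have eq: "S R = measure lebesgue (\<Union>i\<in>?J. C i)"
      unfolding S_def using fin meas neg by (intro measure_negligible_finite_Union_image[symmetric]) (auto simp: pairwise_def)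
    have m: "(\<Union>i\<in>?J. C i) \<in> lmeasurable" using fin meas by (intro fmeasurable.finite_UN) auto
    have "cball 0 (R - \<rho> R) \<subseteq> (\<Union>i\<in>?J. C i)"
    proof
      fix z :: plane assume z: "z \<in> cball 0 (R - \<rho> R)"
      obtain i where i: "z \<in> C i" using cover by auto
      moreover have "z \<in> cball 0 R" using z \<rho> by simp
      ultimately have "C i \<inter> cball 0 R \<noteq> {}" by blast
      then have "dist (b i) z \<le> \<rho> R" using close[of i] i by auto
      then have "norm (b i) \<le> R" using z norm_triangle_ineq2[of "b i" z] by (simp add: dist_norm)
      then show "z \<in> (\<Union>i\<in>?J. C i)" using i by auto
    qed
    then have "measure lebesgue (cball (0::plane) (R - \<rho> R)) \<le> measure lebesgue (\<Union>i\<in>?J. C i)"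
      using m by (intro measure_mono_fmeasurable) auto
    moreover have "(\<Union>i\<in>?J. C i) \<subseteq> cball 0 (R + \<rho> R)"
    proof
      fix z assume "z \<in> (\<Union>i\<in>?J. C i)"
      then obtain i where i: "norm (b i) \<le> R" "z \<in> C i" by auto
      then have "dist (b i) z \<le> \<rho> R" using close[of i] by auto
      then show "z \<in> cball 0 (R + \<rho> R)" using i norm_triangle_ineq2[of z "b i"] by (simp add: dist_norm norm_minus_commute)
    qed
    then have "measure lebesgue (\<Union>i\<in>?J. C i) \<le> measure lebesgue (cball (0::plane) (R + \<rho> R))"
      using m by (intro measure_mono_fmeasurable) (auto dest: fmeasurableD)
    ultimately show ?thesis using eq \<rho> by (simp add: measure_disc)
  qed
  have ev: "\<forall>\<^sub>F R in at_top. (1 - \<rho> R / R)\<^sup>2 \<le> S R / (pi * R\<^sup>2) \<and> S R / (pi * R\<^sup>2) \<le> (1 + \<rho> R / R)\<^sup>2"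
    using eventually_gt_at_top[of 0] eventually_ge_at_top[of "K + K\<^sup>2 / 2"] order_tendstoD(2)[OF \<rho>0, of 1, simplified]
  proof eventually_elim
    case (elim R)
    have eqs: "(1 - \<rho> R / R)\<^sup>2 = pi * (R - \<rho> R)\<^sup>2 / (pi * R\<^sup>2)" "(1 + \<rho> R / R)\<^sup>2 = pi * (R + \<rho> R)\<^sup>2 / (pi * R\<^sup>2)"
      using elim(1) by (simp_all add: power_divide[symmetric] diff_divide_distrib add_divide_distrib)
    show ?case unfolding eqs using bounds[OF elim] by (intro conjI divide_right_mono) auto
  qed
  have lo: "\<forall>\<^sub>F R in at_top. (1 - \<rho> R / R)\<^sup>2 \<le> S R / (pi * R\<^sup>2)" using ev by (rule eventually_mono) (rule conjunct1)
  have hi: "\<forall>\<^sub>F R in at_top. S R / (pi * R\<^sup>2) \<le> (1 + \<rho> R / R)\<^sup>2" using ev by (rule eventually_mono) (rule conjunct2)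
  have "((\<lambda>R. (1 - \<rho> R / R)\<^sup>2) \<longlongrightarrow> (1 - 0)\<^sup>2) at_top" "((\<lambda>R. (1 + \<rho> R / R)\<^sup>2) \<longlongrightarrow> (1 + 0)\<^sup>2) at_top"
    by (intro tendsto_intros \<rho>0)+
  then have "((\<lambda>R. (1 - \<rho> R / R)\<^sup>2) \<longlongrightarrow> 1) at_top" "((\<lambda>R. (1 + \<rho> R / R)\<^sup>2) \<longlongrightarrow> 1) at_top"
    by (simp_all only: diff_0_right add_0_right power_one)
  from tendsto_sandwich[OF lo hi this] show ?thesis unfolding S_def .
qed

text \<open>
  A two-letter word with frequency \<open>\<theta>\<close> and few changes of letter: on the positions
  \<open>m\<^sup>2, \<dots>, (m + 1)\<^sup>2 - 1\<close> all occurrences of the first letter come first. The word is given by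
  the number of occurrences before a position.
\<close>

definition isqrt :: "nat \<Rightarrow> nat" where "isqrt n = nat \<lfloor>sqrt (real n)\<rfloor>"

lemma isqrt: "(isqrt n)\<^sup>2 \<le> n" "n < (isqrt n + 1)\<^sup>2" "real (isqrt n) \<le> sqrt n"
proof -
  have "real (isqrt n) \<le> sqrt n" "sqrt n < real (isqrt n + 1)" unfolding isqrt_def by (simp_all, linarith+)
  then have "(real (isqrt n))\<^sup>2 \<le> (sqrt n)\<^sup>2" "(sqrt n)\<^sup>2 < (real (isqrt n + 1))\<^sup>2"
    by (intro power_mono power_strict_mono; simp)+
  then have "real ((isqrt n)\<^sup>2) \<le> real n" "real n < real ((isqrt n + 1)\<^sup>2)" by (simp_all only: of_nat_power) simp_all
  then show "(isqrt n)\<^sup>2 \<le> n" "n < (isqrt n + 1)\<^sup>2" by (simp_all only: of_nat_le_iff of_nat_less_iff)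
  show "real (isqrt n) \<le> sqrt n" by fact
qed

lemma isqrt_unique: assumes "m\<^sup>2 \<le> n" "n < (m + 1)\<^sup>2" shows "isqrt n = m"
proof -
  have "m\<^sup>2 < (isqrt n + 1)\<^sup>2" "(isqrt n)\<^sup>2 < (m + 1)\<^sup>2" using assms isqrt[of n] by linarith+
  then have "m < isqrt n + 1" "isqrt n < m + 1" by (auto intro: power_less_imp_less_base)
  then show ?thesis by simp
qed

text \<open>At n = m^2 the value is the integer part of \<theta> m^2. It then grows by 1 at each
  step until the quota for (m + 1)^2 is reached, and stays constant for the rest of the
  block.\<close>

definition pattern :: "real \<Rightarrow> nat \<Rightarrow> int" where
  "pattern \<theta> n = min (\<lfloor>\<theta> * (real (isqrt n))\<^sup>2\<rfloor> + int n - int ((isqrt n)\<^sup>2)) \<lfloor>\<theta> * (real (isqrt n) + 1)\<^sup>2\<rfloor>"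

context
  fixes \<theta> :: real assumes \<theta>: "0 \<le> \<theta>" "\<theta> \<le> 1"
begin

lemma square_step: "\<lfloor>\<theta> * (real m)\<^sup>2\<rfloor> \<le> \<lfloor>\<theta> * (real m + 1)\<^sup>2\<rfloor>" "\<lfloor>\<theta> * (real m + 1)\<^sup>2\<rfloor> \<le> \<lfloor>\<theta> * (real m)\<^sup>2\<rfloor> + 2 * int m + 1"
  "\<theta> * (real m + 1)\<^sup>2 \<le> \<theta> * (real m)\<^sup>2 + 2 * real m + 1"
proof -
  have "\<theta> * (real m)\<^sup>2 \<le> \<theta> * (real m + 1)\<^sup>2" using \<theta> by (intro mult_left_mono power_mono) auto
  then show "\<lfloor>\<theta> * (real m)\<^sup>2\<rfloor> \<le> \<lfloor>\<theta> * (real m + 1)\<^sup>2\<rfloor>" by (rule floor_mono)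
  have "\<theta> * (2 * real m + 1) \<le> 1 * (2 * real m + 1)" using \<theta> by (intro mult_right_mono) auto
  then show *: "\<theta> * (real m + 1)\<^sup>2 \<le> \<theta> * (real m)\<^sup>2 + 2 * real m + 1" by (simp add: power2_sum algebra_simps)
  then have "\<lfloor>\<theta> * (real m + 1)\<^sup>2\<rfloor> \<le> \<lfloor>\<theta> * (real m)\<^sup>2 + of_int (2 * int m + 1)\<rfloor>" by (intro floor_mono) simp
  then show "\<lfloor>\<theta> * (real m + 1)\<^sup>2\<rfloor> \<le> \<lfloor>\<theta> * (real m)\<^sup>2\<rfloor> + 2 * int m + 1" unfolding floor_add_int[symmetric] by simp
qed

text \<open>The formula of a block also holds at its right end, which is the start of the next
  block; so steps need no distinction whether they leave the block.\<close>

lemma pattern_on: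
  assumes "m\<^sup>2 \<le> n" "n \<le> (m + 1)\<^sup>2"
  shows "pattern \<theta> n = min (\<lfloor>\<theta> * (real m)\<^sup>2\<rfloor> + int n - int (m\<^sup>2)) \<lfloor>\<theta> * (real m + 1)\<^sup>2\<rfloor>"
proof (cases "n < (m + 1)\<^sup>2")
  case True
  then show ?thesis using isqrt_unique[OF assms(1) True] by (simp add: pattern_def)
next
  case False
  then have n: "n = (m + 1)\<^sup>2" using assms by simp
  have "isqrt n = m + 1" by (rule isqrt_unique) (simp_all add: n power2_eq_square)
  then have "pattern \<theta> n = min \<lfloor>\<theta> * (real m + 1)\<^sup>2\<rfloor> \<lfloor>\<theta> * (real (m + 1) + 1)\<^sup>2\<rfloor>" by (simp add: pattern_def n add.commute)
  also have "\<dots> = \<lfloor>\<theta> * (real m + 1)\<^sup>2\<rfloor>" using square_step(1)[of "m + 1"] by (simp add: add.commute)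
  also have "\<dots> = min (\<lfloor>\<theta> * (real m)\<^sup>2\<rfloor> + int n - int (m\<^sup>2)) \<lfloor>\<theta> * (real m + 1)\<^sup>2\<rfloor>"
    using square_step(2)[of m] by (simp add: n power2_eq_square algebra_simps)
  finally show ?thesis .
qed

lemma pattern_0: "pattern \<theta> 0 = 0"
  using pattern_on[of 0 0] \<theta> by simp

lemma pattern_step: "pattern \<theta> (Suc n) = pattern \<theta> n \<or> pattern \<theta> (Suc n) = pattern \<theta> n + 1"
  using pattern_on[of "isqrt n" n] pattern_on[of "isqrt n" "Suc n"] isqrt[of n] by auto

text \<open>Both numbers lie between \<theta> m^2 - 1 and \<theta> (m + 1)^2 for m =
  \<open>isqrt n\<close>, and these bounds differ by at most 2 m + 2.\<close>

lemma pattern_near: "\<bar>pattern \<theta> n - \<theta> * n\<bar> \<le> 2 * (1 + sqrt n)"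
proof -
  define m where "m = isqrt n"
  have m: "m\<^sup>2 \<le> n" "n < (m + 1)\<^sup>2" "real m \<le> sqrt n" using isqrt[of n] by (simp_all add: m_def)
  then have "(real m)\<^sup>2 \<le> real n" "real n \<le> (real m + 1)\<^sup>2"
    by (metis of_nat_le_iff of_nat_power) (metis m(2) less_imp_le of_nat_1 of_nat_add of_nat_le_iff of_nat_power)
  then have n: "\<theta> * (real m)\<^sup>2 \<le> \<theta> * n" "\<theta> * n \<le> \<theta> * (real m + 1)\<^sup>2" using \<theta> by (auto intro: mult_left_mono)
  have p: "pattern \<theta> n = min (\<lfloor>\<theta> * (real m)\<^sup>2\<rfloor> + int n - int (m\<^sup>2)) \<lfloor>\<theta> * (real m + 1)\<^sup>2\<rfloor>"
    using pattern_on[of m n] m by simp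
  have "pattern \<theta> n \<le> \<lfloor>\<theta> * (real m + 1)\<^sup>2\<rfloor>" "\<lfloor>\<theta> * (real m)\<^sup>2\<rfloor> \<le> pattern \<theta> n"
    unfolding p using square_step(1)[of m] m(1) by (auto simp flip: of_nat_power)
  then have "real_of_int (pattern \<theta> n) \<le> \<theta> * (real m + 1)\<^sup>2" "\<theta> * (real m)\<^sup>2 - 1 \<le> real_of_int (pattern \<theta> n)"
    by linarith+
  then show ?thesis using n square_step(3)[of m] m(3) by (simp add: abs_le_iff)
qed

text \<open>The letter changes only at the end of a block or where its quota is filled, so each
  \<open>m\<close> accounts for at most two changes.\<close>

lemma pattern_change:
  assumes "pattern \<theta> (n + 2) - pattern \<theta> (n + 1) \<noteq> pattern \<theta> (n + 1) - pattern \<theta> n"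
  shows "\<exists>m. real m \<le> sqrt n \<and> (n + 1 = (m + 1)\<^sup>2 \<or> int n + 1 = \<lfloor>\<theta> * (real m + 1)\<^sup>2\<rfloor> - \<lfloor>\<theta> * (real m)\<^sup>2\<rfloor> + int (m\<^sup>2))"
proof (intro exI[of _ "isqrt n"] conjI isqrt(3))
  define m where "m = isqrt n"
  have m: "m\<^sup>2 \<le> n" "n < (m + 1)\<^sup>2" using isqrt[of n] by (simp_all add: m_def)
  have "int n + 1 = \<lfloor>\<theta> * (real m + 1)\<^sup>2\<rfloor> - \<lfloor>\<theta> * (real m)\<^sup>2\<rfloor> + int (m\<^sup>2)" if "n + 1 \<noteq> (m + 1)\<^sup>2"
    using assms pattern_on[of m n] pattern_on[of m "n + 1"] pattern_on[of m "n + 2"] that m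
    by (simp add: min_def split: if_splits)
  then show "n + 1 = (isqrt n + 1)\<^sup>2 \<or> int n + 1 = \<lfloor>\<theta> * (real (isqrt n) + 1)\<^sup>2\<rfloor> - \<lfloor>\<theta> * (real (isqrt n))\<^sup>2\<rfloor> + int ((isqrt n)\<^sup>2)"
    unfolding m_def by blast
qed

lemma pattern_changes:
  fixes N :: nat
  shows "card {n. n \<le> N \<and> pattern \<theta> (n + 2) - pattern \<theta> (n + 1) \<noteq> pattern \<theta> (n + 1) - pattern \<theta> n} \<le> 2 * (1 + sqrt N)"
proof -
  let ?M = "{..isqrt N}"
  let ?f = "\<lambda>m. (m + 1)\<^sup>2 - 1 :: nat" and ?g = "\<lambda>m. nat (\<lfloor>\<theta> * (real m + 1)\<^sup>2\<rfloor> - \<lfloor>\<theta> * (real m)\<^sup>2\<rfloor> + int (m\<^sup>2) - 1)"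
  let ?S = "{n. n \<le> N \<and> pattern \<theta> (n + 2) - pattern \<theta> (n + 1) \<noteq> pattern \<theta> (n + 1) - pattern \<theta> n}"
  have "?S \<subseteq> ?f ` ?M \<union> ?g ` ?M"
  proof
    fix n assume n: "n \<in> ?S"
    then obtain m where m: "real m \<le> sqrt n" "n + 1 = (m + 1)\<^sup>2 \<or> int n + 1 = \<lfloor>\<theta> * (real m + 1)\<^sup>2\<rfloor> - \<lfloor>\<theta> * (real m)\<^sup>2\<rfloor> + int (m\<^sup>2)"
      using pattern_change by blast
    have "real m \<le> sqrt N" using m(1) n order_trans[of "real m" "sqrt n" "sqrt N"] by simp
    then have "m \<in> ?M" unfolding isqrt_def by (simp add: le_nat_floor)
    moreover have "n = ?f m \<or> n = ?g m" using m(2) by (metis add_diff_cancel_right' nat_int)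
    ultimately show "n \<in> ?f ` ?M \<union> ?g ` ?M" by blast
  qed
  then have "card ?S \<le> card (?f ` ?M \<union> ?g ` ?M)" by (intro card_mono) auto
  also have "\<dots> \<le> card (?f ` ?M) + card (?g ` ?M)" by (rule card_Un_le)
  also have "\<dots> \<le> card ?M + card ?M" by (intro add_mono card_image_le) auto
  finally have "card ?S \<le> 2 * (isqrt N + 1)" by simp
  then have "real (card ?S) \<le> real (2 * (isqrt N + 1))" by (simp only: of_nat_le_iff)
  then show ?thesis using isqrt(3)[of N] by simp
qed

lemma two_letter_word:
  obtains \<gamma> :: "int \<Rightarrow> int" where "\<gamma> 0 = 0" "\<And>i. \<gamma> (i + 1) = \<gamma> i \<or> \<gamma> (i + 1) = \<gamma> i + 1"
    "\<And>i. \<bar>\<gamma> i - \<theta> * i\<bar> \<le> 2 * (1 + sqrt \<bar>real_of_int i\<bar>)"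
    "\<And>N::nat. card {i. \<bar>i\<bar> \<le> int N \<and> \<gamma> (i + 2) - \<gamma> (i + 1) \<noteq> \<gamma> (i + 1) - \<gamma> i} \<le> 4 * (1 + sqrt N)"
proof -
  \<comment> \<open>The odd extension of the counting function to negative positions.\<close>
  define \<gamma> where "\<gamma> i = (if 0 \<le> i then pattern \<theta> (nat i) else - pattern \<theta> (nat (- i)))" for i
  have pos: "\<gamma> (int n) = pattern \<theta> n" and neg: "\<gamma> (- int n) = - pattern \<theta> n" for n
    using pattern_0 by (auto simp: \<gamma>_def)
  have 1: "\<gamma> 0 = 0" using pos[of 0] pattern_0 by simp
  have 2: "\<gamma> (i + 1) = \<gamma> i \<or> \<gamma> (i + 1) = \<gamma> i + 1" for i
  proof (cases "0 \<le> i")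
    case True
    then obtain n where i: "i = int n" using nonneg_int_cases by blast
    then have "int n + 1 = int (Suc n)" by simp
    then show ?thesis unfolding i using pattern_step[of n] pos[of n] pos[of "Suc n"] by (simp only:)
  next
    case False
    then obtain n where i: "i = - int (Suc n)" by (metis int_cases of_nat_0_le_iff)
    then have "\<gamma> (i + 1) = - pattern \<theta> n" "\<gamma> i = - pattern \<theta> (Suc n)" using neg[of n] neg[of "Suc n"] by simp_all
    then show ?thesis using pattern_step[of n] by auto
  qed
  have 3: "\<bar>\<gamma> i - \<theta> * i\<bar> \<le> 2 * (1 + sqrt \<bar>real_of_int i\<bar>)" for i
  proof (cases "0 \<le> i")
    case True
    then obtain n where "i = int n" using nonneg_int_cases by blast
    then show ?thesis using pattern_near[of n] pos[of n] by simp
  next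
    case False
    define n where "n = nat (- i)"
    have rn: "real n = - real_of_int i" using False by (simp add: n_def)
    have "\<gamma> i = - pattern \<theta> n" using False by (simp add: \<gamma>_def n_def)
    then have "real_of_int (\<gamma> i) - \<theta> * real_of_int i = - (real_of_int (pattern \<theta> n) - \<theta> * real n)"
      by (simp add: rn)
    moreover have "\<bar>real_of_int i\<bar> = real n" using False by (simp add: rn)
    ultimately show ?thesis using pattern_near[of n] by (simp only: abs_minus_cancel)
  qed
  have 4: "card {i. \<bar>i\<bar> \<le> int N \<and> \<gamma> (i + 2) - \<gamma> (i + 1) \<noteq> \<gamma> (i + 1) - \<gamma> i} \<le> 4 * (1 + sqrt N)" for N :: nat
  proof -
    let ?Q = "{n. n \<le> N \<and> pattern \<theta> (n + 2) - pattern \<theta> (n + 1) \<noteq> pattern \<theta> (n + 1) - pattern \<theta> n}"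
    let ?S = "{i. \<bar>i\<bar> \<le> int N \<and> \<gamma> (i + 2) - \<gamma> (i + 1) \<noteq> \<gamma> (i + 1) - \<gamma> i}"
    have "?S \<subseteq> int ` ?Q \<union> (\<lambda>n. - 2 - int n) ` ?Q"
    proof
      fix i assume i: "i \<in> ?S"
      consider "0 \<le> i" | "i = - 1" | "i \<le> - 2" by linarith
      then show "i \<in> int ` ?Q \<union> (\<lambda>n. - 2 - int n) ` ?Q"
      proof cases
        case 1
        then obtain n where n: "i = int n" using nonneg_int_cases by blast
        then have "i + 1 = int (n + 1)" "i + 2 = int (n + 2)" by simp_all
        then have "\<gamma> (i + 2) = pattern \<theta> (n + 2)" "\<gamma> (i + 1) = pattern \<theta> (n + 1)" "\<gamma> i = pattern \<theta> n"
          using pos n by metis+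
        then have "n \<in> ?Q" using i n by simp
        then show ?thesis using n by blast
      next
        \<comment> \<open>The odd extension repeats the first letter on the left of 0, so no change
          arises at the origin.\<close>
        case 2
        then have "\<gamma> (i + 2) = pattern \<theta> 1" "\<gamma> (i + 1) = 0" "\<gamma> i = - pattern \<theta> 1"
          using pos[of 1] pos[of 0] neg[of 1] pattern_0 by simp_all
        then show ?thesis using i by simp
      next
        case 3
        define n where "n = nat (- 2 - i)"
        have n: "i = - 2 - int n" using 3 by (simp add: n_def)
        then have "i + 2 = - int n" "i + 1 = - int (n + 1)" "i = - int (n + 2)" by simp_all
        then have "\<gamma> (i + 2) = - pattern \<theta> n" "\<gamma> (i + 1) = - pattern \<theta> (n + 1)" "\<gamma> i = - pattern \<theta> (n + 2)"
          using neg by metis+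
        then have "n \<in> ?Q" using i n by simp
        then show ?thesis using n by blast
      qed
    qed
    moreover have "finite ?Q" by simp
    ultimately have "card ?S \<le> card (int ` ?Q \<union> (\<lambda>n. - 2 - int n) ` ?Q)" by (intro card_mono) auto
    also have "\<dots> \<le> card (int ` ?Q) + card ((\<lambda>n. - 2 - int n) ` ?Q)" by (rule card_Un_le)
    also have "\<dots> \<le> card ?Q + card ?Q" using \<open>finite ?Q\<close> by (intro add_mono card_image_le)
    finally have "real (card ?S) \<le> real (card ?Q + card ?Q)" by (simp only: of_nat_le_iff)
    then show ?thesis using pattern_changes[of N] by simp
  qed
  show ?thesis by (rule that[OF 1 2 3 4])
qed

end

text \<open>A sequence with linear growth and square-root error lies below \<open>x\<close> far to
  the left and above \<open>x\<close> far to the right, so somewhere a step passes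
  \<open>x\<close>.\<close>

lemma discrete_between:
  fixes u :: "int \<Rightarrow> real" and \<mu> M x :: real
  assumes u: "\<And>j. \<bar>u j - \<mu> * of_int j\<bar> \<le> M * (1 + sqrt \<bar>real_of_int j\<bar>)" and \<mu>: "0 < \<mu>"
  obtains j where "u j \<le> x" "x \<le> u (j + 1)"
proof -
  \<comment> \<open>By M sqrt N \<le> \<mu> N / 2 + M^2 / (2 \<mu>) half of the linear growth
    absorbs the error term; the bound for \<open>n\<close> lets the other half absorb the
    constants.\<close>
  obtain n :: nat where n: "(2 / \<mu>) * (M + M\<^sup>2 / (2 * \<mu>) + \<bar>x\<bar>) \<le> real n" using real_arch_simple by blast
  define N where "N = Suc n"
  have N: "(2 / \<mu>) * (M + M\<^sup>2 / (2 * \<mu>) + \<bar>x\<bar>) \<le> real N" using n by (simp add: N_def)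
  define s where "s = sqrt (real N)"
  have s: "s\<^sup>2 = N" by (simp add: s_def)
  have "0 \<le> (\<mu> * s - M)\<^sup>2" by simp
  then have "2 * \<mu> * (M * s) \<le> \<mu>\<^sup>2 * N + M\<^sup>2" by (simp add: power2_diff power_mult_distrib s algebra_simps)
  then have Ms: "M * s \<le> \<mu> * N / 2 + M\<^sup>2 / (2 * \<mu>)" using \<mu> by (simp add: field_simps power2_eq_square)
  have "M + M\<^sup>2 / (2 * \<mu>) + \<bar>x\<bar> \<le> \<mu> * N / 2" using N \<mu> by (simp add: field_simps)
  then have big: "M + M * s + \<bar>x\<bar> \<le> \<mu> * N" using Ms by simp
  have "\<bar>u (int N) - \<mu> * N\<bar> \<le> M + M * s" "\<bar>u (- int N) + \<mu> * N\<bar> \<le> M + M * s"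
    using u[of "int N"] u[of "- int N"] by (simp_all add: s_def distrib_left)
  then have ends: "u (- int N) \<le> x" "x \<le> u (int N)" using big by linarith+
  have "\<exists>j. u j \<le> x \<and> x \<le> u (j + 1)"
  proof (rule ccontr)
    assume "\<not> ?thesis"
    then have no: "u (j + 1) < x" if "u j \<le> x" for j using that by (meson not_le)
    have "u j < x" if "- int N < j" for j
    proof -
      have "- int N + 1 \<le> j" using that by simp
      then show ?thesis
      proof (induction j rule: int_ge_induct)
        case base show ?case using no[OF ends(1)] by simp
      next
        case (step i) then show ?case using no[of i] by simp
      qed
    qed
    then have "u (int N) < x" by (simp add: N_def)
    then show False using ends(2) by simp
  qed
  then show ?thesis using that by blast
qed

section \<open>Mixtures of two kinds of columns\<close>

text \<open>For a letter \<open>t\<close>, \<open>W t\<close> is the distance of the two points of a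
  column, 0 for single points, and \<open>\<sigma> t\<close> is the gap to the next column. \<gamma>
  counts one of the letters, which has frequency \<theta>.\<close>

locale mixture = hexagon_frame D c e f r for D c e f r +
  fixes \<gamma> :: "int \<Rightarrow> int" and \<theta> :: real and W \<sigma> :: "bool \<Rightarrow> real"
  assumes freq: "0 \<le> \<theta>" "\<theta> \<le> 1"
    and word_0: "\<gamma> 0 = 0" and word_step: "\<gamma> (i + 1) = \<gamma> i \<or> \<gamma> (i + 1) = \<gamma> i + 1"
    and word_near: "\<bar>\<gamma> i - \<theta> * i\<bar> \<le> 2 * (1 + sqrt \<bar>real_of_int i\<bar>)"
    and word_changes: "card {i. \<bar>i\<bar> \<le> int N \<and> \<gamma> (i + 2) - \<gamma> (i + 1) \<noteq> \<gamma> (i + 1) - \<gamma> i} \<le> 4 * (1 + sqrt (real N))"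
    and W: "W t = 0 \<or> W t = 2" and \<sigma>: "1 \<le> \<sigma> t" "\<sigma> t \<le> 2 * r"
begin

text \<open>
  The columns \<open>2j\<close> and \<open>2j + 1\<close> are of the same kind, so that the points of every row, which
  meets only every second column, follow the same word.
\<close>

definition letter :: "int \<Rightarrow> bool" where "letter k \<longleftrightarrow> \<gamma> (k div 2 + 1) = \<gamma> (k div 2) + 1"

text \<open>A closed form of the sum of \<open>\<phi> (letter i)\<close> over the columns from 0 to
  k - 1, extended to negative \<open>k\<close>: complete pairs of columns count twice, and an odd
  \<open>k\<close> adds the first column of its pair.\<close>

definition cum :: "(bool \<Rightarrow> real) \<Rightarrow> int \<Rightarrow> real" where
  "cum \<phi> k = 2 * (\<phi> False * of_int (k div 2) + (\<phi> True - \<phi> False) * of_int (\<gamma> (k div 2)))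
    + (if odd k then \<phi> (letter k) else 0)"

definition mean :: "(bool \<Rightarrow> real) \<Rightarrow> real" where "mean \<phi> = \<theta> * \<phi> True + (1 - \<theta>) * \<phi> False"

abbreviation "s \<equiv> (\<lambda>t. W t + \<sigma> t)"

lemma cum_0: "cum \<phi> 0 = 0" by (simp add: cum_def word_0)

lemma cum_step: "cum \<phi> (k + 1) = cum \<phi> k + \<phi> (letter k)"
proof (cases "even k")
  case True
  then have d: "(k + 1) div 2 = k div 2" by presburger
  then have "letter (k + 1) = letter k" by (simp only: letter_def)
  then show ?thesis using True unfolding cum_def d by simp
next
  case False
  then have d: "(k + 1) div 2 = k div 2 + 1" by presburger
  have "real_of_int (\<gamma> (k div 2 + 1)) = of_int (\<gamma> (k div 2)) + (if letter k then 1 else 0)"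
    using word_step[of "k div 2"] by (auto simp: letter_def)
  then show ?thesis using False unfolding cum_def d by (cases "letter k") (simp_all add: algebra_simps)
qed

lemma letter_pair: "letter (2 * (k div 2)) = letter k" "letter (2 * (k div 2) + 1) = letter k"
  by (simp_all add: letter_def)

lemma cum_double: "cum \<phi> (2 * ((k + 2) div 2)) = cum \<phi> (2 * (k div 2)) + 2 * \<phi> (letter k)"
proof -
  have d: "2 * ((k + 2) div 2) = 2 * (k div 2) + 1 + 1" by simp
  show ?thesis unfolding d cum_step letter_pair by simp
qed

lemma cum_near: obtains M where "0 \<le> M" "\<And>k. \<bar>cum \<phi> k - mean \<phi> * of_int k\<bar> \<le> M * (1 + sqrt \<bar>real_of_int k\<bar>)"
proof
  define \<Delta> where "\<Delta> = \<phi> True - \<phi> False"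
  define A where "A = \<bar>\<phi> True\<bar> + \<bar>\<phi> False\<bar> + \<bar>mean \<phi>\<bar>"
  show "0 \<le> 4 * \<bar>\<Delta>\<bar> + A" by (simp add: A_def)
  fix k :: int
  define j where "j = k div 2"
  define x where "x = (if odd k then \<phi> (letter k) else 0) - (if odd k then mean \<phi> else 0)"
  have k: "real_of_int k = 2 * of_int j + (if odd k then 1 else 0)"
  proof -
    have "k = 2 * j + (if odd k then 1 else 0)" unfolding j_def by presburger
    then have "real_of_int k = of_int (2 * j + (if odd k then 1 else 0))" by simp
    then show ?thesis by simp
  qed
  have "cum \<phi> k - mean \<phi> * of_int k = 2 * (\<Delta> * (\<gamma> j - \<theta> * j)) + x"
    unfolding cum_def k j_def[symmetric] \<Delta>_def mean_def x_def by (simp add: algebra_simps)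
  then have "\<bar>cum \<phi> k - mean \<phi> * of_int k\<bar> \<le> \<bar>2 * (\<Delta> * (\<gamma> j - \<theta> * j))\<bar> + \<bar>x\<bar>" by (simp only: abs_triangle_ineq)
  moreover have "\<bar>x\<bar> \<le> A" unfolding x_def A_def by (cases "letter k") auto
  moreover have "\<bar>2 * (\<Delta> * (\<gamma> j - \<theta> * j))\<bar> = 2 * (\<bar>\<Delta>\<bar> * \<bar>\<gamma> j - \<theta> * j\<bar>)" by (simp add: abs_mult)
  moreover have "\<bar>\<Delta>\<bar> * \<bar>\<gamma> j - \<theta> * j\<bar> \<le> \<bar>\<Delta>\<bar> * (2 * (1 + sqrt \<bar>real_of_int j\<bar>))"
    using word_near by (rule mult_left_mono) simp
  moreover have "\<bar>j\<bar> \<le> \<bar>k\<bar>" unfolding j_def by linarith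
  then have "sqrt \<bar>real_of_int j\<bar> \<le> sqrt \<bar>real_of_int k\<bar>" by (metis of_int_abs of_int_le_iff real_sqrt_le_iff)
  then have "\<bar>\<Delta>\<bar> * (2 * (1 + sqrt \<bar>real_of_int j\<bar>)) \<le> \<bar>\<Delta>\<bar> * (2 * (1 + sqrt \<bar>real_of_int k\<bar>))" by (intro mult_left_mono) auto
  moreover have "A * 1 \<le> A * (1 + sqrt \<bar>real_of_int k\<bar>)" by (intro mult_left_mono) (auto simp: A_def)
  ultimately show "\<bar>cum \<phi> k - mean \<phi> * of_int k\<bar> \<le> (4 * \<bar>\<Delta>\<bar> + A) * (1 + sqrt \<bar>real_of_int k\<bar>)"
    by (simp add: algebra_simps)
qed

definition a where "a = cum s"
definition b where "b k = a k + W (letter k)"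

sublocale hexagon_columns D c e f r a b
proof
  show "b k = a k \<or> b k = a k + 2" for k using W by (auto simp: b_def)
  show "1 \<le> a (k + 1) - b k" "a (k + 1) - b k \<le> 2 * r" for k using \<sigma> by (simp_all add: a_def b_def cum_step)
qed (use hexagon_frame.r[OF hexagon_frame_axioms] in auto)

lemma s_ge_1: "1 \<le> s t" using W[of t] \<sigma>(1)[of t] by auto

lemma mean_s: "1 \<le> mean s"
proof -
  have "\<theta> * 1 + (1 - \<theta>) * 1 \<le> mean s" unfolding mean_def using freq s_ge_1 by (intro add_mono mult_left_mono) auto
  then show ?thesis by simp
qed

lemma column_abs: "\<bar>real_of_int k\<bar> \<le> \<bar>a k\<bar>"
proof -
  have 0: "a 0 = 0" by (simp add: a_def cum_0)
  consider "k = 0" | "0 < k" | "k < 0" by linarith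
  then show ?thesis
  proof cases
    case 2 then show ?thesis using mono_cols[of 0 k] ab[of 0] 0 by simp
  next
    case 3 then show ?thesis using mono_cols[of k 0] ab[of k] 0 by simp
  qed (simp add: 0)
qed

text \<open>The index \<open>(k, n)\<close> stands for the block of column \<open>k\<close> at
  height \<open>2 * (k + 2 * n)\<close>. The parity condition is built in, so all pairs of integers
  occur.\<close>

definition row :: "int \<times> int \<Rightarrow> real" where "row i = 2 * of_int (fst i + 2 * snd i)"
definition base :: "int \<times> int \<Rightarrow> plane" where "base i = frame e f (pt (a (fst i)) (row i))"
definition points :: "int \<times> int \<Rightarrow> plane set" where
  "points i = {frame e f (pt (a (fst i)) (row i)), frame e f (pt (b (fst i)) (row i))}"

lemma wedge_ne: "wedge e f \<noteq> 0" using hexagon_frame.w[OF hexagon_frame_axioms] .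

lemma frame_eq_iff: "frame e f x = frame e f y \<longleftrightarrow> x = y" using inj_frame[OF wedge_ne] by (auto dest: injD)

lemma frame_below: obtains L where "0 \<le> L" "\<And>z. norm z \<le> L * norm (frame e f z)"
proof -
  obtain B where B: "B > 0" "\<And>z. B * norm z \<le> norm (frame e f z)"
    using linear_inj_bounded_below_pos[OF linear_frame inj_frame[OF wedge_ne]] by blast
  show ?thesis
  proof (rule that)
    show "0 \<le> inverse B" using B(1) by simp
    show "norm z \<le> inverse B * norm (frame e f z)" for z using B by (simp add: field_simps)
  qed
qed

lemma base_bounds: "\<exists>L\<ge>0. \<forall>i. \<bar>real_of_int (fst i)\<bar> \<le> L * norm (base i) \<and> \<bar>row i\<bar> \<le> L * norm (base i)"
proof -
  obtain L where L: "0 \<le> L" "\<And>z. norm z \<le> L * norm (frame e f z)" using frame_below by blast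
  have "\<bar>a (fst i)\<bar> \<le> L * norm (base i)" "\<bar>row i\<bar> \<le> L * norm (base i)" for i
    using L(2)[of "pt (a (fst i)) (row i)"] component_le_norm_cart[of "pt (a (fst i)) (row i)" 1]
      component_le_norm_cart[of "pt (a (fst i)) (row i)" 2] by (simp_all add: base_def)
  then have "\<forall>i. \<bar>real_of_int (fst i)\<bar> \<le> L * norm (base i) \<and> \<bar>row i\<bar> \<le> L * norm (base i)"
    by (intro allI conjI order_trans[OF column_abs])
  with L(1) show ?thesis by blast
qed

lemma columns_disjoint: assumes "k < l" "x = a k \<or> x = b k" "x' = a l \<or> x' = b l" shows "x < x'"
  using assms mono_cols[of k l] ab[of k] ab[of l] by auto

lemma points_disjoint: assumes "i \<noteq> i'" shows "points i \<inter> points i' = {}"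
proof (rule ccontr)
  assume "points i \<inter> points i' \<noteq> {}"
  then obtain p where p: "p \<in> points i" "p \<in> points i'" by blast
  obtain x where x1: "x = a (fst i) \<or> x = b (fst i)" "p = frame e f (pt x (row i))" using p(1) unfolding points_def by blast
  obtain x' where x2: "x' = a (fst i') \<or> x' = b (fst i')" "p = frame e f (pt x' (row i'))" using p(2) unfolding points_def by blast
  have "pt x (row i) = pt x' (row i')" using x1(2) x2(2) by (simp add: frame_eq_iff)
  note x = x1(1) x2(1) this
  from this(3) have xx: "x = x'" "row i = row i'" by (metis pt_nth)+
  have "\<not> fst i < fst i'" "\<not> fst i' < fst i" using columns_disjoint[OF _ x(1,2)] columns_disjoint[OF _ x(2,1)] xx(1) by auto
  then have "fst i = fst i'" by simp
  moreover from this have "snd i = snd i'" using xx(2) by (simp add: row_def)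
  ultimately show False using assms by (simp add: prod_eq_iff)
qed

lemma base_in_points: "base i \<in> points i" by (simp add: base_def points_def)

lemma inj_base: "inj base"
  using points_disjoint base_in_points by (metis injI disjoint_iff)

lemma points_cover: "frame e f ` X = (\<Union>i. points i)"
proof
  show "frame e f ` X \<subseteq> (\<Union>i. points i)"
  proof
    fix p assume "p \<in> frame e f ` X"
    then obtain k m x where h: "p = frame e f (pt x (2 * of_int m))" "even (k + m)" "x = a k \<or> x = b k" unfolding X_def by blast
    have "m = k + 2 * ((m - k) div 2)" using h(2) by presburger
    then have "row (k, (m - k) div 2) = 2 * of_int m" unfolding row_def fst_conv snd_conv by presburger
    then have "p \<in> points (k, (m - k) div 2)" using h by (auto simp: points_def)
    then show "p \<in> (\<Union>i. points i)" by blast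
  qed
  show "(\<Union>i. points i) \<subseteq> frame e f ` X"
  proof
    fix p assume "p \<in> (\<Union>i. points i)"
    then obtain i where "p \<in> points i" by blast
    moreover have "even (fst i + (fst i + 2 * snd i))" by simp
    ultimately show "p \<in> frame e f ` X" unfolding points_def row_def X_def by blast
  qed
qed

lemma finite_base: "finite {i. base i \<in> cball 0 R}"
proof -
  have "finite (base -` (frame e f ` X \<inter> cball 0 R))"
    using packing_finite[OF packing_columns] inj_base by (intro finite_vimageI)
  moreover have "{i. base i \<in> cball 0 R} \<subseteq> base -` (frame e f ` X \<inter> cball 0 R)"
    unfolding points_cover using base_in_points by auto
  ultimately show ?thesis by (rule finite_subset[rotated])
qed

lemma points_near: assumes "p \<in> points i" shows "dist p (base i) \<le> 2 * norm e"
proof -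
  have "frame e f (pt x y) - frame e f (pt x' y) = (x - x') *\<^sub>R e" for x x' y by (simp add: frame_pt algebra_simps)
  then show ?thesis using assms W[of "letter (fst i)"] by (auto simp: points_def base_def dist_norm b_def)
qed

text \<open>
  A tile whose width is proportional to the weight of its block is within \<open>O(\<surd>R)\<close> of it, as the
  word deviates from its frequency by that much only.
\<close>

lemma block_sum_limit:
  assumes \<phi>: "\<And>t. 0 \<le> \<phi> t" "0 < mean \<phi>"
  shows "((\<lambda>R. (\<Sum>i | base i \<in> cball 0 R. \<phi> (letter (fst i))) / (pi * R\<^sup>2)) \<longlongrightarrow>
    mean \<phi> / (4 * \<bar>wedge e f\<bar> * mean s)) at_top"
proof -
  \<comment> \<open>Makes the mean width of a tile equal to the mean distance of columns, so that
    tiles and blocks drift apart only by the irregularity of the word.\<close>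
  define \<kappa> where "\<kappa> = mean s / mean \<phi>"
  have \<kappa>: "0 < \<kappa>" "\<kappa> * mean \<phi> = mean s" using mean_s \<phi>(2) by (simp_all add: \<kappa>_def)
  \<comment> \<open>Depends only on the pair of columns. A row meets every second column, so its
    tile at column \<open>k\<close> reaches from \<open>P k\<close> to \<open>P (k + 2)\<close>, and
    both columns of a pair use the same widths.\<close>
  define P where "P k = \<kappa> * cum \<phi> (2 * (k div 2))" for k
  have P_step: "P (k + 2) = P k + 2 * \<kappa> * \<phi> (letter k)" for k
    unfolding P_def cum_double by (simp add: algebra_simps)
  have P_le: "P k \<le> P (k + 2)" for k unfolding P_step using \<kappa> \<phi> by simp
  define C where "C i = frame e f ` cbox (pt (P (fst i)) (row i)) (pt (P (fst i + 2)) (row i + 2))" for i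
  obtain M where M: "0 \<le> M" "\<And>k. \<bar>cum \<phi> k - mean \<phi> * of_int k\<bar> \<le> M * (1 + sqrt \<bar>real_of_int k\<bar>)" using cum_near[of \<phi>] by blast
  obtain M' where M': "0 \<le> M'" "\<And>k. \<bar>cum s k - mean s * of_int k\<bar> \<le> M' * (1 + sqrt \<bar>real_of_int k\<bar>)" using cum_near[of s] by blast
  obtain L where L0: "0 \<le> L" "\<forall>i. \<bar>real_of_int (fst i)\<bar> \<le> L * norm (base i) \<and> \<bar>row i\<bar> \<le> L * norm (base i)"
    using base_bounds by blast
  have L: "0 \<le> L" "\<bar>real_of_int (fst i)\<bar> \<le> L * norm (base i)" for i using L0 by blast+
  define A where "A = 2 * \<kappa> * (\<phi> True + \<phi> False) + 2 * \<kappa> * M + mean s + M'"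
  have A: "0 \<le> A" using \<kappa> \<phi> M M' mean_s by (simp add: A_def)
  define K where "K = A * (1 + sqrt L) * norm e + 2 * norm f"
  have K: "0 \<le> K" using A L by (simp add: K_def)
  have drift: "\<bar>P k - mean s * of_int k\<bar> \<le> \<kappa> * M * (2 + sqrt \<bar>real_of_int k\<bar>) + mean s" for k
  proof -
    define j where "j = 2 * (k div 2)"
    have kj: "k = j \<or> k = j + 1" unfolding j_def by presburger
    then have "\<bar>real_of_int j\<bar> \<le> \<bar>real_of_int k\<bar> + 1" by auto
    then have "sqrt \<bar>real_of_int j\<bar> \<le> sqrt (\<bar>real_of_int k\<bar> + 1)" by simp
    also have "\<dots> \<le> sqrt \<bar>real_of_int k\<bar> + sqrt 1" by (intro sqrt_add_le_add_sqrt) auto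
    finally have sq: "1 + sqrt \<bar>real_of_int j\<bar> \<le> 2 + sqrt \<bar>real_of_int k\<bar>" by simp
    have "P k - mean s * of_int k = \<kappa> * (cum \<phi> j - mean \<phi> * of_int j) + mean s * (of_int j - of_int k)"
      unfolding P_def j_def[symmetric] \<kappa>(2)[symmetric] by (simp add: algebra_simps)
    also have "\<bar>\<dots>\<bar> \<le> \<bar>\<kappa> * (cum \<phi> j - mean \<phi> * of_int j)\<bar> + \<bar>mean s * (of_int j - of_int k)\<bar>" by (rule abs_triangle_ineq)
    also have "\<bar>\<kappa> * (cum \<phi> j - mean \<phi> * of_int j)\<bar> = \<kappa> * \<bar>cum \<phi> j - mean \<phi> * of_int j\<bar>" using \<kappa> by (simp add: abs_mult)
    also have "\<dots> \<le> \<kappa> * (M * (1 + sqrt \<bar>real_of_int j\<bar>))" using M(2) \<kappa> by (intro mult_left_mono) auto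
    also have "\<dots> \<le> \<kappa> * (M * (2 + sqrt \<bar>real_of_int k\<bar>))" using sq \<kappa> M(1) by (intro mult_left_mono) auto
    also have "\<bar>mean s * (of_int j - of_int k)\<bar> \<le> mean s" using kj mean_s by auto
    finally show ?thesis by (simp add: mult.assoc)
  qed
  have "((\<lambda>R. (\<Sum>i | base i \<in> cball 0 R. measure lebesgue (C i)) / (pi * R\<^sup>2)) \<longlongrightarrow> 1) at_top"
  proof (rule tiling_limit[OF finite_base _ _ _ _ K])
    show "C i \<in> lmeasurable" for i unfolding C_def by (intro measurable_linear_image[OF linear_frame]) simp
    show "negligible (C i \<inter> C i')" if "i \<noteq> i'" for i i'
      unfolding C_def
    proof (rule frame_cbox_negligible[OF wedge_ne])
      show "P (fst i + 2) \<le> P (fst i') \<or> P (fst i' + 2) \<le> P (fst i) \<or> row i + 2 \<le> row i' \<or> row i' + 2 \<le> row i"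
      proof (cases "row i = row i'")
        case True
        then have eq: "fst i + 2 * snd i = fst i' + 2 * snd i'" by (simp add: row_def)
        have mono: "P k \<le> P (k + 2 * int n)" for k n
        proof (induction n)
          case (Suc n) then show ?case using P_le[of "k + 2 * int n"] by (simp add: algebra_simps)
        qed simp
        have order: "P (k + 2) \<le> P l" if lt: "k < l" and ev: "even (l - k)" for k l
        proof -
          obtain h where h: "l - k = 2 * h" using ev by (rule evenE)
          then have "l = k + 2 + 2 * int (nat (h - 1))" using lt by simp
          then show ?thesis using mono[of "k + 2" "nat (h - 1)"] by simp
        qed
        have "fst i \<noteq> fst i'" using eq that by (auto simp: prod_eq_iff)
        moreover have "even (fst i' - fst i)" "even (fst i - fst i')" using eq by presburger+
        ultimately show ?thesis using order[of "fst i" "fst i'"] order[of "fst i'" "fst i"] by linarith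
      next
        case False
        have apart: "row j + 2 \<le> row j'" if "fst j + 2 * snd j < fst j' + 2 * snd j'" for j j'
        proof -
          have "real_of_int (fst j + 2 * snd j + 1) \<le> real_of_int (fst j' + 2 * snd j')"
            unfolding of_int_le_iff using that by simp
          then show ?thesis by (simp add: row_def)
        qed
        from False have "fst i + 2 * snd i < fst i' + 2 * snd i' \<or> fst i' + 2 * snd i' < fst i + 2 * snd i" by (auto simp: row_def)
        then show ?thesis using apart by blast
      qed
    qed
    show "C i \<subseteq> cball (base i) (K * (1 + sqrt (norm (base i))))" for i
    proof
      fix z assume "z \<in> C i"
      then obtain x where x: "z = frame e f x" "P (fst i) \<le> x$1" "x$1 \<le> P (fst i + 2)" "row i \<le> x$2" "x$2 \<le> row i + 2"
        unfolding C_def by (auto simp: mem_cbox_pt)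
      define q where "q = sqrt \<bar>real_of_int (fst i)\<bar>"
      define t where "t = sqrt (norm (base i))"
      have "q \<le> sqrt (L * norm (base i))" unfolding q_def using L(2)[of i] by simp
      then have "q \<le> sqrt L * t" by (simp add: t_def real_sqrt_mult)
      moreover have t0: "0 \<le> t" "0 \<le> sqrt L" using L by (simp_all add: t_def)
      moreover have "(1 + sqrt L) * (1 + t) = 1 + t + sqrt L + sqrt L * t" by (simp add: algebra_simps)
      ultimately have q: "1 + q \<le> (1 + sqrt L) * (1 + t)" by linarith
      have q0: "0 \<le> q" by (simp add: q_def)
      have "\<phi> (letter (fst i)) \<le> \<phi> True + \<phi> False" using \<phi>(1)[of True] \<phi>(1)[of False] by (cases "letter (fst i)") auto
      then have "2 * \<kappa> * \<phi> (letter (fst i)) \<le> 2 * \<kappa> * (\<phi> True + \<phi> False)" using \<kappa> by (intro mult_left_mono) auto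
      then have "\<bar>x$1 - P (fst i)\<bar> \<le> 2 * \<kappa> * (\<phi> True + \<phi> False)" using x(2,3) unfolding P_step by simp
      moreover have "\<bar>P (fst i) - mean s * of_int (fst i)\<bar> \<le> \<kappa> * M * (2 + q) + mean s" unfolding q_def by (rule drift)
      moreover have "\<bar>a (fst i) - mean s * of_int (fst i)\<bar> \<le> M' * (1 + q)" unfolding a_def q_def by (rule M'(2))
      ultimately have "\<bar>x$1 - a (fst i)\<bar> \<le> 2 * \<kappa> * (\<phi> True + \<phi> False) + (\<kappa> * M * (2 + q) + mean s) + M' * (1 + q)" by linarith
      also have "\<dots> \<le> A * (1 + q)"
      proof -
        have "0 \<le> 2 * \<kappa> * (\<phi> True + \<phi> False) * q" "0 \<le> \<kappa> * M * q" "0 \<le> mean s * q" using \<kappa> \<phi> M mean_s q0 by simp_all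
        then show ?thesis unfolding A_def by (simp add: algebra_simps)
      qed
      also have "\<dots> \<le> A * ((1 + sqrt L) * (1 + t))" using q A by (rule mult_left_mono)
      finally have x1: "\<bar>x$1 - a (fst i)\<bar> \<le> A * ((1 + sqrt L) * (1 + t))" .
      have "z - base i = frame e f (x - pt (a (fst i)) (row i))" by (simp add: x(1) base_def frame_diff)
      then have "norm (z - base i) \<le> \<bar>x$1 - a (fst i)\<bar> * norm e + \<bar>x$2 - row i\<bar> * norm f"
        using frame_norm_le[of e f "x - pt (a (fst i)) (row i)"] by simp
      also have "\<dots> \<le> A * ((1 + sqrt L) * (1 + t)) * norm e + 2 * norm f"
        using x1 x(4,5) by (intro add_mono mult_right_mono) auto
      also have "\<dots> \<le> K * (1 + t)" using t0 unfolding K_def by (simp add: algebra_simps)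
      finally show "z \<in> cball (base i) (K * (1 + sqrt (norm (base i))))" by (simp add: t_def dist_norm norm_minus_commute)
    qed
    show "(\<Union>i. C i) = UNIV"
    proof -
      have "z \<in> (\<Union>i. C i)" for z
      proof -
        obtain x where x: "z = frame e f x" using surj_frame[OF wedge_ne] by blast
        define m where "m = \<lfloor>x$2 / 2\<rfloor>"
        have m: "2 * of_int m \<le> x$2" "x$2 \<le> 2 * of_int m + 2" unfolding m_def by linarith+
        have "\<bar>\<kappa> * cum \<phi> (2 * j) - 2 * mean s * of_int j\<bar> \<le> 2 * \<kappa> * M * (1 + sqrt \<bar>real_of_int j\<bar>)" for j
        proof -
          have "\<kappa> * cum \<phi> (2 * j) - 2 * mean s * of_int j = \<kappa> * (cum \<phi> (2 * j) - mean \<phi> * of_int (2 * j))"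
            unfolding \<kappa>(2)[symmetric] by (simp add: algebra_simps)
          then have "\<bar>\<kappa> * cum \<phi> (2 * j) - 2 * mean s * of_int j\<bar> = \<kappa> * \<bar>cum \<phi> (2 * j) - mean \<phi> * of_int (2 * j)\<bar>"
            using \<kappa> by (simp add: abs_mult)
          also have "\<dots> \<le> \<kappa> * (M * (1 + sqrt \<bar>real_of_int (2 * j)\<bar>))"
            by (intro mult_left_mono M(2)) (use \<kappa> in simp)
          also have "\<dots> \<le> \<kappa> * (M * (2 * (1 + sqrt \<bar>real_of_int j\<bar>)))"
          proof (intro mult_left_mono)
            have "\<bar>real_of_int (2 * j)\<bar> \<le> 4 * \<bar>real_of_int j\<bar>" by simp
            then have "sqrt \<bar>real_of_int (2 * j)\<bar> \<le> sqrt (4 * \<bar>real_of_int j\<bar>)" by (rule real_sqrt_le_mono)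
            also have "\<dots> = 2 * sqrt \<bar>real_of_int j\<bar>" unfolding real_sqrt_mult real_sqrt_four ..
            finally show "1 + sqrt \<bar>real_of_int (2 * j)\<bar> \<le> 2 * (1 + sqrt \<bar>real_of_int j\<bar>)" by simp
          qed (use \<kappa> M in simp_all)
          also have "\<dots> = 2 * \<kappa> * M * (1 + sqrt \<bar>real_of_int j\<bar>)" by (simp only: mult_ac)
          finally show ?thesis .
        qed
        then obtain j where j: "\<kappa> * cum \<phi> (2 * j) \<le> x$1" "x$1 \<le> \<kappa> * cum \<phi> (2 * (j + 1))"
          using discrete_between[of "\<lambda>j. \<kappa> * cum \<phi> (2 * j)" "2 * mean s" "2 * \<kappa> * M" "x$1"] mean_s by auto
        \<comment> \<open>Row \<open>m\<close> contains only columns of the parity of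
          \<open>m\<close>; this is the one in the pair \<open>j\<close>.\<close>
        define k where "k = 2 * j + m mod 2"
        have k: "k div 2 = j" "(k + 2) div 2 = j + 1" "k + 2 * ((m - k) div 2) = m" unfolding k_def by presburger+
        have "row (k, (m - k) div 2) = 2 * of_int m" unfolding row_def fst_conv snd_conv k(3) ..
        moreover have "P k \<le> x$1" "x$1 \<le> P (k + 2)" using j unfolding P_def k by simp_all
        ultimately have "z \<in> C (k, (m - k) div 2)" unfolding C_def x using m by (auto simp: mem_cbox_pt)
        then show ?thesis by blast
      qed
      then show ?thesis by blast
    qed
  qed
  moreover have "measure lebesgue (C i) = (4 * \<bar>wedge e f\<bar> * \<kappa>) * \<phi> (letter (fst i))" for i
  proof -
    have "measure lebesgue (C i) = \<bar>wedge e f\<bar> * measure lebesgue (cbox (pt (P (fst i)) (row i)) (pt (P (fst i + 2)) (row i + 2)))"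
      unfolding C_def by (rule measure_frame) simp
    also have "\<dots> = \<bar>wedge e f\<bar> * ((P (fst i + 2) - P (fst i)) * (row i + 2 - row i))"
      by (subst measure_cbox_pt) (simp_all add: P_le)
    finally show ?thesis by (simp add: P_step)
  qed
  ultimately have "((\<lambda>R. (4 * \<bar>wedge e f\<bar> * \<kappa>) * ((\<Sum>i | base i \<in> cball 0 R. \<phi> (letter (fst i))) / (pi * R\<^sup>2))) \<longlongrightarrow> 1) at_top"
    by (simp add: sum_distrib_left[symmetric])
  then have "((\<lambda>R. (4 * \<bar>wedge e f\<bar> * \<kappa>) * ((\<Sum>i | base i \<in> cball 0 R. \<phi> (letter (fst i))) / (pi * R\<^sup>2)) / (4 * \<bar>wedge e f\<bar> * \<kappa>))
      \<longlongrightarrow> 1 / (4 * \<bar>wedge e f\<bar> * \<kappa>)) at_top"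
    using wedge_ne \<kappa> by (intro tendsto_divide tendsto_const) auto
  moreover have "1 / (4 * \<bar>wedge e f\<bar> * \<kappa>) = mean \<phi> / (4 * \<bar>wedge e f\<bar> * mean s)" by (simp add: \<kappa>_def)
  ultimately show ?thesis using wedge_ne \<kappa>(1) by simp
qed

text \<open>Points are within a fixed distance \<delta> of the base of their block. So the sum over
  points is enclosed by block sums for the radii R - \<delta> and R + \<delta>, which have the same
  limit.\<close>

lemma point_sum_limit:
  fixes g :: "plane \<Rightarrow> real"
  assumes g: "\<And>p. 0 \<le> g p"
    and H: "((\<lambda>R. (\<Sum>i | base i \<in> cball 0 R. \<Sum>p\<in>points i. g p) / (pi * R\<^sup>2)) \<longlongrightarrow> l) at_top"
  shows "((\<lambda>R. (\<Sum>p \<in> frame e f ` X \<inter> cball 0 R. g p) / (pi * R\<^sup>2)) \<longlongrightarrow> l) at_top"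
proof -
  define H where "H R = (\<Sum>i | base i \<in> cball 0 R. \<Sum>p\<in>points i. g p)" for R
  define G where "G R = (\<Sum>p \<in> frame e f ` X \<inter> cball 0 R. g p)" for R
  define \<delta> where "\<delta> = 2 * norm e"
  have fp: "finite (points i)" for i by (simp add: points_def)
  have H_eq: "H R = (\<Sum>p \<in> (\<Union>i\<in>{i. base i \<in> cball 0 R}. points i). g p)" for R
    unfolding H_def using finite_base fp points_disjoint by (intro sum.UNION_disjoint[symmetric]) auto
  have fin: "finite (frame e f ` X \<inter> cball 0 R)" for R using packing_finite[OF packing_columns] .
  have sandwich: "H (- \<delta> + R) \<le> G R" "G R \<le> H (\<delta> + R)" for R
  proof -
    have "p \<in> cball 0 R" if "p \<in> points i" "base i \<in> cball 0 (- \<delta> + R)" for p i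
      using points_near[OF that(1)] that(2) norm_triangle_ineq2[of p "base i"] by (simp add: \<delta>_def dist_norm)
    then show "H (- \<delta> + R) \<le> G R" unfolding H_eq G_def using g fin points_cover by (intro sum_mono2) auto
    have "base i \<in> cball 0 (\<delta> + R)" if "p \<in> points i" "p \<in> cball 0 R" for p i
      using points_near[OF that(1)] that(2) norm_triangle_ineq2[of "base i" p] by (simp add: \<delta>_def dist_norm norm_minus_commute)
    then have "frame e f ` X \<inter> cball 0 R \<subseteq> (\<Union>i\<in>{i. base i \<in> cball 0 (\<delta> + R)}. points i)" unfolding points_cover by blast
    then show "G R \<le> H (\<delta> + R)" unfolding H_eq G_def using g finite_base fp by (intro sum_mono2) auto
  qed
  have shift: "((\<lambda>R. H (d + R) / (pi * R\<^sup>2)) \<longlongrightarrow> l) at_top" for d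
  proof -
    have up: "filterlim (\<lambda>R::real. d + R) at_top at_top" by (rule filterlim_tendsto_add_at_top[OF tendsto_const filterlim_ident])
    have "((\<lambda>R. H (d + R) / (pi * (d + R)\<^sup>2)) \<longlongrightarrow> l) at_top" using filterlim_compose[OF H[folded H_def] up] .
    moreover have "((\<lambda>R::real. (d * inverse R + 1)\<^sup>2) \<longlongrightarrow> (d * 0 + 1)\<^sup>2) at_top"
      by (intro tendsto_intros tendsto_inverse_0_at_top filterlim_ident)
    ultimately have "((\<lambda>R. H (d + R) / (pi * (d + R)\<^sup>2) * (d * inverse R + 1)\<^sup>2) \<longlongrightarrow> l * (d * 0 + 1)\<^sup>2) at_top" by (rule tendsto_mult)
    moreover have "\<forall>\<^sub>F R in at_top. H (d + R) / (pi * (d + R)\<^sup>2) * (d * inverse R + 1)\<^sup>2 = H (d + R) / (pi * R\<^sup>2)"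
      using eventually_gt_at_top[of 0] eventually_gt_at_top[of "- d"]
    proof eventually_elim
      case (elim R)
      have "d * inverse R + 1 = (d + R) / R" using elim by (simp add: field_simps)
      then show ?case using elim by (simp add: power_divide)
    qed
    ultimately show ?thesis by (simp add: tendsto_cong)
  qed
  have lo: "\<forall>\<^sub>F R in at_top. H (- \<delta> + R) / (pi * R\<^sup>2) \<le> G R / (pi * R\<^sup>2)"
    using sandwich by (intro always_eventually allI divide_right_mono) auto
  have hi: "\<forall>\<^sub>F R in at_top. G R / (pi * R\<^sup>2) \<le> H (\<delta> + R) / (pi * R\<^sup>2)"
    using sandwich by (intro always_eventually allI divide_right_mono) auto
  show ?thesis using tendsto_sandwich[OF lo hi shift shift] unfolding G_def .
qed

end

section \<open>Degrees and densities of mixtures\<close>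

context mixture
begin

abbreviation "Y \<equiv> frame e f ` X"

definition degree_sum :: "int \<times> int \<Rightarrow> real" where
  "degree_sum i = (\<Sum>p\<in>points i. real (card (neighbours D Y p)))"

definition block_size :: "bool \<Rightarrow> real" where "block_size t = (if W t = 2 then 2 else 1)"
text \<open>The sum of the degrees in a block whose surroundings have the same letter: a pair has
  two points of degree 3; a single point has four slants, and two bridges in addition if the gap is
  1.\<close>

definition block_degree :: "bool \<Rightarrow> real" where "block_degree t = (if W t = 2 \<or> \<sigma> t = 1 then 6 else 4)"

lemma card_points: "real (card (points i)) = block_size (letter (fst i))"
proof -
  have "pt x y = pt x' y \<longleftrightarrow> x = x'" for x x' y by (metis pt_nth(1))
  then show ?thesis using W[of "letter (fst i)"] by (auto simp: points_def block_size_def b_def frame_eq_iff card_insert_if)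
qed

lemma card_neighbours: "card (neighbours D Y (frame e f p)) = card {q \<in> X. q \<noteq> p \<and> hnorm r (q - p) \<le> 2}"
  unfolding neighbours_columns by (intro card_image inj_on_subset[OF inj_frame[OF wedge_ne]]) simp

lemma contact_cases:
  assumes "even (k + m)" "x = a k \<or> x = b k" "q \<in> X" "q \<noteq> pt x (2 * of_int m)" "hnorm r (q - pt x (2 * of_int m)) \<le> 2"
  shows "b k = a k + 2 \<and> (q = pt (a k) (2 * of_int m) \<or> q = pt (b k) (2 * of_int m))
    \<or> x = b k \<and> (\<exists>\<epsilon>\<in>{1, - 1}. q = pt (a (k + 1)) (2 * of_int (m + \<epsilon>)))
    \<or> x = b k \<and> flat (k + 1) \<and> q = pt (a (k + 2)) (2 * of_int m)
    \<or> x = a k \<and> (\<exists>\<epsilon>\<in>{1, - 1}. q = pt (b (k - 1)) (2 * of_int (m + \<epsilon>)))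
    \<or> x = a k \<and> flat (k - 1) \<and> q = pt (b (k - 2)) (2 * of_int m)"
proof -
  obtain l n x' where q: "q = pt x' (2 * of_int n)" "even (l + n)" "x' = a l \<or> x' = b l" using assms(3) unfolding X_def by blast
  have ne: "x \<noteq> x' \<or> m \<noteq> n" "x' \<noteq> x \<or> n \<noteq> m" using assms(4) q(1) by auto
  show ?thesis
  proof (cases "k \<le> l")
    case True
    from contact(2)[OF assms(1) q(2) assms(2) q(3) True ne(1)] assms(5)
    consider "l = k" "n = m" "b k = a k + 2" | "l = k + 1" "n = m + 1 \<or> n = m - 1" "x = b k" "x' = a (k + 1)"
      | "l = k + 2" "n = m" "x = b k" "x' = a (k + 2)" "flat (k + 1)" unfolding q(1) by blast
    then show ?thesis
    proof cases
      case 1 then show ?thesis using q(1,3) by blast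
    next
      case 2
      then have "n - m \<in> {1, - 1}" "m + (n - m) = n" by auto
      then show ?thesis using 2 q(1) by metis
    next
      case 3 then show ?thesis using q(1) by blast
    qed
  next
    case False
    then have lk: "l \<le> k" by simp
    from contact(2)[OF q(2) assms(1) q(3) assms(2) lk ne(2)] assms(5)
    consider "k = l" "m = n" "b l = a l + 2" | "k = l + 1" "m = n + 1 \<or> m = n - 1" "x' = b l" "x = a (l + 1)"
      | "k = l + 2" "m = n" "x' = b l" "x = a (l + 2)" "flat (l + 1)"
      unfolding q(1) hnorm_minus[of "pt x' (2 * of_int n)"] by blast
    then show ?thesis
    proof cases
      case 1 then show ?thesis using False by simp
    next
      case 2
      then have "n - m \<in> {1, - 1}" "m + (n - m) = n" "l = k - 1" by auto
      then show ?thesis using 2 q(1) by (metis diff_add_cancel)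
    next
      case 3
      then have "l = k - 2" "l + 1 = k - 1" by auto
      then show ?thesis using 3 q(1) by (metis diff_add_cancel)
    qed
  qed
qed

lemma contacts:
  assumes "even (k + m)"
  shows "\<epsilon> \<in> {1, - 1} \<Longrightarrow> pt (a (k + 1)) (2 * of_int (m + \<epsilon>)) \<in> X \<and> hnorm r (pt (a (k + 1)) (2 * of_int (m + \<epsilon>)) - pt (b k) (2 * of_int m)) \<le> 2"
    and "\<epsilon> \<in> {1, - 1} \<Longrightarrow> pt (b (k - 1)) (2 * of_int (m + \<epsilon>)) \<in> X \<and> hnorm r (pt (b (k - 1)) (2 * of_int (m + \<epsilon>)) - pt (a k) (2 * of_int m)) \<le> 2"
    and "flat (k + 1) \<Longrightarrow> pt (a (k + 2)) (2 * of_int m) \<in> X \<and> hnorm r (pt (a (k + 2)) (2 * of_int m) - pt (b k) (2 * of_int m)) \<le> 2"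
    and "flat (k - 1) \<Longrightarrow> pt (b (k - 2)) (2 * of_int m) \<in> X \<and> hnorm r (pt (b (k - 2)) (2 * of_int m) - pt (a k) (2 * of_int m)) \<le> 2"
    and "b k = a k + 2 \<Longrightarrow> pt (a k) (2 * of_int m) \<in> X \<and> pt (b k) (2 * of_int m) \<in> X
      \<and> hnorm r (pt (a k) (2 * of_int m) - pt (b k) (2 * of_int m)) \<le> 2 \<and> hnorm r (pt (b k) (2 * of_int m) - pt (a k) (2 * of_int m)) \<le> 2"
proof -
  have inX: "pt (a l) (2 * of_int n) \<in> X \<and> pt (b l) (2 * of_int n) \<in> X" if "even (l + n)" for l n
    using that unfolding X_def by blast
  show "\<epsilon> \<in> {1, - 1} \<Longrightarrow> pt (a (k + 1)) (2 * of_int (m + \<epsilon>)) \<in> X \<and> hnorm r (pt (a (k + 1)) (2 * of_int (m + \<epsilon>)) - pt (b k) (2 * of_int m)) \<le> 2"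
    using inX[of "k + 1" "m + \<epsilon>"] assms s1[of k] s2[of k] unfolding hnorm_pt by auto
  show "\<epsilon> \<in> {1, - 1} \<Longrightarrow> pt (b (k - 1)) (2 * of_int (m + \<epsilon>)) \<in> X \<and> hnorm r (pt (b (k - 1)) (2 * of_int (m + \<epsilon>)) - pt (a k) (2 * of_int m)) \<le> 2"
    using inX[of "k - 1" "m + \<epsilon>"] assms s1[of "k - 1"] s2[of "k - 1"] unfolding hnorm_pt by auto
  show "flat (k + 1) \<Longrightarrow> pt (a (k + 2)) (2 * of_int m) \<in> X \<and> hnorm r (pt (a (k + 2)) (2 * of_int m) - pt (b k) (2 * of_int m)) \<le> 2"
    using inX[of "k + 2" m] assms unfolding hnorm_pt flat_def by (auto simp: add.assoc)
  show "flat (k - 1) \<Longrightarrow> pt (b (k - 2)) (2 * of_int m) \<in> X \<and> hnorm r (pt (b (k - 2)) (2 * of_int m) - pt (a k) (2 * of_int m)) \<le> 2"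
    using inX[of "k - 2" m] assms unfolding hnorm_pt flat_def by auto
  show "b k = a k + 2 \<Longrightarrow> pt (a k) (2 * of_int m) \<in> X \<and> pt (b k) (2 * of_int m) \<in> X
      \<and> hnorm r (pt (a k) (2 * of_int m) - pt (b k) (2 * of_int m)) \<le> 2 \<and> hnorm r (pt (b k) (2 * of_int m) - pt (a k) (2 * of_int m)) \<le> 2"
    using inX[OF assms] unfolding hnorm_pt by auto
qed

text \<open>Columns \<open>k - 2\<close> and \<open>k + 2\<close> belong to the neighbouring pairs
  of columns. If they have the letter of \<open>k\<close>, so do all columns that can touch column
  \<open>k\<close>.\<close>

definition changing :: "int \<Rightarrow> bool" where
  "changing k \<longleftrightarrow> \<not> (letter (k - 2) = letter k \<and> letter (k + 2) = letter k)"

lemma letters_near: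
  assumes "\<not> changing k"
  shows "letter (k - 2) = letter k" "letter (k - 1) = letter k" "letter (k + 1) = letter k"
proof -
  have h: "letter (k - 2) = letter k" "letter (k + 2) = letter k" using assms by (simp_all add: changing_def)
  have eq: "letter x = letter y" if "x div 2 = y div 2" for x y using that by (simp only: letter_def)
  show "letter (k - 2) = letter k" by fact
  show "letter (k - 1) = letter k"
  proof (cases "even k")
    case True
    then have "(k - 1) div 2 = (k - 2) div 2" by presburger
    then show ?thesis using eq h by blast
  next
    case False
    then have "(k - 1) div 2 = k div 2" by presburger
    then show ?thesis by (rule eq)
  qed
  show "letter (k + 1) = letter k"
  proof (cases "even k")
    case True
    then have "(k + 1) div 2 = k div 2" by presburger
    then show ?thesis by (rule eq)
  next
    case False
    then have "(k + 1) div 2 = (k + 2) div 2" by presburger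
    then show ?thesis using eq h by blast
  qed
qed

lemma a_step: "a (k + 1) = b k + \<sigma> (letter k)" by (simp add: a_def b_def cum_step)

lemma degree_sum_eq:
  assumes "\<not> changing (fst i)" shows "degree_sum i = block_degree (letter (fst i))"
proof -
  define k where "k = fst i"
  define m where "m = k + 2 * snd i"
  define t where "t = letter k"
  have km: "even (k + m)" by (simp add: m_def)
  have row: "row i = 2 * of_int m" by (simp add: row_def m_def k_def)
  note t = letters_near[OF assms[folded k_def], folded t_def]
  have a2: "a (k + 2) = b k + \<sigma> t + W t + \<sigma> t"
    using a_step[of "k + 1"] a_step[of k] t by (simp add: b_def t_def add.assoc)
  have b2: "a k = b (k - 2) + \<sigma> t + W t + \<sigma> t"
    using a_step[of "k - 2"] a_step[of "k - 1"] t by (simp add: b_def)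
  have flat: "flat (k + 1) \<longleftrightarrow> W t = 0 \<and> \<sigma> t = 1" "flat (k - 1) \<longleftrightarrow> W t = 0 \<and> \<sigma> t = 1"
    using a2 b2 W[of t] \<sigma>(1)[of t] by (auto simp: flat_def add.assoc)
  define N where "N x = {q \<in> X. q \<noteq> pt x (2 * of_int m) \<and> hnorm r (q - pt x (2 * of_int m)) \<le> 2}" for x
  have ptne: "x \<noteq> x' \<or> y \<noteq> y' \<Longrightarrow> pt x y \<noteq> pt x' y'" for x x' y y' by (metis pt_nth)
  have pteq: "pt x y = pt x' y' \<longleftrightarrow> x = x' \<and> y = y'" for x x' y y' by (metis pt_nth)
  have gaps: "b (k - 2) < b (k - 1)" "b (k - 1) < a k" "a k \<le> b k" "b k < a (k + 1)" "a (k + 1) < a (k + 2)"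
    using mono_cols[of "k - 2" "k - 1"] ab[of "k - 1"] prev_step[of k] ab[of k] step[of k]
      ab[of "k + 1"] step[of "k + 1"] by (simp_all add: add.assoc)
  let ?R = "{pt (a (k + 1)) (2 * of_int (m + 1)), pt (a (k + 1)) (2 * of_int (m + - 1))}"
  let ?L = "{pt (b (k - 1)) (2 * of_int (m + 1)), pt (b (k - 1)) (2 * of_int (m + - 1))}"
  show ?thesis
  proof (cases "W t = 2")
    case True
    then have bk: "b k = a k + 2" by (simp add: b_def t_def)
    have "N (a k) = insert (pt (b k) (2 * of_int m)) ?L"
    proof
      show "N (a k) \<subseteq> insert (pt (b k) (2 * of_int m)) ?L"
        using contact_cases[OF km, of "a k"] flat True bk unfolding N_def by auto
      show "insert (pt (b k) (2 * of_int m)) ?L \<subseteq> N (a k)"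
        using contacts(2)[OF km, of 1] contacts(2)[OF km, of "- 1"] contacts(5)[OF km] bk gaps unfolding N_def by (auto simp: pteq)
    qed
    then have 1: "card (N (a k)) = 3" using gaps by (simp add: pteq)
    have "N (b k) = insert (pt (a k) (2 * of_int m)) ?R"
    proof
      show "N (b k) \<subseteq> insert (pt (a k) (2 * of_int m)) ?R"
        using contact_cases[OF km, of "b k"] flat True bk unfolding N_def by auto
      show "insert (pt (a k) (2 * of_int m)) ?R \<subseteq> N (b k)"
        using contacts(1)[OF km, of 1] contacts(1)[OF km, of "- 1"] contacts(5)[OF km] bk gaps unfolding N_def by (auto simp: pteq)
    qed
    then have 2: "card (N (b k)) = 3" using gaps by (simp add: pteq)
    have "degree_sum i = real (card (N (a k))) + real (card (N (b k)))"
      using bk unfolding degree_sum_def points_def k_def[symmetric] row by (simp add: frame_eq_iff pteq card_neighbours N_def)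
    then show ?thesis using 1 2 True by (simp add: block_degree_def t_def k_def)
  next
    case False
    then have "W t = 0" using W by blast
    then have bk: "b k = a k" by (simp add: b_def t_def)
    let ?F = "if \<sigma> t = 1 then {pt (a (k + 2)) (2 * of_int m), pt (b (k - 2)) (2 * of_int m)} else {}"
    have "N (a k) = ?R \<union> ?L \<union> ?F"
    proof
      show "N (a k) \<subseteq> ?R \<union> ?L \<union> ?F"
        using contact_cases[OF km, of "a k"] flat \<open>W t = 0\<close> bk unfolding N_def by auto
      show "?R \<union> ?L \<union> ?F \<subseteq> N (a k)"
        using contacts(1)[OF km, of 1] contacts(1)[OF km, of "- 1"] contacts(2)[OF km, of 1] contacts(2)[OF km, of "- 1"] contacts(3,4)[OF km] flat \<open>W t = 0\<close> bk gaps unfolding N_def by (auto simp: pteq)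
    qed
    then have "card (N (a k)) = (if \<sigma> t = 1 then 6 else 4)" using gaps by (simp add: pteq)
    moreover have "degree_sum i = real (card (N (a k)))"
      unfolding degree_sum_def points_def k_def[symmetric] row bk by (simp add: card_neighbours N_def)
    ultimately show ?thesis using \<open>W t = 0\<close> by (simp add: block_degree_def t_def k_def)
  qed
qed

lemma card_changing: "real (card {k. \<bar>k\<bar> \<le> int N \<and> changing k}) \<le> 16 * (1 + sqrt (real (N + 2)))"
proof -
  let ?C = "{i. \<bar>i\<bar> \<le> int (N + 2) \<and> \<gamma> (i + 2) - \<gamma> (i + 1) \<noteq> \<gamma> (i + 1) - \<gamma> i}"
  have fin: "finite ?C" by (rule finite_subset[of _ "{- int (N + 2)..int (N + 2)}"]) auto
  have same: "letter x = letter y" if "\<gamma> (j + 2) - \<gamma> (j + 1) = \<gamma> (j + 1) - \<gamma> j" "x div 2 = j" "y div 2 = j + 1" for x y j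
  proof -
    have "j + 1 + 1 = j + 2" by simp
    then show ?thesis unfolding letter_def that(2,3) using that(1) by (auto simp only:; linarith)
  qed
  \<comment> \<open>A change between the pairs \<open>i\<close> and \<open>i + 1\<close> affects
    only their four columns, numbered 2 i to 2 i + 3.\<close>
  have "{k. \<bar>k\<bar> \<le> int N \<and> changing k} \<subseteq> (\<lambda>(i, d). 2 * i + d) ` (?C \<times> {0..3})"
  proof
    fix k assume "k \<in> {k. \<bar>k\<bar> \<le> int N \<and> changing k}"
    then have k: "\<bar>k\<bar> \<le> int N" "letter (k - 2) \<noteq> letter k \<or> letter (k + 2) \<noteq> letter k" by (auto simp: changing_def)
    define j where "j = k div 2"
    have d: "(k - 2) div 2 = j - 1" "(k + 2) div 2 = j + 1" "k div 2 = j" "k div 2 = j - 1 + 1" by (simp_all add: j_def)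
    have "\<bar>j\<bar> \<le> int (N + 2)" "\<bar>j - 1\<bar> \<le> int (N + 2)" using k(1) unfolding j_def by linarith+
    then have jC: "j \<in> ?C \<or> j - 1 \<in> ?C" using k(2) same[OF _ d(3,2)] same[OF _ d(1,4)] by auto
    have im: "k \<in> (\<lambda>(i, d). 2 * i + d) ` (?C \<times> {0..3})" if "i \<in> ?C" "d \<in> {0..3}" "k = 2 * i + d" for i d
    proof -
      have "(i, d) \<in> ?C \<times> {0..3}" using that(1,2) by (rule SigmaI)
      then have "(\<lambda>(i, d). 2 * i + d) (i, d) \<in> (\<lambda>(i, d). 2 * i + d) ` (?C \<times> {0..3})" by (rule imageI)
      then show ?thesis unfolding that(3) by (simp only: case_prod_conv)
    qed
    have kk: "k mod 2 \<in> {0..3}" "k mod 2 + 2 \<in> {0..3}" "k = 2 * j + k mod 2" "k = 2 * (j - 1) + (k mod 2 + 2)"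
      unfolding j_def by simp_all
    from jC show "k \<in> (\<lambda>(i, d). 2 * i + d) ` (?C \<times> {0..3})"
    proof
      assume "j \<in> ?C" from im[OF this kk(1,3)] show ?thesis .
    next
      assume "j - 1 \<in> ?C" from im[OF this kk(2,4)] show ?thesis .
    qed
  qed
  then have "card {k. \<bar>k\<bar> \<le> int N \<and> changing k} \<le> card ((\<lambda>(i, d). 2 * i + d) ` (?C \<times> {0..3}))"
    using fin by (intro card_mono) auto
  also have "\<dots> \<le> card (?C \<times> {0..3::int})" using fin by (intro card_image_le) auto
  also have "\<dots> = 4 * card ?C" by (simp add: card_cartesian_product)
  finally have "real (card {k. \<bar>k\<bar> \<le> int N \<and> changing k}) \<le> real (4 * card ?C)" by (simp only: of_nat_le_iff)
  also have "\<dots> \<le> 16 * (1 + sqrt (real (N + 2)))" using word_changes[of "N + 2"] by simp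
  finally show ?thesis .
qed

text \<open>O(sqrt R) columns with O(R) blocks each: this is R^(3/2), of lower order than the area
  of the disc.\<close>

lemma changing_blocks_negligible:
  "((\<lambda>R. real (card {i. base i \<in> cball 0 R \<and> changing (fst i)}) / (pi * R\<^sup>2)) \<longlongrightarrow> 0) at_top"
proof -
  obtain L where L: "0 \<le> L" "\<forall>i. \<bar>real_of_int (fst i)\<bar> \<le> L * norm (base i) \<and> \<bar>row i\<bar> \<le> L * norm (base i)"
    using base_bounds by blast
  define Q where "Q = 16 * (1 + sqrt (L + 3)) * (2 * L + 3)"
  have bound: "real (card {i. base i \<in> cball 0 R \<and> changing (fst i)}) \<le> Q * (sqrt R * R)" if R: "1 \<le> R" for R
  proof -
    define N where "N = nat \<lceil>L * R\<rceil>"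
    have N: "L * R \<le> N" "real N \<le> L * R + 1" using L R by (simp_all add: N_def real_nat_ceiling_ge)
    let ?K = "{k. \<bar>k\<bar> \<le> int N \<and> changing k}"
    have finK: "finite ?K" by (rule finite_subset[of _ "{- int N..int N}"]) auto
    have "{i. base i \<in> cball 0 R \<and> changing (fst i)} \<subseteq> ?K \<times> {- int N..int N}"
    proof
      fix i assume i: "i \<in> {i. base i \<in> cball 0 R \<and> changing (fst i)}"
      then have "L * norm (base i) \<le> L * R" using L(1) by (intro mult_left_mono) auto
      then have "\<bar>real_of_int (fst i)\<bar> \<le> N" "\<bar>row i\<bar> \<le> N" using L(2) N(1) by (meson order_trans)+
      then have "\<bar>fst i\<bar> \<le> int N" "\<bar>2 * (fst i + 2 * snd i)\<bar> \<le> int N" unfolding row_def by linarith+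
      note fi = this
      have "- fst i \<le> int N" "fst i \<le> int N" "0 \<le> int N" using fi(1) by simp_all
      moreover have "2 * fst i + 4 * snd i \<le> int N" using abs_le_D1[OF fi(2)] by (simp add: distrib_left)
      moreover have "- (2 * fst i + 4 * snd i) \<le> int N" using abs_le_D2[OF fi(2)] by (simp add: distrib_left)
      ultimately have "snd i \<le> int N" "- snd i \<le> int N" by linarith+
      then have "\<bar>snd i\<bar> \<le> int N" by (simp add: abs_le_iff)
      note fi = fi this
      then show "i \<in> ?K \<times> {- int N..int N}" using i fi by (auto simp: mem_Times_iff)
    qed
    then have "card {i. base i \<in> cball 0 R \<and> changing (fst i)} \<le> card (?K \<times> {- int N..int N})"
      using finK by (intro card_mono) auto
    also have "\<dots> = card ?K * (2 * N + 1)"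
    proof -
      have "card {- int N..int N} = 2 * N + 1" unfolding card_atLeastAtMost_int nat_eq_iff by simp
      then show ?thesis by (simp only: card_cartesian_product)
    qed
    finally have "real (card {i. base i \<in> cball 0 R \<and> changing (fst i)}) \<le> real (card ?K) * real (2 * N + 1)"
      by (simp only: of_nat_mult[symmetric] of_nat_le_iff)
    also have "\<dots> \<le> 16 * (1 + sqrt (real (N + 2))) * real (2 * N + 1)" by (intro mult_right_mono card_changing) simp
    also have "\<dots> \<le> 16 * ((1 + sqrt (L + 3)) * sqrt R) * ((2 * L + 3) * R)"
    proof (intro mult_mono)
      have "real (N + 2) \<le> (L + 3) * R" "real (2 * N + 1) \<le> (2 * L + 3) * R" using N R by (simp_all add: distrib_right)
      then show "real (2 * N + 1) \<le> (2 * L + 3) * R" by simp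
      have "sqrt (real (N + 2)) \<le> sqrt ((L + 3) * R)" using \<open>real (N + 2) \<le> (L + 3) * R\<close> by (rule real_sqrt_le_mono)
      then have N2: "sqrt (real (N + 2)) \<le> sqrt (L + 3) * sqrt R" unfolding real_sqrt_mult .
      have R1: "1 \<le> sqrt R" using R by simp
      show "1 + sqrt (real (N + 2)) \<le> (1 + sqrt (L + 3)) * sqrt R"
        unfolding distrib_right mult_1 by (rule add_mono[OF R1 N2])
    qed (use L R in auto)
    finally show ?thesis by (simp add: Q_def mult_ac)
  qed
  have "((\<lambda>R. Q / pi * inverse (sqrt R)) \<longlongrightarrow> Q / pi * 0) at_top"
    by (intro tendsto_intros tendsto_inverse_0_at_top sqrt_at_top)
  then have lim: "((\<lambda>R. Q / pi * inverse (sqrt R)) \<longlongrightarrow> 0) at_top" by simp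
  have hi: "\<forall>\<^sub>F R in at_top. real (card {i. base i \<in> cball 0 R \<and> changing (fst i)}) / (pi * R\<^sup>2) \<le> Q / pi * inverse (sqrt R)"
    using eventually_ge_at_top[of 1]
  proof eventually_elim
    case (elim R)
    have "inverse (sqrt R) = sqrt R / R" using sqrt_divide_self_eq[of R] elim by simp
    then have "Q / pi * inverse (sqrt R) = Q * (sqrt R * R) / (pi * R\<^sup>2)" using elim by (simp add: power2_eq_square)
    then show ?case using bound[OF elim] elim by (simp add: divide_right_mono)
  qed
  have lo: "\<forall>\<^sub>F R in at_top. 0 \<le> real (card {i. base i \<in> cball 0 R \<and> changing (fst i)}) / (pi * R\<^sup>2)" by simp
  show ?thesis by (rule tendsto_sandwich[OF lo hi tendsto_const lim])
qed

lemma mean_pos: assumes "\<And>t. 1 \<le> \<phi> t" shows "0 < mean \<phi>"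
proof -
  have "\<theta> * 1 + (1 - \<theta>) * 1 \<le> mean \<phi>" unfolding mean_def using freq assms by (intro add_mono mult_left_mono) auto
  then show ?thesis by simp
qed

text \<open>Blocks without a change nearby have the regular degree sum. For the others the error is
  bounded, since degrees in a packing are, and these blocks have density zero.\<close>

lemma degree_limit:
  "((\<lambda>R. (\<Sum>p \<in> Y \<inter> cball 0 R. real (card (neighbours D Y p))) / (pi * R\<^sup>2)) \<longlongrightarrow>
    mean block_degree / (4 * \<bar>wedge e f\<bar> * mean s)) at_top"
proof (rule point_sum_limit)
  obtain K where K: "0 \<le> K" "\<And>X x. is_packing D X \<Longrightarrow> real (card (neighbours D X x)) \<le> K" using degree_bound by blast
  define Z where "Z R = {i. base i \<in> cball 0 R}" for R
  define Cg where "Cg R = {i. base i \<in> cball 0 R \<and> changing (fst i)}" for R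
  define S where "S R = (\<Sum>i\<in>Z R. block_degree (letter (fst i)))" for R
  have err: "\<bar>degree_sum i - block_degree (letter (fst i))\<bar> \<le> (if changing (fst i) then 2 * K + 6 else 0)" for i
  proof (cases "changing (fst i)")
    case True
    have "degree_sum i \<le> (\<Sum>p\<in>points i. K)" unfolding degree_sum_def using K(2)[OF packing_columns] by (intro sum_mono)
    also have "\<dots> = block_size (letter (fst i)) * K" by (simp add: card_points)
    also have "\<dots> \<le> 2 * K" using K(1) by (intro mult_right_mono) (simp_all add: block_size_def)
    finally have "degree_sum i \<le> 2 * K" .
    moreover have "0 \<le> degree_sum i" unfolding degree_sum_def by (simp add: sum_nonneg)
    moreover have "0 \<le> block_degree (letter (fst i))" "block_degree (letter (fst i)) \<le> 6" by (simp_all add: block_degree_def)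
    ultimately have "\<bar>degree_sum i - block_degree (letter (fst i))\<bar> \<le> 2 * K + 6" using K(1) by linarith
    then show ?thesis using True by (simp only: if_True)
  qed (simp add: degree_sum_eq)
  have diff: "\<bar>(\<Sum>i\<in>Z R. degree_sum i) - S R\<bar> \<le> (2 * K + 6) * card (Cg R)" for R
  proof -
    have "\<bar>(\<Sum>i\<in>Z R. degree_sum i) - S R\<bar> \<le> (\<Sum>i\<in>Z R. \<bar>degree_sum i - block_degree (letter (fst i))\<bar>)"
      unfolding S_def sum_subtractf[symmetric] by (rule sum_abs)
    also have "\<dots> \<le> (\<Sum>i\<in>Z R. if changing (fst i) then 2 * K + 6 else 0)" by (intro sum_mono err)
    also have "\<dots> = (\<Sum>i\<in>Cg R. 2 * K + 6)"
    proof -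
      have "Cg R = {i \<in> Z R. changing (fst i)}" by (auto simp: Cg_def Z_def)
      moreover have "finite (Z R)" unfolding Z_def by (rule finite_base)
      ultimately show ?thesis by (simp only: sum.inter_filter)
    qed
    finally show ?thesis by (simp add: mult.commute)
  qed
  have "((\<lambda>R. (2 * K + 6) * (card (Cg R) / (pi * R\<^sup>2))) \<longlongrightarrow> (2 * K + 6) * 0) at_top"
    unfolding Cg_def by (intro tendsto_mult tendsto_const changing_blocks_negligible)
  then have null: "((\<lambda>R. (2 * K + 6) * (card (Cg R) / (pi * R\<^sup>2))) \<longlongrightarrow> 0) at_top" by simp
  have le: "\<bar>((\<Sum>i\<in>Z R. degree_sum i) - S R) / (pi * R\<^sup>2)\<bar> \<le> (2 * K + 6) * (card (Cg R) / (pi * R\<^sup>2))" for R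
    using divide_right_mono[OF diff[of R], of "pi * R\<^sup>2"] by (simp add: abs_divide)
  have "((\<lambda>R. ((\<Sum>i\<in>Z R. degree_sum i) - S R) / (pi * R\<^sup>2)) \<longlongrightarrow> 0) at_top"
    by (rule Lim_null_comparison[OF always_eventually[OF allI] null]) (simp only: real_norm_def le)
  moreover have "((\<lambda>R. S R / (pi * R\<^sup>2)) \<longlongrightarrow> mean block_degree / (4 * \<bar>wedge e f\<bar> * mean s)) at_top"
    unfolding S_def Z_def by (intro block_sum_limit mean_pos) (simp_all add: block_degree_def)
  ultimately have "((\<lambda>R. ((\<Sum>i\<in>Z R. degree_sum i) - S R) / (pi * R\<^sup>2) + S R / (pi * R\<^sup>2)) \<longlongrightarrow>
      0 + mean block_degree / (4 * \<bar>wedge e f\<bar> * mean s)) at_top" by (rule tendsto_add)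
  then show "((\<lambda>R. (\<Sum>i | base i \<in> cball 0 R. \<Sum>p\<in>points i. real (card (neighbours D Y p))) / (pi * R\<^sup>2)) \<longlongrightarrow>
      mean block_degree / (4 * \<bar>wedge e f\<bar> * mean s)) at_top"
    unfolding Z_def degree_sum_def by (simp add: add_divide_distrib[symmetric])
qed simp

lemma number_limit:
  "((\<lambda>R. real (num_points Y R) / (pi * R\<^sup>2)) \<longlongrightarrow> mean block_size / (4 * \<bar>wedge e f\<bar> * mean s)) at_top"
proof -
  have "((\<lambda>R. (\<Sum>i | base i \<in> cball 0 R. \<Sum>p\<in>points i. 1) / (pi * R\<^sup>2)) \<longlongrightarrow> mean block_size / (4 * \<bar>wedge e f\<bar> * mean s)) at_top"
    using block_sum_limit[of block_size] mean_pos[of block_size] by (simp add: card_points block_size_def)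
  from point_sum_limit[OF _ this] show ?thesis by (simp add: num_points_def)
qed

text \<open>The mean degree is the quotient of the limits for degrees and for points. In the
  density, the area \<open>2 * (1 + r) * \<bar>wedge e f\<bar>\<close> of \<open>D\<close> cancels
  the determinant.\<close>

theorem mixture_attained:
  "bound_attained D (mean block_degree / mean block_size) (mean block_size * (1 + r) / (2 * mean s))"
  unfolding bound_attained_def
proof (intro exI conjI)
  have pos: "0 < mean block_size" "0 < mean s" "0 < \<bar>wedge e f\<bar>"
    using mean_pos[of block_size] mean_s wedge_ne by (auto simp: block_size_def)
  define q where "q = 4 * \<bar>wedge e f\<bar> * mean s"
  have q: "0 < q" using pos by (simp add: q_def)
  show "packing_with_small_faces D Y" by (rule small_faces_columns)
  have "((\<lambda>R. ((\<Sum>p \<in> Y \<inter> cball 0 R. real (card (neighbours D Y p))) / (pi * R\<^sup>2)) / (real (num_points Y R) / (pi * R\<^sup>2))) \<longlongrightarrow>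
      (mean block_degree / q) / (mean block_size / q)) at_top"
    unfolding q_def using pos by (intro tendsto_divide degree_limit number_limit) auto
  moreover have "\<forall>\<^sub>F R in at_top. ((\<Sum>p \<in> Y \<inter> cball 0 R. real (card (neighbours D Y p))) / (pi * R\<^sup>2)) / (real (num_points Y R) / (pi * R\<^sup>2))
      = avg_neighbours D Y R"
    using eventually_gt_at_top[of 0] by eventually_elim (simp add: avg_neighbours_def)
  ultimately show "(avg_neighbours D Y \<longlongrightarrow> mean block_degree / mean block_size) at_top"
    using q by (simp add: tendsto_cong)
  have "((\<lambda>R. real (num_points Y R) / (pi * R\<^sup>2) * measure lebesgue D) \<longlongrightarrow> mean block_size / q * measure lebesgue D) at_top"
    unfolding q_def by (intro tendsto_mult tendsto_const number_limit)
  moreover have "mean block_size / q * measure lebesgue D = mean block_size * (1 + r) / (2 * mean s)"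
    unfolding q_def measure_D using pos by (simp add: field_simps)
  ultimately show "(disc_density D Y \<longlongrightarrow> mean block_size * (1 + r) / (2 * mean s)) at_top"
    unfolding disc_density_def by simp
qed

end

section \<open>Mixtures that attain the three bounds\<close>

context hexagon_frame
begin

text \<open>The values for mean degree and density are stated in cross-multiplied form, so that the
  applications are polynomial identities.\<close>

lemma mixture_exists:
  fixes \<theta> :: real and W \<sigma> :: "bool \<Rightarrow> real"
  assumes \<theta>: "0 \<le> \<theta>" "\<theta> \<le> 1" and W: "\<And>t. W t = 0 \<or> W t = 2" and \<sigma>: "\<And>t. 1 \<le> \<sigma> t" "\<And>t. \<sigma> t \<le> 2 * r"
    and l: "l * (\<theta> * (if W True = 2 then 2 else 1) + (1 - \<theta>) * (if W False = 2 then 2 else 1))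
      = \<theta> * (if W True = 2 \<or> \<sigma> True = 1 then 6 else 4) + (1 - \<theta>) * (if W False = 2 \<or> \<sigma> False = 1 then 6 else 4)"
    and d: "\<delta> * (2 * (\<theta> * (W True + \<sigma> True) + (1 - \<theta>) * (W False + \<sigma> False)))
      = (\<theta> * (if W True = 2 then 2 else 1) + (1 - \<theta>) * (if W False = 2 then 2 else 1)) * (1 + r)"
  shows "bound_attained D l \<delta>"
proof -
  obtain \<gamma> :: "int \<Rightarrow> int" where \<gamma>: "\<gamma> 0 = 0" "\<And>i. \<gamma> (i + 1) = \<gamma> i \<or> \<gamma> (i + 1) = \<gamma> i + 1"
    "\<And>i. \<bar>\<gamma> i - \<theta> * i\<bar> \<le> 2 * (1 + sqrt \<bar>real_of_int i\<bar>)"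
    "\<And>N::nat. card {i. \<bar>i\<bar> \<le> int N \<and> \<gamma> (i + 2) - \<gamma> (i + 1) \<noteq> \<gamma> (i + 1) - \<gamma> i} \<le> 4 * (1 + sqrt N)"
    using two_letter_word[OF \<theta>] by blast
  interpret m: mixture D c e f r \<gamma> \<theta> W \<sigma> by unfold_locales (use \<theta> \<gamma> W \<sigma> in auto)
  have "0 < m.mean m.block_size" "0 < m.mean m.s" using m.mean_pos[of m.block_size] m.mean_s by (auto simp: m.block_size_def)
  moreover have "l * m.mean m.block_size = m.mean m.block_degree" "\<delta> * (2 * m.mean m.s) = m.mean m.block_size * (1 + r)"
    using l d by (simp_all add: m.mean_def m.block_size_def m.block_degree_def)
  ultimately have "l = m.mean m.block_degree / m.mean m.block_size" "\<delta> = m.mean m.block_size * (1 + r) / (2 * m.mean m.s)"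
    by (simp_all add: eq_divide_eq)
  then show ?thesis using m.mixture_attained by simp
qed

text \<open>Single columns with gap 1 give triangles and degree 6; single columns with gap
  \<open>2 * r\<close> give quadrangles of the largest area \<open>M - 2 * \<Delta>\<close> and
  degree 4. Then \<theta> solves l = 6 \<theta> + 4 (1 - \<theta>).\<close>

lemma attained_i:
  assumes d: "d = (1 + r) / 2" "7 / 8 \<le> d" and l: "4 \<le> l" "l \<le> 6"
  shows "bound_attained D l (bound_i d l)"
proof (rule mixture_exists)
  let ?\<theta> = "(l - 4) / 2" and ?W = "\<lambda>t::bool. 0::real" and ?\<sigma> = "\<lambda>t. if t then 1 else 2 * r"
  have r: "3 / 4 \<le> r" "r \<le> 1" using d hexagon_frame.r[OF hexagon_frame_axioms] by simp_all
  have pos: "0 < 2 * d * (6 - l) + (3 / 2 * l - 8)"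
  proof -
    have le: "7 / 4 * (6 - l) \<le> 2 * d * (6 - l)" using d l by (intro mult_right_mono) auto
    have "0 < 7 / 4 * (6 - l) + (3 / 2 * l - 8)" using l by (simp add: field_simps)
    then show ?thesis using add_right_mono[OF le] by (rule less_le_trans)
  qed
  show "0 \<le> ?\<theta>" "?\<theta> \<le> 1" using l by simp_all
  show "?W t = 0 \<or> ?W t = 2" "1 \<le> ?\<sigma> t" "?\<sigma> t \<le> 2 * r" for t using r by auto
  show "l * (?\<theta> * (if ?W True = 2 then 2 else 1) + (1 - ?\<theta>) * (if ?W False = 2 then 2 else 1))
      = ?\<theta> * (if ?W True = 2 \<or> ?\<sigma> True = 1 then 6 else 4) + (1 - ?\<theta>) * (if ?W False = 2 \<or> ?\<sigma> False = 1 then 6 else 4)"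
    \<comment> \<open>The bound \<open>3 / 4 \<le> r\<close> excludes \<open>2 * r = 1\<close>, for
      which the second kind of column would have degree 6.\<close>
    using r by (simp add: field_simps)
  show "bound_i d l * (2 * (?\<theta> * (?W True + ?\<sigma> True) + (1 - ?\<theta>) * (?W False + ?\<sigma> False)))
      = (?\<theta> * (if ?W True = 2 then 2 else 1) + (1 - ?\<theta>) * (if ?W False = 2 then 2 else 1)) * (1 + r)"
  proof -
    have r2: "r = 2 * d - 1" using d by simp
    define q where "q = 2 * d * (6 - l) + (3 / 2 * l - 8)"
    have e: "2 * (?\<theta> * (?W True + ?\<sigma> True) + (1 - ?\<theta>) * (?W False + ?\<sigma> False)) = 2 * q"
      unfolding r2 q_def by (simp add: field_simps)
    have "q \<noteq> 0" using pos unfolding q_def by simp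
    then show ?thesis unfolding e bound_i_def q_def[symmetric] by (simp add: r2)
  qed
qed

text \<open>Pairs with gap \<open>2 * r\<close> give hexagons of area \<open>M\<close> and degree 3;
  single columns with the same gap give quadrangles and degree 4. A pair has two points, so \<theta>
  solves l (1 + \<theta>) = 6 \<theta> + 4 (1 - \<theta>).\<close>

lemma attained_ii:
  assumes d: "d = (1 + r) / 2" "7 / 8 \<le> d" and l: "3 \<le> l" "l \<le> 4"
  shows "bound_attained D l (bound_ii d l)"
proof (rule mixture_exists)
  let ?\<theta> = "(4 - l) / (l - 2)" and ?W = "\<lambda>t. if t then 2 else 0::real" and ?\<sigma> = "\<lambda>t::bool. 2 * r"
  have r: "3 / 4 \<le> r" "r \<le> 1" using d hexagon_frame.r[OF hexagon_frame_axioms] by simp_all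
  have l2: "0 < l - 2" using l by simp
  define \<theta> where "\<theta> = ?\<theta>"
  have \<theta>: "\<theta> * (l - 2) = 4 - l" using l2 by (simp add: \<theta>_def)
  have pos: "0 < 2 * d * (l - 2) + 6 - 2 * l"
  proof -
    have le: "7 / 4 * (l - 2) \<le> 2 * d * (l - 2)" using d l by (intro mult_right_mono) auto
    have "0 < 7 / 4 * (l - 2) + 6 - 2 * l" using l by (simp add: field_simps)
    then show ?thesis using diff_right_mono[OF add_right_mono[OF le]] by (rule less_le_trans)
  qed
  show "0 \<le> ?\<theta>" "?\<theta> \<le> 1" using l by simp_all
  show "?W t = 0 \<or> ?W t = 2" "1 \<le> ?\<sigma> t" "?\<sigma> t \<le> 2 * r" for t using r by auto
  have "l * (\<theta> * 2 + (1 - \<theta>)) = \<theta> * 6 + (1 - \<theta>) * 4" using \<theta> by (simp add: algebra_simps)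
  then show "l * (?\<theta> * (if ?W True = 2 then 2 else 1) + (1 - ?\<theta>) * (if ?W False = 2 then 2 else 1))
      = ?\<theta> * (if ?W True = 2 \<or> ?\<sigma> True = 1 then 6 else 4) + (1 - ?\<theta>) * (if ?W False = 2 \<or> ?\<sigma> False = 1 then 6 else 4)"
    using r unfolding \<theta>_def by simp
  show "bound_ii d l * (2 * (?\<theta> * (?W True + ?\<sigma> True) + (1 - ?\<theta>) * (?W False + ?\<sigma> False)))
      = (?\<theta> * (if ?W True = 2 then 2 else 1) + (1 - ?\<theta>) * (if ?W False = 2 then 2 else 1)) * (1 + r)"
  proof -
    have r2: "r = 2 * d - 1" using d by simp
    define q where "q = 2 * d * (l - 2) + 6 - 2 * l"
    have A: "(l - 2) * (\<theta> + r) = q" using \<theta> unfolding r2 q_def by (simp add: algebra_simps)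
    have B: "(l - 2) * (\<theta> + 1) = 2" using \<theta> by (simp add: algebra_simps)
    have "(l - 2) * (d * (4 * (\<theta> + r))) = d * 4 * ((l - 2) * (\<theta> + r))" by (simp only: mult_ac)
    also have "\<dots> = q * (2 * d) * ((l - 2) * (\<theta> + 1))" unfolding A B by simp
    also have "\<dots> = (l - 2) * (q * ((\<theta> + 1) * (2 * d)))" by (simp only: mult_ac)
    finally have "(l - 2) * (d * (4 * (\<theta> + r))) = (l - 2) * (q * ((\<theta> + 1) * (2 * d)))" .
    then have "d * (4 * (\<theta> + r)) = q * ((\<theta> + 1) * (2 * d))" using l2 by simp
    then have "d / q * (4 * (\<theta> + r)) = q * ((\<theta> + 1) * (2 * d)) / q" by (simp only: times_divide_eq_left)
    then have "d / q * (4 * (\<theta> + r)) = (\<theta> + 1) * (2 * d)" using pos unfolding q_def[symmetric] by simp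
    moreover have "2 * (?\<theta> * (?W True + ?\<sigma> True) + (1 - ?\<theta>) * (?W False + ?\<sigma> False)) = 4 * (\<theta> + r)"
      unfolding \<theta>_def[symmetric] by (simp add: algebra_simps)
    moreover have "?\<theta> * (if ?W True = 2 then 2 else 1) + (1 - ?\<theta>) * (if ?W False = 2 then 2 else 1) = \<theta> + 1"
      unfolding \<theta>_def[symmetric] by simp
    ultimately show ?thesis unfolding bound_ii_def q_def[symmetric] by (simp only: r2) simp
  qed
qed

text \<open>Pairs with gap \<open>2 * r\<close>, which give hexagons, and single columns with gap 1,
  which give triangles; quadrangles are avoided. Either block has degree sum 6, so \<theta> solves l
  (1 + \<theta>) = 6.\<close>

lemma attained_iii:
  assumes d: "d = (1 + r) / 2" and l: "3 \<le> l" "l \<le> 6"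
  shows "bound_attained D l (bound_iii d l)"
proof (rule mixture_exists)
  let ?\<theta> = "6 / l - 1" and ?W = "\<lambda>t. if t then 2 else 0::real" and ?\<sigma> = "\<lambda>t. if t then 2 * r else 1"
  have r: "1 / 2 \<le> r" "r \<le> 1" using hexagon_frame.r[OF hexagon_frame_axioms] by simp_all
  have l2: "0 < l" using l by simp
  define \<theta> where "\<theta> = ?\<theta>"
  have \<theta>: "\<theta> * l = 6 - l" using l2 by (simp add: \<theta>_def field_simps)
  have pos: "0 < 2 / 3 * d * (6 - l) + 1 / 3 * (l - 3)"
  proof -
    have le: "1 / 2 * (6 - l) \<le> 2 / 3 * d * (6 - l)" using d r l by (intro mult_right_mono) auto
    have "0 < 1 / 2 * (6 - l) + 1 / 3 * (l - 3)" using l by (simp add: field_simps)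
    then show ?thesis using add_right_mono[OF le] by (rule less_le_trans)
  qed
  show "0 \<le> ?\<theta>" "?\<theta> \<le> 1" using l by (simp_all add: field_simps)
  show "?W t = 0 \<or> ?W t = 2" "1 \<le> ?\<sigma> t" "?\<sigma> t \<le> 2 * r" for t using r by auto
  have "l * (\<theta> * 2 + (1 - \<theta>)) = \<theta> * 6 + (1 - \<theta>) * 6" using \<theta> by (simp add: algebra_simps)
  then show "l * (?\<theta> * (if ?W True = 2 then 2 else 1) + (1 - ?\<theta>) * (if ?W False = 2 then 2 else 1))
      = ?\<theta> * (if ?W True = 2 \<or> ?\<sigma> True = 1 then 6 else 4) + (1 - ?\<theta>) * (if ?W False = 2 \<or> ?\<sigma> False = 1 then 6 else 4)"
    unfolding \<theta>_def by simp
  show "bound_iii d l * (2 * (?\<theta> * (?W True + ?\<sigma> True) + (1 - ?\<theta>) * (?W False + ?\<sigma> False)))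
      = (?\<theta> * (if ?W True = 2 then 2 else 1) + (1 - ?\<theta>) * (if ?W False = 2 then 2 else 1)) * (1 + r)"
  proof -
    have r2: "r = 2 * d - 1" using d by simp
    define q where "q = 2 / 3 * d * (6 - l) + 1 / 3 * (l - 3)"
    have "l * (\<theta> * (4 * d) + (1 - \<theta>)) = 4 * d * (\<theta> * l) + l - \<theta> * l" by (simp add: algebra_simps)
    also have "\<dots> = 6 * q" unfolding \<theta> q_def by (simp add: field_simps)
    finally have A: "l * (\<theta> * (4 * d) + (1 - \<theta>)) = 6 * q" .
    have B: "l * (\<theta> + 1) = 6" using \<theta> by (simp add: algebra_simps)
    have "l * (d * (2 * (\<theta> * (4 * d) + (1 - \<theta>)))) = 2 * d * (l * (\<theta> * (4 * d) + (1 - \<theta>)))" by (simp only: mult_ac)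
    also have "\<dots> = q * (2 * d) * (l * (\<theta> + 1))" unfolding A B by simp
    also have "\<dots> = l * (q * ((\<theta> + 1) * (2 * d)))" by (simp only: mult_ac)
    finally have "l * (d * (2 * (\<theta> * (4 * d) + (1 - \<theta>)))) = l * (q * ((\<theta> + 1) * (2 * d)))" .
    then have "d * (2 * (\<theta> * (4 * d) + (1 - \<theta>))) = q * ((\<theta> + 1) * (2 * d))" using l2 by simp
    then have "d / q * (2 * (\<theta> * (4 * d) + (1 - \<theta>))) = q * ((\<theta> + 1) * (2 * d)) / q" by (simp only: times_divide_eq_left)
    then have "d / q * (2 * (\<theta> * (4 * d) + (1 - \<theta>))) = (\<theta> + 1) * (2 * d)" using pos unfolding q_def[symmetric] by simp
    moreover have "2 * (?\<theta> * (?W True + ?\<sigma> True) + (1 - ?\<theta>) * (?W False + ?\<sigma> False)) = 2 * (\<theta> * (4 * d) + (1 - \<theta>))"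
      unfolding \<theta>_def[symmetric] r2 by (simp add: algebra_simps)
    moreover have "?\<theta> * (if ?W True = 2 then 2 else 1) + (1 - ?\<theta>) * (if ?W False = 2 then 2 else 1) = \<theta> + 1"
      unfolding \<theta>_def[symmetric] by simp
    ultimately show ?thesis unfolding bound_iii_def q_def[symmetric] by (simp only: r2) simp
  qed
qed

end

lemma (in hexagon_frame) centered: "centered_body D c" by (rule centered_body_axioms)

lemma centered_body_exists: "convex_domain D \<Longrightarrow> centrosymmetric D \<Longrightarrow> \<exists>c. centered_body D c"
  unfolding centrosymmetric_def centered_body_def by blast

theorem mainTheorem2:
  shows
   "(\<forall>D X :: plane set.
       convex_domain D \<and> centrosymmetric D \<and> packing_with_small_faces D X \<longrightarrow>
       (\<forall>l :: real.
          (thinnest_density D \<ge> 7/8 \<and> 4 \<le> l \<and> l \<le> 6 \<longrightarrow>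
             asymptotic_lower_bound D X l (bound_i (thinnest_density D) l)) \<and>
          (thinnest_density D \<ge> 7/8 \<and> 3 \<le> l \<and> l \<le> 4 \<longrightarrow>
             asymptotic_lower_bound D X l (bound_ii (thinnest_density D) l)) \<and>
          (thinnest_density D \<le> 7/8 \<longrightarrow>
             asymptotic_lower_bound D X l (bound_iii (thinnest_density D) l)))) \<and>
    (\<forall>d0 l :: real.
       3/4 \<le> d0 \<and> d0 \<le> 1 \<and> 3 \<le> l \<and> l \<le> 6 \<longrightarrow>
       (\<exists>D. special_hexagon (2 * d0 - 1) D) \<and>
       (\<forall>D. special_hexagon (2 * d0 - 1) D \<longrightarrow>
          convex_domain D \<and> centrosymmetric D \<and> thinnest_density D = d0 \<and>
          (d0 \<ge> 7/8 \<and> 4 \<le> l \<longrightarrow> bound_attained D l (bound_i d0 l)) \<and>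
          (d0 \<ge> 7/8 \<and> l \<le> 4 \<longrightarrow> bound_attained D l (bound_ii d0 l)) \<and>
          (d0 \<le> 7/8 \<longrightarrow> bound_attained D l (bound_iii d0 l))))"
proof ((rule conjI; intro allI impI), goal_cases)
  case (1 D X l)
  then have D: "convex_domain D" "centrosymmetric D" and X: "packing_with_small_faces D X" by simp_all
  obtain c where c: "centered_body D c" using centered_body_exists[OF D] by (rule exE)
  show ?case
  proof (intro conjI impI; (elim conjE)?)
    assume "7 / 8 \<le> thinnest_density D"
    from centered_body.small_faces_bound_i[OF c X this]
    show "asymptotic_lower_bound D X l (bound_i (thinnest_density D) l)" .
  next
    assume "7 / 8 \<le> thinnest_density D"
    from centered_body.small_faces_bound_ii[OF c X this]
    show "asymptotic_lower_bound D X l (bound_ii (thinnest_density D) l)" .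
  next
    assume "thinnest_density D \<le> 7 / 8"
    from centered_body.small_faces_bound_iii[OF c X this]
    show "asymptotic_lower_bound D X l (bound_iii (thinnest_density D) l)" .
  qed
next
  case (2 d l)
  define r where "r = 2 * d - 1"
  have r: "1 / 2 \<le> r" "r \<le> 1" and d: "d = (1 + r) / 2" using 2 by (simp_all add: r_def)
  have l: "3 \<le> l" "l \<le> 6" using 2 by simp_all
  show ?case unfolding r_def[symmetric]
  proof (rule conjI, rule special_hexagon_exists[OF r], rule allI, rule impI)
    fix D assume hex: "special_hexagon r D"
    obtain c e f where F: "hexagon_frame D c e f r" by (rule special_hexagon_frame[OF r hex])
    have c: "centered_body D c" by (rule hexagon_frame.centered[OF F])
    show "convex_domain D \<and> centrosymmetric D \<and> thinnest_density D = d \<and>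
      (7/8 \<le> d \<and> 4 \<le> l \<longrightarrow> bound_attained D l (bound_i d l)) \<and>
      (7/8 \<le> d \<and> l \<le> 4 \<longrightarrow> bound_attained D l (bound_ii d l)) \<and>
      (d \<le> 7/8 \<longrightarrow> bound_attained D l (bound_iii d l))"
    proof (intro conjI impI; (elim conjE)?)
      show "convex_domain D" by (rule centered_body.domain[OF c])
      show "centrosymmetric D" unfolding centrosymmetric_def using centered_body.center[OF c] by blast
      show "thinnest_density D = d" unfolding d by (rule hexagon_frame.thinnest_eq[OF F])
      show "bound_attained D l (bound_i d l)" if "7/8 \<le> d" "4 \<le> l"
        by (rule hexagon_frame.attained_i[OF F d that l(2)])
      show "bound_attained D l (bound_ii d l)" if "7/8 \<le> d" "l \<le> 4"
        by (rule hexagon_frame.attained_ii[OF F d that(1) l(1) that(2)])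
      show "bound_attained D l (bound_iii d l)" if "d \<le> 7/8"
        by (rule hexagon_frame.attained_iii[OF F d l])
    qed
  qed
qed

end
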